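(* Let $r\ge1$ and let $E=T_r^{max}$. Then the embedding semiring $V_E$ is isomorphic to the semiring $\mathbb Z_+[\mathrm{Pend}(\mathcal P_r)]$ (with the discrete metric). As an additive abelian semigroup $V_E=\mathbb Z_+^{d(E)}$, where the embedding rank is $$d(E)=\binom{2r+1}{r+1}-(r+1).$$
   Context: A homomorphism $A\to B$ of operator algebras is star-extendible (a map) if it is the restriction of a *-homomorphism $C^*(A)\to C^*(B)$ of the generated C*-algebras. $T_r\subseteq M_r$ is the algebra of upper triangular matrices. For an interval $I=\{i,i+1,\dots,j\}\subseteq\{1,\dots,r\}$ let $p_I=\sum_{k\in I}e_{kk}$. $T_r^{max}$ is the operator algebra $\{\bigoplus_I p_Iap_I: a\in T_r\}\subseteq\bigoplus_I M_{|I|}$, the direct sum over all nonempty intervals $I$; it generates $\bigoplus_IM_{|I|}$. For a finitely acting unital operator algebra $E$ (one with $C^*(E)$ finite-dimensional) the embedding semiring $V_E$ is the set of inner unitary equivalence classes $[\phi]$ of star-extendible homomorphisms $\phi:E\to E\otimes M_n\subseteq E\otimes\mathcal K$ ($n$ arbitrary; $\mathcal K$ the compact operators; $\phi\sim\psi$ if $\phi=(\mathrm{Ad}\,u)\circ\psi$ with $u$ a unitary such that $u,u^*$ lie in the unitisation of $E\otimes\mathcal K$), with $[\phi]+[\psi]=[\phi\oplus\psi]$, $[\phi][\psi]=[(\phi\otimes\mathrm{id})\circ\psi]$ and metric $d([\phi],[\psi])=\inf_u\|\phi-(\mathrm{Ad}\,u)\circ\psi\|$ over such unitaries. A map is indecomposable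 if it is not a direct sum of two nonzero maps; the embedding rank $d(E)$ is the number of inner unitary equivalence classes of (nonzero) indecomposable maps $E\to E\otimes\mathcal K$. "With the discrete metric" means that $V_E$ carries the discrete topology in this metric. $\mathcal P_r$ is the chain $\{1<2<\dots<r\}$. $\mathrm{Pend}(\mathcal P_r)$ is the semigroup, under composition, of partially defined monotone (order preserving, $i\le j\Rightarrow h(i)\le h(j)$) maps $h:\mathcal P_r\to\mathcal P_r$ whose domains are nonempty intervals of $\mathcal P_r$; the composition $g\circ h$ has domain $h^{-1}(\mathrm{dom}\,g)$. $\mathbb Z_+[\mathrm{Pend}(\mathcal P_r)]$ is the semiring of formal $\mathbb Z_+$-combinations of elements of $\mathrm{Pend}(\mathcal P_r)$ with multiplication extended bilinearly from composition, a composition with empty domain being interpreted as $0$. *)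

theory Defs
  imports
    "HOL-Analysis.Analysis"
    "HOL-Algebra.QuotRing"
    "HOL-Algebra.Product_Groups"
    "HOL-Library.Function_Algebras"
begin

section \<open>Operators on \<open>\<ell>\<^sup>2\<close>, written as matrices\<close>

text \<open>A bounded operator on the Hilbert space of square summable families indexed by \<open>'i\<close> is
  represented by its matrix.  Sums, differences and the zero matrix are pointwise
  (\<open>Function_Algebras\<close>); the pointwise product and the constant function 1 of that theory are
  never used.  Operators on a finite dimensional space are the matrices with finite support.\<close>

type_synonym 'i cmat = "'i \<Rightarrow> 'i \<Rightarrow> complex"

definition mat_one :: "'i cmat" where
  "mat_one = (\<lambda>i j. if i = j then 1 else 0)"

definition mat_scale :: "complex \<Rightarrow> 'i cmat \<Rightarrow> 'i cmat" where
  "mat_scale c a = (\<lambda>i j. c * a i j)"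

definition mat_adj :: "'i cmat \<Rightarrow> 'i cmat" where
  "mat_adj a = (\<lambda>i j. cnj (a j i))"

definition mat_mul :: "'i cmat \<Rightarrow> 'i cmat \<Rightarrow> 'i cmat" (infixl \<open>\<bullet>\<bullet>\<close> 70) where
  "a \<bullet>\<bullet> b = (\<lambda>i j. \<Sum>\<^sub>\<infinity>k. a i k * b k j)"

definition ell2 :: "('i \<Rightarrow> complex) set" where
  "ell2 = {x. (\<lambda>i. (cmod (x i))\<^sup>2) summable_on UNIV}"

definition ell2_norm :: "('i \<Rightarrow> complex) \<Rightarrow> real" where
  "ell2_norm x = sqrt (\<Sum>\<^sub>\<infinity>i. (cmod (x i))\<^sup>2)"

definition mat_app :: "'i cmat \<Rightarrow> ('i \<Rightarrow> complex) \<Rightarrow> 'i \<Rightarrow> complex" where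
  "mat_app a x = (\<lambda>i. \<Sum>\<^sub>\<infinity>j. a i j * x j)"

definition bounded_op :: "'i cmat \<Rightarrow> bool" where
  "bounded_op a \<longleftrightarrow>
     (\<exists>C. \<forall>x\<in>ell2. mat_app a x \<in> ell2 \<and> ell2_norm (mat_app a x) \<le> C * ell2_norm x)"

text \<open>Meaningful for bounded operators only.\<close>

definition op_norm :: "'i cmat \<Rightarrow> real" where
  "op_norm a = Sup {ell2_norm (mat_app a x) | x. x \<in> ell2 \<and> ell2_norm x \<le> 1}"

definition op_closure :: "'i cmat set \<Rightarrow> 'i cmat set" where
  "op_closure S = {a. bounded_op a \<and> (\<forall>e>0. \<exists>b\<in>S. bounded_op b \<and> op_norm (a - b) < e)}"

definition cstar_algebra :: "'i cmat set \<Rightarrow> bool" where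
  "cstar_algebra B \<longleftrightarrow>
     B \<subseteq> Collect bounded_op \<and> 0 \<in> B \<and>
     (\<forall>a\<in>B. \<forall>b\<in>B. a + b \<in> B \<and> a \<bullet>\<bullet> b \<in> B) \<and>
     (\<forall>c. \<forall>a\<in>B. mat_scale c a \<in> B) \<and>
     (\<forall>a\<in>B. mat_adj a \<in> B) \<and>
     op_closure B \<subseteq> B"

text \<open>The C*-algebra generated by \<open>A\<close>.\<close>

definition cstar :: "'i cmat set \<Rightarrow> 'i cmat set" where
  "cstar A = cstar_algebra hull A"

definition star_hom :: "'i cmat set \<Rightarrow> 'j cmat set \<Rightarrow> ('i cmat \<Rightarrow> 'j cmat) \<Rightarrow> bool" where
  "star_hom A B \<pi> \<longleftrightarrow>
     \<pi> ` A \<subseteq> B \<and>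
     (\<forall>a\<in>A. \<forall>b\<in>A. \<pi> (a + b) = \<pi> a + \<pi> b \<and> \<pi> (a \<bullet>\<bullet> b) = \<pi> a \<bullet>\<bullet> \<pi> b) \<and>
     (\<forall>c. \<forall>a\<in>A. \<pi> (mat_scale c a) = mat_scale c (\<pi> a)) \<and>
     (\<forall>a\<in>A. \<pi> (mat_adj a) = mat_adj (\<pi> a))"

text \<open>Only the values of \<open>\<phi>\<close> on \<open>A\<close> matter; functions that agree on \<open>A\<close> are the same
  homomorphism, and all notions below respect this.\<close>

definition star_extendible :: "'i cmat set \<Rightarrow> 'j cmat set \<Rightarrow> ('i cmat \<Rightarrow> 'j cmat) \<Rightarrow> bool" where
  "star_extendible A B \<phi> \<longleftrightarrow>
     \<phi> ` A \<subseteq> B \<and> (\<exists>\<pi>. star_hom (cstar A) (cstar B) \<pi> \<and> (\<forall>a\<in>A. \<pi> a = \<phi> a))"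


section \<open>Maps into the stable algebra and inner unitary equivalence\<close>

text \<open>From here on \<open>E\<close> stands for a finitely acting unital operator algebra, given as a linear
  space of matrices supported on a fixed finite set of indices.\<close>

text \<open>\<open>E \<otimes> M\<^sub>n\<close>: the \<open>n \<times> n\<close> block matrices with blocks in \<open>E\<close>, as a corner of the
  matrices indexed by \<open>'i \<times> nat\<close>; so \<open>E \<otimes> M\<^sub>n\<close> increases with \<open>n\<close>.\<close>

definition block :: "('i \<times> nat) cmat \<Rightarrow> nat \<Rightarrow> nat \<Rightarrow> 'i cmat" where
  "block b k l = (\<lambda>i j. b (i, k) (j, l))"

definition tensor_M :: "'i cmat set \<Rightarrow> nat \<Rightarrow> ('i \<times> nat) cmat set" where
  "tensor_M E n = {b. \<forall>k l. if k < n \<and> l < n then block b k l \<in> E else block b k l = 0}"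

definition tensor_K :: "'i cmat set \<Rightarrow> ('i \<times> nat) cmat set" where
  "tensor_K E = op_closure (\<Union>n. tensor_M E n)"

text \<open>The algebra \<open>E \<otimes> \<K>\<close> has no unit, so adjoining the identity operator of the ambient
  \<open>\<ell>\<^sup>2\<close> space gives its unitisation, whether or not the unit of \<open>E\<close> is the identity of
  \<open>\<ell>\<^sup>2('i)\<close>.\<close>

definition unitisation :: "'i cmat set \<Rightarrow> ('i \<times> nat) cmat set" where
  "unitisation E = {b + mat_scale c mat_one | b c. b \<in> tensor_K E}"

definition inner_unitaries :: "'i cmat set \<Rightarrow> ('i \<times> nat) cmat set" where
  "inner_unitaries E =
     {u. u \<in> unitisation E \<and> mat_adj u \<in> unitisation E \<and>
         u \<bullet>\<bullet> mat_adj u = mat_one \<and> mat_adj u \<bullet>\<bullet> u = mat_one}"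

definition Ad :: "'i cmat \<Rightarrow> 'i cmat \<Rightarrow> 'i cmat" where
  "Ad u b = u \<bullet>\<bullet> b \<bullet>\<bullet> mat_adj u"

type_synonym 'i stable_map = "'i cmat \<Rightarrow> ('i \<times> nat) cmat"

definition maps_M :: "'i cmat set \<Rightarrow> nat \<Rightarrow> 'i stable_map set" where
  "maps_M E n = {\<phi>. star_extendible E (tensor_M E n) \<phi>}"

definition maps_fin :: "'i cmat set \<Rightarrow> 'i stable_map set" where
  "maps_fin E = (\<Union>n. maps_M E n)"

definition maps_K :: "'i cmat set \<Rightarrow> 'i stable_map set" where
  "maps_K E = {\<phi>. star_extendible E (tensor_K E) \<phi>}"

definition inner_equiv_on ::
  "'i cmat set \<Rightarrow> 'i stable_map set \<Rightarrow> ('i stable_map \<times> 'i stable_map) set" where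
  "inner_equiv_on E S =
     {(\<phi>, \<psi>). \<phi> \<in> S \<and> \<psi> \<in> S \<and> (\<exists>u\<in>inner_unitaries E. \<forall>a\<in>E. \<phi> a = Ad u (\<psi> a))}"


section \<open>The embedding semiring\<close>

abbreviation map_class :: "'i cmat set \<Rightarrow> 'i stable_map \<Rightarrow> 'i stable_map set" where
  "map_class E \<phi> \<equiv> inner_equiv_on E (maps_fin E) `` {\<phi>}"

text \<open>\<open>\<phi> \<oplus> \<psi>\<close> for \<open>\<phi> : E \<rightarrow> E \<otimes> M\<^sub>n\<close> and \<open>\<psi> : E \<rightarrow> E \<otimes> M\<^sub>m\<close>, with values in
  \<open>E \<otimes> M\<^bsub>n+m\<^esub>\<close>.\<close>

definition dsum :: "nat \<Rightarrow> 'i stable_map \<Rightarrow> 'i stable_map \<Rightarrow> 'i stable_map" where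
  "dsum n \<phi> \<psi> a = (\<lambda>(i, k) (j, l).
     if k < n \<and> l < n then \<phi> a (i, k) (j, l)
     else if n \<le> k \<and> n \<le> l then \<psi> a (i, k - n) (j, l - n)
     else 0)"

text \<open>\<open>\<phi> \<otimes> id\<close> for \<open>\<phi> : E \<rightarrow> E \<otimes> M\<^sub>m\<close>, with \<open>M\<^sub>m \<otimes> M\<^sub>n\<close> identified with \<open>M\<^bsub>mn\<^esub>\<close> by
  \<open>(k, l) \<mapsto> l * m + k\<close>.\<close>

definition amplify :: "nat \<Rightarrow> 'i stable_map \<Rightarrow> ('i \<times> nat) cmat \<Rightarrow> ('i \<times> nat) cmat" where
  "amplify m \<phi> b = (\<lambda>(i, p) (j, q).
     \<phi> (block b (p div m) (q div m)) (i, p mod m) (j, q mod m))"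

definition corner_map :: "'i stable_map" where
  "corner_map a = (\<lambda>(i, k) (j, l). if k = 0 \<and> l = 0 then a i j else 0)"

text \<open>Sum and product of classes are computed on representatives; the unions are over all
  representatives and sizes, and are single classes because the operations are well defined.\<close>

definition embedding_semiring :: "'i cmat set \<Rightarrow> 'i stable_map set ring" where
  "embedding_semiring E =
     \<lparr>carrier = maps_fin E // inner_equiv_on E (maps_fin E),
      mult = (\<lambda>X Y. \<Union>{map_class E (\<lambda>a. amplify m \<phi> (\<psi> a)) | \<phi> \<psi> m.
                          \<phi> \<in> X \<and> \<psi> \<in> Y \<and> \<phi> \<in> maps_M E m}),
      one = map_class E corner_map,
      zero = map_class E (\<lambda>a. 0),
      add = (\<lambda>X Y. \<Union>{map_class E (dsum n \<phi> \<psi>) | \<phi> \<psi> n.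
                         \<phi> \<in> X \<and> \<psi> \<in> Y \<and> \<phi> \<in> maps_M E n})\<rparr>"

definition map_norm :: "'i cmat set \<Rightarrow> 'i stable_map \<Rightarrow> real" where
  "map_norm E \<theta> = Sup {op_norm (\<theta> a) | a. a \<in> E \<and> op_norm a \<le> 1}"

definition map_dist :: "'i cmat set \<Rightarrow> 'i stable_map \<Rightarrow> 'i stable_map \<Rightarrow> real" where
  "map_dist E \<phi> \<psi> = Inf {map_norm E (\<lambda>a. \<phi> a - Ad u (\<psi> a)) | u. u \<in> inner_unitaries E}"

text \<open>The common value of \<^const>\<open>map_dist\<close> on representatives.  The value 0 outside the carrier
  is a convention, needed because the locale \<^locale>\<open>Metric_space\<close> asks for a total function
  that is nonnegative and symmetric everywhere.\<close>

definition embedding_dist ::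
  "'i cmat set \<Rightarrow> 'i stable_map set \<Rightarrow> 'i stable_map set \<Rightarrow> real" where
  "embedding_dist E X Y =
     (if X \<in> carrier (embedding_semiring E) \<and> Y \<in> carrier (embedding_semiring E)
      then THE c. \<forall>\<phi>\<in>X. \<forall>\<psi>\<in>Y. map_dist E \<phi> \<psi> = c
      else 0)"


section \<open>Embedding rank\<close>

definition nonzero_map :: "'i cmat set \<Rightarrow> 'i stable_map \<Rightarrow> bool" where
  "nonzero_map E \<phi> \<longleftrightarrow> (\<exists>a\<in>E. \<phi> a \<noteq> 0)"

text \<open>\<open>\<phi>\<close> is the (internal, orthogonal) direct sum of \<open>\<phi>\<^sub>1\<close> and \<open>\<phi>\<^sub>2\<close>: they act on
  orthogonal subspaces of the Hilbert space.\<close>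

definition is_direct_sum ::
  "'i cmat set \<Rightarrow> 'i stable_map \<Rightarrow> 'i stable_map \<Rightarrow> 'i stable_map \<Rightarrow> bool" where
  "is_direct_sum E \<phi> \<phi>1 \<phi>2 \<longleftrightarrow>
     (\<forall>a\<in>E. \<phi> a = \<phi>1 a + \<phi>2 a) \<and>
     (\<forall>a\<in>E. \<forall>b\<in>E. \<forall>x\<in>{\<phi>1 a, mat_adj (\<phi>1 a)}. \<forall>y\<in>{\<phi>2 b, mat_adj (\<phi>2 b)}. x \<bullet>\<bullet> y = 0)"

definition indecomposable :: "'i cmat set \<Rightarrow> 'i stable_map \<Rightarrow> bool" where
  "indecomposable E \<phi> \<longleftrightarrow>
     \<not> (\<exists>\<phi>1\<in>maps_K E. \<exists>\<phi>2\<in>maps_K E.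
          nonzero_map E \<phi>1 \<and> nonzero_map E \<phi>2 \<and> is_direct_sum E \<phi> \<phi>1 \<phi>2)"

definition indecomposable_maps :: "'i cmat set \<Rightarrow> 'i stable_map set" where
  "indecomposable_maps E = {\<phi> \<in> maps_K E. nonzero_map E \<phi> \<and> indecomposable E \<phi>}"

definition embedding_rank :: "'i cmat set \<Rightarrow> nat" where
  "embedding_rank E =
     card (indecomposable_maps E // inner_equiv_on E (indecomposable_maps E))"


section \<open>The algebra \<open>T\<^sub>r\<^sup>m\<^sup>a\<^sup>x\<close>\<close>

definition intervals :: "nat \<Rightarrow> nat set set" where
  "intervals r = {{i..j} | i j. 1 \<le> i \<and> i \<le> j \<and> j \<le> r}"

definition upper_triangular :: "nat \<Rightarrow> nat cmat set" where
  "upper_triangular r = {a. \<forall>i j. a i j \<noteq> 0 \<longrightarrow> 1 \<le> i \<and> i \<le> j \<and> j \<le> r}"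

text \<open>The direct sum of the algebras \<open>M\<^bsub>|I|\<^esub>\<close> acts on the basis of all pairs \<open>(I, i)\<close> with \<open>I\<close>
  an interval and \<open>i \<in> I\<close>; the summand \<open>p\<^sub>I a p\<^sub>I\<close> is the submatrix of \<open>a\<close> on \<open>I\<close>.\<close>

definition T_max :: "nat \<Rightarrow> (nat set \<times> nat) cmat set" where
  "T_max r =
     (\<lambda>a (I, i) (J, j). if I = J \<and> I \<in> intervals r \<and> i \<in> I \<and> j \<in> I then a i j else 0)
       ` upper_triangular r"


section \<open>Partially defined monotone maps of the chain\<close>

definition Pend :: "nat \<Rightarrow> (nat \<rightharpoonup> nat) set" where
  "Pend r = {h. dom h \<in> intervals r \<and> ran h \<subseteq> {1..r} \<and>
               (\<forall>i\<in>dom h. \<forall>j\<in>dom h. i \<le> j \<longrightarrow> the (h i) \<le> the (h j))}"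

text \<open>Formal combinations of elements of the finite set \<open>Pend r\<close> are their coefficient functions.
  The coefficient of \<open>k\<close> in a product collects the pairs composing to \<open>k\<close>; compositions with
  empty domain, not being in \<open>Pend r\<close>, contribute nothing.\<close>

definition Pend_semiring :: "nat \<Rightarrow> ((nat \<rightharpoonup> nat) \<Rightarrow> nat) ring" where
  "Pend_semiring r =
     \<lparr>carrier = {x. \<forall>h. h \<notin> Pend r \<longrightarrow> x h = 0},
      mult = (\<lambda>x y k. if k \<in> Pend r
                then \<Sum>(g, h) \<in> {(g, h) \<in> Pend r \<times> Pend r. g \<circ>\<^sub>m h = k}. x g * y h
                else 0),
      one = (\<lambda>h. if h = (\<lambda>i. if i \<in> {1..r} then Some i else None) then 1 else 0),
      zero = (\<lambda>h. 0),
      add = (\<lambda>x y h. x h + y h)\<rparr>"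

definition nat_add_monoid :: "nat monoid" where
  "nat_add_monoid = \<lparr>carrier = UNIV, mult = (+), one = 0\<rparr>"

text \<open>\<open>\<int>\<^sub>+\<^sup>d\<close>; the library's \<^const>\<open>product_group\<close> is the plain product of
  monoids.\<close>

definition nat_power_monoid :: "nat \<Rightarrow> (nat \<Rightarrow> nat) monoid" where
  "nat_power_monoid d = product_group {..<d} (\<lambda>_. nat_add_monoid)"

end

theory Submission imports Defs begin

text \<open>A star-extendible map is recovered from the images \<open>V\<^sub>i\<^sub>j\<close> of the matrix units of \<open>T\<^sub>r\<^sup>m\<^sup>a\<^sup>x\<close>: these are
 partial isometries in the block upper triangular algebra all of whose interval compressions are
 partial isometries again, because every interval is a summand of \<open>T\<^sub>r\<^sup>m\<^sup>a\<^sup>x\<close>.  This forces the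
 projections \<open>V\<^sub>i\<^sub>j\<^sup>* P\<^sub>k V\<^sub>i\<^sub>j\<close> to commute with the diagonal projections \<open>P\<^sub>l\<close>, so that a common unit
 vector can be split off along a longest nonzero string; compactness ends the process.  The map is
 thus an orthogonal sum of maps \<open>e\<^sub>i\<^sub>j \<mapsto> e\<^bsub>h i, h j\<^esub>\<close> for \<open>h\<close> in \<open>Pend(P\<^sub>r)\<close>.  Householder reflections
 show that the multiplicities determine the class, and ranks of products of the \<open>V\<^sub>i\<^sub>j\<close> and the \<open>P\<^sub>k\<close>
 recover the multiplicities from any map at distance less than \<open>1 / (r + 1)\<close>.\<close>

section \<open>Bounded matrices\<close>

text \<open>Upper triangular matrices may be cut down to an interval of indices without losing
  multiplicativity, since a path k \<le> m \<le> l between members of an interval stays inside it.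
  Hence a single corner \<open>W\<close> carries an element of the stable algebra. Conversely, the
  preimage of an interval under a map in \<open>Pend r\<close> is empty or an interval, so a copy of
  such a map reads complete summands of the generated C*-algebra; this is what makes it
  star-extendible. The ranks see only how many copies extend a given partial map, so multiplicities
  are recovered by descending along the order of extension. A product contains at most r of the
  operators \<open>W i j\<close>, and exchanging each of them for a perturbed one costs the distance
  once; this is the origin of a constant of the order of 1 / r. The work is done by equations in a
  ring of operators: vectors are operators with one nonzero column, dimensions are bounded through
  orthonormal families, and positivity enters through the fact that x^* x + y^* y = 0 forces x =
  0.\<close>

abbreviation l2 :: "('i => complex) => 'i set => real" where
 "l2 x F \<equiv> L2_set (\<lambda>i. cmod (x i)) F"

text \<open>Only finite sections of the matrix occur, so that adjoints and sums are estimated by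
  finite sums alone; \<open>bounded_op_bnd\<close> identifies this with boundedness on the whole
  space.\<close>

definition bnd :: "real => 'i cmat => bool" where
 "bnd C a \<longleftrightarrow> 0 \<le> C \<and>
   (\<forall>F G x. finite F \<longrightarrow> finite G \<longrightarrow> l2 (\<lambda>i. \<Sum>j\<in>G. a i j * x j) F \<le> C * l2 x G)"

lemma bndD: "bnd C a ==> finite F ==> finite G ==> l2 (\<lambda>i. \<Sum>j\<in>G. a i j * x j) F \<le> C * l2 x G"
 by (auto simp: bnd_def)

lemma bnd_nonneg: "bnd C a ==> 0 \<le> C"
 by (simp add: bnd_def)

lemma l2_cauchy: "cmod (\<Sum>i\<in>F. x i * y i) \<le> l2 x F * l2 y F"
proof -
 have "cmod (\<Sum>i\<in>F. x i * y i) \<le> (\<Sum>i\<in>F. \<bar>cmod (x i)\<bar> * \<bar>cmod (y i)\<bar>)"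
  by (rule order_trans[OF norm_sum]) (simp add: norm_mult)
 also have "... \<le> l2 x F * l2 y F" by (rule L2_set_mult_ineq)
 finally show ?thesis .
qed

lemma l2_triangle: "l2 (\<lambda>i. x i + y i) F \<le> l2 x F + l2 y F"
 by (rule order_trans[OF L2_set_mono L2_set_triangle_ineq]) (auto intro: norm_triangle_ineq)

lemma l2_scale: "l2 (\<lambda>i. c * x i) F = cmod c * l2 x F"
 by (simp add: norm_mult L2_set_right_distrib)

lemma l2_cnj: "l2 (\<lambda>i. cnj (x i)) F = l2 x F" by simp

lemma l2_singleton: "l2 x {i} = cmod (x i)"
 by (simp add: L2_set_def)

lemma l2_square: "(l2 x F)\<^sup>2 = (\<Sum>i\<in>F. (cmod (x i))\<^sup>2)"
 by (simp add: L2_set_def sum_nonneg)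

lemma l2_self: "(\<Sum>i\<in>F. x i * cnj (x i)) = of_real ((l2 x F)\<^sup>2)"
 unfolding l2_square by (simp only: complex_norm_square of_real_sum)

lemma ell2_l2_le: "x \<in> ell2 ==> finite F ==> l2 x F \<le> ell2_norm x"
 unfolding ell2_def ell2_norm_def L2_set_def
 by (auto intro!: real_sqrt_le_mono finite_sum_le_infsum)

lemma l2_bounded_ell2:
 assumes "\<And>F. finite F ==> l2 x F \<le> K"
 shows "x \<in> ell2" "ell2_norm x \<le> K"
proof -
 have K: "0 \<le> K" using assms[of "{}"] by simp
 have le: "(\<Sum>i\<in>F. (cmod (x i))\<^sup>2) \<le> K\<^sup>2" if "finite F" for F
  using power_mono[OF assms[OF that], of 2] by (simp add: l2_square)
 show "x \<in> ell2" unfolding ell2_def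
  by (auto intro!: nonneg_bdd_above_summable_on bdd_aboveI2[where M = "K\<^sup>2"] le)
 hence "(\<Sum>\<^sub>\<infinity>i. (cmod (x i))\<^sup>2) \<le> K\<^sup>2"
  by (intro infsum_le_finite_sums) (auto simp: ell2_def le)
 thus "ell2_norm x \<le> K"
  unfolding ell2_norm_def using K real_le_lsqrt by blast
qed

lemma ell2_norm_nonneg: "0 \<le> ell2_norm x"
 by (simp add: ell2_norm_def infsum_nonneg)

lemma ell2_scale:
 assumes "x \<in> ell2"
 shows "(\<lambda>i. c * x i) \<in> ell2" "ell2_norm (\<lambda>i. c * x i) \<le> cmod c * ell2_norm x"
 using l2_bounded_ell2[of "\<lambda>i. c * x i" "cmod c * ell2_norm x"]
  ell2_l2_le[OF assms] by (simp_all add: l2_scale mult_left_mono)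

lemma ell2_finite_support:
 assumes "finite G" "\<And>i. i \<notin> G ==> x i = 0"
 shows "x \<in> ell2" "ell2_norm x = l2 x G"
proof -
 have le: "l2 x F \<le> l2 x G" if "finite F" for F
 proof -
  have "(\<Sum>i\<in>F. (cmod (x i))\<^sup>2) = (\<Sum>i\<in>F \<inter> G. (cmod (x i))\<^sup>2)"
   using that assms by (intro sum.mono_neutral_right) auto
  also have "... \<le> (\<Sum>i\<in>G. (cmod (x i))\<^sup>2)" using assms by (intro sum_mono2) auto
  finally show ?thesis by (simp add: L2_set_def)
 qed
 show "x \<in> ell2" using l2_bounded_ell2[OF le] by blast
 thus "ell2_norm x = l2 x G"
  using l2_bounded_ell2[OF le] ell2_l2_le[OF _ assms(1)] by (meson order_antisym)
qed

lemma ell2_mult_summable: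
 assumes "x \<in> ell2" "y \<in> ell2"
 shows "(\<lambda>i. x i * y i) summable_on UNIV"
proof -
 have "(\<lambda>i. cmod (x i * y i)) summable_on UNIV"
  by (rule abs_summable_product) (use assms in \<open>simp_all add: ell2_def norm_mult power2_eq_square\<close>)
 thus ?thesis by (rule abs_summable_summable)
qed

text \<open>Splitting a vector into a finitely supported part and a small rest is how infinite sums
  are handled: it serves associativity of the product and, later, the truncation of frame vectors to
  finitely many copies.\<close>

lemma ell2_tail:
 assumes "x \<in> ell2" "e > 0"
 obtains L where "finite L" "(\<lambda>i. if i \<in> L then 0 else x i) \<in> ell2"
  "ell2_norm (\<lambda>i. if i \<in> L then 0 else x i) \<le> e"
proof -
 let ?f = "\<lambda>i. (cmod (x i))\<^sup>2"
 have s: "?f summable_on UNIV" using assms by (simp add: ell2_def)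
 obtain L where L: "finite L" "dist (sum ?f L) (infsum ?f UNIV) \<le> e\<^sup>2"
  using infsum_finite_approximation[OF s, of "e\<^sup>2"] assms(2) by auto
 let ?y = "\<lambda>i. if i \<in> L then 0 else x i"
 have "l2 ?y F \<le> e" if "finite F" for F
 proof -
  have "(l2 ?y F)\<^sup>2 = (\<Sum>i\<in>F - L. ?f i)"
   unfolding l2_square using that by (intro sum.mono_neutral_cong_right) auto
  moreover have "sum ?f (F - L) + sum ?f L = sum ?f ((F - L) \<union> L)"
   using that L(1) by (intro sum.union_disjoint[symmetric]) auto
  moreover have "sum ?f ((F - L) \<union> L) \<le> infsum ?f UNIV"
   by (rule finite_sum_le_infsum[OF s]) (use that L(1) in auto)
  ultimately have "(l2 ?y F)\<^sup>2 \<le> e\<^sup>2" using L(2) by (simp add: dist_real_def abs_le_iff)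
  thus ?thesis using assms(2) by (auto intro: power2_le_imp_le)
 qed
 from l2_bounded_ell2[of ?y, OF this] show ?thesis by (intro that[OF L(1)])
qed

text \<open>Testing the bound on the conjugate of the row itself gives norm squared \<le> C times
  norm, and one factor cancels.\<close>

lemma bnd_row:
 assumes "bnd C a"
 shows "(\<lambda>j. a i j) \<in> ell2" "ell2_norm (\<lambda>j. a i j) \<le> C"
proof -
 have "l2 (\<lambda>j. a i j) G \<le> C" if "finite G" for G
 proof -
  have "(l2 (\<lambda>j. a i j) G)\<^sup>2 \<le> C * l2 (\<lambda>j. a i j) G"
   using bndD[OF assms, of "{i}" G "\<lambda>j. cnj (a i j)"] that
   by (simp add: l2_singleton l2_self norm_mult power2_eq_square)
  thus ?thesis
   using bnd_nonneg[OF assms] by (cases "l2 (\<lambda>j. a i j) G = 0")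
    (auto simp: power2_eq_square dest!: mult_right_le_imp_le[of _ "l2 (\<lambda>j. a i j) G"] simp: less_le)
 qed
 from l2_bounded_ell2[of "\<lambda>j. a i j", OF this]
 show "(\<lambda>j. a i j) \<in> ell2" "ell2_norm (\<lambda>j. a i j) \<le> C" by auto
qed

text \<open>Duality on finite sections: for z = a^* x one has |z|^2 = <x, a z>, and Cauchy-Schwarz
  together with the bound for a leaves |z| \<le> C |x| after a factor |z| is cancelled.\<close>

lemma bnd_adj:
 assumes "bnd C a"
 shows "bnd C (mat_adj a)"
 unfolding bnd_def
proof (intro conjI allI impI)
 show "0 \<le> C" using assms by (rule bnd_nonneg)
 fix F G :: "'a set" and x :: "'a => complex"
 assume fin: "finite F" "finite G"
 define z where "z j = (\<Sum>i\<in>G. mat_adj a j i * x i)" for j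
 have "of_real ((l2 z F)\<^sup>2) = (\<Sum>j\<in>F. cnj (z j) * (\<Sum>i\<in>G. mat_adj a j i * x i))"
  unfolding l2_self[symmetric] by (simp add: z_def mult.commute)
 also have "... = (\<Sum>i\<in>G. x i * cnj (\<Sum>j\<in>F. a i j * z j))"
  by (simp add: sum_distrib_left mat_adj_def, subst sum.swap) (simp add: mult_ac)
 finally have "(l2 z F)\<^sup>2 = cmod (\<Sum>i\<in>G. x i * cnj (\<Sum>j\<in>F. a i j * z j))"
  by (metis norm_of_real abs_of_nonneg zero_le_power2)
 also have "... \<le> l2 x G * l2 (\<lambda>i. cnj (\<Sum>j\<in>F. a i j * z j)) G" by (rule l2_cauchy)
 also have "... \<le> l2 x G * (C * l2 z F)"
  unfolding l2_cnj by (intro mult_left_mono bndD assms fin) auto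
 finally have *: "l2 z F * l2 z F \<le> (C * l2 x G) * l2 z F" by (simp add: power2_eq_square mult_ac)
 show "l2 (\<lambda>i. \<Sum>j\<in>G. mat_adj a i j * x j) F \<le> C * l2 x G"
 proof (cases "l2 z F = 0")
  case True
  thus ?thesis using bnd_nonneg[OF assms] by (simp add: z_def[symmetric])
 next
  case False
  hence "0 < l2 z F" by (simp add: less_le)
  with * have "l2 z F \<le> C * l2 x G" by (rule mult_right_le_imp_le)
  thus ?thesis by (simp add: z_def)
 qed
qed

lemma bnd_col:
 assumes "bnd C a"
 shows "(\<lambda>i. a i j) \<in> ell2" "ell2_norm (\<lambda>i. a i j) \<le> C"
 using bnd_row[OF bnd_adj[OF assms], of j] by (simp_all add: mat_adj_def ell2_def ell2_norm_def)

lemma bnd_entry: "bnd C a ==> cmod (a i j) \<le> C"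
 using ell2_l2_le[OF bnd_row(1), of C a "{j}" i] bnd_row(2)[of C a i] by (simp add: l2_singleton)

lemma mat_app_tendsto:
 assumes "bnd C a" "y \<in> ell2"
 shows "((\<lambda>K. \<Sum>k\<in>K. a i k * y k) \<longlongrightarrow> mat_app a y i) (finite_subsets_at_top UNIV)"
 unfolding mat_app_def
 by (rule infsum_tendsto) (intro ell2_mult_summable bnd_row(1)[OF assms(1)] assms(2))

lemma bnd_app_l2:
 assumes "bnd C a" "y \<in> ell2" "finite F"
 shows "l2 (mat_app a y) F \<le> C * ell2_norm y"
proof (rule tendsto_upperbound)
 show "((\<lambda>K. l2 (\<lambda>i. \<Sum>k\<in>K. a i k * y k) F) \<longlongrightarrow> l2 (mat_app a y) F) (finite_subsets_at_top UNIV)"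
  unfolding L2_set_def by (intro tendsto_intros mat_app_tendsto[OF assms(1,2)])
 show "\<forall>\<^sub>F K in finite_subsets_at_top UNIV. l2 (\<lambda>i. \<Sum>k\<in>K. a i k * y k) F \<le> C * ell2_norm y"
 proof (rule eventually_finite_subsets_at_top_weakI)
  fix K :: "'a set" assume K: "finite K"
  have "l2 (\<lambda>i. \<Sum>k\<in>K. a i k * y k) F \<le> C * l2 y K" by (rule bndD[OF assms(1,3) K])
  also have "... \<le> C * ell2_norm y"
   by (intro mult_left_mono ell2_l2_le assms K bnd_nonneg[OF assms(1)])
  finally show "l2 (\<lambda>i. \<Sum>k\<in>K. a i k * y k) F \<le> C * ell2_norm y" .
 qed
qed simp

lemma bnd_app:
 assumes "bnd C a" "y \<in> ell2"
 shows "mat_app a y \<in> ell2" "ell2_norm (mat_app a y) \<le> C * ell2_norm y"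
 using l2_bounded_ell2[of "mat_app a y", OF bnd_app_l2[OF assms]] by auto

lemma bnd_bounded_op: "bnd C a ==> bounded_op a"
 unfolding bounded_op_def using bnd_app by blast

lemma mat_app_finite:
 assumes "finite G" "\<And>j. j \<notin> G ==> x j = 0"
 shows "mat_app a x i = (\<Sum>j\<in>G. a i j * x j)"
proof -
 have "mat_app a x i = infsum (\<lambda>j. a i j * x j) G"
  unfolding mat_app_def using assms by (intro infsum_cong_neutral) auto
 thus ?thesis using assms by simp
qed

lemma bounded_op_bndI:
 assumes "0 \<le> C" "\<And>x. x \<in> ell2 ==> mat_app a x \<in> ell2 \<and> ell2_norm (mat_app a x) \<le> C * ell2_norm x"
 shows "bnd C a"
 unfolding bnd_def
proof (intro conjI allI impI)
 fix F G :: "'a set" and x :: "'a => complex"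
 assume fin: "finite F" "finite G"
 define y where "y j = (if j \<in> G then x j else 0)" for j
 have y: "y \<in> ell2" "ell2_norm y = l2 y G"
  using ell2_finite_support[of G y] fin by (auto simp: y_def)
 have "l2 y G = l2 x G" by (rule L2_set_cong) (auto simp: y_def)
 moreover have "mat_app a y i = (\<Sum>j\<in>G. a i j * x j)" for i
  using mat_app_finite[of G y a i] fin by (auto simp: y_def)
 ultimately show "l2 (\<lambda>i. \<Sum>j\<in>G. a i j * x j) F \<le> C * l2 x G"
  using assms(2)[OF y(1)] ell2_l2_le[of "mat_app a y" F] fin y(2) by auto
qed (rule assms(1))

lemma bounded_op_bnd: "bounded_op a \<longleftrightarrow> (\<exists>C. bnd C a)"
proof
 assume "bounded_op a"
 then obtain C where C: "\<And>x. x \<in> ell2 ==> mat_app a x \<in> ell2 \<and> ell2_norm (mat_app a x) \<le> C * ell2_norm x"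
  by (auto simp: bounded_op_def)
 have "bnd (max C 0) a"
  by (rule bounded_op_bndI) (use C in \<open>force intro: order_trans[OF _ mult_right_mono[OF max.cobounded1]] simp: ell2_norm_nonneg\<close>)+
 thus "\<exists>C. bnd C a" ..
qed (auto intro: bnd_bounded_op)

lemma op_norm_le:
 assumes "bnd C a"
 shows "op_norm a \<le> C"
 unfolding op_norm_def
proof (rule cSup_least)
 show "{ell2_norm (mat_app a x) |x. x \<in> ell2 \<and> ell2_norm x \<le> 1} \<noteq> {}"
  using ell2_finite_support[of "{} :: 'a set" "\<lambda>_. 0"] by auto
 fix t assume "t \<in> {ell2_norm (mat_app a x) |x. x \<in> ell2 \<and> ell2_norm x \<le> 1}"
 then obtain x where x: "x \<in> ell2" "ell2_norm x \<le> 1" "t = ell2_norm (mat_app a x)" by auto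
 thus "t \<le> C"
  using bnd_app(2)[OF assms x(1)] mult_left_mono[OF x(2) bnd_nonneg[OF assms]] by simp
qed

lemma op_norm_upper:
 assumes "bnd C a" "x \<in> ell2" "ell2_norm x \<le> 1"
 shows "ell2_norm (mat_app a x) \<le> op_norm a"
 unfolding op_norm_def
proof (rule cSup_upper)
 show "ell2_norm (mat_app a x) \<in> {ell2_norm (mat_app a x) |x. x \<in> ell2 \<and> ell2_norm x \<le> 1}"
  using assms by auto
 show "bdd_above {ell2_norm (mat_app a x) |x. x \<in> ell2 \<and> ell2_norm x \<le> 1}"
 proof (rule bdd_aboveI)
  fix t assume "t \<in> {ell2_norm (mat_app a x) |x. x \<in> ell2 \<and> ell2_norm x \<le> 1}"
  then obtain x where x: "x \<in> ell2" "ell2_norm x \<le> 1" "t = ell2_norm (mat_app a x)" by auto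
  thus "t \<le> C"
   using bnd_app(2)[OF assms(1) x(1)] mult_left_mono[OF x(2) bnd_nonneg[OF assms(1)]] by simp
 qed
qed

text \<open>The supremum over the unit ball becomes a bound for every vector by rescaling. Vectors
  of norm 0 cannot be normalised and are covered by an arbitrary bound C.\<close>

lemma bnd_op_norm:
 assumes "bounded_op a"
 shows "bnd (op_norm a) a"
proof (rule bounded_op_bndI)
 obtain C where C: "bnd C a" using assms bounded_op_bnd by blast
 have z: "(\<lambda>_. 0) \<in> (ell2 :: ('a => complex) set)" "ell2_norm (\<lambda>_ :: 'a. 0) = 0"
  using ell2_finite_support[of "{} :: 'a set" "\<lambda>_. 0"] by auto
 show "0 \<le> op_norm a"
  using op_norm_upper[OF C z(1)] z(2) ell2_norm_nonneg[of "mat_app a (\<lambda>_. 0)"] by simp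
 fix x :: "'a => complex" assume x: "x \<in> ell2"
 show "mat_app a x \<in> ell2 \<and> ell2_norm (mat_app a x) \<le> op_norm a * ell2_norm x"
 proof (cases "ell2_norm x = 0")
  case True
  thus ?thesis using bnd_app[OF C x] ell2_norm_nonneg[of "mat_app a x"] by simp
 next
  case False
  hence pos: "0 < ell2_norm x" using ell2_norm_nonneg[of x] by simp
  define c where "c = complex_of_real (ell2_norm x)"
  define y where "y i = (1 / c) * x i" for i
  have y: "y \<in> ell2" "ell2_norm y \<le> 1"
   using ell2_scale[OF x, of "1 / c"] pos by (auto simp: y_def[abs_def] c_def norm_divide)
  have xy: "x = (\<lambda>i. c * y i)" using pos by (auto simp: y_def c_def)
  have "mat_app a x = (\<lambda>i. c * mat_app a y i)"
   by (subst xy) (simp add: mat_app_def mult.left_commute infsum_cmult_right')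
  hence "ell2_norm (mat_app a x) \<le> cmod c * ell2_norm (mat_app a y)"
   using ell2_scale(2)[OF bnd_app(1)[OF C y(1)]] by simp
  also have "... \<le> cmod c * op_norm a"
   by (intro mult_left_mono op_norm_upper[OF C y]) simp
  finally show ?thesis using bnd_app(1)[OF C x] pos by (simp add: c_def mult.commute)
 qed
qed

lemma bnd_add:
 assumes "bnd C a" "bnd D b"
 shows "bnd (C + D) (a + b)"
 unfolding bnd_def
proof (intro conjI allI impI)
 show "0 \<le> C + D" using bnd_nonneg[OF assms(1)] bnd_nonneg[OF assms(2)] by simp
 fix F G :: "'a set" and x :: "'a => complex"
 assume fin: "finite F" "finite G"
 have "l2 (\<lambda>i. \<Sum>j\<in>G. (a + b) i j * x j) F
   = l2 (\<lambda>i. (\<Sum>j\<in>G. a i j * x j) + (\<Sum>j\<in>G. b i j * x j)) F"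
  by (simp add: sum.distrib distrib_right)
 also have "... \<le> C * l2 x G + D * l2 x G"
  by (rule order_trans[OF l2_triangle add_mono]) (intro bndD assms fin)+
 finally show "l2 (\<lambda>i. \<Sum>j\<in>G. (a + b) i j * x j) F \<le> (C + D) * l2 x G"
  by (simp add: distrib_right)
qed

lemma bnd_scale:
 assumes "bnd C a"
 shows "bnd (cmod c * C) (mat_scale c a)"
 unfolding bnd_def
proof (intro conjI allI impI)
 show "0 \<le> cmod c * C" using assms bnd_nonneg by fastforce
 fix F G :: "'a set" and x :: "'a => complex"
 assume fin: "finite F" "finite G"
 have "l2 (\<lambda>i. \<Sum>j\<in>G. mat_scale c a i j * x j) F = cmod c * l2 (\<lambda>i. \<Sum>j\<in>G. a i j * x j) F"
  unfolding l2_scale[symmetric] by (simp add: mat_scale_def sum_distrib_left mult.assoc)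
 also have "... \<le> cmod c * (C * l2 x G)" by (intro mult_left_mono bndD assms fin) simp
 finally show "l2 (\<lambda>i. \<Sum>j\<in>G. mat_scale c a i j * x j) F \<le> cmod c * C * l2 x G"
  by (simp add: mult.assoc)
qed

lemma mat_mul_eq_app: "(a \<bullet>\<bullet> b) i j = mat_app a (\<lambda>k. b k j) i"
 by (simp add: mat_mul_def mat_app_def)

lemma has_sum_finite_sum:
 fixes f :: "'j => 'k => complex"
 assumes "\<And>j. j \<in> G ==> f j summable_on A"
 shows "((\<lambda>k. \<Sum>j\<in>G. f j k) has_sum (\<Sum>j\<in>G. infsum (f j) A)) A"
 using assms by (induction G rule: infinite_finite_induct) (auto intro: has_sum_add)

lemma mat_app_sum:
 assumes "bnd C a" "\<And>j. j \<in> G ==> y j \<in> ell2"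
 shows "mat_app a (\<lambda>k. \<Sum>j\<in>G. y j k * x j) i = (\<Sum>j\<in>G. mat_app a (y j) i * x j)"
 unfolding mat_app_def
proof -
 have s: "(\<lambda>k. a i k * y j k * x j) summable_on UNIV" if "j \<in> G" for j
  by (intro summable_on_cmult_left ell2_mult_summable bnd_row[OF assms(1)] assms(2) that)
 have "(\<Sum>\<^sub>\<infinity>k. a i k * (\<Sum>j\<in>G. y j k * x j)) = (\<Sum>\<^sub>\<infinity>k. \<Sum>j\<in>G. a i k * y j k * x j)"
  by (simp add: sum_distrib_left mult.assoc)
 also have "... = (\<Sum>j\<in>G. \<Sum>\<^sub>\<infinity>k. a i k * y j k * x j)"
  by (rule infsumI, rule has_sum_finite_sum) (rule s)
 also have "... = (\<Sum>j\<in>G. (\<Sum>\<^sub>\<infinity>k. a i k * y j k) * x j)"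
  by (simp add: infsum_cmult_left')
 finally show "(\<Sum>\<^sub>\<infinity>k. a i k * (\<Sum>j\<in>G. y j k * x j)) = (\<Sum>j\<in>G. (\<Sum>\<^sub>\<infinity>k. a i k * y j k) * x j)" .
qed

lemma bnd_mul:
 assumes "bnd C a" "bnd D b"
 shows "bnd (C * D) (a \<bullet>\<bullet> b)"
 unfolding bnd_def
proof (intro conjI allI impI)
 show "0 \<le> C * D" using bnd_nonneg[OF assms(1)] bnd_nonneg[OF assms(2)] by simp
 fix F G :: "'a set" and x :: "'a => complex"
 assume fin: "finite F" "finite G"
 define y where "y k = (\<Sum>j\<in>G. b k j * x j)" for k
 have y: "y \<in> ell2" "ell2_norm y \<le> D * l2 x G"
  using l2_bounded_ell2[of y "D * l2 x G"] bndD[OF assms(2) _ fin(2)] by (auto simp: y_def)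
 have "(\<Sum>j\<in>G. (a \<bullet>\<bullet> b) i j * x j) = mat_app a y i" for i
  unfolding y_def[abs_def] mat_mul_eq_app
  by (rule mat_app_sum[OF assms(1), symmetric]) (rule bnd_col[OF assms(2)])
 hence "l2 (\<lambda>i. \<Sum>j\<in>G. (a \<bullet>\<bullet> b) i j * x j) F = l2 (mat_app a y) F" by simp
 also have "... \<le> C * ell2_norm y" by (rule bnd_app_l2[OF assms(1) y(1) fin(1)])
 also have "... \<le> C * (D * l2 x G)" by (intro mult_left_mono y bnd_nonneg[OF assms(1)])
 finally show "l2 (\<lambda>i. \<Sum>j\<in>G. (a \<bullet>\<bullet> b) i j * x j) F \<le> C * D * l2 x G" by (simp add: mult.assoc)
qed

lemma mat_app_add:
 assumes "bnd C a" "x \<in> ell2" "y \<in> ell2"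
 shows "mat_app a (\<lambda>k. x k + y k) i = mat_app a x i + mat_app a y i"
 unfolding mat_app_def distrib_left
 by (intro infsum_add ell2_mult_summable bnd_row[OF assms(1)] assms(2,3))

text \<open>Exchanging the two infinite sums is avoided. For finitely supported x the claim is
  finite linearity; a rest of norm at most e contributes at most C D e on either side, and e is
  arbitrary. Associativity of the matrix product is the case where x is a column.\<close>

lemma mat_app_mul:
 assumes "bnd C a" "bnd D b" "x \<in> ell2"
 shows "mat_app (a \<bullet>\<bullet> b) x i = mat_app a (mat_app b x) i"
proof -
 have ab: "bnd (C * D) (a \<bullet>\<bullet> b)" by (rule bnd_mul) fact+
 have "cmod (mat_app (a \<bullet>\<bullet> b) x i - mat_app a (mat_app b x) i) \<le> 2 * (C * D) * e" if e: "e > 0" for e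
 proof -
  obtain L where L: "finite L" "(\<lambda>i. if i \<in> L then 0 else x i) \<in> ell2"
   "ell2_norm (\<lambda>i. if i \<in> L then 0 else x i) \<le> e"
   using ell2_tail[OF assms(3) e] by blast
  define y where "y i = (if i \<in> L then x i else 0)" for i
  define z where "z i = (if i \<in> L then 0 else x i)" for i
  have y: "y \<in> ell2" using ell2_finite_support[of L y] L by (auto simp: y_def)
  have z: "z \<in> ell2" "ell2_norm z \<le> e" using L by (auto simp: z_def[abs_def])
  have xyz: "x = (\<lambda>i. y i + z i)" by (auto simp: y_def z_def)
  have b: "mat_app b x = (\<lambda>i. mat_app b y i + mat_app b z i)"
   by (subst xyz) (auto intro: mat_app_add[OF assms(2) y z(1)])
  have fin: "mat_app (a \<bullet>\<bullet> b) y i = mat_app a (mat_app b y) i"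
  proof -
   have "mat_app b y = (\<lambda>k. \<Sum>j\<in>L. b k j * y j)"
    using mat_app_finite[of L y b] L by (auto simp: y_def)
   moreover have "mat_app (a \<bullet>\<bullet> b) y i = (\<Sum>j\<in>L. (a \<bullet>\<bullet> b) i j * y j)"
    using mat_app_finite[of L y "a \<bullet>\<bullet> b"] L by (auto simp: y_def)
   ultimately show ?thesis
    using mat_app_sum[OF assms(1), of L "\<lambda>j k. b k j" y i] bnd_col[OF assms(2)]
    by (simp add: mat_mul_eq_app)
  qed
  have "mat_app (a \<bullet>\<bullet> b) x i - mat_app a (mat_app b x) i
    = mat_app (a \<bullet>\<bullet> b) z i - mat_app a (mat_app b z) i"
   unfolding b mat_app_add[OF assms(1) bnd_app(1)[OF assms(2) y] bnd_app(1)[OF assms(2) z(1)]]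
   using mat_app_add[OF ab y z(1)] xyz fin by simp
  moreover have "cmod (mat_app (a \<bullet>\<bullet> b) z i) \<le> C * D * e"
   using bnd_app_l2[OF ab z(1), of "{i}"] mult_left_mono[OF z(2) bnd_nonneg[OF ab]]
   by (simp add: l2_singleton)
  moreover have "cmod (mat_app a (mat_app b z) i) \<le> C * D * e"
  proof -
   have "cmod (mat_app a (mat_app b z) i) \<le> C * ell2_norm (mat_app b z)"
    using bnd_app_l2[OF assms(1) bnd_app(1)[OF assms(2) z(1)], of "{i}"] by (simp add: l2_singleton)
   also have "... \<le> C * (D * e)"
    using bnd_app(2)[OF assms(2) z(1)] mult_left_mono[OF z(2) bnd_nonneg[OF assms(2)]]
    by (intro mult_left_mono bnd_nonneg[OF assms(1)]) simp
   finally show ?thesis by (simp add: mult.assoc)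
  qed
  ultimately show ?thesis
   using norm_triangle_ineq4[of "mat_app (a \<bullet>\<bullet> b) z i" "mat_app a (mat_app b z) i"] by simp
 qed
 hence "cmod (mat_app (a \<bullet>\<bullet> b) x i - mat_app a (mat_app b x) i) \<le> 0 + e" if "e > 0" for e
 proof -
  let ?K = "2 * (C * D)"
  have K: "0 \<le> ?K" using bnd_nonneg[OF ab] by simp
  \<comment> \<open>Dividing by \<open>?K + 1\<close> instead of \<open>?K\<close> covers the case
    \<open>?K = 0\<close>.\<close>
  have "cmod (mat_app (a \<bullet>\<bullet> b) x i - mat_app a (mat_app b x) i) \<le> ?K * (e / (?K + 1))"
   by (rule \<open>\<And>e. e > 0 ==> _\<close>) (use K that in simp)
  also have "... \<le> e" using K that by (simp add: field_simps)
  finally show ?thesis by simp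
 qed
 hence "cmod (mat_app (a \<bullet>\<bullet> b) x i - mat_app a (mat_app b x) i) \<le> 0"
  by (rule field_le_epsilon)
 thus ?thesis by simp
qed

lemma mat_mul_assoc:
 assumes "bnd A a" "bnd B b" "bnd C c"
 shows "a \<bullet>\<bullet> b \<bullet>\<bullet> c = a \<bullet>\<bullet> (b \<bullet>\<bullet> c)"
 using mat_app_mul[OF assms(1,2) bnd_col(1)[OF assms(3)]]
 by (intro ext) (simp add: mat_mul_eq_app)

lemma mat_mul_add_right:
 assumes "bnd A a" "bnd B b" "bnd C c"
 shows "a \<bullet>\<bullet> (b + c) = a \<bullet>\<bullet> b + a \<bullet>\<bullet> c"
 using mat_app_add[OF assms(1) bnd_col(1)[OF assms(2)] bnd_col(1)[OF assms(3)]]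
 by (intro ext) (simp add: mat_mul_eq_app)

lemma mat_adj_mul: "mat_adj (a \<bullet>\<bullet> b) = mat_adj b \<bullet>\<bullet> mat_adj a"
 unfolding mat_adj_def mat_mul_def by (simp add: infsum_cnj[symmetric] mult.commute del: infsum_cnj)

lemma mat_adj_add: "mat_adj (a + b) = mat_adj a + mat_adj b"
 by (intro ext) (simp add: mat_adj_def)

lemma mat_adj_adj [simp]: "mat_adj (mat_adj a) = a"
 by (auto simp: mat_adj_def)

lemma mat_mul_add_left:
 assumes "bnd A a" "bnd B b" "bnd C c"
 shows "(a + b) \<bullet>\<bullet> c = a \<bullet>\<bullet> c + b \<bullet>\<bullet> c"
 using mat_mul_add_right[OF bnd_adj[OF assms(3)] bnd_adj[OF assms(1)] bnd_adj[OF assms(2)]]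
 by (metis mat_adj_adj mat_adj_add mat_adj_mul)

text \<open>Matrix units, diagonal projections and shifts are all 0/1 matrices of partial injections,
 given as relations: their calculus is that of relational composition.\<close>

definition rmat :: "('i \<times> 'i) set => 'i cmat" where
 "rmat R = (\<lambda>i j. if (i, j) \<in> R then 1 else 0)"

definition pinj :: "('i \<times> 'i) set => bool" where
 "pinj R \<longleftrightarrow> single_valued R \<and> single_valued (R\<inverse>)"

text \<open>A partial injection only moves coordinates: each row picks at most one coordinate of x
  and no coordinate is picked twice, so the norm cannot grow.\<close>

lemma bnd_rmat:
 assumes "pinj R"
 shows "bnd 1 (rmat R)"
 unfolding bnd_def
proof (intro conjI allI impI)
 fix F G :: "'a set" and x :: "'a => complex"
 assume fin: "finite F" "finite G"
 define F' where "F' = {i \<in> F. \<exists>j\<in>G. (i, j) \<in> R}"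
 define g where "g i = (SOME j. j \<in> G \<and> (i, j) \<in> R)" for i
 have g: "g i \<in> G" "(i, g i) \<in> R" if "i \<in> F'" for i
  using someI_ex[of "\<lambda>j. j \<in> G \<and> (i, j) \<in> R"] that by (auto simp: F'_def g_def)
 have uniq: "j = g i" if "i \<in> F'" "(i, j) \<in> R" for i j
  using g(2)[OF that(1)] that(2) assms by (auto simp: pinj_def single_valued_def)
 have inj: "inj_on g F'"
  using g(2) assms by (auto simp: inj_on_def pinj_def single_valued_def) metis
 have "(\<Sum>j\<in>G. rmat R i j * x j) = (if i \<in> F' then x (g i) else 0)" if "i \<in> F" for i
 proof (cases "i \<in> F'")
  case True
  hence "(\<Sum>j\<in>G. rmat R i j * x j) = (\<Sum>j\<in>{g i}. rmat R i j * x j)"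
   using g(1)[OF True] fin by (intro sum.mono_neutral_right) (auto simp: rmat_def dest: uniq[OF True])
  thus ?thesis using True g(2)[OF True] by (simp add: rmat_def)
 next
  case False
  thus ?thesis using that by (auto simp: F'_def rmat_def intro!: sum.neutral)
 qed
 hence "(l2 (\<lambda>i. \<Sum>j\<in>G. rmat R i j * x j) F)\<^sup>2 = (\<Sum>i\<in>F'. (cmod (x (g i)))\<^sup>2)"
  unfolding l2_square using fin by (intro sum.mono_neutral_cong_right) (auto simp: F'_def)
 also have "... = (\<Sum>j\<in>g ` F'. (cmod (x j))\<^sup>2)" using inj by (simp add: sum.reindex)
 also have "... \<le> (l2 x G)\<^sup>2" unfolding l2_square using fin g(1) by (intro sum_mono2) auto
 finally have "l2 (\<lambda>i. \<Sum>j\<in>G. rmat R i j * x j) F \<le> l2 x G"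
  by (rule power2_le_imp_le) simp
 thus "l2 (\<lambda>i. \<Sum>j\<in>G. rmat R i j * x j) F \<le> 1 * l2 x G" by simp
qed simp

lemma infsum_single:
 assumes "\<And>k. k \<noteq> k0 ==> f k = 0"
 shows "infsum f UNIV = (f k0 :: complex)"
proof -
 have "infsum f UNIV = infsum f {k0}" using assms by (intro infsum_cong_neutral) auto
 thus ?thesis by simp
qed

lemma rmat_mul_entry:
 assumes "pinj R" "(i, k) \<in> R"
 shows "(rmat R \<bullet>\<bullet> b) i j = b k j"
proof -
 have "(\<Sum>\<^sub>\<infinity>l. rmat R i l * b l j) = rmat R i k * b k j"
  by (rule infsum_single) (use assms in \<open>auto simp: rmat_def pinj_def single_valued_def\<close>)
 thus ?thesis using assms(2) by (simp add: mat_mul_def rmat_def)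
qed

lemma rmat_mul_entry0:
 assumes "\<And>k. (i, k) \<notin> R"
 shows "(rmat R \<bullet>\<bullet> b) i j = 0"
 unfolding mat_mul_def using assms by (auto simp: rmat_def)

lemma rmat_mul:
 assumes "pinj R"
 shows "rmat R \<bullet>\<bullet> rmat S = rmat (R O S)"
proof (intro ext)
 fix i j
 show "(rmat R \<bullet>\<bullet> rmat S) i j = rmat (R O S) i j"
 proof (cases "\<exists>k. (i, k) \<in> R")
  case True
  then obtain k where k: "(i, k) \<in> R" by blast
  thus ?thesis using rmat_mul_entry[OF assms k, of "rmat S" j] assms
   by (auto simp: rmat_def pinj_def single_valued_def)
 next
  case False
  thus ?thesis using rmat_mul_entry0[of i R "rmat S" j] by (auto simp: rmat_def)
 qed
qed

lemma rmat_adj: "mat_adj (rmat R) = rmat (R\<inverse>)"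
 by (intro ext) (simp add: mat_adj_def rmat_def)

lemma pinj_O: "pinj R ==> pinj S ==> pinj (R O S)"
 by (auto simp: pinj_def single_valued_def) blast+

lemma pinj_converse: "pinj (R\<inverse>) = pinj R"
 by (auto simp: pinj_def)

lemma mat_one_rmat: "mat_one = rmat Id"
 by (auto simp: mat_one_def rmat_def)

lemma pinj_Id: "pinj Id"
 by (auto simp: pinj_def single_valued_def)

section \<open>Bounded operators as a ring with adjoint and norm\<close>

lemma bounded_op_mul: "bounded_op a ==> bounded_op b ==> bounded_op (a \<bullet>\<bullet> b)"
 using bnd_mul bounded_op_bnd by blast

lemma bounded_op_add: "bounded_op a ==> bounded_op b ==> bounded_op (a + b)"
 using bnd_add bounded_op_bnd by blast

lemma bounded_op_scale: "bounded_op a ==> bounded_op (mat_scale c a)"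
 using bnd_scale bounded_op_bnd by blast

lemma bounded_op_adj: "bounded_op a ==> bounded_op (mat_adj a)"
 using bnd_adj bounded_op_bnd by blast

lemma bounded_op_rmat: "pinj R ==> bounded_op (rmat R)"
 using bnd_rmat bounded_op_bnd by blast

lemma pinj_empty: "pinj {}"
 by (simp add: pinj_def)

lemma rmat_empty: "rmat {} = 0"
 by (intro ext) (simp add: rmat_def)

lemma bounded_op_0: "bounded_op 0"
 using bounded_op_rmat[OF pinj_empty] by (simp add: rmat_empty)

lemma bounded_op_one: "bounded_op mat_one"
 using bounded_op_rmat[OF pinj_Id] by (simp add: mat_one_rmat)

lemma uminus_eq_scale: "- a = mat_scale (-1) a"
 by (intro ext) (simp add: mat_scale_def)

lemma bounded_op_uminus: "bounded_op a ==> bounded_op (- a)"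
 unfolding uminus_eq_scale by (rule bounded_op_scale)

lemma bounded_op_diff: "bounded_op a ==> bounded_op b ==> bounded_op (a - b)"
 using bounded_op_add[of a "- b"] bounded_op_uminus[of b] by simp

lemma mat_scale_mul_left: "mat_scale c a \<bullet>\<bullet> b = mat_scale c (a \<bullet>\<bullet> b)"
 by (intro ext) (simp add: mat_mul_def mat_scale_def mult.assoc infsum_cmult_right')

lemma mat_scale_mul_right: "a \<bullet>\<bullet> mat_scale c b = mat_scale c (a \<bullet>\<bullet> b)"
 by (intro ext) (simp add: mat_mul_def mat_scale_def mult.left_commute infsum_cmult_right')

lemma mat_one_mul_left: "mat_one \<bullet>\<bullet> a = a"
 unfolding mat_one_rmat by (intro ext) (rule rmat_mul_entry[OF pinj_Id], simp)

lemma mat_adj_one: "mat_adj mat_one = mat_one"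
 by (simp add: mat_one_rmat rmat_adj)

lemma mat_one_mul_right: "a \<bullet>\<bullet> mat_one = a"
 using mat_one_mul_left[of "mat_adj a"] by (metis mat_adj_adj mat_adj_mul mat_adj_one)

text \<open>As a type the bounded operators are an instance of \<open>ring_1\<close>, which turns
  the long computations with blocks into equational reasoning. Passing between a matrix and its
  operator is done by \<open>mat\<close> and \<open>Bop\<close>.\<close>

typedef 'i bop = "{a :: 'i cmat. bounded_op a}" morphisms mat Bop
 using bounded_op_0 by blast

setup_lifting type_definition_bop

instantiation bop :: (type) ring_1
begin

lift_definition zero_bop :: "'a bop" is 0 by (rule bounded_op_0)
lift_definition one_bop :: "'a bop" is mat_one by (rule bounded_op_one)
lift_definition plus_bop :: "'a bop => 'a bop => 'a bop" is "(+)" by (rule bounded_op_add)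
lift_definition minus_bop :: "'a bop => 'a bop => 'a bop" is "(-)" by (rule bounded_op_diff)
lift_definition uminus_bop :: "'a bop => 'a bop" is "uminus" by (rule bounded_op_uminus)
lift_definition times_bop :: "'a bop => 'a bop => 'a bop" is "(\<bullet>\<bullet>)" by (rule bounded_op_mul)

instance
proof
 fix a b c :: "'a bop"
 show "a * b * c = a * (b * c)"
  by transfer (auto simp: bounded_op_bnd intro: mat_mul_assoc)
 show "(a + b) * c = a * c + b * c"
  by transfer (auto simp: bounded_op_bnd intro: mat_mul_add_left)
 show "a * (b + c) = a * b + a * c"
  by transfer (auto simp: bounded_op_bnd intro: mat_mul_add_right)
 show "1 * a = a" by transfer (rule mat_one_mul_left)
 show "a * 1 = a" by transfer (rule mat_one_mul_right)
 show "(0::'a bop) \<noteq> 1" by transfer (auto simp: mat_one_def fun_eq_iff)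
 show "a + b + c = a + (b + c)" by transfer (rule add.assoc)
 show "a + b = b + a" by transfer (rule add.commute)
 show "0 + a = a" by transfer simp
 show "- a + a = 0" by transfer simp
 show "a - b = a + - b" by transfer simp
qed

end

lift_definition adj :: "'i bop => 'i bop" is mat_adj by (rule bounded_op_adj)
text \<open>Scalars enter as central operators c 1, so that a scalar multiple is an ordinary product
  in the ring.\<close>

lift_definition sc :: "complex => 'i bop" is "\<lambda>c. mat_scale c mat_one"
 by (rule bounded_op_scale[OF bounded_op_one])
text \<open>The value 0 for relations that are not partial injections is a default that makes the
  operator bounded for every argument.\<close>

lift_definition rl :: "('i \<times> 'i) set => 'i bop" is "\<lambda>R. if pinj R then rmat R else 0"
 by (auto simp: bounded_op_rmat bounded_op_0)
lift_definition nrm :: "'i bop => real" is op_norm .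

lemma bop_eqI: "(\<And>i j. mat a i j = mat b i j) ==> a = b"
 by transfer (intro ext)

lemma bounded_mat [simp]: "bounded_op (mat a)"
 using mat by blast

lemma mat_Bop: "bounded_op a ==> mat (Bop a) = a"
 by (simp add: Bop_inverse)

lemma mat_add: "mat (a + b) = mat a + mat b" by (rule plus_bop.rep_eq)
lemma mat_mult: "mat (a * b) = mat a \<bullet>\<bullet> mat b" by (rule times_bop.rep_eq)
lemma mat_minus: "mat (a - b) = mat a - mat b" by (rule minus_bop.rep_eq)
lemma mat_adj: "mat (adj a) = mat_adj (mat a)" by (rule adj.rep_eq)
lemma mat_sc_mult: "mat (sc c * a) = mat_scale c (mat a)"
 by transfer (simp add: mat_scale_mul_left mat_one_mul_left)
lemma mat_sum: "mat (\<Sum>x\<in>A. f x) i j = (\<Sum>x\<in>A. mat (f x) i j)"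
 by (induction A rule: infinite_finite_induct) (simp_all add: mat_add zero_bop.rep_eq)

lemma adj_entry: "mat (adj a) i j = cnj (mat a j i)"
 by (simp add: mat_adj mat_adj_def)

lemma sc_mult_entry: "mat (sc c * a) i j = c * mat a i j"
 by (simp add: mat_sc_mult mat_scale_def)

lemma adj_mult [simp]: "adj (a * b) = adj b * adj a" by transfer (rule mat_adj_mul)
lemma adj_add [simp]: "adj (a + b) = adj a + adj b" by transfer (rule mat_adj_add)
lemma adj_adj [simp]: "adj (adj a) = a" by transfer simp
lemma adj_0 [simp]: "adj 0 = 0" by (rule bop_eqI) (simp add: adj_entry zero_bop.rep_eq)
lemma adj_1 [simp]: "adj 1 = 1" by transfer (rule mat_adj_one)
lemma adj_minus [simp]: "adj (- a) = - adj a"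
 by (rule bop_eqI) (simp add: adj_entry uminus_bop.rep_eq)
lemma adj_diff [simp]: "adj (a - b) = adj a - adj b"
 by (rule bop_eqI) (simp add: adj_entry minus_bop.rep_eq)
lemma adj_sum [simp]: "adj (\<Sum>x\<in>A. f x) = (\<Sum>x\<in>A. adj (f x))"
 by (induction A rule: infinite_finite_induct) simp_all
lemma adj_eq_0 [simp]: "adj a = 0 \<longleftrightarrow> a = 0" by (metis adj_adj adj_0)

lemma sc_add: "sc (c + d) = sc c + sc d"
 by transfer (intro ext, simp add: mat_scale_def distrib_right)
lemma sc_0 [simp]: "sc 0 = 0" by transfer (intro ext, simp add: mat_scale_def)
lemma sc_1 [simp]: "sc 1 = 1" by transfer (simp add: mat_scale_def)
lemma sc_mult: "sc (c * d) = sc c * sc d"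
 by (rule bop_eqI) (simp add: sc_mult_entry, simp add: sc.rep_eq mat_scale_def)
lemma sc_commute: "a * sc c = sc c * a"
 by transfer (simp add: mat_scale_mul_right mat_scale_mul_left mat_one_mul_left mat_one_mul_right)
lemma sc_left_commute: "a * (sc c * b) = sc c * (a * b)"
 by (metis mult.assoc sc_commute)
lemma adj_sc [simp]: "adj (sc c) = sc (cnj c)"
 by (rule bop_eqI) (simp add: adj_entry sc.rep_eq mat_scale_def mat_one_def)
lemma sc_minus: "sc (- c) = - sc c"
 using sc_add[of c "- c"] by (simp add: eq_neg_iff_add_eq_0 add.commute)
lemma sc_diff: "sc (c - d) = sc c - sc d"
 using sc_add[of c "- d"] by (simp add: sc_minus)
lemma sc_sum: "sc (\<Sum>x\<in>A. f x) = (\<Sum>x\<in>A. sc (f x))"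
 by (induction A rule: infinite_finite_induct) (simp_all add: sc_add)

lemma bnd_nrm: "bnd (nrm a) (mat a)"
 unfolding nrm.rep_eq by (rule bnd_op_norm) simp

lemma nrm_le: "bnd C (mat a) ==> nrm a \<le> C"
 unfolding nrm.rep_eq by (rule op_norm_le)

lemma nrm_nonneg [simp]: "0 \<le> nrm a"
 using bnd_nrm bnd_nonneg by blast

lemma nrm_add: "nrm (a + b) \<le> nrm a + nrm b"
 by (rule nrm_le) (simp add: mat_add bnd_add bnd_nrm)

lemma nrm_mult: "nrm (a * b) \<le> nrm a * nrm b"
 by (rule nrm_le) (simp add: mat_mult bnd_mul bnd_nrm)

lemma nrm_sc_le: "nrm (sc c * a) \<le> cmod c * nrm a"
 by (rule nrm_le) (simp add: mat_sc_mult bnd_scale bnd_nrm)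

lemma nrm_adj [simp]: "nrm (adj a) = nrm a"
proof -
 have "nrm (adj a) \<le> nrm a" for a :: "'a bop"
  by (rule nrm_le) (simp add: mat_adj bnd_adj bnd_nrm)
 from this[of a] this[of "adj a"] show ?thesis by simp
qed

lemma nrm_entry: "cmod (mat a i j) \<le> nrm a"
 by (rule bnd_entry[OF bnd_nrm])

lemma nrm_eq_0 [simp]: "nrm a = 0 \<longleftrightarrow> a = 0"
proof
 assume "nrm a = 0"
 hence "mat a i j = 0" for i j using nrm_entry[of a i j] by simp
 thus "a = 0" by (intro bop_eqI) (simp add: zero_bop.rep_eq)
next
 have "bnd 0 (mat (0::'a bop))" by (simp add: bnd_def zero_bop.rep_eq L2_set_def)
 thus "a = 0 ==> nrm a = 0" using nrm_le nrm_nonneg by (metis order_antisym)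
qed

lemma nrm_0 [simp]: "nrm 0 = 0" by simp

lemma nrm_minus [simp]: "nrm (- a) = nrm a"
proof -
 have "nrm (- a) \<le> nrm a" for a :: "'a bop"
  using nrm_sc_le[of "-1" a] by (simp add: sc_minus)
 from this[of a] this[of "- a"] show ?thesis by simp
qed

lemma nrm_diff_commute: "nrm (a - b) = nrm (b - a)"
 using nrm_minus[of "a - b"] by (simp del: nrm_minus)

lemma nrm_sum: "nrm (\<Sum>x\<in>A. f x) \<le> (\<Sum>x\<in>A. nrm (f x))"
 by (induction A rule: infinite_finite_induct)
  (auto intro: order_trans[OF nrm_add])

lemma mat_rl: "pinj R ==> mat (rl R) = rmat R"
 by (simp add: rl.rep_eq)

lemma rl_mult: "pinj R ==> pinj S ==> rl R * rl S = rl (R O S)"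
 by (simp add: bop_eqI mat_mult mat_rl rmat_mul pinj_O)

lemma adj_rl: "pinj R ==> adj (rl R) = rl (R\<inverse>)"
 by (simp add: bop_eqI mat_adj mat_rl rmat_adj pinj_converse)

lemma rl_entry: "pinj R ==> mat (rl R) i j = (if (i, j) \<in> R then 1 else 0)"
 by (simp add: mat_rl rmat_def)

lemma rl_empty [simp]: "rl {} = 0"
 by (rule bop_eqI) (simp add: mat_rl pinj_empty rmat_empty zero_bop.rep_eq)

lemma nrm_rl: "nrm (rl R) \<le> 1"
proof (cases "pinj R")
 case True
 thus ?thesis by (intro nrm_le) (simp add: mat_rl bnd_rmat)
next
 case False
 hence "rl R = 0" by (intro bop_eqI) (simp add: rl.rep_eq zero_bop.rep_eq)
 thus ?thesis by (simp add: nrm_eq_0[THEN iffD2])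
qed

lemma rl_mult_entry: "pinj R ==> (i, k) \<in> R ==> mat (rl R * a) i j = mat a k j"
 by (simp add: mat_mult mat_rl rmat_mul_entry)

lemma rl_mult_entry0: "pinj R ==> (\<And>k. (i, k) \<notin> R) ==> mat (rl R * a) i j = 0"
 by (simp add: mat_mult mat_rl rmat_mul_entry0)

lemma mult_adj_rl_entry: "pinj R ==> (j, k) \<in> R ==> mat (a * adj (rl R)) i j = mat a i k"
 using rl_mult_entry[of R j k "adj a" i] adj_entry[of "rl R * adj a" i j]
 by (simp add: adj_entry)

lemma mult_adj_rl_entry0: "pinj R ==> (\<And>k. (j, k) \<notin> R) ==> mat (a * adj (rl R)) i j = 0"
 using rl_mult_entry0[of R j "adj a" i] adj_entry[of "rl R * adj a" i j]
 by (simp add: adj_entry)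

text \<open>For finitely supported v the square |a v|^2 equals <a^* a v, v> and is therefore at most
  the norm of a^* a times |v|^2. Finite support of v permits the sum over its coordinates to be
  exchanged with the infinite sum in |a v|^2.\<close>

lemma nrm_cstar: "(nrm a)\<^sup>2 \<le> nrm (adj a * a)"
proof -
 let ?K = "nrm (adj a * a)"
 have "bnd (sqrt ?K) (mat a)"
  unfolding bnd_def
 proof (intro conjI allI impI)
  fix F G :: "'a set" and x :: "'a => complex"
  assume fin: "finite F" "finite G"
  define v where "v j = (if j \<in> G then x j else 0)" for j
  have v: "v \<in> ell2" "ell2_norm v = l2 v G" using ell2_finite_support[of G v] fin by (auto simp: v_def)
  have lv: "l2 v G = l2 x G" by (rule L2_set_cong) (auto simp: v_def)
  define w where "w = mat_app (mat a) v"
  have w: "w i = (\<Sum>j\<in>G. mat a i j * v j)" for i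
   unfolding w_def using fin by (intro mat_app_finite) (auto simp: v_def)
  have we: "w \<in> ell2" unfolding w_def by (rule bnd_app[OF bnd_nrm v(1)])
  have s: "(\<lambda>i. mat (adj a) j i * w i * cnj (v j)) summable_on UNIV" for j
   by (intro summable_on_cmult_left ell2_mult_summable bnd_row[OF bnd_nrm] we)
  have aw: "mat_app (mat (adj a)) w j = (\<Sum>k\<in>G. mat (adj a * a) j k * v k)" for j
   unfolding w_def mat_mult
   using mat_app_mul[OF bnd_nrm bnd_nrm v(1), of "adj a" a j]
    mat_app_finite[of G v "mat (adj a) \<bullet>\<bullet> mat a" j] fin by (simp add: v_def)
  have "complex_of_real (\<Sum>\<^sub>\<infinity>i. (cmod (w i))\<^sup>2) = (\<Sum>\<^sub>\<infinity>i. w i * cnj (w i))"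
   unfolding complex_norm_square[symmetric]
   by (rule infsumI[symmetric], rule has_sum_of_real, rule has_sum_infsum)
    (use we in \<open>simp add: ell2_def\<close>)
  also have "... = (\<Sum>\<^sub>\<infinity>i. \<Sum>j\<in>G. mat (adj a) j i * w i * cnj (v j))"
   unfolding w by (simp add: adj_entry sum_distrib_left mult_ac)
  also have "... = (\<Sum>j\<in>G. mat_app (mat (adj a)) w j * cnj (v j))"
   using has_sum_finite_sum[of G "\<lambda>j i. mat (adj a) j i * w i * cnj (v j)" UNIV] s
   by (intro infsumI) (simp add: mat_app_def infsum_cmult_left')
  finally have eq: "complex_of_real (\<Sum>\<^sub>\<infinity>i. (cmod (w i))\<^sup>2)
    = (\<Sum>j\<in>G. mat_app (mat (adj a)) w j * cnj (v j))" .
  have "(\<Sum>\<^sub>\<infinity>i. (cmod (w i))\<^sup>2) = cmod (complex_of_real (\<Sum>\<^sub>\<infinity>i. (cmod (w i))\<^sup>2))"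
   unfolding norm_of_real by (simp add: infsum_nonneg)
  also have "... = cmod (\<Sum>j\<in>G. mat_app (mat (adj a)) w j * cnj (v j))" unfolding eq ..
  also have "... \<le> l2 (mat_app (mat (adj a)) w) G * l2 (\<lambda>j. cnj (v j)) G" by (rule l2_cauchy)
  also have "... \<le> (?K * l2 v G) * l2 v G"
   unfolding l2_cnj aw by (intro mult_right_mono bndD bnd_nrm fin) simp
  finally have "(\<Sum>\<^sub>\<infinity>i. (cmod (w i))\<^sup>2) \<le> (sqrt ?K * l2 v G)\<^sup>2"
   by (simp add: power_mult_distrib power2_eq_square mult_ac)
  hence "ell2_norm w \<le> sqrt ?K * l2 v G"
   unfolding ell2_norm_def by (intro real_le_lsqrt) (auto intro: infsum_nonneg)
  hence "l2 w F \<le> sqrt ?K * l2 v G" using ell2_l2_le[OF we fin(1)] by simp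
  moreover have "w = (\<lambda>i. \<Sum>j\<in>G. mat a i j * x j)" by (intro ext) (simp add: w v_def)
  ultimately show "l2 (\<lambda>i. \<Sum>j\<in>G. mat a i j * x j) F \<le> sqrt ?K * l2 x G" using lv by simp
 qed simp
 hence "nrm a \<le> sqrt ?K" by (rule nrm_le)
 hence "(nrm a)\<^sup>2 \<le> (sqrt ?K)\<^sup>2" by (intro power_mono) simp_all
 thus ?thesis by simp
qed

lemma nrm_cstar_eq: "nrm (adj a * a) = (nrm a)\<^sup>2"
 using nrm_cstar[of a] nrm_mult[of "adj a" a] by (simp add: power2_eq_square)

lemma nrm_1 [simp]: "nrm (1 :: 'i bop) = 1"
proof -
 have "nrm (1 :: 'i bop) = (nrm (1 :: 'i bop))\<^sup>2" using nrm_cstar_eq[of "1 :: 'i bop"] by simp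
 hence "nrm (1 :: 'i bop) = 0 \<or> nrm (1 :: 'i bop) = 1" by (simp add: power2_eq_square)
 thus ?thesis using nrm_eq_0[of "1 :: 'i bop"] by (auto simp del: nrm_eq_0)
qed

lemma adj_mult_self_0: "adj x * x = 0 ==> x = 0"
proof -
 assume "adj x * x = 0"
 hence "(nrm x)\<^sup>2 = 0" using nrm_cstar_eq[of x] by simp
 thus ?thesis by simp
qed

lemma adj_self_diag: "mat (adj x * x) i i = of_real ((ell2_norm (\<lambda>k. mat x k i))\<^sup>2)"
proof -
 have "mat (adj x * x) i i = (\<Sum>\<^sub>\<infinity>k. mat x k i * cnj (mat x k i))"
  by (simp add: mat_mult mat_mul_def adj_entry mult.commute)
 also have "... = of_real (\<Sum>\<^sub>\<infinity>k. (cmod (mat x k i))\<^sup>2)"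
  unfolding complex_norm_square[symmetric]
  by (rule infsumI, rule has_sum_of_real, rule has_sum_infsum)
   (use bnd_col(1)[OF bnd_nrm, of x i] in \<open>simp add: ell2_def\<close>)
 finally show ?thesis by (simp add: ell2_norm_def infsum_nonneg)
qed

text \<open>Diagonal entries of \<open>adj x * x\<close> are squared column norms; a vanishing sum
  of two nonnegative numbers makes both vanish. This stands in for the order on selfadjoint
  operators.\<close>

lemma adj_mult_self_add_0:
 assumes "adj x * x + adj y * y = 0"
 shows "x = 0"
proof -
 have "mat (adj x * x) i i + mat (adj y * y) i i = 0" for i
  using assms by (metis mat_add zero_bop.rep_eq plus_fun_apply zero_fun_apply)
 hence 0: "(ell2_norm (\<lambda>k. mat x k i))\<^sup>2 + (ell2_norm (\<lambda>k. mat y k i))\<^sup>2 = 0" for i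
  unfolding adj_self_diag by (metis of_real_add of_real_eq_0_iff)
 have "mat x k i = 0" for k i
 proof -
  have "ell2_norm (\<lambda>k. mat x k i) = 0" using 0[of i] by (simp add: add_nonneg_eq_0_iff)
  thus ?thesis
   using ell2_l2_le[OF bnd_col(1)[OF bnd_nrm, of x i], of "{k}"] by (simp add: l2_singleton)
 qed
 thus ?thesis by (intro bop_eqI) (simp add: zero_bop.rep_eq)
qed

section \<open>Generated C*-algebras\<close>

lemma cstar_algebra_bounded: "cstar_algebra (Collect bounded_op)"
 by (auto simp: cstar_algebra_def op_closure_def bounded_op_0 bounded_op_add bounded_op_mul
   bounded_op_scale bounded_op_adj)

lemma op_closure_mono: "S \<subseteq> T ==> op_closure S \<subseteq> op_closure T"
 unfolding op_closure_def by blast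

lemma cstar_algebra_Inter:
 assumes "T \<noteq> {}" "\<And>B. B \<in> T ==> cstar_algebra B"
 shows "cstar_algebra (\<Inter>T)"
proof -
 have "op_closure (\<Inter>T) \<subseteq> B" if "B \<in> T" for B
  using op_closure_mono[OF Inter_lower[OF that]] assms(2)[OF that] unfolding cstar_algebra_def by blast
 moreover have "\<Inter>T \<subseteq> Collect bounded_op" using assms unfolding cstar_algebra_def by blast
 ultimately show ?thesis
  using assms(2) unfolding cstar_algebra_def by (auto intro!: Inter_greatest)
qed

text \<open>The intersection that defines the hull is over a nonempty family, because the bounded
  operators themselves form a C*-algebra.\<close>

lemma cstar_algebra_cstar:
 assumes "A \<subseteq> Collect bounded_op"
 shows "cstar_algebra (cstar A)"
 unfolding cstar_def hull_def
 by (rule cstar_algebra_Inter) (use assms cstar_algebra_bounded in auto)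

lemma cstar_superset: "A \<subseteq> cstar A"
 unfolding cstar_def by (rule hull_subset)

lemma cstar_least: "A \<subseteq> B ==> cstar_algebra B ==> cstar A \<subseteq> B"
 unfolding cstar_def by (rule hull_minimal)

lemma cstar_mono: "A \<subseteq> B ==> cstar A \<subseteq> cstar B"
 unfolding cstar_def by (rule hull_mono)

text \<open>Makes an equation for a product of two factors applicable inside right-nested products,
  where the two factors are not a subterm.\<close>

lemma assoc_left: "x * y = z ==> x * (y * c) = z * (c :: 'a :: semigroup_mult)"
 by (simp flip: mult.assoc)

section \<open>Vectors and inner products inside the ring\<close>

definition eu :: "'i => 'i bop" where "eu z = rl {(z, z)}"

lemma pinj_single: "pinj {(i, j)}"
 by (simp add: pinj_def single_valued_def)

lemma single_O: "{(i, j)} O {(k, l)} = (if j = k then {(i, l)} else {})" by auto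

lemma single_converse: "{(i, j)}\<inverse> = {(j, i)}" by auto

lemma eu_eu [simp]: "eu z * eu z = eu z"
 by (simp add: eu_def rl_mult pinj_single single_O)

lemma adj_eu [simp]: "adj (eu z) = eu z"
 by (simp add: eu_def adj_rl pinj_single single_converse)

lemma eu_mult_eu: "eu z * a * eu z = sc (mat a z z) * eu z"
proof (rule bop_eqI)
 fix i j
 have p: "pinj {(z, z)}" by (rule pinj_single)
 have "mat (eu z * a * eu z) i j = mat (eu z * a * adj (rl {(z, z)})) i j"
  by (metis adj_eu eu_def)
 also have "... = (if j = z then mat (eu z * a) i z else 0)"
  using mult_adj_rl_entry[OF p, of j z] mult_adj_rl_entry0[OF p, of j] by auto
 also have "mat (eu z * a) i z = (if i = z then mat a z z else 0)"
  unfolding eu_def using rl_mult_entry[OF p, of i z] rl_mult_entry0[OF p, of i] by auto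
 finally show "mat (eu z * a * eu z) i j = mat (sc (mat a z z) * eu z) i j"
  by (simp add: sc_mult_entry eu_def rl_entry p)
qed

text \<open>After fixing a basis index z, a Hilbert space vector is coded as an operator x with
  \<open>x * eu z = x\<close>, that is by its column z. Then \<open>adj x * y\<close> is the inner
  product times \<open>eu z\<close>, and \<open>x * adj y\<close> is the usual rank one
  operator.\<close>

lemma vec_inner:
 assumes "x * eu z = x" "y * eu z = y"
 shows "adj x * y = sc (mat (adj x * y) z z) * eu z"
proof -
 have "adj x * y = adj (x * eu z) * (y * eu z)" using assms by simp
 also have "... = eu z * (adj x * y) * eu z" by (simp add: mult.assoc)
 finally show ?thesis by (simp add: eu_mult_eu)
qed

lemma eu_neq_0: "eu z \<noteq> 0"
proof
 assume "eu z = 0"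
 hence "mat (eu z) z z = 0" by (simp add: zero_bop.rep_eq)
 thus False by (simp add: eu_def rl_entry pinj_single)
qed

lemma nrm_eu [simp]: "nrm (eu z) = 1"
proof -
 have "nrm (eu z) = (nrm (eu z))\<^sup>2" using nrm_cstar_eq[of "eu z"] by simp
 hence "nrm (eu z) = 0 \<or> nrm (eu z) = 1" by (simp add: power2_eq_square)
 thus ?thesis using eu_neq_0[of z] by simp
qed

lemma inner_sc: "adj (sc c * x) * (sc d * y) = sc (cnj c * d) * (adj x * y)"
proof -
 have "adj (sc c * x) * (sc d * y) = sc (cnj c) * (adj x * (sc d * y))"
  by (simp add: mult.assoc sc_commute)
 also have "... = sc (cnj c) * (sc d * (adj x * y))" by (simp only: sc_left_commute[of "adj x"])
 finally show ?thesis by (simp add: sc_mult mult.assoc)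
qed

lemma normalize_vec:
 assumes "x * eu z = x" "x \<noteq> 0"
 obtains c where "adj (sc c * x) * (sc c * x) = eu z" "c \<noteq> 0"
proof -
 define n where "n = ell2_norm (\<lambda>k. mat x k z)"
 have n: "adj x * x = sc (of_real (n\<^sup>2)) * eu z"
  using vec_inner[OF assms(1,1)] by (simp add: adj_self_diag n_def)
 hence "n \<noteq> 0" using assms(2) adj_mult_self_0[of x] by auto
 have "adj (sc (of_real (1 / n)) * x) * (sc (of_real (1 / n)) * x)
   = sc (of_real (1 / n) * of_real (1 / n)) * (adj x * x)"
  unfolding inner_sc by simp
 also have "... = sc (of_real (1 / n) * of_real (1 / n) * of_real (n\<^sup>2)) * eu z"
  unfolding n by (simp only: sc_mult mult.assoc)
 also have "of_real (1 / n) * of_real (1 / n) * of_real (n\<^sup>2) = (1 :: complex)"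
  using \<open>n \<noteq> 0\<close> by (simp add: power2_eq_square)
 finally show ?thesis using that[of "of_real (1 / n)"] \<open>n \<noteq> 0\<close> by simp
qed

text \<open>Some entry of Z is nonzero. The column containing it, moved to position z, is a nonzero
  vector fixed by the idempotent Z, and normalising keeps both properties.\<close>

lemma idempotent_unit_vec:
 assumes "Z * Z = Z" "Z \<noteq> 0"
 obtains x where "x * eu z = x" "adj x * x = eu z" "Z * x = x"
proof -
 obtain i q where iq: "mat Z i q \<noteq> 0"
  using assms(2) by (metis bop_eqI zero_bop.rep_eq zero_fun_apply)
 define y where "y = Z * rl {(q, z)}"
 have y: "y * eu z = y"
  by (simp add: y_def eu_def mult.assoc rl_mult pinj_single single_O)
 have "y = Z * adj (rl {(z, q)})" by (simp add: y_def adj_rl pinj_single single_converse)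
 hence "mat y i z = mat Z i q"
  using mult_adj_rl_entry[of "{(z, q)}" z q Z i] by (simp add: pinj_single)
 hence "y \<noteq> 0" using iq by (auto simp: zero_bop.rep_eq)
 from normalize_vec[OF y this] obtain c where c: "adj (sc c * y) * (sc c * y) = eu z" "c \<noteq> 0" .
 have "Z * y = y" by (simp add: y_def assms(1) flip: mult.assoc)
 thus ?thesis
  using that[of "sc c * y"] c y by (simp add: mult.assoc sc_left_commute[of Z])
qed

section \<open>Orthogonality of blocks\<close>

text \<open>If the row \<open>S + T\<close> of a partial isometry has orthogonal pieces of which \<open>S\<close> is itself a
 partial isometry, then there is no room left in the range of \<open>S\<close> for \<open>T\<close>.\<close>

lemma partial_isometry_row:
 fixes R S T P :: "'i bop"
 assumes R: "R * adj R * R = R" and P: "adj P = P" and row: "P * R = S + T"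
  and ST: "S * adj T = 0" and PS: "P * S = S" and S: "S * adj S * S = S"
 shows "adj S * T = 0"
proof -
 define D where "D = R * adj R"
 define e where "e = S * adj S"
 have D: "D * D = D" "adj D = D" using R by (simp_all add: D_def flip: mult.assoc)
 have e: "e * e = e" "adj e = e" using S by (simp_all add: e_def flip: mult.assoc)
 have TS: "T * adj S = 0" using arg_cong[OF ST, of adj] by simp
 have PDP: "P * D * P = e + T * adj T"
 proof -
  have "P * D * P = (P * R) * adj (P * R)" by (simp add: D_def P mult.assoc)
  also have "... = e + T * adj T" unfolding row by (simp add: e_def distrib_left distrib_right ST TS)
  finally show ?thesis .
 qed
 have Pe: "P * e = e" by (simp add: e_def PS flip: mult.assoc)
 have eP: "e * P = e" using arg_cong[OF Pe, of adj] by (simp add: e(2) P)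
 have "e * D * e = e * (P * D * P) * e" by (metis Pe eP mult.assoc)
 also have "... = e + e * T * adj T * e"
  unfolding PDP by (simp add: distrib_left distrib_right e(1) mult.assoc assoc_left[OF e(1)])
 finally have eDe: "e * D * e = e + e * T * adj T * e" .
 \<comment> \<open>Both sides of the chain have opposite signs: e (1 - D) e is positive because D is
   a projection, while the formula for e D e makes it minus a positive operator. So both vanish, and
   with them e T.\<close>
 have "(e * (1 - D)) * adj (e * (1 - D)) = e * (1 - D) * e"
  by (simp add: e D algebra_simps assoc_left[OF D(1)] assoc_left[OF e(1)])
 also have "... = - (e * T * adj T * e)"
  using eDe by (simp add: algebra_simps e(1))
 finally have "adj (adj (e * T)) * adj (e * T) + adj (adj (e * (1 - D))) * adj (e * (1 - D)) = 0"
  by (simp add: e mult.assoc)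
 hence "e * T = 0" using adj_mult_self_add_0 by (metis adj_eq_0)
 hence "adj (adj S * T) * (adj S * T) = 0" by (simp add: e_def mult.assoc)
 thus ?thesis by (rule adj_mult_self_0)
qed

locale projections =
 fixes r :: nat and P :: "nat => 'i bop"
 assumes P_adj [simp]: "adj (P k) = P k"
  and P_orth: "k \<in> {1..r} ==> l \<in> {1..r} ==> P k * P l = (if k = l then P k else 0)"
begin

definition pI :: "nat set => 'i bop" where "pI I = (\<Sum>k\<in>I. P k)"

lemma pI_adj [simp]: "adj (pI I) = pI I" by (simp add: pI_def)

lemma P_pI: "k \<in> {1..r} ==> I \<subseteq> {1..r} ==> P k * pI I = (if k \<in> I then P k else 0)"
proof -
 assume a: "k \<in> {1..r}" "I \<subseteq> {1..r}"
 hence fin: "finite I" using finite_subset by blast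
 have "P k * pI I = (\<Sum>l\<in>I. P k * P l)" by (simp add: pI_def sum_distrib_left)
 also have "... = (\<Sum>l\<in>I. if k = l then P k else 0)"
  using a by (intro sum.cong) (auto simp: P_orth)
 also have "... = (if k \<in> I then P k else 0)" using fin by simp
 finally show ?thesis .
qed

lemma pI_P: "k \<in> {1..r} ==> I \<subseteq> {1..r} ==> pI I * P k = (if k \<in> I then P k else 0)"
 using arg_cong[OF P_pI[of k I], of adj] by simp

lemma pI_pI: "I \<subseteq> {1..r} ==> J \<subseteq> I ==> pI J * pI I = pI J"
proof -
 assume a: "I \<subseteq> {1..r}" "J \<subseteq> I"
 have "pI J * pI I = (\<Sum>k\<in>J. P k * pI I)" by (simp add: pI_def[of J] sum_distrib_right)
 also have "... = (\<Sum>k\<in>J. P k)" using a by (intro sum.cong refl, subst P_pI) auto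
 finally show ?thesis by (simp add: pI_def)
qed

text \<open>Induction on the length of the interval from a to b. By triangularity the first product
  vanishes unless k is below both outer indices, the second unless k is above both. A triple of
  indices that lies in neither of the two shorter intervals thus has k = a with b among the outer
  indices, or k = b with a among them. These cases concern the row a and the column b, where
  \<open>partial_isometry_row\<close> applies.\<close>

lemma block_orthogonality:
 fixes W :: "'i bop"
 assumes ut: "\<And>k l. k \<in> {1..r} ==> l \<in> {1..r} ==> l < k ==> P k * W * P l = 0"
  and pis: "\<And>a b. 1 \<le> a ==> a \<le> b ==> b \<le> r ==>
    (pI {a..b} * W * pI {a..b}) * adj (pI {a..b} * W * pI {a..b}) * (pI {a..b} * W * pI {a..b})
    = pI {a..b} * W * pI {a..b}"
  and "k \<in> {1..r}" "m \<in> {1..r}" "m' \<in> {1..r}" "m \<noteq> m'"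
 shows "P m * adj W * P k * W * P m' = 0" "P m * W * P k * adj W * P m' = 0"
proof -
 note One_nat_def [simp del]
 have ut': "P l * adj W * P k = 0" if "k \<in> {1..r}" "l \<in> {1..r}" "l < k" for k l
  using arg_cong[OF ut[OF that], of adj] by (simp add: mult.assoc)
 have claim: "\<forall>k\<in>{a..b}. \<forall>m\<in>{a..b}. \<forall>m'\<in>{a..b}. m \<noteq> m' \<longrightarrow>
   P m * adj W * P k * W * P m' = 0 \<and> P m * W * P k * adj W * P m' = 0"
  if "1 \<le> a" "a \<le> b" "b \<le> r" for a b
  using that
 proof (induction "b - a" arbitrary: a b rule: less_induct)
  case less
  show ?case
  proof (cases "a = b")
   case False
   with less.prems have ab: "a < b" by simp
   let ?q = "pI {a..b}"
   define R where "R = ?q * W * ?q"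
   have RR: "R * adj R * R = R" unfolding R_def by (rule pis[OF less.prems])
   have ir: "{a..b} \<subseteq> {1..r}" "{a..b-1} \<subseteq> {a..b}" "{a+1..b} \<subseteq> {a..b}" using less.prems by auto
   have ir2: "{a..b-1} \<subseteq> {1..r}" "{a+1..b} \<subseteq> {1..r}" using less.prems by auto
   have inr: "a \<in> {1..r}" "b \<in> {1..r}" using less.prems by auto
   have split1: "?q = pI {a..b-1} + P b"
   proof -
    have "{a..b} = insert b {a..b-1}" using ab by auto
    thus ?thesis using ab by (simp add: pI_def add.commute)
   qed
   have split2: "?q = pI {a+1..b} + P a"
   proof -
    have "{a..b} = insert a {a+1..b}" using ab by auto
    thus ?thesis using ab by (simp add: pI_def add.commute)
   qed
   let ?p = "pI {a..b-1}" and ?s = "pI {a+1..b}"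
   have IH1: "P m * W * P k * adj W * P m' = 0" "P m * adj W * P k * W * P m' = 0"
    if "k \<in> {a..b-1}" "m \<in> {a..b-1}" "m' \<in> {a..b-1}" "m \<noteq> m'" for k m m'
    using less.hyps[of "b - 1" a] less.prems ab that by auto
   have IH2: "P m * W * P k * adj W * P m' = 0" "P m * adj W * P k * W * P m' = 0"
    if "k \<in> {a+1..b}" "m \<in> {a+1..b}" "m' \<in> {a+1..b}" "m \<noteq> m'" for k m m'
    using less.hyps[of b "a + 1"] less.prems ab that by auto
   have p_idem: "?p * ?p = ?p" "?s * ?s = ?s" using ir by (intro pI_pI; auto)+
   have aP: "P a * ?p = P a" "?p * P a = P a" "?p * P b = 0" "P b * ?p = 0"
     "P b * ?s = P b" "?s * P b = P b" "?s * P a = 0" "P a * ?s = 0"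
     "P a * ?q = P a" "P b * ?q = P b"
    using ab P_pI[OF inr(1) ir2(1)] pI_P[OF inr(1) ir2(1)] P_pI[OF inr(2) ir2(1)] pI_P[OF inr(2) ir2(1)]
     P_pI[OF inr(1) ir2(2)] pI_P[OF inr(1) ir2(2)] P_pI[OF inr(2) ir2(2)] pI_P[OF inr(2) ir2(2)]
     P_pI[OF inr(1) ir(1)] P_pI[OF inr(2) ir(1)] by auto
   have PP: "P a * P a = P a" "P b * P b = P b" using inr by (simp_all add: P_orth)
   \<comment> \<open>In row a, \<open>S\<close> is the part in the old columns a, ..., b - 1 and
     \<open>T\<close> the entry in the new column b. The induction hypothesis makes \<open>S\<close>
     a partial isometry, and \<open>S + T\<close> is a row of the partial isometry \<open>R\<close>;
     hence the ranges of \<open>S\<close> and \<open>T\<close> are orthogonal.\<close>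
   have row: "P m * adj W * P a * W * P b = 0" if m: "m \<in> {a..b-1}" for m
   proof -
    define S where "S = P a * W * ?p"
    define T where "T = P a * W * P b"
    define R' where "R' = ?p * W * ?p"
    have R'R: "R' * adj R' * R' = R'" unfolding R'_def
     by (rule pis) (use ab less.prems in auto)
    have S: "S = P a * R'" by (simp add: S_def R'_def aP flip: mult.assoc)
    have pR': "?p * R' = R'" by (simp add: R'_def p_idem flip: mult.assoc)
    \<comment> \<open>By the induction hypothesis \<open>R' * adj R'\<close> has no block joining a
      to another index, so cutting \<open>R'\<close> down to the row a leaves a partial
      isometry.\<close>
    have "P a * R' * adj R' = P a * R' * adj R' * P a"
    proof -
     have z: "P a * W * ?p * adj W * P n = 0" if "n \<in> {a..b-1}" "n \<noteq> a" for n
     proof -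
      have "P a * W * ?p * adj W * P n = (\<Sum>k\<in>{a..b-1}. P a * W * P k * adj W * P n)"
       by (simp add: pI_def sum_distrib_left sum_distrib_right)
      also have "... = 0" using that ab by (intro sum.neutral ballI IH1(1)) auto
      finally show ?thesis .
     qed
     have "P a * R' * adj R' = P a * W * ?p * adj W * ?p"
      by (simp add: R'_def assoc_left[OF p_idem(1)] assoc_left[OF aP(1)] mult.assoc)
     also have "... = (\<Sum>n\<in>{a..b-1}. P a * W * ?p * adj W * P n)"
      by (simp add: pI_def sum_distrib_left)
     also have "... = (\<Sum>n\<in>{a}. P a * W * ?p * adj W * P n)"
      using ab z by (intro sum.mono_neutral_right) auto
     finally have "P a * R' * adj R' = P a * W * ?p * adj W * P a" by simp
     thus ?thesis by (simp add: mult.assoc PP)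
    qed
    hence "S * adj S * S = P a * R' * adj R' * R'"
     by (simp add: S mult.assoc assoc_left[OF PP(1)])
    hence SS: "S * adj S * S = S" using R'R by (simp add: S mult.assoc)
    have "adj S * T = 0"
    proof (rule partial_isometry_row[OF RR])
     show "adj (P a) = P a" by simp
     show "P a * R = S + T"
      unfolding R_def S_def T_def
      by (simp add: aP flip: mult.assoc) (simp add: split1 distrib_left)
     show "S * adj T = 0" by (simp add: S_def T_def mult.assoc assoc_left[OF aP(3)])
     show "P a * S = S" by (simp add: S_def PP flip: mult.assoc)
    qed (rule SS)
    hence "P m * adj S * T = 0" by (simp add: mult.assoc)
    moreover have "P m * ?p = P m" using m less.prems by (subst P_pI) auto
    ultimately show ?thesis
     by (simp add: S_def T_def mult.assoc assoc_left[OF PP(1)] assoc_left[of "P m" ?p])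
   qed
   \<comment> \<open>The mirror image of the previous argument: for \<open>adj W\<close> the index b
     takes the place of a, and the shorter interval is a + 1, ..., b.\<close>
   have col: "P m * W * P b * adj W * P a = 0" if m: "m \<in> {a+1..b}" for m
   proof -
    define S where "S = P b * adj W * ?s"
    define T where "T = P b * adj W * P a"
    define R' where "R' = ?s * adj W * ?s"
    have R'R: "R' * adj R' * R' = R'"
    proof -
     have "(?s * W * ?s) * adj (?s * W * ?s) * (?s * W * ?s) = ?s * W * ?s"
      by (rule pis) (use ab less.prems in auto)
     from arg_cong[OF this, of adj] show ?thesis by (simp add: R'_def mult.assoc)
    qed
    have S: "S = P b * R'" by (simp add: S_def R'_def aP flip: mult.assoc)
    have "P b * R' * adj R' = P b * R' * adj R' * P b"
    proof -
     have z: "P b * adj W * ?s * W * P n = 0" if "n \<in> {a+1..b}" "n \<noteq> b" for n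
     proof -
      have "P b * adj W * ?s * W * P n = (\<Sum>k\<in>{a+1..b}. P b * adj W * P k * W * P n)"
       by (simp add: pI_def sum_distrib_left sum_distrib_right)
      also have "... = 0" using that ab by (intro sum.neutral ballI IH2(2)) auto
      finally show ?thesis .
     qed
     have "P b * R' * adj R' = P b * adj W * ?s * W * ?s"
      by (simp add: R'_def assoc_left[OF p_idem(2)] assoc_left[OF aP(5)] mult.assoc)
     also have "... = (\<Sum>n\<in>{a+1..b}. P b * adj W * ?s * W * P n)"
      by (simp add: pI_def sum_distrib_left)
     also have "... = (\<Sum>n\<in>{b}. P b * adj W * ?s * W * P n)"
      using ab z by (intro sum.mono_neutral_right) auto
     finally have "P b * R' * adj R' = P b * adj W * ?s * W * P b" by simp
     thus ?thesis by (simp add: mult.assoc PP)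
    qed
    hence "S * adj S * S = P b * R' * adj R' * R'"
     by (simp add: S mult.assoc assoc_left[OF PP(2)])
    hence SS: "S * adj S * S = S" using R'R by (simp add: S mult.assoc)
    have "adj S * T = 0"
    proof (rule partial_isometry_row)
     show "adj R * adj (adj R) * adj R = adj R" using arg_cong[OF RR, of adj] by (simp add: mult.assoc)
     show "adj (P b) = P b" by simp
     show "P b * adj R = S + T"
      unfolding R_def S_def T_def
      by (simp add: mult.assoc assoc_left[OF aP(10)]) (simp add: split2 distrib_left)
     show "S * adj T = 0" by (simp add: S_def T_def mult.assoc assoc_left[OF aP(7)])
     show "P b * S = S" by (simp add: S_def PP flip: mult.assoc)
    qed (rule SS)
    hence "P m * adj S * T = 0" by (simp add: mult.assoc)
    moreover have "P m * ?s = P m" using m less.prems by (subst P_pI) auto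
    ultimately show ?thesis
     by (simp add: S_def T_def mult.assoc assoc_left[OF PP(2)] assoc_left[of "P m" ?s])
   qed
   have row': "P b * adj W * P a * W * P m = 0" if "m \<in> {a..b-1}" for m
    using arg_cong[OF row[OF that], of adj] by (simp add: mult.assoc)
   have col': "P a * W * P b * adj W * P m = 0" if "m \<in> {a+1..b}" for m
    using arg_cong[OF col[OF that], of adj] by (simp add: mult.assoc)
   show ?thesis
   proof (intro ballI impI)
    fix k m m' assume kmm: "k \<in> {a..b}" "m \<in> {a..b}" "m' \<in> {a..b}" "m \<noteq> m'"
    hence kr: "k \<in> {1..r}" "m \<in> {1..r}" "m' \<in> {1..r}" using less.prems by auto
    consider (lo) "k \<in> {a..b-1}" "m \<in> {a..b-1}" "m' \<in> {a..b-1}"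
     | (hi) "k \<in> {a+1..b}" "m \<in> {a+1..b}" "m' \<in> {a+1..b}"
     | (both) "a \<in> {k, m, m'}" "b \<in> {k, m, m'}"
    proof -
     have "a \<notin> {k, m, m'} ==> k \<in> {a+1..b} \<and> m \<in> {a+1..b} \<and> m' \<in> {a+1..b}" using kmm by auto
     moreover have "b \<notin> {k, m, m'} ==> k \<in> {a..b-1} \<and> m \<in> {a..b-1} \<and> m' \<in> {a..b-1}" using kmm by auto
     ultimately show ?thesis using that by blast
    qed
    thus "P m * adj W * P k * W * P m' = 0 \<and> P m * W * P k * adj W * P m' = 0"
    proof cases
     case lo
     thus ?thesis using IH1 kmm by blast
    next
     case hi
     thus ?thesis using IH2 kmm by blast
    next
     case both
     have 1: "P m * adj W * P k * W * P m' = 0"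
     proof (cases "m < k \<or> m' < k")
      case True
      thus ?thesis
      proof
       assume "m < k"
       thus ?thesis using ut'[of k m] kr by simp
      next
       assume "m' < k"
       hence "P k * W * P m' = 0" using ut[of k m'] kr by simp
       thus ?thesis by (simp add: mult.assoc)
      qed
     next
      case False
      hence "k = a" "b \<in> {m, m'}" using both kmm ab by auto
      thus ?thesis using row[of m] row'[of m'] kmm ab by auto
     qed
     have 2: "P m * W * P k * adj W * P m' = 0"
     proof (cases "k < m \<or> k < m'")
      case True
      thus ?thesis
      proof
       assume "k < m"
       thus ?thesis using ut[of m k] kr by simp
      next
       assume "k < m'"
       hence "P k * adj W * P m' = 0" using ut'[of m' k] kr by simp
       thus ?thesis by (simp add: mult.assoc)
      qed
     next
      case False
      hence "k = b" "a \<in> {m, m'}" using both kmm ab by auto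
      thus ?thesis using col[of m] col'[of m'] kmm ab by auto
     qed
     show ?thesis using 1 2 ..
    qed
   qed
  qed auto
 qed
 show "P m * adj W * P k * W * P m' = 0" "P m * W * P k * adj W * P m' = 0"
  using claim[of 1 r] assms(3-6) by auto
qed

end

section \<open>Abstract systems of partial isometries and their strings\<close>

lemma commute_mult:
 fixes x :: "'a :: semigroup_mult"
 shows "x * a = a * x ==> x * b = b * x ==> x * (a * b) = a * b * x"
 by (metis mult.assoc)

text \<open>These are the relations between the corners of the images of the matrix units.
  \<open>W_comm\<close> and \<open>W_comm'\<close> are what \<open>block_orthogonality\<close>
  extracts from the interval compressions; in this form they survive cutting by a reducing
  projection, as the induction in \<open>tri_frame_exists\<close> requires.\<close>

locale tri = projections r P for r and P :: "nat => 'i bop" +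
 fixes W :: "nat => nat => 'i bop"
 assumes W_mult: "1 \<le> i ==> i \<le> j ==> j \<le> k ==> k \<le> r ==> W i j * W j k = W i k"
  and W_orth: "1 \<le> i ==> i \<le> j ==> j \<le> r ==> 1 \<le> k ==> k \<le> l ==> l \<le> r ==> j \<noteq> k ==> W i j * W k l = 0"
  and W_pi: "1 \<le> i ==> i \<le> j ==> j \<le> r ==> W i j * adj (W i j) * W i j = W i j"
  and W_adj: "1 \<le> i ==> i \<le> r ==> adj (W i i) = W i i"
  and W_left: "1 \<le> i ==> i \<le> j ==> j \<le> r ==> pI {1..r} * W i j = W i j"
  and W_ut: "1 \<le> i ==> i \<le> j ==> j \<le> r ==> k \<in> {1..r} ==> l \<in> {1..r} ==> l < k ==> P k * W i j * P l = 0"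
  and W_comm: "1 \<le> i ==> i \<le> j ==> j \<le> r ==> k \<in> {1..r} ==> l \<in> {1..r} ==>
   P l * (adj (W i j) * P k * W i j) = (adj (W i j) * P k * W i j) * P l"
  and W_comm': "1 \<le> i ==> i \<le> j ==> j \<le> r ==> k \<in> {1..r} ==> l \<in> {1..r} ==>
   P l * (W i j * P k * adj (W i j)) = (W i j * P k * adj (W i j)) * P l"
begin

text \<open>Summing \<open>W_comm'\<close> over k yields the final projection, provided that
  \<open>W i j\<close> is supported in the corner from the right as well. This follows from
  \<open>W i j * W j j = W i j\<close> and selfadjointness of \<open>W j j\<close>.\<close>

lemma W_comm_range:
 assumes "1 \<le> i" "i \<le> j" "j \<le> r" "l \<in> {1..r}"
 shows "P l * (W i j * adj (W i j)) = W i j * adj (W i j) * P l"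
proof (cases "W i j * pI {1..r} = W i j")
 case True
 have e: "W i j * adj (W i j) = (\<Sum>k\<in>{1..r}. W i j * P k * adj (W i j))"
  by (subst True[symmetric]) (simp add: pI_def sum_distrib_left sum_distrib_right)
 show ?thesis unfolding e sum_distrib_left sum_distrib_right
  by (intro sum.cong refl W_comm' assms)
next
 case False
 have "W j j * pI {1..r} = W j j"
  using arg_cong[OF W_left[of j j], of adj] W_adj[of j] assms by simp
 hence "W i j * W j j * pI {1..r} = W i j * W j j" by (simp add: mult.assoc)
 hence "W i j * pI {1..r} = W i j" using W_mult[of i j j] assms by simp
 with False show ?thesis by simp
qed

text \<open>A string consists of orthonormal vectors \<open>\<xi> i\<close> in blocks
  \<open>\<kappa> i\<close> on which the \<open>W i j\<close> act as matrix units. Taking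
  \<open>b - a\<close> maximal with \<open>W a b\<close> nonzero ensures that the string cannot be
  prolonged on either side. All its vectors come from one unit vector x in the initial space of
  \<open>W a b\<close>, chosen so that each \<open>W i b * x\<close> lies in a single block.\<close>

lemma string_exists:
 assumes "1 \<le> i0" "i0 \<le> j0" "j0 \<le> r" "W i0 j0 \<noteq> 0"
 obtains a b \<kappa> \<xi> where "1 \<le> a" "a \<le> b" "b \<le> r"
  "\<And>i. i \<in> {a..b} ==> \<kappa> i \<in> {1..r}"
  "\<And>i j. a \<le> i ==> i \<le> j ==> j \<le> b ==> \<kappa> i \<le> \<kappa> j"
  "\<And>i. i \<in> {a..b} ==> \<xi> i * eu z = \<xi> i"
  "\<And>i. i \<in> {a..b} ==> P (\<kappa> i) * \<xi> i = \<xi> i"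
  "\<And>i j. i \<in> {a..b} ==> j \<in> {a..b} ==> adj (\<xi> i) * \<xi> j = (if i = j then eu z else 0)"
  "\<And>i j. a \<le> i ==> i \<le> j ==> j \<le> b ==> W i j * \<xi> j = \<xi> i"
  "\<And>i j. 1 \<le> i ==> i < a ==> j \<in> {a..b} ==> W i j * \<xi> j = 0"
  "\<And>i j. a \<le> i ==> i \<le> j ==> j \<le> b ==> adj (W i j) * \<xi> i = \<xi> j"
  "\<And>i j. i \<in> {a..b} ==> b < j ==> j \<le> r ==> adj (W i j) * \<xi> i = 0"
proof -
 note One_nat_def [simp del]
 define T where "T = {(i, j). 1 \<le> i \<and> i \<le> j \<and> j \<le> r \<and> W i j \<noteq> 0}"
 have "T \<subseteq> {1..r} \<times> {1..r}" by (auto simp: T_def)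
 hence "finite T" using finite_subset by blast
 moreover have "T \<noteq> {}" using assms by (auto simp: T_def)
 ultimately obtain p where p: "p \<in> T" "\<And>q. q \<in> T ==> snd q - fst q \<le> snd p - fst p"
 proof -
  let ?f = "\<lambda>q. snd q - fst q"
  have "Max (?f ` T) \<in> ?f ` T" using \<open>finite T\<close> \<open>T \<noteq> {}\<close> by (intro Max_in) auto
  then obtain p where "p \<in> T" "?f p = Max (?f ` T)" by auto
  thus ?thesis using that[of p] \<open>finite T\<close> by simp
 qed
 obtain a b where ab_p: "p = (a, b)" by (cases p)
 with p have ab: "1 \<le> a" "a \<le> b" "b \<le> r" "W a b \<noteq> 0"
  and max: "\<And>i j. (i, j) \<in> T ==> j - i \<le> b - a" by (auto simp: T_def)
 have zero_left: "W i b = 0" if "1 \<le> i" "i < a" for i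
  using max[of i b] that ab by (force simp: T_def)
 have zero_right: "W a j = 0" if "b < j" "j \<le> r" for j
  using max[of a j] that ab by (force simp: T_def)
 \<comment> \<open>\<open>G i\<close> and \<open>F i\<close> are the initial and final projections
   of \<open>W i b\<close>; the projections \<open>Q i k\<close> split \<open>G i\<close> according
   to the block k into which \<open>W i b\<close> maps.\<close>
 define G where "G i = adj (W i b) * W i b" for i
 define F where "F i = W i b * adj (W i b)" for i
 define Q where "Q i k = adj (W i b) * P k * W i b" for i k
 have WG: "W i b * G i = W i b" if "a \<le> i" "i \<le> b" for i
  using W_pi[of i b] that ab by (simp add: G_def mult.assoc)
 have FW: "F i * W i b = W i b" if "a \<le> i" "i \<le> b" for i
  using W_pi[of i b] that ab by (simp add: F_def mult.assoc)
 have WF: "adj (W i b) * F i = adj (W i b)" if "a \<le> i" "i \<le> b" for i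
  using arg_cong[OF FW[OF that], of adj] by (simp add: F_def)
 have PF: "P k * F i = F i * P k" if "a \<le> i" "i \<le> b" "k \<in> {1..r}" for i k
  unfolding F_def by (rule W_comm_range) (use that ab in auto)
 have sumQ: "(\<Sum>k\<in>{1..r}. Q i k) = G i" if "a \<le> i" "i \<le> b" for i
 proof -
  have "(\<Sum>k\<in>{1..r}. Q i k) = adj (W i b) * (pI {1..r} * W i b)"
   by (simp add: Q_def pI_def sum_distrib_left sum_distrib_right mult.assoc)
  thus ?thesis using W_left[of i b] that ab by (simp add: G_def)
 qed
 have QQ: "Q i k * Q i l = (if k = l then Q i k else 0)"
  if "a \<le> i" "i \<le> b" "k \<in> {1..r}" "l \<in> {1..r}" for i k l
 proof -
  have "Q i k * Q i l = adj (W i b) * P k * F i * P l * W i b" by (simp add: Q_def F_def mult.assoc)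
  also have "... = adj (W i b) * F i * P k * P l * W i b"
   using PF[OF that(1-3)] by (simp add: mult.assoc)
  also have "... = adj (W i b) * (P k * P l) * W i b"
   using WF[OF that(1,2)] by (simp add: mult.assoc)
  finally show ?thesis using P_orth[OF that(3,4)] by (simp add: Q_def)
 qed
 \<comment> \<open>For i \<le> i' the operator \<open>W i b\<close> factors through
   \<open>W i' b\<close>, so both projections are pulled back along \<open>W i' b\<close>. Before
   the pullback the claim is \<open>W_comm\<close> for \<open>W i i'\<close>; the final projection
   \<open>F i'\<close> in between is harmless because it commutes with the blocks.\<close>
 have Qcomm: "Q i k * Q i' k' = Q i' k' * Q i k"
  if "a \<le> i" "i \<le> i'" "i' \<le> b" "k \<in> {1..r}" "k' \<in> {1..r}" for i k i' k'
 proof -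
  define Y where "Y = adj (W i i') * P k * W i i'"
  let ?w = "W i' b"
  have w: "W i b = W i i' * ?w" using W_mult[of i i' b] that ab by simp
  have Q: "Q i k = adj ?w * Y * ?w" by (simp add: Q_def w Y_def mult.assoc)
  have YP: "P k' * Y = Y * P k'" unfolding Y_def by (rule W_comm) (use that ab in auto)
  have 1: "F i' * (P k' * ?w) = P k' * ?w"
   using FW[of i'] that by (simp add: assoc_left[OF PF[of i' k', symmetric]] mult.assoc)
  have 2: "adj ?w * (P k' * F i') = adj ?w * P k'"
   using PF[of i' k'] WF[of i'] that by (simp flip: mult.assoc)
  have "Q i k * Q i' k' = adj ?w * Y * (F i' * (P k' * ?w))"
   unfolding Q Q_def[of i' k'] F_def by (simp add: mult.assoc)
  also have "... = adj ?w * (Y * P k') * ?w" unfolding 1 by (simp add: mult.assoc)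
  also have "... = (adj ?w * (P k' * F i')) * Y * ?w" unfolding 2 YP[symmetric] by (simp add: mult.assoc)
  also have "... = Q i' k' * Q i k" unfolding Q Q_def[of i' k'] F_def by (simp add: mult.assoc)
  finally show ?thesis .
 qed
 have Qcomm2: "Q i k * Q i' k' = Q i' k' * Q i k"
  if "i \<in> {a..b}" "i' \<in> {a..b}" "k \<in> {1..r}" "k' \<in> {1..r}" for i k i' k'
  using Qcomm[of i i' k k'] Qcomm[of i' i k' k] that by (cases "i \<le> i'") auto
 \<comment> \<open>\<open>W a b\<close> factors through \<open>W i b\<close>, so its initial
   projection lies below every \<open>G i\<close>. This keeps the refinement that follows from
   collapsing to zero.\<close>
 have QG: "Q a k * G i = Q a k" if "a \<le> i" "i \<le> b" "k \<in> {1..r}" for i k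
 proof -
  have "W a b * G i = W a i * (W i b * G i)" using W_mult[of a i b] that ab by (simp flip: mult.assoc)
  hence "W a b * G i = W a b" using WG[OF that(1,2)] W_mult[of a i b] that ab by simp
  thus ?thesis by (simp add: Q_def mult.assoc)
 qed
 \<comment> \<open>\<open>Z\<close> is a product of commuting projections
   \<open>Q i (\<kappa> i)\<close> for the indices up to n. The blocks \<open>\<kappa> i\<close> are
   chosen one after the other so that the product stays nonzero.\<close>
 have "\<exists>\<kappa> Z. (\<forall>i\<in>{a..n}. \<kappa> i \<in> {1..r}) \<and> Z * Z = Z \<and> Z \<noteq> 0 \<and> Q a (\<kappa> a) * Z = Z \<and>
   (\<forall>i\<in>{a..n}. Q i (\<kappa> i) * Z = Z) \<and> (\<forall>i\<in>{a..b}. \<forall>k\<in>{1..r}. Q i k * Z = Z * Q i k)"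
  if "a \<le> n" "n \<le> b" for n
  using that
 proof (induction n rule: dec_induct)
  case base
  have "G a \<noteq> 0" using WG[of a] ab by auto
  then obtain k where k: "k \<in> {1..r}" "Q a k \<noteq> 0"
   using sumQ[of a] ab by (metis sum.neutral order_refl)
  have qq: "Q a k * Q a k = Q a k" using QQ[of a k k] ab k by simp
  have cm: "\<forall>i\<in>{a..b}. \<forall>l\<in>{1..r}. Q i l * Q a k = Q a k * Q i l"
   using Qcomm2[of _ a _ k] ab k(1) by simp
  show ?case
   by (rule exI[of _ "\<lambda>_. k"], rule exI[of _ "Q a k"]) (use k qq cm in simp)
 next
  case (step n)
  then obtain \<kappa> Z where IH: "\<forall>i\<in>{a..n}. \<kappa> i \<in> {1..r}" "Z * Z = Z" "Z \<noteq> 0" "Q a (\<kappa> a) * Z = Z"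
   "\<forall>i\<in>{a..n}. Q i (\<kappa> i) * Z = Z" "\<forall>i\<in>{a..b}. \<forall>k\<in>{1..r}. Q i k * Z = Z * Q i k" by auto
  have sn: "Suc n \<in> {a..b}" "a \<in> {a..b}" using step by auto
  have ka: "\<kappa> a \<in> {1..r}" using IH(1) step by auto
  have "Z * G (Suc n) = Z"
  proof -
   have "Z = Z * Q a (\<kappa> a)" using IH(4) IH(6)[rule_format, OF sn(2) ka] by simp
   thus ?thesis using QG[of "Suc n" "\<kappa> a"] sn ka
    by (simp) (metis mult.assoc)
  qed
  \<comment> \<open>As \<open>Z\<close> lies below \<open>G (Suc n)\<close>, the sum over all blocks
    is \<open>Z\<close> itself, so at least one summand survives.\<close>
  hence "(\<Sum>k\<in>{1..r}. Z * Q (Suc n) k) \<noteq> 0"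
   using sumQ[of "Suc n"] sn IH(3) by (simp flip: sum_distrib_left)
  then obtain k where k: "k \<in> {1..r}" "Z * Q (Suc n) k \<noteq> 0" by (metis (no_types, lifting) sum.neutral)
  define Z' where "Z' = Z * Q (Suc n) k"
  define \<kappa>' where "\<kappa>' = \<kappa>(Suc n := k)"
  have ZQ: "Q i l * Z = Z * Q i l" if "i \<in> {a..b}" "l \<in> {1..r}" for i l using IH(6) that by auto
  have 1: "Z' * Z' = Z'"
  proof -
   have "Z' * Z' = Z * (Q (Suc n) k * Z) * Q (Suc n) k" by (simp add: Z'_def mult.assoc)
   also have "... = (Z * Z) * (Q (Suc n) k * Q (Suc n) k)"
    unfolding ZQ[OF sn(1) k(1)] by (simp add: mult.assoc)
   finally show ?thesis using IH(2) QQ[of "Suc n" k k] sn k by (simp add: Z'_def)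
  qed
  have 2: "Q i (\<kappa>' i) * Z' = Z'" if "i \<in> {a..Suc n}" for i
  proof (cases "i = Suc n")
   case True
   have "Q (Suc n) k * Z' = Z * (Q (Suc n) k * Q (Suc n) k)"
    using ZQ[OF sn(1) k(1)] by (simp add: Z'_def flip: mult.assoc)
   thus ?thesis using True QQ[of "Suc n" k k] sn k by (simp add: \<kappa>'_def Z'_def)
  next
   case False
   thus ?thesis using IH(5) that by (auto simp: \<kappa>'_def Z'_def simp flip: mult.assoc)
  qed
  have 3: "Q i l * Z' = Z' * Q i l" if "i \<in> {a..b}" "l \<in> {1..r}" for i l
  proof -
   have "Q i l * Z' = Z * (Q i l * Q (Suc n) k)" using ZQ[OF that] by (simp add: Z'_def flip: mult.assoc)
   thus ?thesis unfolding Qcomm2[OF that(1) sn(1) that(2) k(1)] by (simp add: Z'_def mult.assoc)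
  qed
  have 4: "\<forall>i\<in>{a..Suc n}. \<kappa>' i \<in> {1..r}" using IH(1) k by (auto simp: \<kappa>'_def)
  have "Q a (\<kappa>' a) * Z' = Z'" using 2[of a] step by auto
  thus ?case using 1 2 3 4 k(2) by (intro exI[of _ \<kappa>'] exI[of _ Z']) (auto simp: Z'_def)
 qed
 from this[of b] ab obtain \<kappa> Z where Z: "\<forall>i\<in>{a..b}. \<kappa> i \<in> {1..r}" "Z * Z = Z" "Z \<noteq> 0"
  "\<forall>i\<in>{a..b}. Q i (\<kappa> i) * Z = Z" by auto
 obtain x where x: "x * eu z = x" "adj x * x = eu z" "Z * x = x"
  using idempotent_unit_vec[OF Z(2,3)] .
 define \<xi> where "\<xi> i = W i b * x" for i
 have Qx: "Q i (\<kappa> i) * x = x" if "i \<in> {a..b}" for i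
  using Z(4) x(3) that by (metis mult.assoc)
 have Gx: "G i * x = x" if "i \<in> {a..b}" for i
 proof -
  have "G i * Q i (\<kappa> i) = Q i (\<kappa> i)"
  proof -
   have "adj (W i b) * W i b * adj (W i b) = adj (W i b)"
    using arg_cong[OF WG[of i], of adj] that by (simp add: G_def)
   thus ?thesis by (simp add: G_def Q_def flip: mult.assoc)
  qed
  thus ?thesis using Qx[OF that] by (metis mult.assoc)
 qed
 have Pxi: "P (\<kappa> i) * \<xi> i = \<xi> i" if "i \<in> {a..b}" for i
 proof -
  have "W i b * x = W i b * Q i (\<kappa> i) * x" using Qx[OF that] by (simp add: mult.assoc)
  also have "... = F i * P (\<kappa> i) * W i b * x" by (simp add: Q_def F_def mult.assoc)
  also have "... = P (\<kappa> i) * (F i * W i b) * x"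
   using PF[of i "\<kappa> i"] that Z(1) by (simp flip: mult.assoc)
  finally show ?thesis using assoc_left[OF FW[of i], of x] that by (simp add: \<xi>_def mult.assoc)
 qed
 have Wxi: "W i j * \<xi> j = \<xi> i" if "a \<le> i" "i \<le> j" "j \<le> b" for i j
  using W_mult[of i j b] that ab by (simp add: \<xi>_def flip: mult.assoc)
 have norm: "adj (\<xi> i) * \<xi> i = eu z" if "i \<in> {a..b}" for i
  using Gx[OF that] x(2) by (simp add: \<xi>_def G_def mult.assoc)
 have orth: "adj (\<xi> i) * \<xi> j = 0" if "i \<in> {a..b}" "j \<in> {a..b}" "i \<noteq> j" for i j
 proof -
  have "adj (\<xi> i) * \<xi> j = adj (W i i * \<xi> i) * (W j j * \<xi> j)" using Wxi[of i i] Wxi[of j j] that by simp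
  also have "... = adj (\<xi> i) * (W i i * W j j) * \<xi> j"
   using W_adj[of i] that ab by (simp add: mult.assoc)
  finally show ?thesis using W_orth[of i i j j] that ab by simp
 qed
 \<comment> \<open>\<open>W i j\<close> preserves the norm of \<open>\<xi> j\<close>, so its initial
   projection \<open>H\<close> fixes this vector; applying \<open>adj (W i j)\<close> to
   \<open>W i j * \<xi> j = \<xi> i\<close> gives it back.\<close>
 have adjW: "adj (W i j) * \<xi> i = \<xi> j" if "a \<le> i" "i \<le> j" "j \<le> b" for i j
 proof -
  define H where "H = adj (W i j) * W i j"
  have HH: "H * H = H" "adj H = H"
   using W_pi[of i j] that ab by (simp_all add: H_def mult.assoc)
  define y where "y = H * \<xi> j - \<xi> j"
  have m: "adj (\<xi> j) * (H * \<xi> j) = eu z"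
  proof -
   have "adj (\<xi> j) * (H * \<xi> j) = adj (W i j * \<xi> j) * (W i j * \<xi> j)" by (simp add: H_def mult.assoc)
   thus ?thesis using Wxi[OF that] norm[of i] that by simp
  qed
  have "adj y * y = 0"
   using m norm[of j] that
   by (simp add: y_def HH algebra_simps assoc_left[OF HH(1)])
  hence "H * \<xi> j = \<xi> j" using adj_mult_self_0[of y] by (simp add: y_def)
  thus ?thesis using Wxi[OF that] by (simp add: H_def mult.assoc)
 qed
 show ?thesis
 proof (rule that[of a b \<kappa> \<xi>])
  show "1 \<le> a" "a \<le> b" "b \<le> r" by fact+
  show "\<And>i. i \<in> {a..b} ==> \<kappa> i \<in> {1..r}" using Z(1) by blast
  show "\<And>i. i \<in> {a..b} ==> \<xi> i * eu z = \<xi> i" using x(1) by (simp add: \<xi>_def mult.assoc)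
  show "\<And>i. i \<in> {a..b} ==> P (\<kappa> i) * \<xi> i = \<xi> i" by (rule Pxi)
  show "\<And>i j. i \<in> {a..b} ==> j \<in> {a..b} ==> adj (\<xi> i) * \<xi> j = (if i = j then eu z else 0)"
   using norm orth by auto
  show "\<And>i j. a \<le> i ==> i \<le> j ==> j \<le> b ==> W i j * \<xi> j = \<xi> i" by (rule Wxi)
  show "\<And>i j. a \<le> i ==> i \<le> j ==> j \<le> b ==> adj (W i j) * \<xi> i = \<xi> j" by (rule adjW)
  show "W i j * \<xi> j = 0" if "1 \<le> i" "i < a" "j \<in> {a..b}" for i j
   using W_mult[of i j b] zero_left[OF that(1,2)] that ab by (simp add: \<xi>_def flip: mult.assoc)
  \<comment> \<open>Carried back to the left end a of the string, the product turns into
    \<open>adj (W a j) * \<xi> a\<close>, and \<open>W a j = 0\<close> by maximality.\<close>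
  show "adj (W i j) * \<xi> i = 0" if "i \<in> {a..b}" "b < j" "j \<le> r" for i j
  proof -
   have "adj (W i j) * \<xi> i = adj (W i j) * (adj (W a i) * \<xi> a)" using adjW[of a i] that by simp
   also have "... = adj (W a i * W i j) * \<xi> a" by (simp add: mult.assoc)
   also have "W a i * W i j = 0" using W_mult[of a i j] zero_right[of j] that ab by simp
   finally show ?thesis by simp
  qed
  \<comment> \<open>Otherwise triangularity kills the part of \<open>W i j\<close> from block
    \<open>\<kappa> j\<close> to block \<open>\<kappa> i\<close>, although that part carries
    \<open>\<xi> j\<close> to \<open>\<xi> i\<close>.\<close>
  show "\<kappa> i \<le> \<kappa> j" if "a \<le> i" "i \<le> j" "j \<le> b" for i j
  proof (rule ccontr)
   assume "\<not> \<kappa> i \<le> \<kappa> j"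
   hence "P (\<kappa> i) * W i j * P (\<kappa> j) = 0" using W_ut[of i j "\<kappa> i" "\<kappa> j"] that ab Z(1) by auto
   hence "P (\<kappa> i) * W i j * P (\<kappa> j) * \<xi> j = 0" by simp
   hence "P (\<kappa> i) * (W i j * \<xi> j) = 0" using Pxi[of j] that by (simp add: mult.assoc)
   hence "\<xi> i = 0" using Wxi[OF that] Pxi[of i] that by simp
   thus False using norm[of i] that eu_neq_0[of z] by simp
  qed
 qed
qed

text \<open>\<open>Q\<close> reduces the whole system, so it can be moved to the end of every
  product; each relation for \<open>W i j * Q\<close> is then the old relation times
  \<open>Q\<close>.\<close>

lemma compress:
 assumes Q: "Q * Q = Q" "adj Q = Q"
  and WQ: "\<And>i j. 1 \<le> i ==> i \<le> j ==> j \<le> r ==> W i j * Q = Q * W i j"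
  and PQ: "\<And>k. k \<in> {1..r} ==> P k * Q = Q * P k"
 shows "tri r P (\<lambda>i j. W i j * Q)"
proof -
 have aWQ: "adj (W i j) * Q = Q * adj (W i j)" if "1 \<le> i" "i \<le> j" "j \<le> r" for i j
  using arg_cong[OF WQ[OF that], of adj] by (simp add: Q)
 note QQ = assoc_left[OF Q(1)]
 show ?thesis
 proof (unfold_locales)
  fix i j k assume a: "1 \<le> i" "i \<le> j" "j \<le> k" "k \<le> r"
  show "W i j * Q * (W j k * Q) = W i k * Q"
  proof -
   have "W i j * Q * (W j k * Q) = W i j * (Q * W j k) * Q" by (simp add: mult.assoc)
   also have "... = W i j * W j k * Q" using WQ[of j k, symmetric] a by (simp add: mult.assoc Q)
   finally show ?thesis using W_mult[OF a] by simp
  qed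
 next
  fix i j k l assume a: "1 \<le> i" "i \<le> j" "j \<le> r" "1 \<le> k" "k \<le> l" "l \<le> r" "j \<noteq> k"
  have "W i j * Q * (W k l * Q) = W i j * W k l * Q"
   using WQ[of k l, symmetric] a by (simp add: mult.assoc assoc_left[of Q "W k l"] Q)
  thus "W i j * Q * (W k l * Q) = 0" using W_orth[OF a] by simp
 next
  fix i j assume a: "1 \<le> i" "i \<le> j" "j \<le> r"
  have "W i j * Q * adj (W i j * Q) * (W i j * Q) = W i j * (Q * adj (W i j)) * W i j * Q"
   by (simp add: Q mult.assoc QQ)
  also have "... = W i j * adj (W i j) * (Q * W i j) * Q"
   unfolding aWQ[OF a, symmetric] by (simp add: mult.assoc)
  also have "... = W i j * adj (W i j) * W i j * Q"
   unfolding WQ[OF a, symmetric] by (simp add: mult.assoc Q)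
  finally show "W i j * Q * adj (W i j * Q) * (W i j * Q) = W i j * Q" using W_pi[OF a] by simp
 next
  fix i assume a: "1 \<le> i" "i \<le> r"
  show "adj (W i i * Q) = W i i * Q" using W_adj[OF a] WQ[of i i] a by (simp add: Q)
 next
  fix i j assume a: "1 \<le> i" "i \<le> j" "j \<le> r"
  show "pI {1..r} * (W i j * Q) = W i j * Q" using W_left[OF a] by (simp flip: mult.assoc)
 next
  fix i j k l assume a: "1 \<le> i" "i \<le> j" "j \<le> r" "k \<in> {1..r}" "l \<in> {1..r}" "l < k"
  have "P k * (W i j * Q) * P l = P k * W i j * P l * Q" using PQ[OF a(5)] by (simp add: mult.assoc)
  thus "P k * (W i j * Q) * P l = 0" using W_ut[OF a] by simp
 next
  fix i j k l assume a: "1 \<le> i" "i \<le> j" "j \<le> r" "k \<in> {1..r}" "l \<in> {1..r}"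
  have 1: "adj (W i j * Q) * P k * (W i j * Q) = adj (W i j) * P k * W i j * Q"
  proof -
   have "adj (W i j * Q) * P k * (W i j * Q) = (Q * adj (W i j)) * P k * W i j * Q" by (simp add: Q mult.assoc)
   also have "... = adj (W i j) * (Q * P k) * W i j * Q" unfolding aWQ[OF a(1-3), symmetric] by (simp add: mult.assoc)
   also have "... = adj (W i j) * P k * (Q * W i j) * Q" unfolding PQ[OF a(4), symmetric] by (simp add: mult.assoc)
   also have "... = adj (W i j) * P k * W i j * Q" unfolding WQ[OF a(1-3), symmetric] by (simp add: mult.assoc Q)
   finally show ?thesis .
  qed
  show "P l * (adj (W i j * Q) * P k * (W i j * Q)) = adj (W i j * Q) * P k * (W i j * Q) * P l"
   unfolding 1 by (intro commute_mult W_comm a PQ)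
  have 2: "W i j * Q * P k * adj (W i j * Q) = W i j * P k * adj (W i j) * Q"
  proof -
   have "W i j * Q * P k * adj (W i j * Q) = W i j * (Q * P k) * (Q * adj (W i j))" by (simp add: Q mult.assoc)
   also have "... = W i j * P k * (Q * Q) * adj (W i j)" unfolding PQ[OF a(4), symmetric] by (simp add: mult.assoc)
   also have "... = W i j * P k * (Q * adj (W i j))" unfolding Q by (simp add: mult.assoc)
   finally show ?thesis unfolding aWQ[OF a(1-3), symmetric] by (simp add: mult.assoc)
  qed
  show "P l * (W i j * Q * P k * adj (W i j * Q)) = W i j * Q * P k * adj (W i j * Q) * P l"
   unfolding 2 by (intro commute_mult W_comm' a PQ)
 qed
qed

end

text \<open>Every \<open>s \<in> S\<close> stands for one copy of the partial map \<open>h s\<close>.  Vectors are operators whose only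
 nonzero column is the one with index \<open>z\<close>; the matrix unit \<open>e\<^sub>i\<^sub>j\<close> acts as \<open>\<Sum>\<^sub>s \<xi> s i (\<xi> s j)\<^sup>*\<close>.\<close>

definition is_frame :: "nat => (nat => 'i bop) => 'i => 's set => ('s => nat \<rightharpoonup> nat) => ('s => nat => 'i bop) => bool"
 where "is_frame r P z S h \<xi> \<longleftrightarrow> finite S \<and> h ` S \<subseteq> Pend r \<and>
  (\<forall>s\<in>S. \<forall>i\<in>dom (h s). \<xi> s i * eu z = \<xi> s i \<and> P (the (h s i)) * \<xi> s i = \<xi> s i) \<and>
  (\<forall>s\<in>S. \<forall>t\<in>S. \<forall>i\<in>dom (h s). \<forall>j\<in>dom (h t).
    adj (\<xi> s i) * \<xi> t j = (if s = t \<and> i = j then eu z else 0))"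

definition frame_op :: "'s set => ('s => nat \<rightharpoonup> nat) => ('s => nat => 'i bop) => nat => nat => 'i bop"
 where "frame_op S h \<xi> i j =
  (\<Sum>s\<in>S. if i \<in> dom (h s) \<and> j \<in> dom (h s) then \<xi> s i * adj (\<xi> s j) else 0)"

lemma is_frameD:
 assumes "is_frame r P z S h \<xi>"
 shows "finite S" "s \<in> S ==> h s \<in> Pend r"
  "s \<in> S ==> i \<in> dom (h s) ==> \<xi> s i * eu z = \<xi> s i"
  "s \<in> S ==> i \<in> dom (h s) ==> P (the (h s i)) * \<xi> s i = \<xi> s i"
  "s \<in> S ==> t \<in> S ==> i \<in> dom (h s) ==> j \<in> dom (h t) ==>
    adj (\<xi> s i) * \<xi> t j = (if s = t \<and> i = j then eu z else 0)"
 using assms unfolding is_frame_def by blast+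

text \<open>Orthonormality removes every copy except s, so on its own vectors each copy acts by
  matrix units.\<close>

lemma frame_op_apply:
 assumes F: "is_frame r P z S h \<xi>" and s: "s \<in> S" "j \<in> dom (h s)"
 shows "frame_op S h \<xi> i j * \<xi> s j = (if i \<in> dom (h s) then \<xi> s i else 0)"
proof -
 have "frame_op S h \<xi> i j * \<xi> s j
   = (\<Sum>t\<in>S. if t = s then if i \<in> dom (h s) then \<xi> s i else 0 else 0)"
  unfolding frame_op_def sum_distrib_right
 proof (intro sum.cong refl)
  fix t assume t: "t \<in> S"
  show "(if i \<in> dom (h t) \<and> j \<in> dom (h t) then \<xi> t i * adj (\<xi> t j) else 0) * \<xi> s j
    = (if t = s then if i \<in> dom (h s) then \<xi> s i else 0 else 0)"
  proof (cases "i \<in> dom (h t) \<and> j \<in> dom (h t)")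
   case True
   thus ?thesis
    using is_frameD(5)[OF F t s(1) _ s(2), of j] is_frameD(3)[OF F t, of i] s
    by (cases "t = s") (auto simp: mult.assoc)
  next
   case False
   thus ?thesis using s by auto
  qed
 qed
 thus ?thesis using is_frameD(1)[OF F] s by simp
qed

lemma Pend_dom: "h \<in> Pend r ==> i \<in> dom h ==> i \<in> {1..r}"
proof -
 assume h: "h \<in> Pend r" "i \<in> dom h"
 hence "dom h \<in> intervals r" by (simp add: Pend_def)
 then obtain a b where "dom h = {a..b}" "1 \<le> a" "b \<le> r" unfolding intervals_def by blast
 thus ?thesis using h(2) by auto
qed

lemma Pend_ran: "h \<in> Pend r ==> i \<in> dom h ==> the (h i) \<in> {1..r}"
proof -
 assume h: "h \<in> Pend r" "i \<in> dom h"
 then obtain y where y: "h i = Some y" by blast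
 hence "y \<in> ran h" by (rule ranI)
 thus ?thesis using h(1) y by (auto simp: Pend_def)
qed

lemma Pend_mono: "h \<in> Pend r ==> i \<in> dom h ==> j \<in> dom h ==> i \<le> j ==> the (h i) \<le> the (h j)"
 unfolding Pend_def by blast

definition orthonormal :: "'i => nat => (nat => 'i bop) => bool" where
 "orthonormal z n x \<longleftrightarrow> (\<forall>t<n. x t * eu z = x t) \<and>
   (\<forall>s<n. \<forall>t<n. adj (x s) * x t = (if s = t then eu z else 0))"

text \<open>A bound for the dimension of the fixed space of U, expressed by orthonormal families. It
  is the measure by which the splitting of strings terminates.\<close>

definition fix_dim_le :: "'i => 'i bop => nat => bool" where
 "fix_dim_le z U n \<longleftrightarrow> (\<forall>m x. orthonormal z m x \<longrightarrow> (\<forall>t<m. U * x t = x t) \<longrightarrow> m \<le> n)"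

text \<open>Induction on the dimension bound. The projection \<open>R\<close> onto the span of one
  string reduces the system, and what remains after cutting with \<open>1 - R\<close> has a smaller
  fixed space, since \<open>\<xi> b\<close> is fixed by \<open>U\<close> and orthogonal to the rest.
  The string itself becomes one new copy of the frame.\<close>

lemma tri_frame_exists:
 fixes W :: "nat => nat => 'i bop"
 assumes "tri r P W" "fix_dim_le z (\<Sum>i\<in>{1..r}. W i i) n"
 shows "\<exists>(S :: nat set) h \<xi>. is_frame r P z S h \<xi> \<and>
  (\<forall>i j. 1 \<le> i \<longrightarrow> i \<le> j \<longrightarrow> j \<le> r \<longrightarrow> W i j = frame_op S h \<xi> i j)"
 using assms
proof (induction n arbitrary: W rule: less_induct)
 case (less n W)
 note One_nat_def [simp del]
 interpret tri r P W by fact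
 show ?case
 proof (cases "\<exists>i j. 1 \<le> i \<and> i \<le> j \<and> j \<le> r \<and> W i j \<noteq> 0")
  case False
  thus ?thesis
   by (intro exI[of _ "{}"] exI[of _ "\<lambda>_. Map.empty"] exI[of _ "\<lambda>_ _. 0"])
    (auto simp: is_frame_def frame_op_def)
 next
  case True
  then obtain i0 j0 where ij: "1 \<le> i0" "i0 \<le> j0" "j0 \<le> r" "W i0 j0 \<noteq> 0" by blast
  obtain a b \<kappa> \<xi> where ab: "1 \<le> a" "a \<le> b" "b \<le> r"
   and kap: "\<And>i. i \<in> {a..b} ==> \<kappa> i \<in> {1..r}"
   and kmono: "\<And>i j. a \<le> i ==> i \<le> j ==> j \<le> b ==> \<kappa> i \<le> \<kappa> j"
   and xe: "\<And>i. i \<in> {a..b} ==> \<xi> i * eu z = \<xi> i"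
   and Px: "\<And>i. i \<in> {a..b} ==> P (\<kappa> i) * \<xi> i = \<xi> i"
   and on: "\<And>i j. i \<in> {a..b} ==> j \<in> {a..b} ==> adj (\<xi> i) * \<xi> j = (if i = j then eu z else 0)"
   and Wx: "\<And>i j. a \<le> i ==> i \<le> j ==> j \<le> b ==> W i j * \<xi> j = \<xi> i"
   and Wx0: "\<And>i j. 1 \<le> i ==> i < a ==> j \<in> {a..b} ==> W i j * \<xi> j = 0"
   and aWx: "\<And>i j. a \<le> i ==> i \<le> j ==> j \<le> b ==> adj (W i j) * \<xi> i = \<xi> j"
   and aWx0: "\<And>i j. i \<in> {a..b} ==> b < j ==> j \<le> r ==> adj (W i j) * \<xi> i = 0"
   by (rule string_exists[OF ij, of z]) (rule that)
  have Wm: "W i j * \<xi> m = 0" if "1 \<le> i" "i \<le> j" "j \<le> r" "m \<in> {a..b}" "j \<noteq> m" for i j m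
  proof -
   have "W i j * (W m m * \<xi> m) = 0" using W_orth[of i j m m] that ab by (simp flip: mult.assoc)
   thus ?thesis using Wx[of m m] that by simp
  qed
  have aWm: "adj (W i j) * \<xi> m = 0" if "1 \<le> i" "i \<le> j" "j \<le> r" "m \<in> {a..b}" "i \<noteq> m" for i j m
  proof -
   have "W m m * W i j = 0" using W_orth[of m m i j] that ab by simp
   from arg_cong[OF this, of adj] have "adj (W i j) * (W m m * \<xi> m) = 0"
    using W_adj[of m] that ab by (simp flip: mult.assoc)
   thus ?thesis using Wx[of m m] that by simp
  qed
  define R where "R = (\<Sum>m\<in>{a..b}. \<xi> m * adj (\<xi> m))"
  have R_adj: "adj R = R" by (simp add: R_def)
  have Rx: "R * \<xi> m = \<xi> m" if "m \<in> {a..b}" for m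
  proof -
   have "R * \<xi> m = (\<Sum>l\<in>{a..b}. if l = m then \<xi> m else 0)"
    unfolding R_def sum_distrib_right using that xe by (intro sum.cong refl) (simp add: mult.assoc on)
   thus ?thesis using that by simp
  qed
  have xR: "adj (\<xi> m) * R = adj (\<xi> m)" if "m \<in> {a..b}" for m
   using arg_cong[OF Rx[OF that], of adj] by (simp add: R_adj)
  have RR: "R * R = R"
  proof -
   have "R * R = (\<Sum>m\<in>{a..b}. R * \<xi> m * adj (\<xi> m))"
    by (subst (2) R_def) (simp add: sum_distrib_left mult.assoc)
   also have "... = (\<Sum>m\<in>{a..b}. \<xi> m * adj (\<xi> m))" by (intro sum.cong refl) (simp add: Rx)
   finally show ?thesis by (simp only: R_def[symmetric])
  qed
  \<comment> \<open>\<open>W i j * R\<close> and \<open>R * W i j\<close> turn out to be the same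
    operator, so \<open>R\<close> commutes with the system. The clauses \<open>Wx0\<close> and
    \<open>aWx0\<close>, which come from maximality of the string, are what makes the parts outside
    the string vanish.\<close>
  have WR: "W i j * R = (if i \<in> {a..b} \<and> j \<in> {a..b} then \<xi> i * adj (\<xi> j) else 0)"
   if "1 \<le> i" "i \<le> j" "j \<le> r" for i j
  proof -
   have "W i j * R = (\<Sum>m\<in>{a..b}. if m = j then W i j * \<xi> j * adj (\<xi> j) else 0)"
    unfolding R_def sum_distrib_left
   proof (intro sum.cong refl)
    fix m assume "m \<in> {a..b}"
    thus "W i j * (\<xi> m * adj (\<xi> m)) = (if m = j then W i j * \<xi> j * adj (\<xi> j) else 0)"
     using Wm[OF that, of m] by (cases "m = j") (simp_all flip: mult.assoc)
   qed
   also have "... = (if j \<in> {a..b} then W i j * \<xi> j * adj (\<xi> j) else 0)" by simp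
   also have "... = (if i \<in> {a..b} \<and> j \<in> {a..b} then \<xi> i * adj (\<xi> j) else 0)"
    using Wx[of i j] Wx0[of i j] that by (cases "i < a") auto
   finally show ?thesis .
  qed
  have RW: "R * W i j = (if i \<in> {a..b} \<and> j \<in> {a..b} then \<xi> i * adj (\<xi> j) else 0)"
   if "1 \<le> i" "i \<le> j" "j \<le> r" for i j
  proof -
   have "adj (W i j) * R = (\<Sum>m\<in>{a..b}. if m = i then adj (W i j) * \<xi> i * adj (\<xi> i) else 0)"
    unfolding R_def sum_distrib_left
   proof (intro sum.cong refl)
    fix m assume "m \<in> {a..b}"
    thus "adj (W i j) * (\<xi> m * adj (\<xi> m)) = (if m = i then adj (W i j) * \<xi> i * adj (\<xi> i) else 0)"
     using aWm[OF that, of m] by (cases "m = i") (simp_all flip: mult.assoc)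
   qed
   also have "... = (if i \<in> {a..b} then adj (W i j) * \<xi> i * adj (\<xi> i) else 0)" by simp
   also have "... = (if i \<in> {a..b} \<and> j \<in> {a..b} then \<xi> j * adj (\<xi> i) else 0)"
    using aWx[of i j] aWx0[of i j] that by (cases "b < j") auto
   finally have "adj (adj (W i j) * R) = adj (if i \<in> {a..b} \<and> j \<in> {a..b} then \<xi> j * adj (\<xi> i) else 0)" by simp
   thus ?thesis by (simp add: R_adj split: if_splits)
  qed
  have PR: "P k * R = R * P k" if "k \<in> {1..r}" for k
  proof -
   have "P k * (\<xi> m * adj (\<xi> m)) = \<xi> m * adj (\<xi> m) * P k" if m: "m \<in> {a..b}" for m
   proof (cases "k = \<kappa> m")
    case True
    have "adj (\<xi> m) * P (\<kappa> m) = adj (\<xi> m)" using arg_cong[OF Px[OF m], of adj] by simp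
    thus ?thesis using True Px[OF m] by (simp add: mult.assoc) (simp flip: mult.assoc)
   next
    case False
    have 1: "P k * \<xi> m = 0"
     using P_orth[OF \<open>k \<in> {1..r}\<close> kap[OF m]] False Px[OF m] by (metis assoc_left mult_zero_left)
    have "adj (\<xi> m) * P k = 0" using arg_cong[OF 1, of adj] by simp
    thus ?thesis using 1 by (simp add: mult.assoc) (simp flip: mult.assoc)
   qed
   thus ?thesis unfolding R_def sum_distrib_left sum_distrib_right by (intro sum.cong refl)
  qed
  define Q where "Q = 1 - R"
  have Q: "Q * Q = Q" "adj Q = Q" by (simp_all add: Q_def R_adj RR algebra_simps)
  define U where "U = (\<Sum>i\<in>{1..r}. W i i)"
  have WQ: "W i j * Q = Q * W i j" if "1 \<le> i" "i \<le> j" "j \<le> r" for i j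
   using WR[OF that] RW[OF that] by (simp add: Q_def algebra_simps)
  have UQ: "U * Q = Q * U"
   unfolding U_def sum_distrib_left sum_distrib_right by (intro sum.cong refl WQ) auto
  have tri': "tri r P (\<lambda>i j. W i j * Q)"
   by (rule compress[OF Q WQ]) (auto simp: Q_def algebra_simps PR)
  have b: "b \<in> {a..b}" using ab by simp
  have Uxb: "U * \<xi> b = \<xi> b"
  proof -
   have "U * \<xi> b = (\<Sum>i\<in>{b}. W i i * \<xi> b)"
    unfolding U_def sum_distrib_right using Wm[of _ _ b] ab by (intro sum.mono_neutral_right) auto
   thus ?thesis using Wx[of b b] ab by simp
  qed
  have "orthonormal z 1 (\<lambda>_. \<xi> b)" using xe[OF b] on[OF b b] by (auto simp: orthonormal_def)
  hence "1 \<le> n" using less.prems(2) Uxb unfolding fix_dim_le_def U_def by blast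
  hence n: "n - 1 < n" by simp
  have "fix_dim_le z (\<Sum>i\<in>{1..r}. W i i * Q) (n - 1)"
   unfolding fix_dim_le_def
  proof (intro allI impI)
   fix m x assume x: "orthonormal z m x" "\<forall>t<m. (\<Sum>i\<in>{1..r}. W i i * Q) * x t = x t"
   have Rxt: "R * x t = 0" and Uxt: "U * x t = x t" if "t < m" for t
   proof -
    have e: "U * Q * x t = x t" using x(2) that by (simp add: U_def sum_distrib_right)
    have "R * Q = 0" by (simp add: Q_def algebra_simps RR)
    hence "R * (Q * (U * x t)) = 0" by (simp flip: mult.assoc)
    thus 1: "R * x t = 0" using e unfolding UQ by (simp add: mult.assoc)
    hence "Q * x t = x t" by (simp add: Q_def algebra_simps)
    thus "U * x t = x t" using e by (simp add: mult.assoc)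
   qed
   \<comment> \<open>A fixed orthonormal family of the remaining system is prolonged by
     \<open>\<xi> b\<close> in position m; this is the one dimension by which the bound
     drops.\<close>
   define y where "y t = (if t < m then x t else \<xi> b)" for t
   have zl: "adj (\<xi> b) * x t = 0" if "t < m" for t
    using xR[OF b] Rxt[OF that] by (metis assoc_left mult.assoc mult_zero_right)
   have zr: "adj (x t) * \<xi> b = 0" if "t < m" for t
    using arg_cong[OF zl[OF that], of adj] by simp
   have "orthonormal z (Suc m) y"
    using x(1) xe[OF b] on[OF b b] zl zr by (auto simp: orthonormal_def y_def less_Suc_eq)
   moreover have "\<forall>t<Suc m. U * y t = y t" using Uxt Uxb by (auto simp: y_def)
   ultimately have "Suc m \<le> n" using less.prems(2) unfolding fix_dim_le_def U_def by blast
   thus "m \<le> n - 1" by simp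
  qed
  from less.IH[OF n tri' this] obtain S :: "nat set" and h \<eta> where F: "is_frame r P z S h \<eta>"
   and WQF: "\<And>i j. 1 \<le> i ==> i \<le> j ==> j \<le> r ==> W i j * Q = frame_op S h \<eta> i j" by blast
  \<comment> \<open>Copies are numbered by naturals, so a fresh number is available for the new
    string.\<close>
  obtain s0 where s0: "s0 \<notin> S" using ex_new_if_finite[OF infinite_UNIV_nat is_frameD(1)[OF F]] by blast
  define g where "g i = (if i \<in> {a..b} then Some (\<kappa> i) else None)" for i
  have dg: "dom g = {a..b}" by (auto simp: g_def dom_def)
  have gP: "g \<in> Pend r"
   unfolding Pend_def mem_Collect_eq dg
  proof (intro conjI ballI impI)
   show "{a..b} \<in> intervals r" using ab by (auto simp: intervals_def)
   show "ran g \<subseteq> {1..r}" using kap by (auto simp: ran_def g_def split: if_splits)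
  qed (auto simp: g_def intro: kmono)
  \<comment> \<open>The vectors of the remaining frame are reproduced by \<open>W j j * Q\<close>,
    hence lie in the range of \<open>Q\<close> and are orthogonal to the string.\<close>
  have R\<eta>: "R * \<eta> s j = 0" if "s \<in> S" "j \<in> dom (h s)" for s j
  proof -
   have j: "j \<in> {1..r}" using is_frameD(2)[OF F that(1)] that(2) Pend_dom by blast
   have "\<eta> s j = W j j * Q * \<eta> s j" using frame_op_apply[OF F that, of j] WQF[of j j] that j by simp
   also have "... = Q * (W j j * \<eta> s j)" using WQ[of j j] j by (simp add: mult.assoc)
   finally have e: "\<eta> s j = Q * (W j j * \<eta> s j)" .
   have "R * Q = 0" by (simp add: Q_def algebra_simps RR)
   hence "R * (Q * (W j j * \<eta> s j)) = 0" by (simp flip: mult.assoc)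
   thus ?thesis using e by simp
  qed
  have x\<eta>: "adj (\<xi> i) * \<eta> s j = 0" if "s \<in> S" "j \<in> dom (h s)" "i \<in> {a..b}" for s i j
   using xR[OF that(3)] R\<eta>[OF that(1,2)] by (metis assoc_left mult.assoc mult_zero_right)
  have \<eta>x: "adj (\<eta> s j) * \<xi> i = 0" if "s \<in> S" "j \<in> dom (h s)" "i \<in> {a..b}" for s i j
   using arg_cong[OF x\<eta>[OF that], of adj] by simp
  have "is_frame r P z (insert s0 S) (h(s0 := g)) (\<eta>(s0 := \<xi>))"
   unfolding is_frame_def
  proof (intro conjI ballI)
   show "finite (insert s0 S)" using is_frameD(1)[OF F] by simp
   show "(h(s0 := g)) ` insert s0 S \<subseteq> Pend r" using is_frameD(2)[OF F] gP by auto
   fix s i assume s: "s \<in> insert s0 S" "i \<in> dom ((h(s0 := g)) s)"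
   show "(\<eta>(s0 := \<xi>)) s i * eu z = (\<eta>(s0 := \<xi>)) s i"
    using s is_frameD(3)[OF F, of s i] xe dg by (cases "s = s0") auto
   have gi: "the (g i) = \<kappa> i" if "i \<in> {a..b}" for i using that by (simp add: g_def)
   show "P (the ((h(s0 := g)) s i)) * (\<eta>(s0 := \<xi>)) s i = (\<eta>(s0 := \<xi>)) s i"
    using s is_frameD(4)[OF F, of s i] Px[of i] dg gi[of i] by (cases "s = s0") auto
   fix t j assume t: "t \<in> insert s0 S" "j \<in> dom ((h(s0 := g)) t)"
   show "adj ((\<eta>(s0 := \<xi>)) s i) * (\<eta>(s0 := \<xi>)) t j = (if s = t \<and> i = j then eu z else 0)"
   proof (cases "s = s0")
    case True
    thus ?thesis using s t x\<eta>[of t j i] on[of i j] dg by (cases "t = s0") auto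
   next
    case False
    thus ?thesis using s t \<eta>x[of s i j] is_frameD(5)[OF F, of s t i j] dg
     by (cases "t = s0") auto
   qed
  qed
  moreover have "W i j = frame_op (insert s0 S) (h(s0 := g)) (\<eta>(s0 := \<xi>)) i j"
   if "1 \<le> i" "i \<le> j" "j \<le> r" for i j
  proof -
   have "frame_op (insert s0 S) (h(s0 := g)) (\<eta>(s0 := \<xi>)) i j
     = (if i \<in> dom g \<and> j \<in> dom g then \<xi> i * adj (\<xi> j) else 0) + frame_op S h \<eta> i j"
    unfolding frame_op_def using is_frameD(1)[OF F] s0
    by (subst sum.insert) (auto intro!: arg_cong2[where f = "(+)"] sum.cong)
   also have "... = W i j * R + W i j * Q" using WR[OF that] WQF[OF that] dg by simp
   also have "... = W i j" by (simp add: Q_def algebra_simps)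
   finally show ?thesis by simp
  qed
  ultimately show ?thesis by blast
 qed
qed

text \<open>A Householder reflection: \<open>u = 1 - c w w\<^sup>*\<close> with \<open>w = x - y\<close> and \<open>c = (1 - \<langle>y, x\<rangle>)\<^sup>-\<^sup>1\<close>
 is unitary, moves the unit vector \<open>x\<close> to the unit vector \<open>y\<close>, and fixes what is orthogonal
 to both.\<close>

lemma householder:
 assumes x: "x * eu z = x" "adj x * x = eu z" and y: "y * eu z = y" "adj y * y = eu z" and "x \<noteq> y"
 obtains c K where "K = sc c * ((x - y) * adj (x - y))"
  "(1 + K) * adj (1 + K) = 1" "adj (1 + K) * (1 + K) = 1" "(1 + K) * x = y"
  "\<And>v. adj x * v = 0 ==> adj y * v = 0 ==> (1 + K) * v = v"
proof -
 define w where "w = x - y"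
 define d where "d = mat (adj y * x) z z"
 have yx: "adj y * x = sc d * eu z" unfolding d_def by (rule vec_inner[OF y(1) x(1)])
 have xy: "adj x * y = sc (cnj d) * eu z" using arg_cong[OF yx, of adj] by (simp add: sc_commute)
 have ww: "adj w * w = sc (2 - d - cnj d) * eu z"
 proof -
  have "adj w * w = adj x * x - adj x * y - adj y * x + adj y * y"
   by (simp add: w_def algebra_simps)
  also have "... = (sc 1 + sc 1 - sc d - sc (cnj d)) * eu z"
   unfolding x y xy yx by (simp add: algebra_simps mult_2)
  finally show ?thesis by (simp only: sc_diff sc_add[symmetric] one_add_one)
 qed
 \<comment> \<open>The case of equality in Cauchy-Schwarz: two unit vectors with inner product 1
   coincide.\<close>
 have d1: "d \<noteq> 1"
 proof
  assume "d = 1"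
  hence "adj w * w = 0" using ww by simp
  thus False using adj_mult_self_0[of w] \<open>x \<noteq> y\<close> by (simp add: w_def)
 qed
 define c where "c = - (1 / (1 - d))"
 have c1: "c * (1 - d) = -1" using d1 by (simp add: c_def)
 \<comment> \<open>The identity expresses unitarity of 1 + c w w^*, because w^* w is the scalar 2 -
   d - cnj d.\<close>
 have cc: "c + cnj c + c * cnj c * (2 - d - cnj d) = 0"
 proof -
  have "cnj c * (1 - cnj d) = -1" using arg_cong[OF c1, of cnj] by simp
  hence "c * cnj c * (1 - cnj d) = - c" by (simp add: mult.assoc)
  moreover have "c * cnj c * (1 - d) = cnj c * (c * (1 - d))" by (simp only: mult_ac)
  hence "c * cnj c * (1 - d) = - cnj c" unfolding c1 by simp
  moreover have "c * cnj c * (2 - d - cnj d) = c * cnj c * (1 - d) + c * cnj c * (1 - cnj d)"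
   by (simp add: algebra_simps)
  ultimately show ?thesis by simp
 qed
 define K where "K = sc c * (w * adj w)"
 have aK: "adj K = sc (cnj c) * (w * adj w)" by (simp add: K_def sc_commute)
 have we: "w * eu z = w" by (simp add: w_def x y algebra_simps)
 have wwww: "(w * adj w) * (w * adj w) = sc (2 - d - cnj d) * (w * adj w)"
 proof -
  have "(w * adj w) * (w * adj w) = w * (adj w * w) * adj w" by (simp add: mult.assoc)
  also have "... = sc (2 - d - cnj d) * (w * eu z * adj w)"
   unfolding ww by (simp add: mult.assoc sc_left_commute[of w])
  finally show ?thesis by (simp add: we)
 qed
 have KK: "sc a * (w * adj w) * (sc b * (w * adj w)) = sc (a * b * (2 - d - cnj d)) * (w * adj w)" for a b
 proof -
  have "sc a * (w * adj w) * (sc b * (w * adj w)) = sc a * (sc b * ((w * adj w) * (w * adj w)))"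
   by (simp only: mult.assoc sc_left_commute[of "adj w" b] sc_left_commute[of w b])
  thus ?thesis unfolding wwww by (simp add: sc_mult mult.assoc)
 qed
 have z0: "sc a * (w * adj w) + sc b * (w * adj w) + sc e * (w * adj w) = 0" if "a + b + e = 0" for a b e
  using that by (metis distrib_right mult_zero_left sc_0 sc_add)
 have u1: "(1 + K) * adj (1 + K) = 1"
 proof -
  have "K + adj K + K * adj K = 0" unfolding aK unfolding K_def KK by (rule z0[OF cc])
  thus ?thesis by (simp add: distrib_left distrib_right add.assoc)
 qed
 have u2: "adj (1 + K) * (1 + K) = 1"
 proof -
  have "K + adj K + adj K * K = 0"
   unfolding aK unfolding K_def KK by (rule z0) (use cc in \<open>simp add: mult.commute\<close>)
  thus ?thesis by (simp add: distrib_left distrib_right add_ac)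
 qed
 have wx: "adj w * x = sc (1 - d) * eu z"
  by (simp add: w_def x yx algebra_simps sc_diff)
 have ux: "(1 + K) * x = y"
 proof -
  have "K * x = sc c * (w * (adj w * x))" by (simp add: K_def mult.assoc)
  also have "... = sc c * (sc (1 - d) * (w * eu z))" unfolding wx by (simp only: sc_left_commute[of w])
  also have "... = sc (c * (1 - d)) * w" by (simp add: we sc_mult mult.assoc)
  finally have "K * x = - w" unfolding c1 by (simp add: sc_minus)
  thus ?thesis by (simp add: distrib_right w_def)
 qed
 show ?thesis
 proof (rule that[of K c])
  show "K = sc c * ((x - y) * adj (x - y))" by (simp add: K_def w_def)
  fix v assume "adj x * v = 0" "adj y * v = 0"
  hence "adj w * v = 0" by (simp add: w_def algebra_simps)
  thus "(1 + K) * v = v" by (simp add: K_def distrib_right mult.assoc)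
 qed (rule u1 u2 ux)+
qed

text \<open>The vectors are put in place one at a time. After the earlier reflections the next
  vector is still a unit vector of the same block and orthogonal to those already placed, so the new
  Householder reflection does not disturb them. The closure properties of \<open>\<K>\<close> keep
  the product of the reflections inside the unitisation and diagonal with respect to the
  blocks.\<close>

lemma orthonormal_unitary:
 fixes P :: "nat => 'i bop" and x y :: "'a => 'i bop" and k :: "'a => nat"
 assumes "finite A"
  and x: "\<And>\<mu>. \<mu> \<in> A ==> x \<mu> * eu z = x \<mu> \<and> P (k \<mu>) * x \<mu> = x \<mu>"
  and y: "\<And>\<mu>. \<mu> \<in> A ==> y \<mu> * eu z = y \<mu> \<and> P (k \<mu>) * y \<mu> = y \<mu>"
  and xo: "\<And>\<mu> \<nu>. \<mu> \<in> A ==> \<nu> \<in> A ==> adj (x \<mu>) * x \<nu> = (if \<mu> = \<nu> then eu z else 0)"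
  and yo: "\<And>\<mu> \<nu>. \<mu> \<in> A ==> \<nu> \<in> A ==> adj (y \<mu>) * y \<nu> = (if \<mu> = \<nu> then eu z else 0)"
  and k: "\<And>\<mu>. \<mu> \<in> A ==> k \<mu> \<in> I"
  and K0: "0 \<in> \<K>"
  and Kadd: "\<And>a b. a \<in> \<K> ==> b \<in> \<K> ==> a + b \<in> \<K>"
  and Kmult: "\<And>a b. a \<in> \<K> ==> b \<in> \<K> ==> a * b \<in> \<K>"
  and Ksc: "\<And>c a. a \<in> \<K> ==> sc c * a \<in> \<K>"
  and KP: "\<And>i a. i \<in> I ==> a \<in> \<K> ==> P i * a = a * P i"
  and Kvec: "\<And>i v. i \<in> I ==> v * eu z = v ==> P i * v = v ==> v * adj v \<in> \<K>"
 shows "\<exists>K\<in>\<K>. (1 + K) * adj (1 + K) = 1 \<and> adj (1 + K) * (1 + K) = 1 \<and>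
  (\<forall>\<mu>\<in>A. (1 + K) * x \<mu> = y \<mu>)"
 using assms(1) x y xo yo k
proof (induction A rule: finite_induct)
 case empty
 thus ?case using K0 by (intro bexI[of _ 0]) auto
next
 case (insert \<mu> A)
 have "\<exists>K\<in>\<K>. (1 + K) * adj (1 + K) = 1 \<and> adj (1 + K) * (1 + K) = 1 \<and>
   (\<forall>\<nu>\<in>A. (1 + K) * x \<nu> = y \<nu>)"
  by (rule insert.IH) (use insert.prems in blast)+
 then obtain K where K: "K \<in> \<K>" "(1 + K) * adj (1 + K) = 1"
  "adj (1 + K) * (1 + K) = 1" "\<And>\<nu>. \<nu> \<in> A ==> (1 + K) * x \<nu> = y \<nu>" by blast
 define u where "u = 1 + K"
 define x' where "x' = u * x \<mu>"
 note p = insert.prems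
 have x'e: "x' * eu z = x'" using p(1)[of \<mu>] by (simp add: x'_def mult.assoc)
 have aux: "adj (u * a) * (u * b) = adj a * b" for a b
  using K(3) by (simp add: u_def[symmetric] mult.assoc) (simp flip: mult.assoc)
 have x'x': "adj x' * x' = eu z" unfolding x'_def aux using p(3)[of \<mu> \<mu>] by simp
 have x'y: "adj x' * y \<nu> = 0" if "\<nu> \<in> A" for \<nu>
  using aux[of "x \<mu>" "x \<nu>"] K(4)[OF that] p(3)[of \<mu> \<nu>] that insert.hyps by (auto simp: x'_def u_def)
 have Px': "P (k \<mu>) * x' = x'"
 proof -
  have "P (k \<mu>) * u = u * P (k \<mu>)" using KP[OF _ K(1), of "k \<mu>"] p(5)[of \<mu>]
   by (simp add: u_def algebra_simps)
  thus ?thesis using p(1)[of \<mu>] by (metis insertI1 mult.assoc x'_def)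
 qed
 \<comment> \<open>A reflection exists only for distinct vectors; if \<open>x'\<close> has already
   arrived at its target, the identity is taken instead.\<close>
 have "\<exists>L\<in>\<K>. (1 + L) * adj (1 + L) = 1 \<and> adj (1 + L) * (1 + L) = 1 \<and> (1 + L) * x' = y \<mu> \<and>
   (\<forall>\<nu>\<in>A. (1 + L) * y \<nu> = y \<nu>)"
 proof (cases "x' = y \<mu>")
  case True
  thus ?thesis using K0 by (intro bexI[of _ 0]) auto
 next
  case False
  have ya: "y \<mu> * eu z = y \<mu>" "P (k \<mu>) * y \<mu> = y \<mu>" "adj (y \<mu>) * y \<mu> = eu z"
   using p(2)[of \<mu>] p(4)[of \<mu> \<mu>] by auto
  obtain c L where L: "L = sc c * ((x' - y \<mu>) * adj (x' - y \<mu>))"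
   "(1 + L) * adj (1 + L) = 1" "adj (1 + L) * (1 + L) = 1" "(1 + L) * x' = y \<mu>"
   "\<And>v. adj x' * v = 0 ==> adj (y \<mu>) * v = 0 ==> (1 + L) * v = v"
   using householder[OF x'e x'x' ya(1,3) False] by metis
  have "(x' - y \<mu>) * adj (x' - y \<mu>) \<in> \<K>"
   by (rule Kvec[of "k \<mu>"]) (use p(5)[of \<mu>] x'e ya Px' in \<open>auto simp: left_diff_distrib right_diff_distrib\<close>)
  hence "L \<in> \<K>" unfolding L(1) by (rule Ksc)
  moreover have "(1 + L) * y \<nu> = y \<nu>" if "\<nu> \<in> A" for \<nu>
   by (rule L(5)) (use x'y[OF that] p(4)[of \<mu> \<nu>] that insert.hyps in auto)
  ultimately show ?thesis using L(2-4) by blast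
 qed
 then obtain L where L: "L \<in> \<K>" "(1 + L) * adj (1 + L) = 1" "adj (1 + L) * (1 + L) = 1"
  "(1 + L) * x' = y \<mu>" "\<And>\<nu>. \<nu> \<in> A ==> (1 + L) * y \<nu> = y \<nu>" by blast
 \<comment> \<open>Chosen so that 1 + \<open>M\<close> is the product of 1 + \<open>L\<close> and 1
   + \<open>K\<close>.\<close>
 define M where "M = K + L + L * K"
 have M: "1 + M = (1 + L) * u" by (simp add: M_def u_def algebra_simps)
 have "M \<in> \<K>" unfolding M_def by (intro Kadd Kmult K(1) L(1))
 moreover have "(1 + M) * adj (1 + M) = (1 + L) * (u * adj u) * adj (1 + L)"
  unfolding M by (simp only: adj_mult mult.assoc)
 hence "(1 + M) * adj (1 + M) = 1" using K(2) L(2) by (simp add: u_def)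
 moreover have "adj (1 + M) * (1 + M) = adj u * (adj (1 + L) * (1 + L)) * u"
  unfolding M by (simp only: adj_mult mult.assoc)
 hence "adj (1 + M) * (1 + M) = 1" using K(3) L(3) by (simp add: u_def)
 moreover have "\<forall>\<nu>\<in>insert \<mu> A. (1 + M) * x \<nu> = y \<nu>"
  unfolding M using K(4) L(4,5) by (auto simp: mult.assoc x'_def u_def[symmetric])
 ultimately show ?case by blast
qed

declare One_nat_def [simp del]

section \<open>The concrete blocks, the interval summands and spreading\<close>

type_synonym bix = "(nat set \<times> nat) \<times> nat"

definition prel :: "nat set => nat => (bix \<times> bix) set" where
 "prel T k = {(((T, k), p), ((T, k), p)) | p. True}"

definition trel :: "nat set => nat set => (bix \<times> bix) set" where
 "trel T I = {(((I, l), p), ((T, l), p)) | l p. l \<in> I}"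

lemma pinj_prel: "pinj (prel T k)"
 unfolding pinj_def single_valued_def prel_def by blast

lemma pinj_trel: "pinj (trel T I)"
 unfolding pinj_def single_valued_def trel_def by blast

lemma mem_prel: "(((I, l), p), ((J, m), q)) \<in> prel T k \<longleftrightarrow> I = T \<and> J = I \<and> l = k \<and> m = k \<and> q = p"
 unfolding prel_def by blast

lemma mem_trel: "(((J, l), p), ((K, m), q)) \<in> trel T I \<longleftrightarrow> J = I \<and> K = T \<and> l \<in> I \<and> m = l \<and> q = p"
 unfolding trel_def by blast

definition Pk :: "nat => nat => bix bop" where
 "Pk r k = rl (prel {1..r} k)"

text \<open>A partial isometry carrying the basis vectors of the largest summand with index in
  \<open>I\<close> to the summand \<open>I\<close>. Conjugation with it moves the compression of an
  operator to \<open>I\<close> into its place in the direct sum.\<close>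

definition tau :: "nat => nat set => bix bop" where
 "tau r I = rl (trel {1..r} I)"

lemma Pk_entry: "mat (Pk r k) ((I, l), p) ((J, m), q)
  = (if I = {1..r} \<and> J = I \<and> l = k \<and> m = k \<and> q = p then 1 else 0)"
 unfolding Pk_def rl_entry[OF pinj_prel] mem_prel ..

lemma Pk_mult_entry: "mat (Pk r k * a) ((I, l), p) j = (if I = {1..r} \<and> l = k then mat a ((I, l), p) j else 0)"
proof (cases "I = {1..r} \<and> l = k")
 case True
 have "mat (Pk r k * a) ((I, l), p) j = mat a ((I, l), p) j"
  unfolding Pk_def by (rule rl_mult_entry[OF pinj_prel]) (use True in \<open>simp add: mem_prel\<close>)
 thus ?thesis using True by simp
next
 case False
 have "mat (Pk r k * a) ((I, l), p) j = 0"
  unfolding Pk_def by (rule rl_mult_entry0[OF pinj_prel]) (use False mem_prel in \<open>metis surj_pair\<close>)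
 thus ?thesis unfolding if_not_P[OF False] .
qed

lemma bix_eqI:
 fixes a b :: "bix bop"
 assumes "\<And>I k p J l q. mat a ((I, k), p) ((J, l), q) = mat b ((I, k), p) ((J, l), q)"
 shows "a = b"
proof (rule bop_eqI)
 fix i j :: bix
 show "mat a i j = mat b i j"
  using assms[of "fst (fst i)" "snd (fst i)" "snd i" "fst (fst j)" "snd (fst j)" "snd j"] by simp
qed

lemma Pk_projections: "projections r (Pk r)"
proof
 show "adj (Pk r k) = Pk r k" for k
  by (rule bix_eqI) (auto simp: adj_entry Pk_entry)
 fix k l
 show "Pk r k * Pk r l = (if k = l then Pk r k else 0)"
  by (rule bix_eqI, cases "k = l") (simp_all add: Pk_mult_entry Pk_entry zero_bop.rep_eq)
qed

interpretation Pk: projections r "Pk r" for r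
 by (rule Pk_projections)

lemma mult_Pk_entry: "mat (a * Pk r k) i ((J, m), q) = (if J = {1..r} \<and> m = k then mat a i ((J, m), q) else 0)"
 using Pk_mult_entry[of r k "adj a" J m q i] adj_entry[of "Pk r k * adj a" i "((J, m), q)"]
 by (simp add: adj_entry)

lemma tau_mult_entry: "mat (tau r I * a) ((J, l), p) j = (if J = I \<and> l \<in> I then mat a (({1..r}, l), p) j else 0)"
proof (cases "J = I \<and> l \<in> I")
 case True
 have "mat (tau r I * a) ((J, l), p) j = mat a (({1..r}, l), p) j"
  unfolding tau_def by (rule rl_mult_entry[OF pinj_trel]) (use True in \<open>simp add: mem_trel\<close>)
 thus ?thesis using True by simp
next
 case False
 have "mat (tau r I * a) ((J, l), p) j = 0"
  unfolding tau_def by (rule rl_mult_entry0[OF pinj_trel]) (use False mem_trel in \<open>metis surj_pair\<close>)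
 thus ?thesis unfolding if_not_P[OF False] .
qed

lemma tau_entry: "mat (tau r I) ((J, l), p) ((K, m), q)
  = (if J = I \<and> K = {1..r} \<and> l \<in> I \<and> m = l \<and> q = p then 1 else 0)"
 unfolding tau_def rl_entry[OF pinj_trel] mem_trel ..

lemma adj_tau_mult_entry: "mat (adj (tau r I) * a) ((K, m), q) j = (if K = {1..r} \<and> m \<in> I then mat a ((I, m), q) j else 0)"
proof (cases "K = {1..r} \<and> m \<in> I")
 case True
 have "mat (adj (tau r I) * a) ((K, m), q) j = mat a ((I, m), q) j"
  unfolding tau_def adj_rl[OF pinj_trel]
  by (rule rl_mult_entry[OF pinj_converse[THEN iffD2, OF pinj_trel]]) (use True in \<open>simp add: mem_trel\<close>)
 thus ?thesis using True by simp
next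
 case False
 have "mat (adj (tau r I) * a) ((K, m), q) j = 0"
  unfolding tau_def adj_rl[OF pinj_trel]
  by (rule rl_mult_entry0[OF pinj_converse[THEN iffD2, OF pinj_trel]]) (use False mem_trel in \<open>metis surj_pair converseD\<close>)
 thus ?thesis unfolding if_not_P[OF False] .
qed

lemma mult_adj_tau_entry: "mat (a * adj (tau r I)) i ((J, m), q) = (if J = I \<and> m \<in> I then mat a i (({1..r}, m), q) else 0)"
 using tau_mult_entry[of r I "adj a" J m q i] adj_entry[of "tau r I * adj a" i "((J, m), q)"]
 by (simp add: adj_entry)

lemma pI_entry: "finite I ==> mat (Pk.pI r I) ((J, l), p) ((K, m), q)
  = (if J = {1..r} \<and> K = J \<and> l \<in> I \<and> m = l \<and> q = p then 1 else 0)"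
proof -
 assume I: "finite I"
 have "mat (Pk.pI r I) ((J, l), p) ((K, m), q) = (\<Sum>k\<in>I. if k = l then
   (if J = {1..r} \<and> K = J \<and> m = l \<and> q = p then 1 else 0) else 0)"
  unfolding Pk.pI_def mat_sum Pk_entry by (intro sum.cong refl) auto
 thus ?thesis using I by simp
qed

lemma adj_tau_tau:
 assumes "finite I"
 shows "adj (tau r I) * tau r J = (if I = J then Pk.pI r I else 0)"
proof (cases "I = J")
 case True
 thus ?thesis
  by (intro bix_eqI) (use assms in \<open>simp add: adj_tau_mult_entry tau_entry pI_entry\<close>)
next
 case False
 thus ?thesis
  by (intro bix_eqI) (simp add: adj_tau_mult_entry tau_entry zero_bop.rep_eq)
qed

lemma intervals_finite: "finite (intervals r)"
 by (rule finite_subset[of _ "Pow {1..r}"]) (auto simp: intervals_def)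

lemma intervals_subset: "I \<in> intervals r ==> I \<subseteq> {1..r} \<and> finite I \<and> I \<noteq> {}"
 by (auto simp: intervals_def)

lemma intervals_convex: "I \<in> intervals r ==> i \<in> I ==> j \<in> I ==> i \<le> k ==> k \<le> j ==> k \<in> I"
 by (auto simp: intervals_def)

lemma top_interval: "r \<ge> 1 ==> {1..r} \<in> intervals r"
 unfolding intervals_def by blast

lemma tau_pI: "I \<in> intervals r ==> tau r I * Pk.pI r I = tau r I"
 by (rule bix_eqI) (simp add: tau_mult_entry tau_entry pI_entry intervals_subset)

lemma adj_tau_tau': "I \<in> intervals r ==> adj (tau r I) * tau r J = (if I = J then Pk.pI r I else 0)"
 using adj_tau_tau intervals_subset by blast

lemma nrm_tau: "nrm (tau r I) \<le> 1" unfolding tau_def by (rule nrm_rl)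

text \<open>Elements of \<open>E \<otimes> \<K>\<close> are determined by their corner \<open>W\<close> at the largest interval; \<open>spread\<close>
 copies the compressions of \<open>W\<close> to the other summands.\<close>

definition spread :: "nat => bix bop => bix bop" where
 "spread r W = (\<Sum>I\<in>intervals r. tau r I * W * adj (tau r I))"

text \<open>The component of \<open>X\<close> in the summand \<open>I\<close>, carried back into the
  largest summand, where all components can be compared.\<close>

definition cp :: "nat => nat set => bix bop => bix bop" where
 "cp r I X = adj (tau r I) * X * tau r I"

lemma spread_entry: "mat (spread r W) ((I, k), p) ((J, l), q) =
  (if I = J \<and> I \<in> intervals r \<and> k \<in> I \<and> l \<in> I then mat W (({1..r}, k), p) (({1..r}, l), q) else 0)"
proof -
 have "mat (spread r W) ((I, k), p) ((J, l), q) =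
   (\<Sum>K\<in>intervals r. if K = I then (if I = J \<and> k \<in> I \<and> l \<in> I then mat W (({1..r}, k), p) (({1..r}, l), q) else 0) else 0)"
  unfolding spread_def mat_sum mult.assoc
  by (intro sum.cong refl) (auto simp: tau_mult_entry mult_adj_tau_entry)
 also have "... = (if I \<in> intervals r then (if I = J \<and> k \<in> I \<and> l \<in> I then mat W (({1..r}, k), p) (({1..r}, l), q) else 0) else 0)"
  using intervals_finite by (simp only: sum.delta)
 finally show ?thesis
  by (cases "I = J"; cases "I \<in> intervals r"; cases "k \<in> I"; cases "l \<in> I") simp_all
qed

lemma spread_add: "spread r (W + W') = spread r W + spread r W'"
 by (simp add: spread_def distrib_left distrib_right sum.distrib)
lemma spread_diff: "spread r (W - W') = spread r W - spread r W'"
 by (simp add: spread_def left_diff_distrib right_diff_distrib sum_subtractf)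
lemma spread_0 [simp]: "spread r 0 = 0" by (simp add: spread_def)
lemma spread_sum: "spread r (\<Sum>x\<in>A. f x) = (\<Sum>x\<in>A. spread r (f x))"
 by (induction A rule: infinite_finite_induct) (simp_all add: spread_add)
lemma spread_sc: "spread r (sc c * W) = sc c * spread r W"
 unfolding spread_def sum_distrib_left
 by (intro sum.cong refl) (simp only: mult.assoc sc_left_commute[of "tau r _" c])
lemma spread_adj: "adj (spread r W) = spread r (adj W)"
 by (simp add: spread_def mult.assoc)

text \<open>The factor, the number of intervals, is crude; continuity and boundedness of
  \<open>spread\<close> are all that is drawn from it.\<close>

lemma nrm_spread: "nrm (spread r W) \<le> card (intervals r) * nrm W"
proof -
 have "nrm (tau r I * W * adj (tau r I)) \<le> nrm W" for I
 proof -
  have "nrm (tau r I * W * adj (tau r I)) \<le> nrm (tau r I) * nrm W * nrm (tau r I)"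
   using nrm_mult[of "tau r I * W" "adj (tau r I)"] mult_right_mono[OF nrm_mult[of "tau r I" W] nrm_nonneg[of "tau r I"]]
   by simp
  also have "... \<le> 1 * nrm W * 1" by (intro mult_mono nrm_tau) simp_all
  finally show ?thesis by simp
 qed
 hence "(\<Sum>I\<in>intervals r. nrm (tau r I * W * adj (tau r I))) \<le> card (intervals r) * nrm W"
  by (intro sum_bounded_above)
 thus ?thesis unfolding spread_def by (rule order_trans[OF nrm_sum])
qed

lemma nrm_cp: "nrm (cp r I X) \<le> nrm X"
proof -
 have "nrm (adj (tau r I) * X * tau r I) \<le> nrm (tau r I) * nrm X * nrm (tau r I)"
  using nrm_mult[of "adj (tau r I) * X" "tau r I"] mult_right_mono[OF nrm_mult[of "adj (tau r I)" X] nrm_nonneg[of "tau r I"]]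
  by simp
 also have "... \<le> 1 * nrm X * 1" by (intro mult_mono nrm_tau) simp_all
 finally show ?thesis by (simp add: cp_def)
qed

text \<open>Different summands have orthogonal ranges, so only \<open>I\<close> contributes. The
  trailing factor \<open>X\<close> allows repeated use along a product.\<close>

lemma cp_spread_mult:
 assumes "I \<in> intervals r"
 shows "adj (tau r I) * (spread r W * X) = Pk.pI r I * W * adj (tau r I) * X"
proof -
 have "adj (tau r I) * (spread r W * X)
   = (\<Sum>J\<in>intervals r. adj (tau r I) * tau r J * W * adj (tau r J) * X)"
  by (simp add: spread_def sum_distrib_left sum_distrib_right mult.assoc)
 also have "... = (\<Sum>J\<in>intervals r. if I = J then Pk.pI r I * W * adj (tau r I) * X else 0)"
  using assms by (intro sum.cong refl) (simp add: adj_tau_tau')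
 finally show ?thesis using assms intervals_finite by simp
qed

lemma cp_spread:
 assumes "I \<in> intervals r"
 shows "cp r I (spread r W) = Pk.pI r I * W * Pk.pI r I"
 using cp_spread_mult[OF assms, of W "tau r I"] adj_tau_tau'[OF assms, of I]
 by (simp add: cp_def mult.assoc)

definition UT :: "nat => bix bop => bool" where
 "UT r W \<longleftrightarrow> Pk.pI r {1..r} * W = W \<and> W * Pk.pI r {1..r} = W \<and>
   (\<forall>k\<in>{1..r}. \<forall>l\<in>{1..r}. l < k \<longrightarrow> Pk r k * W * Pk r l = 0)"

lemma UT_D:
 assumes "UT r W"
 shows "Pk.pI r {1..r} * W = W" "W * Pk.pI r {1..r} = W"
  "k \<in> {1..r} ==> l \<in> {1..r} ==> l < k ==> Pk r k * W * Pk r l = 0"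
 using assms unfolding UT_def by blast+

lemma UT_mult:
 assumes "UT r W" "UT r W'"
 shows "UT r (W * W')"
 unfolding UT_def
proof (intro conjI ballI impI)
 show "Pk.pI r {1..r} * (W * W') = W * W'" using UT_D[OF assms(1)] by (simp flip: mult.assoc)
 show "W * W' * Pk.pI r {1..r} = W * W'" using UT_D[OF assms(2)] by (simp add: mult.assoc)
 fix k l assume kl: "k \<in> {1..r}" "l \<in> {1..r}" "l < k"
 have "Pk r k * (W * W') * Pk r l = Pk r k * (W * Pk.pI r {1..r} * W') * Pk r l"
  using UT_D[OF assms(1)] by simp
 also have "... = (\<Sum>m\<in>{1..r}. (Pk r k * W * Pk r m) * (Pk r m * W' * Pk r l))"
  unfolding Pk.pI_def sum_distrib_left sum_distrib_right
  by (intro sum.cong refl) (simp add: mult.assoc assoc_left[OF Pk.P_orth])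
 also have "... = 0"
 proof (rule sum.neutral, rule ballI)
  fix m assume m: "m \<in> {1..r}"
  thus "(Pk r k * W * Pk r m) * (Pk r m * W' * Pk r l) = 0"
   using UT_D(3)[OF assms(1) kl(1) m] UT_D(3)[OF assms(2) m kl(2)] kl by (cases "m < k") auto
 qed
 finally show "Pk r k * (W * W') * Pk r l = 0" .
qed

lemma UT_add: "UT r W ==> UT r W' ==> UT r (W + W')"
 by (auto simp: UT_def distrib_left distrib_right)

lemma UT_0: "UT r 0" by (auto simp: UT_def)

lemma UT_sc: "UT r W ==> UT r (sc c * W)"
 unfolding UT_def by (simp add: mult.assoc sc_left_commute[of "Pk.pI r {1..r}" c] sc_left_commute[of "Pk r _" c])

lemma UT_sum: "(\<And>x. x \<in> A ==> UT r (f x)) ==> UT r (\<Sum>x\<in>A. f x)"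
 by (induction A rule: infinite_finite_induct) (auto simp: UT_0 UT_add)

text \<open>Compression to an interval is multiplicative on triangular operators. An intermediate
  index m outside \<open>I\<close> lies, by convexity, below k or above l, and then triangularity
  kills the left or the right factor.\<close>

lemma UT_compress:
 assumes "UT r W" "UT r W'" "I \<in> intervals r"
 shows "Pk.pI r I * W * Pk.pI r I * W' * Pk.pI r I = Pk.pI r I * (W * W') * Pk.pI r I"
proof -
 have sub: "I \<subseteq> {1..r}" and fin: "finite I" using intervals_subset[OF assms(3)] by auto
 have top: "Pk.pI r {1..r} = Pk.pI r I + Pk.pI r ({1..r} - I)"
  unfolding Pk.pI_def using sub by (metis add.commute finite_atLeastAtMost sum.subset_diff)
 have 00: "Pk r k * W * Pk.pI r ({1..r} - I) * W' * Pk r l = 0" if kl: "k \<in> I" "l \<in> I" for k l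
 proof -
  have "Pk r k * W * Pk.pI r ({1..r} - I) * W' * Pk r l
    = (\<Sum>m\<in>{1..r} - I. Pk r k * W * Pk r m * W' * Pk r l)"
   by (simp add: Pk.pI_def sum_distrib_left sum_distrib_right)
  also have "... = 0"
  proof (intro sum.neutral ballI)
   fix m assume m: "m \<in> {1..r} - I"
   hence "m < k \<or> l < m" using intervals_convex[OF assms(3), of k l m] kl by (meson DiffD2 not_le)
   thus "Pk r k * W * Pk r m * W' * Pk r l = 0"
   proof
    assume "m < k"
    hence "Pk r k * W * Pk r m = 0" using UT_D(3)[OF assms(1), of k m] m kl sub by auto
    thus ?thesis by simp
   next
    assume "l < m"
    hence "Pk r m * W' * Pk r l = 0" using UT_D(3)[OF assms(2), of m l] m kl sub by auto
    thus ?thesis by (simp add: mult.assoc)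
   qed
  qed
  finally show ?thesis .
 qed
 have "Pk.pI r I * W * Pk.pI r ({1..r} - I) * W' * Pk.pI r I
   = (\<Sum>k\<in>I. Pk r k * W * Pk.pI r ({1..r} - I) * W' * (\<Sum>l\<in>I. Pk r l))"
  by (subst (1) Pk.pI_def) (simp add: sum_distrib_right, simp add: Pk.pI_def[of r I])
 also have "... = 0" unfolding sum_distrib_left using 00 by (simp add: sum.neutral)
 finally have 0: "Pk.pI r I * W * Pk.pI r ({1..r} - I) * W' * Pk.pI r I = 0" .
 have "Pk.pI r I * (W * W') * Pk.pI r I = Pk.pI r I * (W * Pk.pI r {1..r} * W') * Pk.pI r I"
  using UT_D(2)[OF assms(1)] by simp
 also have "... = Pk.pI r I * W * Pk.pI r I * W' * Pk.pI r I + Pk.pI r I * W * Pk.pI r ({1..r} - I) * W' * Pk.pI r I"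
  unfolding top by (simp add: distrib_left distrib_right mult.assoc)
 finally show ?thesis using 0 by simp
qed

lemma tau_conj_pI:
 assumes "I \<in> intervals r"
 shows "tau r I * X * adj (tau r I) = tau r I * (Pk.pI r I * X * Pk.pI r I) * adj (tau r I)"
proof -
 have "Pk.pI r I * adj (tau r I) = adj (tau r I)" using arg_cong[OF tau_pI[OF assms], of adj] by simp
 thus ?thesis using tau_pI[OF assms] by (simp add: mult.assoc) (simp flip: mult.assoc)
qed

text \<open>Summand by summand this is \<open>UT_compress\<close>. It allows products in the direct
  sum to be computed in the single corner.\<close>

lemma spread_mult:
 assumes "UT r W" "UT r W'"
 shows "spread r W * spread r W' = spread r (W * W')"
proof -
 have "spread r W * spread r W' = (\<Sum>I\<in>intervals r. tau r I * W * (adj (tau r I) * (spread r W' * 1)))"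
  by (simp add: spread_def[of r W] sum_distrib_right mult.assoc)
 also have "... = (\<Sum>I\<in>intervals r. tau r I * (W * W') * adj (tau r I))"
 proof (intro sum.cong refl)
  fix I assume I: "I \<in> intervals r"
  have "tau r I * W * (adj (tau r I) * (spread r W' * 1)) = tau r I * (W * Pk.pI r I * W') * adj (tau r I)"
   unfolding cp_spread_mult[OF I] by (simp add: mult.assoc)
  also have "... = tau r I * (Pk.pI r I * W * Pk.pI r I * W' * Pk.pI r I) * adj (tau r I)"
   by (subst tau_conj_pI[OF I]) (simp add: mult.assoc)
  also have "... = tau r I * (W * W') * adj (tau r I)"
   unfolding UT_compress[OF assms I] by (rule tau_conj_pI[OF I, symmetric])
  finally show "tau r I * W * (adj (tau r I) * (spread r W' * 1)) = tau r I * (W * W') * adj (tau r I)" .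
 qed
 finally show ?thesis by (simp add: spread_def)
qed

lemma top_entry:
 assumes "Pk.pI r {1..r} * W = W" "W * Pk.pI r {1..r} = W" "mat W ((I, k), p) ((J, l), q) \<noteq> 0"
 shows "I = {1..r}" "J = {1..r}" "k \<in> {1..r}" "l \<in> {1..r}"
proof -
 have "mat W ((I, k), p) j = (if I = {1..r} \<and> k \<in> {1..r} then mat W ((I, k), p) j else 0)" for j
  by (subst assms(1)[symmetric], cases "I = {1..r}") (simp_all add: Pk.pI_def sum_distrib_right mat_sum Pk_mult_entry)
 thus "I = {1..r}" "k \<in> {1..r}" using assms(3) by metis+
 have "mat W i ((J, l), q) = (if J = {1..r} \<and> l \<in> {1..r} then mat W i ((J, l), q) else 0)" for i
  by (subst assms(2)[symmetric], cases "J = {1..r}") (simp_all add: Pk.pI_def sum_distrib_left mat_sum mult_Pk_entry)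
 thus "J = {1..r}" "l \<in> {1..r}" using assms(3) by metis+
qed

lemma UT_entry:
 assumes "UT r W" "mat W ((I, k), p) ((J, l), q) \<noteq> 0"
 shows "I = {1..r}" "J = {1..r}" "k \<in> {1..r}" "l \<in> {1..r}" "k \<le> l"
proof -
 show *: "I = {1..r}" "J = {1..r}" "k \<in> {1..r}" "l \<in> {1..r}"
  using top_entry[OF UT_D(1,2)[OF assms(1)] assms(2)] by auto
 show "k \<le> l"
 proof (rule ccontr)
  assume "\<not> k \<le> l"
  hence "Pk r k * W * Pk r l = 0" using UT_D(3)[OF assms(1)] * by auto
  hence "mat (Pk r k * W * Pk r l) ((I, k), p) ((J, l), q) = 0" by (simp add: zero_bop.rep_eq)
  thus False using assms(2) * by (simp add: mult_Pk_entry Pk_mult_entry)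
 qed
qed

lemma UT_I:
 assumes "\<And>I k p J l q. mat W ((I, k), p) ((J, l), q) \<noteq> 0 ==>
   I = {1..r} \<and> J = {1..r} \<and> k \<in> {1..r} \<and> l \<in> {1..r} \<and> k \<le> l"
 shows "UT r W"
 unfolding UT_def
proof (intro conjI ballI impI)
 show "Pk.pI r {1..r} * W = W"
 proof (rule bop_eqI)
  fix i j :: bix
  obtain I k p J l q where ij: "i = ((I, k), p)" "j = ((J, l), q)" by (metis surj_pair)
  have "mat (Pk.pI r {1..r} * W) i j = (\<Sum>m\<in>{1..r}. if m = k then if I = {1..r} then mat W i j else 0 else 0)"
   unfolding ij Pk.pI_def sum_distrib_right mat_sum Pk_mult_entry by (intro sum.cong refl) auto
  also have "... = (if k \<in> {1..r} then if I = {1..r} then mat W i j else 0 else 0)" by simp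
  finally have "mat (Pk.pI r {1..r} * W) i j = (if k \<in> {1..r} then if I = {1..r} then mat W i j else 0 else 0)" .
  moreover have "mat W i j = 0" if "\<not> (I = {1..r} \<and> k \<in> {1..r})"
   using assms[of I k p J l q] that unfolding ij by blast
  ultimately show "mat (Pk.pI r {1..r} * W) i j = mat W i j" by metis
 qed
 show "W * Pk.pI r {1..r} = W"
 proof (rule bop_eqI)
  fix i j :: bix
  obtain I k p J l q where ij: "i = ((I, k), p)" "j = ((J, l), q)" by (metis surj_pair)
  have "mat (W * Pk.pI r {1..r}) i j = (\<Sum>m\<in>{1..r}. if m = l then if J = {1..r} then mat W i j else 0 else 0)"
   unfolding ij Pk.pI_def sum_distrib_left mat_sum mult_Pk_entry by (intro sum.cong refl) auto
  also have "... = (if l \<in> {1..r} then if J = {1..r} then mat W i j else 0 else 0)" by simp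
  finally have "mat (W * Pk.pI r {1..r}) i j = (if l \<in> {1..r} then if J = {1..r} then mat W i j else 0 else 0)" .
  moreover have "mat W i j = 0" if "\<not> (J = {1..r} \<and> l \<in> {1..r})"
   using assms[of I k p J l q] that unfolding ij by blast
  ultimately show "mat (W * Pk.pI r {1..r}) i j = mat W i j" by metis
 qed
 fix k l :: nat assume "l < k"
 thus "Pk r k * W * Pk r l = 0"
 proof (intro bop_eqI)
  fix i j :: bix
  obtain I k' p J l' q where ij: "i = ((I, k'), p)" "j = ((J, l'), q)" by (metis surj_pair)
  show "mat (Pk r k * W * Pk r l) i j = mat 0 i j"
  proof -
   have "mat W i j = 0" if "k' = k" "l' = l"
    using assms[of I k' p J l' q] \<open>l < k\<close> that unfolding ij by (metis not_le)
   thus ?thesis unfolding ij mult_Pk_entry Pk_mult_entry zero_bop.rep_eq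
    by (cases "I = {1..r}"; cases "J = {1..r}"; cases "k' = k"; cases "l' = l") simp_all
  qed
 qed
qed

section \<open>The matrix algebras\<close>

lemma block_entry: "block b p q x y = b (x, p) (y, q)"
 by (simp add: block_def)

lemma T_max_entries:
 assumes "a \<in> T_max r"
 shows "a (I, k) (J, l) = (if I = J \<and> I \<in> intervals r \<and> k \<in> I \<and> l \<in> I then a ({1..r}, k) ({1..r}, l) else 0)"
  and "a ({1..r}, k) ({1..r}, l) \<noteq> 0 ==> k \<le> l \<and> k \<in> {1..r} \<and> l \<in> {1..r}"
proof -
 obtain a0 where a0: "a0 \<in> upper_triangular r"
  and a: "a = (\<lambda>(I, i) (J, j). if I = J \<and> I \<in> intervals r \<and> i \<in> I \<and> j \<in> I then a0 i j else 0)"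
  using assms unfolding T_max_def by blast
 have av: "a (I, k) (J, l) = (if I = J \<and> I \<in> intervals r \<and> k \<in> I \<and> l \<in> I then a0 k l else 0)" for I J
  unfolding a by (simp only: prod.case)
 have top: "{1..r} = {1..r} \<and> {1..r} \<in> intervals r \<and> k \<in> {1..r} \<and> l \<in> {1..r}" if "I \<in> intervals r" "k \<in> I" "l \<in> I"
  using top_interval[of r] intervals_subset[OF that(1)] that by auto
 show "a (I, k) (J, l) = (if I = J \<and> I \<in> intervals r \<and> k \<in> I \<and> l \<in> I then a ({1..r}, k) ({1..r}, l) else 0)"
 proof (cases "I = J \<and> I \<in> intervals r \<and> k \<in> I \<and> l \<in> I")
  case True
  hence "a ({1..r}, k) ({1..r}, l) = a0 k l" using av[of "{1..r}" "{1..r}"] top by (metis (full_types))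
  thus ?thesis unfolding if_P[OF True] using av[of I J] if_P[OF True] by metis
 next
  case False
  show ?thesis unfolding if_not_P[OF False] using av[of I J] if_not_P[OF False] by metis
 qed
 assume "a ({1..r}, k) ({1..r}, l) \<noteq> 0"
 hence "k \<in> {1..r} \<and> l \<in> {1..r} \<and> a0 k l \<noteq> 0" using av[of "{1..r}" "{1..r}"] by metis
 thus "k \<le> l \<and> k \<in> {1..r} \<and> l \<in> {1..r}" using a0 unfolding upper_triangular_def by blast
qed

lemma T_maxI:
 assumes "\<And>I k J l. a (I, k) (J, l) = (if I = J \<and> I \<in> intervals r \<and> k \<in> I \<and> l \<in> I then a ({1..r}, k) ({1..r}, l) else 0)"
  and "\<And>k l. a ({1..r}, k) ({1..r}, l) \<noteq> 0 ==> k \<le> l \<and> k \<in> {1..r} \<and> l \<in> {1..r}"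
 shows "a \<in> T_max r"
proof -
 define a0 where "a0 k l = a ({1..r}, k) ({1..r}, l)" for k l
 have "a0 \<in> upper_triangular r"
  unfolding upper_triangular_def a0_def mem_Collect_eq using assms(2) by (metis atLeastAtMost_iff)
 moreover have "a = (\<lambda>(I, i) (J, j). if I = J \<and> I \<in> intervals r \<and> i \<in> I \<and> j \<in> I then a0 i j else 0)"
 proof (intro ext)
  fix x y :: "nat set \<times> nat"
  obtain I k J l where xy: "x = (I, k)" "y = (J, l)" by (metis surj_pair)
  show "a x y = (\<lambda>(I, i) (J, j). if I = J \<and> I \<in> intervals r \<and> i \<in> I \<and> j \<in> I then a0 i j else 0) x y"
   unfolding xy a0_def prod.case by (rule assms(1))
 qed
 ultimately show ?thesis unfolding T_max_def by blast
qed

text \<open>The projection onto the first n copies of the underlying Hilbert space; elements of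
  \<open>tensor_M\<close> of size n are those it leaves unchanged from both sides.\<close>

definition Nn :: "nat => bix bop" where "Nn n = rl {(x, x) | x. snd x < n}"

lemma pinj_Nn: "pinj {(x, x) | x. snd x < n}"
 unfolding pinj_def single_valued_def by blast

lemma Nn_mult_entry: "mat (Nn n * a) (x, p) j = (if p < n then mat a (x, p) j else 0)"
proof (cases "p < n")
 case True
 have "mat (Nn n * a) (x, p) j = mat a (x, p) j"
  unfolding Nn_def by (rule rl_mult_entry[OF pinj_Nn]) (use True in simp)
 thus ?thesis using True by simp
next
 case False
 have "mat (Nn n * a) (x, p) j = 0"
  unfolding Nn_def by (rule rl_mult_entry0[OF pinj_Nn]) (use False in simp)
 thus ?thesis using False by simp
qed

lemma adj_Nn [simp]: "adj (Nn n) = Nn n"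
 unfolding Nn_def adj_rl[OF pinj_Nn] by (rule arg_cong[of _ _ rl]) blast

lemma mult_Nn_entry: "mat (a * Nn n) i (x, p) = (if p < n then mat a i (x, p) else 0)"
 using Nn_mult_entry[of n "adj a" x p i] adj_entry[of "Nn n * adj a" i "(x, p)"]
 by (simp add: adj_entry)

lemma nrm_Nn: "nrm (Nn n) \<le> 1" unfolding Nn_def by (rule nrm_rl)

lemma Nn_idem: "n \<le> m ==> Nn n * Nn m = Nn n" "n \<le> m ==> Nn m * Nn n = Nn n"
proof -
 show 1: "Nn m * Nn n = Nn n" if "n \<le> m" for n m
 proof (rule bop_eqI)
  fix i j :: bix
  show "mat (Nn m * Nn n) i j = mat (Nn n) i j"
   using that Nn_mult_entry[of m "Nn n" "fst i" "snd i" j] Nn_mult_entry[of n 1 "fst i" "snd i" j] by simp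
 qed
 show "Nn n * Nn m = Nn n" if "n \<le> m" using arg_cong[OF 1[OF that], of adj] by simp
qed

lemma tensor_M_mono: "n \<le> m ==> 0 \<in> E ==> tensor_M E n \<subseteq> tensor_M E m"
 unfolding tensor_M_def by (auto simp: zero_fun_def) (metis less_le_trans)+

lemma zero_T_max: "0 \<in> T_max r"
 by (rule T_maxI) simp_all

text \<open>The entry relations that all elements of the amplified algebra share: block diagonal,
  every block a part of the block at the largest interval, and that block upper triangular. They are
  stable under limits and therefore hold throughout \<open>TK r\<close>.\<close>

definition good :: "nat => bix cmat => bool" where
 "good r b \<longleftrightarrow> (\<forall>I k p J l q. b ((I, k), p) ((J, l), q) =
   (if I = J \<and> I \<in> intervals r \<and> k \<in> I \<and> l \<in> I then b (({1..r}, k), p) (({1..r}, l), q) else 0)) \<and>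
  (\<forall>k p l q. b (({1..r}, k), p) (({1..r}, l), q) \<noteq> 0 \<longrightarrow> k \<le> l \<and> k \<in> {1..r} \<and> l \<in> {1..r})"

lemma tensor_M_good:
 assumes "b \<in> tensor_M (T_max r) n"
 shows "good r b" "b (x, p) (y, q) \<noteq> 0 ==> p < n \<and> q < n"
proof -
 have blk: "block b p q \<in> T_max r" for p q
  using assms zero_T_max[of r] unfolding tensor_M_def mem_Collect_eq by metis
 show "good r b"
  unfolding good_def
  using T_max_entries[OF blk] unfolding block_entry by blast
 assume "b (x, p) (y, q) \<noteq> 0"
 hence "block b p q \<noteq> 0" by (metis block_entry zero_fun_apply)
 thus "p < n \<and> q < n" using assms unfolding tensor_M_def mem_Collect_eq by metis
qed

lemma tensor_MI:
 assumes "good r b" "\<And>x p y q. b (x, p) (y, q) \<noteq> 0 ==> p < n \<and> q < n"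
 shows "b \<in> tensor_M (T_max r) n"
 unfolding tensor_M_def mem_Collect_eq
proof (intro allI)
 fix p q
 have "block b p q = 0" if "\<not> (p < n \<and> q < n)"
  using assms(2) that by (intro ext) (metis block_entry zero_fun_apply)
 moreover have "block b p q \<in> T_max r"
  by (rule T_maxI) (use assms(1) in \<open>unfold good_def block_entry, blast+\<close>)
 ultimately show "if p < n \<and> q < n then block b p q \<in> T_max r else block b p q = 0" by simp
qed

text \<open>A relation links at most two entries, so an approximation within e / 2 shows it up to e.
  For the support condition the approximation is taken finer than the modulus of the nonzero entry
  in question.\<close>

lemma good_eq_approx:
 assumes "\<And>e :: real. e > 0 ==> \<exists>b'. good r b' \<and> (\<forall>i j. cmod (b i j - b' i j) < e)"
 shows "good r b"
 unfolding good_def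
proof (intro conjI allI impI)
 fix I k p J l q
 let ?c = "I = J \<and> I \<in> intervals r \<and> k \<in> I \<and> l \<in> I"
 have "cmod (b ((I, k), p) ((J, l), q) - (if ?c then b (({1..r}, k), p) (({1..r}, l), q) else 0)) \<le> 0 + e"
  if epos: "e > 0" for e
 proof -
  obtain b' where b': "good r b'" "\<And>i j. cmod (b i j - b' i j) < e / 2"
   using assms[OF half_gt_zero[OF epos]] by blast
  have g: "b' ((I, k), p) ((J, l), q) = (if ?c then b' (({1..r}, k), p) (({1..r}, l), q) else 0)"
   using b'(1) unfolding good_def by blast
  show ?thesis
  proof (cases ?c)
   case True
   have "cmod (b ((I, k), p) ((J, l), q) - b (({1..r}, k), p) (({1..r}, l), q)) \<le>
    cmod (b ((I, k), p) ((J, l), q) - b' ((I, k), p) ((J, l), q)) +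
    cmod (b (({1..r}, k), p) (({1..r}, l), q) - b' (({1..r}, k), p) (({1..r}, l), q))"
    using g norm_triangle_ineq4[of "b ((I, k), p) ((J, l), q) - b' ((I, k), p) ((J, l), q)"
     "b (({1..r}, k), p) (({1..r}, l), q) - b' (({1..r}, k), p) (({1..r}, l), q)"]
    unfolding if_P[OF True] by simp
   also have "... \<le> e / 2 + e / 2" by (intro add_mono less_imp_le b'(2))
   finally show ?thesis unfolding if_P[OF True] by simp
  next
   case False
   thus ?thesis
    using b'(2)[of "((I, k), p)" "((J, l), q)"] g epos unfolding if_not_P[OF False] by simp
  qed
 qed
 hence "cmod (b ((I, k), p) ((J, l), q) - (if ?c then b (({1..r}, k), p) (({1..r}, l), q) else 0)) \<le> 0"
  by (rule field_le_epsilon)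
 thus "b ((I, k), p) ((J, l), q) = (if ?c then b (({1..r}, k), p) (({1..r}, l), q) else 0)"
  by (simp only: norm_le_zero_iff right_minus_eq)
next
 fix k p l q assume nz: "b (({1..r}, k), p) (({1..r}, l), q) \<noteq> 0"
 have "0 < cmod (b (({1..r}, k), p) (({1..r}, l), q))" using nz by (simp only: zero_less_norm_iff not_False_eq_True)
 from assms[OF this] obtain b' where b': "good r b'"
  "\<And>i j. cmod (b i j - b' i j) < cmod (b (({1..r}, k), p) (({1..r}, l), q))" by blast
 have "b' (({1..r}, k), p) (({1..r}, l), q) \<noteq> 0"
  using b'(2)[of "(({1..r}, k), p)" "(({1..r}, l), q)"] by auto
 hence "k \<le> l \<and> k \<in> {1..r} \<and> l \<in> {1..r}" using b'(1) unfolding good_def by blast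
 thus "k \<le> l" "k \<in> {1..r}" "l \<in> {1..r}" by auto
qed

abbreviation TK :: "nat => bix cmat set" where "TK r \<equiv> tensor_K (T_max r)"

lemma tensor_K_bounded: "b \<in> tensor_K E ==> bounded_op b"
 by (simp add: tensor_K_def op_closure_def)

lemma tensor_K_good:
 assumes "b \<in> TK r"
 shows "good r b"
proof (rule good_eq_approx)
 fix e :: real assume "e > 0"
 then obtain c n where c: "c \<in> tensor_M (T_max r) n" "bounded_op c" "op_norm (b - c) < e"
  using assms unfolding tensor_K_def op_closure_def by blast
 have "bounded_op (b - c)" using tensor_K_bounded[OF assms] c(2) by (rule bounded_op_diff)
 hence "cmod (b i j - c i j) < e" for i j
  using bnd_entry[OF bnd_op_norm, of "b - c" i j] c(3) by simp
 thus "\<exists>b'. good r b' \<and> (\<forall>i j. cmod (b i j - b' i j) < e)" using tensor_M_good(1)[OF c(1)] by blast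
qed

lemma spread_good: "UT r W ==> good r (mat (spread r W))"
 unfolding good_def spread_entry
proof (intro conjI allI impI)
 assume U: "UT r W"
 fix I k p J l q
 have top: "{1..r} \<in> intervals r \<and> k \<in> {1..r} \<and> l \<in> {1..r}" if "I \<in> intervals r" "k \<in> I" "l \<in> I"
  using top_interval[of r] intervals_subset[OF that(1)] that by auto
 show "(if I = J \<and> I \<in> intervals r \<and> k \<in> I \<and> l \<in> I then mat W (({1..r}, k), p) (({1..r}, l), q) else 0)
   = (if I = J \<and> I \<in> intervals r \<and> k \<in> I \<and> l \<in> I then
     if {1..r} = {1..r} \<and> {1..r} \<in> intervals r \<and> k \<in> {1..r} \<and> l \<in> {1..r}
     then mat W (({1..r}, k), p) (({1..r}, l), q) else 0 else 0)"
  by (rule if_cong[OF refl _ refl], rule if_P[symmetric]) (use top in blast)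
next
 assume U: "UT r W"
 fix k p l q
 assume "(if {1..r} = {1..r} \<and> {1..r} \<in> intervals r \<and> k \<in> {1..r} \<and> l \<in> {1..r}
     then mat W (({1..r}, k), p) (({1..r}, l), q) else 0) \<noteq> 0"
 hence "mat W (({1..r}, k), p) (({1..r}, l), q) \<noteq> 0" by metis
 from UT_entry[OF U this] show "k \<le> l" "k \<in> {1..r}" "l \<in> {1..r}" by auto
qed

lemma good_spread:
 assumes r: "r \<ge> 1" and b: "good r (mat b)"
 obtains W where "UT r W" "b = spread r W" "W = cp r {1..r} b"
proof -
 define W where "W = cp r {1..r} b"
 have tt: "tau r {1..r} = Pk.pI r {1..r}"
  unfolding tau_entry pI_entry[OF finite_atLeastAtMost] by (rule bix_eqI) (unfold tau_entry pI_entry[OF finite_atLeastAtMost], rule if_cong, blast, rule refl, rule refl)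
 have We: "mat W ((I, k), p) ((J, l), q) =
   (if I = {1..r} \<and> k \<in> {1..r} then if J = {1..r} \<and> l \<in> {1..r} then mat b (({1..r}, k), p) (({1..r}, l), q) else 0 else 0)"
  for I k p J l q
 proof -
  have "W = tau r {1..r} * (b * adj (tau r {1..r}))" by (simp add: W_def cp_def tt mult.assoc)
  thus ?thesis by (simp only: tau_mult_entry mult_adj_tau_entry)
 qed
 have "UT r W"
 proof (rule UT_I)
  fix I k p J l q assume nz: "mat W ((I, k), p) ((J, l), q) \<noteq> 0"
  hence "I = {1..r} \<and> k \<in> {1..r} \<and> J = {1..r} \<and> l \<in> {1..r} \<and> mat b (({1..r}, k), p) (({1..r}, l), q) \<noteq> 0"
   unfolding We by metis
  thus "I = {1..r} \<and> J = {1..r} \<and> k \<in> {1..r} \<and> l \<in> {1..r} \<and> k \<le> l"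
   using b unfolding good_def by blast
 qed
 moreover have "b = spread r W"
 proof (rule bix_eqI)
  fix I k p J l q
  have sub: "k \<in> {1..r} \<and> l \<in> {1..r}" if "I \<in> intervals r" "k \<in> I" "l \<in> I"
   using intervals_subset[OF that(1)] that by auto
  have "mat b ((I, k), p) ((J, l), q) =
   (if I = J \<and> I \<in> intervals r \<and> k \<in> I \<and> l \<in> I then mat b (({1..r}, k), p) (({1..r}, l), q) else 0)"
   using b unfolding good_def by blast
  thus "mat b ((I, k), p) ((J, l), q) = mat (spread r W) ((I, k), p) ((J, l), q)"
   unfolding spread_entry We using sub by metis
 qed
 ultimately show ?thesis using that W_def by blast
qed

lemma cp_top_spread:
 assumes "r \<ge> 1" "UT r W"
 shows "cp r {1..r} (spread r W) = W"
 using cp_spread[OF top_interval[OF assms(1)], of W] UT_D[OF assms(2)] by simp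

lemma spread_inj: "r \<ge> 1 ==> UT r W ==> UT r W' ==> spread r W = spread r W' ==> W = W'"
 using cp_top_spread by metis

lemma spread_Nn: "Nn n * spread r W * Nn n = spread r (Nn n * W * Nn n)"
proof (rule bix_eqI)
 fix I k p J l q
 show "mat (Nn n * spread r W * Nn n) ((I, k), p) ((J, l), q) = mat (spread r (Nn n * W * Nn n)) ((I, k), p) ((J, l), q)"
  unfolding mult_Nn_entry Nn_mult_entry spread_entry
  by (cases "p < n"; cases "q < n") (simp_all only: if_True if_False if_cancel simp_thms)
qed

lemma spread_in_tensor_M:
 assumes "UT r W" "Nn n * W * Nn n = W"
 shows "mat (spread r W) \<in> tensor_M (T_max r) n"
proof (rule tensor_MI[OF spread_good[OF assms(1)]])
 fix x p y q assume "mat (spread r W) (x, p) (y, q) \<noteq> 0"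
 hence "mat (Nn n * spread r W * Nn n) (x, p) (y, q) \<noteq> 0" unfolding spread_Nn assms(2) .
 thus "p < n \<and> q < n" unfolding mult_Nn_entry Nn_mult_entry by metis
qed

lemma tensor_M_spread:
 assumes r: "r \<ge> 1" and b: "mat b \<in> tensor_M (T_max r) n"
 obtains W where "UT r W" "b = spread r W" "Nn n * W * Nn n = W"
proof -
 obtain W where W: "UT r W" "b = spread r W" "W = cp r {1..r} b"
  using good_spread[OF r tensor_M_good(1)[OF b]] by blast
 have "Nn n * b * Nn n = b"
 proof (rule bop_eqI)
  fix i j :: bix
  obtain x p y q where ij: "i = (x, p)" "j = (y, q)" by (metis surj_pair)
  show "mat (Nn n * b * Nn n) i j = mat b i j"
   using tensor_M_good(2)[OF b, of x p y q] unfolding ij mult_Nn_entry Nn_mult_entry by metis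
 qed
 hence "spread r (Nn n * W * Nn n) = spread r W" using W(2) spread_Nn by metis
 moreover have "UT r (Nn n * W * Nn n)"
 proof (rule UT_I)
  fix I k p J l q assume "mat (Nn n * W * Nn n) ((I, k), p) ((J, l), q) \<noteq> 0"
  hence "mat W ((I, k), p) ((J, l), q) \<noteq> 0" unfolding mult_Nn_entry Nn_mult_entry by metis
  from UT_entry[OF W(1) this] show "I = {1..r} \<and> J = {1..r} \<and> k \<in> {1..r} \<and> l \<in> {1..r} \<and> k \<le> l" by blast
 qed
 ultimately show ?thesis using that[OF W(1,2)] spread_inj[OF r _ W(1)] by blast
qed

definition inTK :: "nat => bix bop => bool" where
 "inTK r b \<longleftrightarrow> mat b \<in> TK r"

lemma inTK_iff: "inTK r b \<longleftrightarrow> (\<forall>e>0. \<exists>c n. mat c \<in> tensor_M (T_max r) n \<and> nrm (b - c) < e)"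
proof -
 have "(\<exists>c\<in>(\<Union>n. tensor_M (T_max r) n). bounded_op c \<and> op_norm (mat b - c) < e) \<longleftrightarrow>
   (\<exists>c n. mat c \<in> tensor_M (T_max r) n \<and> nrm (b - c) < e)" for e
 proof
  assume "\<exists>c\<in>(\<Union>n. tensor_M (T_max r) n). bounded_op c \<and> op_norm (mat b - c) < e"
  then obtain c n where c: "c \<in> tensor_M (T_max r) n" "bounded_op c" "op_norm (mat b - c) < e" by blast
  thus "\<exists>c n. mat c \<in> tensor_M (T_max r) n \<and> nrm (b - c) < e"
   by (intro exI[of _ "Bop c"] exI[of _ n]) (simp add: mat_Bop nrm.rep_eq mat_minus)
 next
  assume "\<exists>c n. mat c \<in> tensor_M (T_max r) n \<and> nrm (b - c) < e"
  thus "\<exists>c\<in>(\<Union>n. tensor_M (T_max r) n). bounded_op c \<and> op_norm (mat b - c) < e"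
   by (metis UN_I UNIV_I bounded_mat mat_minus nrm.rep_eq)
 qed
 thus ?thesis unfolding inTK_def tensor_K_def op_closure_def by simp
qed

lemma inTK_approx:
 assumes "\<And>e. e > 0 ==> \<exists>c. inTK r c \<and> nrm (b - c) < e"
 shows "inTK r b"
 unfolding inTK_iff
proof (intro allI impI)
 fix e :: real assume "e > 0"
 then obtain c where c: "inTK r c" "nrm (b - c) < e / 2" using assms[of "e / 2"] by auto
 then obtain d n where d: "mat d \<in> tensor_M (T_max r) n" "nrm (c - d) < e / 2"
  using \<open>e > 0\<close> unfolding inTK_iff by (meson half_gt_zero)
 have "nrm (b - d) \<le> nrm (b - c) + nrm (c - d)" using nrm_add[of "b - c" "c - d"] by simp
 thus "\<exists>c n. mat c \<in> tensor_M (T_max r) n \<and> nrm (b - c) < e" using c d by (intro exI[of _ d] exI[of _ n]) auto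
qed

lemma inTK_tensor_M: "mat b \<in> tensor_M (T_max r) n ==> inTK r b"
 unfolding inTK_iff by (intro allI impI exI[of _ b] exI[of _ n]) simp

lemma inTK_spread:
 assumes "r \<ge> 1" "inTK r b"
 obtains W where "UT r W" "b = spread r W" "W = cp r {1..r} b"
 using good_spread[OF assms(1) tensor_K_good[OF assms(2)[unfolded inTK_def]]] by blast

lemma tensor_M_add:
 assumes "r \<ge> 1" "mat a \<in> tensor_M (T_max r) n" "mat b \<in> tensor_M (T_max r) n"
 shows "mat (a + b) \<in> tensor_M (T_max r) n" "mat (a * b) \<in> tensor_M (T_max r) n"
  "mat (sc c * a) \<in> tensor_M (T_max r) n"
proof -
 obtain W where W: "UT r W" "a = spread r W" "Nn n * W * Nn n = W" using tensor_M_spread[OF assms(1,2)] .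
 obtain W' where W': "UT r W'" "b = spread r W'" "Nn n * W' * Nn n = W'" using tensor_M_spread[OF assms(1,3)] .
 show "mat (a + b) \<in> tensor_M (T_max r) n"
  unfolding W(2) W'(2) spread_add[symmetric]
  by (rule spread_in_tensor_M) (use W W' in \<open>simp_all add: UT_add distrib_left distrib_right\<close>)
 have 1: "Nn n * W = W" using W(3) by (metis Nn_idem(1) mult.assoc order_refl)
 have 2: "W' * Nn n = W'" using W'(3) by (metis Nn_idem(1) mult.assoc order_refl)
 show "mat (a * b) \<in> tensor_M (T_max r) n"
  unfolding W(2) W'(2) spread_mult[OF W(1) W'(1)]
  by (rule spread_in_tensor_M) (use W W' 1 2 in \<open>simp_all add: UT_mult flip: mult.assoc, simp add: mult.assoc\<close>)
 show "mat (sc c * a) \<in> tensor_M (T_max r) n"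
  unfolding W(2) spread_sc[symmetric]
  by (rule spread_in_tensor_M) (use W in \<open>simp_all add: UT_sc mult.assoc sc_left_commute[of "Nn n" c]\<close>)
qed

text \<open>Approximants of two elements may have different sizes; since \<open>tensor_M\<close>
  grows with n, both fit into the larger one, where they can be added and multiplied.\<close>

lemma inTK_pair:
 assumes "inTK r a" "inTK r b" "e > 0"
 obtains c d n where "mat c \<in> tensor_M (T_max r) n" "mat d \<in> tensor_M (T_max r) n"
  "nrm (a - c) < e" "nrm (b - d) < e"
proof -
 obtain c n where c: "mat c \<in> tensor_M (T_max r) n" "nrm (a - c) < e"
  using assms unfolding inTK_iff by blast
 obtain d m where d: "mat d \<in> tensor_M (T_max r) m" "nrm (b - d) < e"
  using assms unfolding inTK_iff by blast
 show ?thesis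
 proof (rule that)
  have "n \<le> max n m" "m \<le> max n m" by simp_all
  thus "mat c \<in> tensor_M (T_max r) (max n m)" "mat d \<in> tensor_M (T_max r) (max n m)"
   using c(1) d(1) tensor_M_mono[OF _ zero_T_max] by blast+
 qed (rule c(2) d(2))+
qed

lemma inTK_add:
 assumes "r \<ge> 1" "inTK r a" "inTK r b"
 shows "inTK r (a + b)"
proof (rule inTK_approx)
 fix e :: real assume "e > 0"
 hence "e / 2 > 0" by simp
 from inTK_pair[OF assms(2,3) this] obtain c d n where cd: "mat c \<in> tensor_M (T_max r) n"
  "mat d \<in> tensor_M (T_max r) n" "nrm (a - c) < e / 2" "nrm (b - d) < e / 2" .
 have "nrm (a + b - (c + d)) \<le> nrm (a - c) + nrm (b - d)"
  using nrm_add[of "a - c" "b - d"] by (simp add: algebra_simps)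
 thus "\<exists>c. inTK r c \<and> nrm (a + b - c) < e"
  using cd inTK_tensor_M[OF tensor_M_add(1)[OF assms(1) cd(1,2)]] by (intro exI[of _ "c + d"]) auto
qed

lemma inTK_mult:
 assumes "r \<ge> 1" "inTK r a" "inTK r b"
 shows "inTK r (a * b)"
proof (rule inTK_approx)
 fix e :: real assume e: "e > 0"
 define K where "K = nrm a + nrm b + 1"
 have K: "K \<ge> 1" by (simp add: K_def)
 \<comment> \<open>With errors below d \<le> 1 the product changes by at most d (|a| + |b| + 1) = d
   K, and the second entry of the minimum makes this at most e / 2.\<close>
 define d where "d = min 1 (e / (2 * K))"
 have d: "d > 0" "d \<le> 1" "d * K < e"
 proof -
  show "d > 0" "d \<le> 1" using e K by (auto simp: d_def)
  have "d * K \<le> e / (2 * K) * K" using K by (intro mult_right_mono) (auto simp: d_def)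
  also have "... = e / 2" using K by simp
  finally show "d * K < e" using e by simp
 qed
 from inTK_pair[OF assms(2,3) d(1)] obtain x y n where xy: "mat x \<in> tensor_M (T_max r) n"
  "mat y \<in> tensor_M (T_max r) n" "nrm (a - x) < d" "nrm (b - y) < d" .
 have "a * b - x * y = a * (b - y) + (a - x) * b - (a - x) * (b - y)" by (simp add: algebra_simps)
 hence "nrm (a * b - x * y) \<le> nrm a * nrm (b - y) + nrm (a - x) * nrm b + nrm (a - x) * nrm (b - y)"
  using nrm_add[of "a * (b - y) + (a - x) * b" "- ((a - x) * (b - y))"] nrm_add[of "a * (b - y)" "(a - x) * b"]
   nrm_mult[of a "b - y"] nrm_mult[of "a - x" b] nrm_mult[of "a - x" "b - y"] by simp
 also have "... \<le> nrm a * d + d * nrm b + d * 1"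
  using xy d by (intro add_mono mult_mono) auto
 also have "... = d * K" by (simp add: K_def algebra_simps)
 finally have "nrm (a * b - x * y) < e" using d(3) by simp
 thus "\<exists>c. inTK r c \<and> nrm (a * b - c) < e"
  using inTK_tensor_M[OF tensor_M_add(2)[OF assms(1) xy(1,2)]] by blast
qed

lemma inTK_sc:
 assumes "r \<ge> 1" "inTK r a"
 shows "inTK r (sc c * a)"
proof (rule inTK_approx)
 fix e :: real assume e: "e > 0"
 \<comment> \<open>The added 1 takes care of c = 0.\<close>
 hence "e / (cmod c + 1) > 0" by (simp add: add_nonneg_pos)
 then obtain x n where x: "mat x \<in> tensor_M (T_max r) n" "nrm (a - x) < e / (cmod c + 1)"
  using assms(2) unfolding inTK_iff by blast
 have "nrm (sc c * a - sc c * x) \<le> cmod c * nrm (a - x)"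
  using nrm_sc_le[of c "a - x"] by (simp add: right_diff_distrib)
 also have "... \<le> cmod c * (e / (cmod c + 1))" using x(2) by (intro mult_left_mono) auto
 also have "... < e"
 proof -
  have p: "0 < cmod c + 1" by (simp add: add_nonneg_pos)
  show ?thesis
   by (subst times_divide_eq_right, subst pos_divide_less_eq[OF p]) (use e in \<open>simp add: algebra_simps\<close>)
 qed
 finally show "\<exists>d. inTK r d \<and> nrm (sc c * a - d) < e"
  using inTK_tensor_M[OF tensor_M_add(3)[OF assms(1) x(1,1)]] by blast
qed

lemma inTK_0: "inTK r 0"
 by (rule inTK_tensor_M[of _ _ 0]) (simp add: tensor_M_def zero_bop.rep_eq block_def zero_fun_def)

lemma inTK_sum: "r \<ge> 1 ==> (\<And>x. x \<in> A ==> inTK r (f x)) ==> inTK r (\<Sum>x\<in>A. f x)"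
 by (induction A rule: infinite_finite_induct) (auto simp: inTK_0 inTK_add)

lemma nrm_vec:
 assumes "x * eu z = x"
 shows "nrm x = ell2_norm (\<lambda>k. mat x k z)"
proof -
 let ?n = "ell2_norm (\<lambda>k. mat x k z)"
 have "adj x * x = sc (of_real (?n\<^sup>2)) * eu z"
  using vec_inner[OF assms assms] by (simp add: adj_self_diag)
 hence "(nrm x)\<^sup>2 \<le> ?n\<^sup>2"
  using nrm_cstar_eq[of x] nrm_sc_le[of "of_real (?n\<^sup>2)" "eu z"] by (simp add: norm_power)
 hence "nrm x \<le> ?n" using ell2_norm_nonneg by (rule power2_le_imp_le)
 moreover have "?n \<le> nrm x" by (rule bnd_col(2)[OF bnd_nrm])
 ultimately show ?thesis by simp
qed

text \<open>The norm of a single-column operator is that of its column, which has small tails; n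
  only has to exceed the numbers of the copies met by a finite set that carries the bulk of the
  column.\<close>

lemma Nn_vec_approx:
 fixes x :: "bix bop"
 assumes x: "x * eu z = x" and e: "e > 0"
 obtains n where "nrm (x - Nn n * x) \<le> e"
proof -
 obtain L where L: "finite L" "(\<lambda>i. if i \<in> L then 0 else mat x i z) \<in> ell2"
  "ell2_norm (\<lambda>i. if i \<in> L then 0 else mat x i z) \<le> e"
  by (rule ell2_tail[OF bnd_col(1)[OF bnd_nrm] e])
 define n where "n = Suc (Max (insert 0 (snd ` L)))"
 have n: "snd i < n" if "i \<in> L" for i
  unfolding n_def using L(1) that by (intro le_imp_less_Suc Max_ge) auto
 have v: "(x - Nn n * x) * eu z = x - Nn n * x" using x by (simp add: left_diff_distrib mult.assoc)
 have entry: "mat (x - Nn n * x) i z = (if snd i < n then 0 else mat x i z)" for i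
  using Nn_mult_entry[of n x "fst i" "snd i" z] by (simp add: mat_minus)
 have "l2 (\<lambda>i. mat (x - Nn n * x) i z) F \<le> e" if "finite F" for F
 proof -
  have "l2 (\<lambda>i. mat (x - Nn n * x) i z) F \<le> l2 (\<lambda>i. if i \<in> L then 0 else mat x i z) F"
   unfolding entry using n by (intro L2_set_mono) auto
  also have "... \<le> e" using ell2_l2_le[OF L(2) that] L(3) by simp
  finally show ?thesis .
 qed
 hence "nrm (x - Nn n * x) \<le> e" unfolding nrm_vec[OF v] by (rule l2_bounded_ell2(2))
 thus ?thesis by (rule that)
qed

lemma Nn_Pk: "Nn n * Pk r k = Pk r k * Nn n"
proof (rule bix_eqI)
 fix I l p J m q
 show "mat (Nn n * Pk r k) ((I, l), p) ((J, m), q) = mat (Pk r k * Nn n) ((I, l), p) ((J, m), q)"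
  unfolding Nn_mult_entry mult_Nn_entry Pk_entry by (cases "p = q") simp_all
qed

lemma UT_rank_one:
 assumes "Pk r k * x = x" "Pk r l * y = y" "k \<in> {1..r}" "l \<in> {1..r}" "k \<le> l"
 shows "UT r (x * adj y)"
 unfolding UT_def
proof (intro conjI ballI impI)
 have y: "adj y * Pk r l = adj y" using arg_cong[OF assms(2), of adj] by simp
 have "Pk.pI r {1..r} * Pk r k = Pk r k" "Pk r l * Pk.pI r {1..r} = Pk r l"
  using Pk.pI_P[OF assms(3) subset_refl] Pk.P_pI[OF assms(4) subset_refl] assms by auto
 hence "Pk.pI r {1..r} * x = x" "adj y * Pk.pI r {1..r} = adj y"
  using assms(1) y by (metis mult.assoc)+
 thus "Pk.pI r {1..r} * (x * adj y) = x * adj y" "x * adj y * Pk.pI r {1..r} = x * adj y"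
  by (simp_all add: mult.assoc) (simp flip: mult.assoc)
 fix m n assume mn: "m \<in> {1..r}" "n \<in> {1..r}" "n < m"
 hence "Pk r m * Pk r k = 0 \<or> Pk r l * Pk r n = 0"
  using Pk.P_orth[OF mn(1) assms(3)] Pk.P_orth[OF assms(4) mn(2)] assms(5) by auto
 hence "Pk r m * x = 0 \<or> adj y * Pk r n = 0" using assms(1) y by (metis mult.assoc mult_zero_left mult_zero_right)
 thus "Pk r m * (x * adj y) * Pk r n = 0" by (auto simp: mult.assoc) (simp flip: mult.assoc)
qed

text \<open>Truncation by \<open>Nn\<close> commutes with the blocks, so truncated vectors stay in
  their blocks and give a triangular rank one operator of finite size. These approximate the given
  operator, and \<open>spread\<close> is continuous.\<close>

lemma inTK_rank_one:
 assumes r: "r \<ge> 1" and x: "x * eu z = x" "Pk r k * x = x" and y: "y * eu z = y" "Pk r l * y = y"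
  and kl: "k \<in> {1..r}" "l \<in> {1..r}" "k \<le> l"
 shows "inTK r (spread r (x * adj y))"
proof (rule inTK_approx)
 fix e :: real assume e: "e > 0"
 \<comment> \<open>\<open>C - 1\<close> is the factor produced by the norm estimate and by
   \<open>nrm_spread\<close>; the added 1 keeps the divisor positive.\<close>
 define C where "C = real (card (intervals r)) * (nrm x + nrm y) + 1"
 have C: "C \<ge> 1" by (simp add: C_def)
 obtain n where n: "nrm (x - Nn n * x) \<le> e / (2 * C)"
  using Nn_vec_approx[OF x(1), of "e / (2 * C)"] e C by auto
 obtain m where m: "nrm (y - Nn m * y) \<le> e / (2 * C)"
  using Nn_vec_approx[OF y(1), of "e / (2 * C)"] e C by auto
 define x' where "x' = Nn n * x"
 define y' where "y' = Nn m * y"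
 have P: "Pk r k * x' = x'" "Pk r l * y' = y'"
  using x(2) y(2) Nn_Pk unfolding x'_def y'_def by (metis mult.assoc)+
 define M where "M = max n m"
 have "Nn M * (x' * adj y') * Nn M = x' * adj y'"
 proof -
  have "Nn M * x' = x'" using Nn_idem(2)[of n M] by (simp add: x'_def M_def flip: mult.assoc)
  moreover have "Nn M * y' = y'" using Nn_idem(2)[of m M] by (simp add: y'_def M_def flip: mult.assoc)
  hence "adj y' * Nn M = adj y'" by (metis adj_mult adj_Nn)
  ultimately show ?thesis by (simp add: mult.assoc) (simp flip: mult.assoc)
 qed
 from spread_in_tensor_M[OF UT_rank_one[OF P kl] this]
 have in': "inTK r (spread r (x' * adj y'))" by (rule inTK_tensor_M)
 have ny': "nrm y' \<le> nrm y"
  using nrm_mult[of "Nn m" y] mult_right_mono[OF nrm_Nn[of m] nrm_nonneg[of y]] by (simp add: y'_def)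
 have "x * adj y - x' * adj y' = x * adj (y - y') + (x - x') * adj y'" by (simp add: algebra_simps)
 hence "nrm (x * adj y - x' * adj y') \<le> nrm x * nrm (y - y') + nrm (x - x') * nrm y'"
  using nrm_add[of "x * adj (y - y')" "(x - x') * adj y'"] nrm_mult[of x "adj (y - y')"]
   nrm_mult[of "x - x'" "adj y'"] by (simp only: nrm_adj)
 also have "... \<le> nrm x * (e / (2 * C)) + e / (2 * C) * nrm y"
  using n m ny' e C by (intro add_mono mult_mono) (auto simp: x'_def y'_def)
 also have "... = (nrm x + nrm y) * (e / (2 * C))" by (simp add: algebra_simps add_divide_distrib)
 finally have a: "nrm (x * adj y - x' * adj y') \<le> (nrm x + nrm y) * (e / (2 * C))" .
 have "nrm (spread r (x * adj y) - spread r (x' * adj y'))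
   \<le> card (intervals r) * nrm (x * adj y - x' * adj y')"
  using nrm_spread[of r "x * adj y - x' * adj y'"] by (simp add: spread_diff)
 also have "... \<le> card (intervals r) * ((nrm x + nrm y) * (e / (2 * C)))"
  using a by (intro mult_left_mono) auto
 also have "... = (C - 1) * (e / (2 * C))" by (simp add: C_def)
 also have "... \<le> C * (e / (2 * C))" using e C by (intro mult_right_mono) auto
 also have "... < e" using e C by simp
 finally show "\<exists>c. inTK r c \<and> nrm (spread r (x * adj y) - c) < e" using in' by blast
qed

section \<open>Matrix units and boundedness of the matrix algebras\<close>

definition erel :: "nat => nat => nat => ((nat set \<times> nat) \<times> (nat set \<times> nat)) set" where
 "erel r i j = {((I, i), (I, j)) | I. I \<in> intervals r \<and> i \<in> I \<and> j \<in> I}"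

definition eT :: "nat => nat => nat => (nat set \<times> nat) cmat" where
 "eT r i j = rmat (erel r i j)"

lemma pinj_erel: "pinj (erel r i j)"
 unfolding pinj_def single_valued_def erel_def by blast

lemma bounded_eT: "bounded_op (eT r i j)"
 unfolding eT_def by (rule bounded_op_rmat[OF pinj_erel])

text \<open>The composite runs over the intervals containing i, j and k. By convexity an interval
  that contains i and k contains j, so none is lost.\<close>

lemma erel_O: "i \<le> j ==> j \<le> k ==> erel r i j O erel r j k = erel r i k"
 unfolding erel_def using intervals_convex by blast

lemma erel_O0: "j \<noteq> k ==> erel r i j O erel r k l = {}"
 unfolding erel_def by blast

lemma eT_mul: "i \<le> j ==> j \<le> k ==> eT r i j \<bullet>\<bullet> eT r j k = eT r i k"
 unfolding eT_def by (simp add: rmat_mul pinj_erel erel_O)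

lemma eT_mul0: "j \<noteq> k ==> eT r i j \<bullet>\<bullet> eT r k l = 0"
 unfolding eT_def by (simp add: rmat_mul pinj_erel erel_O0 rmat_empty)

lemma eT_adj: "mat_adj (eT r i i) = eT r i i"
proof -
 have "(erel r i i)\<inverse> = erel r i i" unfolding erel_def by blast
 thus ?thesis unfolding eT_def by (simp add: rmat_adj)
qed

lemma eT_pi: "eT r i j \<bullet>\<bullet> mat_adj (eT r i j) \<bullet>\<bullet> eT r i j = eT r i j"
proof -
 have "(erel r i j O (erel r i j)\<inverse>) O erel r i j = erel r i j" unfolding erel_def by blast
 thus ?thesis
  unfolding eT_def by (simp add: rmat_adj rmat_mul pinj_erel pinj_converse pinj_O)
qed

lemma eT_entry: "eT r i j (I, k) (J, l) = (if I = J \<and> I \<in> intervals r \<and> k = i \<and> l = j \<and> i \<in> I \<and> j \<in> I then 1 else 0)"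
proof -
 have "((I, k), (J, l)) \<in> erel r i j \<longleftrightarrow> I = J \<and> I \<in> intervals r \<and> k = i \<and> l = j \<and> i \<in> I \<and> j \<in> I"
  unfolding erel_def by blast
 thus ?thesis unfolding eT_def rmat_def by metis
qed

lemma eT_top_entry: "i \<in> {1..r} ==> j \<in> {1..r} ==>
  eT r i j ({1..r}, k) ({1..r}, l) = (if k = i \<and> l = j then 1 else 0)"
proof -
 assume a: "i \<in> {1..r}" "j \<in> {1..r}"
 hence "{1..r} \<in> intervals r" by (intro top_interval) simp
 thus ?thesis unfolding eT_entry using a by metis
qed

lemma eT_in: "1 \<le> i ==> i \<le> j ==> j \<le> r ==> eT r i j \<in> T_max r"
proof (rule T_maxI)
 assume ij: "1 \<le> i" "i \<le> j" "j \<le> r"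
 hence m: "i \<in> {1..r}" "j \<in> {1..r}" by auto
 show "eT r i j (I, k) (J, l) = (if I = J \<and> I \<in> intervals r \<and> k \<in> I \<and> l \<in> I then eT r i j ({1..r}, k) ({1..r}, l) else 0)" for I k J l
  unfolding eT_top_entry[OF m] unfolding eT_entry by auto
 fix k l assume "eT r i j ({1..r}, k) ({1..r}, l) \<noteq> 0"
 hence "k = i \<and> l = j" unfolding eT_top_entry[OF m] by metis
 thus "k \<le> l \<and> k \<in> {1..r} \<and> l \<in> {1..r}" using m ij by simp
qed

lemma sum_cmat_apply: "(\<Sum>x\<in>A. f x) i j = (\<Sum>x\<in>A. (f x :: 'i cmat) i j)"
 by (induction A rule: infinite_finite_induct) simp_all

lemma T_max_expand:
 assumes "a \<in> T_max r"
 shows "a = (\<Sum>i\<in>{1..r}. \<Sum>j\<in>{i..r}. mat_scale (a ({1..r}, i) ({1..r}, j)) (eT r i j))"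
proof (intro ext)
 fix x y :: "nat set \<times> nat"
 obtain I k J l where xy: "x = (I, k)" "y = (J, l)" by (metis surj_pair)
 let ?c = "I = J \<and> I \<in> intervals r \<and> k \<in> I \<and> l \<in> I"
 let ?t = "\<lambda>k l. a ({1..r}, k) ({1..r}, l)"
 have "(\<Sum>i\<in>{1..r}. \<Sum>j\<in>{i..r}. mat_scale (?t i j) (eT r i j)) x y
   = (\<Sum>i\<in>{1..r}. \<Sum>j\<in>{i..r}. if j = l then if i = k then if ?c then ?t k l else 0 else 0 else 0)"
  unfolding sum_cmat_apply mat_scale_def xy eT_entry
  by (intro sum.cong refl) auto
 also have "... = (\<Sum>i\<in>{1..r}. if i = k then if l \<in> {k..r} then if ?c then ?t k l else 0 else 0 else 0)"
  by (intro sum.cong refl) (simp only: sum.delta finite_atLeastAtMost, auto)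
 also have "... = (if k \<in> {1..r} then if l \<in> {k..r} then if ?c then ?t k l else 0 else 0 else 0)"
  by (simp only: sum.delta finite_atLeastAtMost)
 also have "... = (if ?c then ?t k l else 0)"
 proof (cases "?t k l = 0")
  case False
  hence "k \<in> {1..r} \<and> l \<in> {k..r}" using T_max_entries(2)[OF assms False] by simp
  thus ?thesis by simp
 qed simp
 also have "... = a x y" unfolding xy by (rule T_max_entries(1)[OF assms, symmetric])
 finally show "a x y = (\<Sum>i\<in>{1..r}. \<Sum>j\<in>{i..r}. mat_scale (?t i j) (eT r i j)) x y" by simp
qed

lemma bounded_op_sum: "(\<And>x. x \<in> A ==> bounded_op (f x)) ==> bounded_op (\<Sum>x\<in>A. f x)"
 by (induction A rule: infinite_finite_induct) (auto simp: bounded_op_0 bounded_op_add)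

lemma T_max_bounded: "T_max r \<subseteq> Collect bounded_op"
proof
 fix a assume "a \<in> T_max r"
 have "bounded_op (\<Sum>i\<in>{1..r}. \<Sum>j\<in>{i..r}. mat_scale (a ({1..r}, i) ({1..r}, j)) (eT r i j))"
  by (intro bounded_op_sum bounded_op_scale bounded_eT)
 thus "a \<in> Collect bounded_op" using T_max_expand[OF \<open>a \<in> T_max r\<close>] by simp
qed

lemma cstar_algebraD:
 assumes "cstar_algebra B"
 shows "a \<in> B ==> bounded_op a" "0 \<in> B" "a \<in> B ==> b \<in> B ==> a + b \<in> B"
  "a \<in> B ==> b \<in> B ==> a \<bullet>\<bullet> b \<in> B" "a \<in> B ==> mat_scale c a \<in> B" "a \<in> B ==> mat_adj a \<in> B"
  "a \<in> op_closure B ==> a \<in> B"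
 using assms unfolding cstar_algebra_def by blast+

text \<open>Finitely many blocks are nonzero and each is a combination of matrix units, which are
  0/1 matrices of partial injections.\<close>

lemma tensor_M_bounded: "b \<in> tensor_M (T_max r) n ==> bounded_op b"
proof -
 assume b: "b \<in> tensor_M (T_max r) n"
 \<comment> \<open>\<open>sh p q c\<close> is the matrix c placed in the block (p, q).\<close>
 define sh where "sh p q c = (\<lambda>(x, p') (y, q'). if p' = p \<and> q' = q then c x y else 0 :: complex)"
  for p q :: nat and c :: "(nat set \<times> nat) cmat"
 have bsh: "bounded_op (sh p q (eT r i j))" for p q i j
 proof -
  have "pinj {((x, p), (y, q)) | x y. (x, y) \<in> erel r i j}"
   unfolding pinj_def single_valued_def erel_def by blast
  moreover have "sh p q (eT r i j) = rmat {((x, p), (y, q)) | x y. (x, y) \<in> erel r i j}"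
   unfolding sh_def rmat_def eT_def by (intro ext) auto
  ultimately show ?thesis by (simp only: bounded_op_rmat)
 qed
 have e: "b = (\<Sum>p<n. \<Sum>q<n. sh p q (block b p q))"
 proof (intro ext)
  fix u v :: bix
  obtain x p y q where uv: "u = (x, p)" "v = (y, q)" by (metis surj_pair)
  have "(\<Sum>p<n. \<Sum>q<n. sh p q (block b p q)) u v
    = (\<Sum>p'<n. \<Sum>q'<n. if q' = q then if p' = p then b (x, p) (y, q) else 0 else 0)"
   unfolding sum_cmat_apply uv sh_def block_def by (intro sum.cong refl) auto
  also have "... = (if p < n \<and> q < n then b (x, p) (y, q) else 0)"
   by (cases "p < n"; cases "q < n") simp_all
  also have "... = b u v" using tensor_M_good(2)[OF b, of x p y q] unfolding uv by metis
  finally show "b u v = (\<Sum>p<n. \<Sum>q<n. sh p q (block b p q)) u v" by simp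
 qed
 have blk: "block b p q \<in> T_max r" for p q
  using b zero_T_max[of r] unfolding tensor_M_def mem_Collect_eq by metis
 have shs: "sh p q (\<Sum>x\<in>A. f x) = (\<Sum>x\<in>A. sh p q (f x))" for p q and A :: "nat set" and f
 proof (induction A rule: infinite_finite_induct)
  case (insert x A)
  have "sh p q (f x + c) = sh p q (f x) + sh p q c" for c
   unfolding sh_def by (intro ext) (auto split: prod.splits)
  thus ?case unfolding sum.insert[OF insert.hyps(1,2)] insert.IH[symmetric] .
 qed (auto simp: sh_def intro!: ext split: prod.splits)
 have shc: "sh p q (mat_scale c a) = mat_scale c (sh p q a)" for p q c a
  unfolding sh_def mat_scale_def by (intro ext) (auto split: prod.splits)
 have "bounded_op (sh p q (block b p q))" for p q
  by (subst T_max_expand[OF blk]) (unfold shs shc, intro bounded_op_sum bounded_op_scale bsh)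
 thus "bounded_op b" by (subst e) (intro bounded_op_sum)
qed

lemma tensor_M_subset_K: "tensor_M (T_max r) n \<subseteq> tensor_K (T_max r)"
proof
 fix b assume b: "b \<in> tensor_M (T_max r) n"
 have "mat (Bop b) = b" using tensor_M_bounded[OF b] by (rule mat_Bop)
 thus "b \<in> tensor_K (T_max r)" using inTK_tensor_M[of "Bop b" r n] b unfolding inTK_def by simp
qed

text \<open>Results on maps into the stable algebra become applicable to the maps of finite size
  that make up the semiring.\<close>

lemma maps_fin_subset_K: "maps_fin (T_max r) \<subseteq> maps_K (T_max r)"
proof
 fix \<phi> assume "\<phi> \<in> maps_fin (T_max r)"
 then obtain n where "star_extendible (T_max r) (tensor_M (T_max r) n) \<phi>"
  unfolding maps_fin_def maps_M_def by blast
 then obtain \<pi> where \<pi>: "\<phi> ` T_max r \<subseteq> tensor_M (T_max r) n"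
  "star_hom (cstar (T_max r)) (cstar (tensor_M (T_max r) n)) \<pi>" "\<forall>a\<in>T_max r. \<pi> a = \<phi> a"
  unfolding star_extendible_def by blast
 have "star_hom (cstar (T_max r)) (cstar (tensor_K (T_max r))) \<pi>"
  using \<pi>(2) order_trans[OF _ cstar_mono[OF tensor_M_subset_K]] unfolding star_hom_def by (elim conjE, intro conjI)
 thus "\<phi> \<in> maps_K (T_max r)"
  using \<pi>(1,3) tensor_M_subset_K[of r n] unfolding maps_K_def star_extendible_def mem_Collect_eq by (meson order_trans)
qed

section \<open>Star-extendible maps are given by frames\<close>

text \<open>An element of \<open>T_max r\<close> is determined by its block at the largest interval,
  so only those entries serve as coefficients of the matrix units.\<close>

definition fmap :: "nat => 's set => ('s => nat \<rightharpoonup> nat) => ('s => nat => bix bop) => (nat set \<times> nat) cmat => bix bop" where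
 "fmap r S h \<xi> a = spread r (\<Sum>i\<in>{1..r}. \<Sum>j\<in>{1..r}. sc (a ({1..r}, i) ({1..r}, j)) * frame_op S h \<xi> i j)"

definition has_frame :: "nat => bix => (nat set \<times> nat) stable_map => 's set => ('s => nat \<rightharpoonup> nat) => ('s => nat => bix bop) => bool" where
 "has_frame r z \<phi> S h \<xi> \<longleftrightarrow> is_frame r (Pk r) z S h \<xi> \<and> (\<forall>a\<in>T_max r. \<phi> a = mat (fmap r S h \<xi> a))"

lemma fmap_eT:
 assumes "i \<in> {1..r}" "j \<in> {1..r}"
 shows "fmap r S h \<xi> (eT r i j) = spread r (frame_op S h \<xi> i j)"
proof -
 have "(\<Sum>k\<in>{1..r}. \<Sum>l\<in>{1..r}. sc (eT r i j ({1..r}, k) ({1..r}, l)) * frame_op S h \<xi> k l)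
   = (\<Sum>k\<in>{1..r}. \<Sum>l\<in>{1..r}. if l = j then if k = i then frame_op S h \<xi> i j else 0 else 0)"
  unfolding eT_top_entry[OF assms] by (intro sum.cong refl) auto
 also have "... = frame_op S h \<xi> i j" using assms by simp
 finally show ?thesis by (simp add: fmap_def)
qed

text \<open>Gaussian elimination. A row e0 with a nonzero coefficient at the last unknown removes
  this unknown from the other rows; if there is no such row, the last unit vector is a solution.
  Both the finiteness of fixed spaces and the comparison of ranks rest on this fact.\<close>

lemma solve_underdetermined:
 fixes A :: "nat => nat => complex"
 assumes "d < m"
 shows "\<exists>c. (\<exists>t<m. c t \<noteq> 0) \<and> (\<forall>e<d. (\<Sum>t<m. A e t * c t) = 0)"
 using assms
proof (induction d arbitrary: m A)
 case 0
 thus ?case by (intro exI[of _ "\<lambda>_. 1"]) auto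
next
 case (Suc d)
 then obtain m' where m: "m = Suc m'" by (cases m) auto
 show ?case
 proof (cases "\<exists>e\<le>d. A e m' \<noteq> 0")
  case False
  have "(\<Sum>t<m. A e t * (if t = m' then 1 else 0)) = 0" if "e < Suc d" for e
   using False that by (intro sum.neutral) auto
  thus ?thesis by (intro exI[of _ "\<lambda>t. if t = m' then 1 else 0"]) (auto simp: m)
 next
  case True
  then obtain e0 where e0: "e0 \<le> d" "A e0 m' \<noteq> 0" by blast
  \<comment> \<open>Enumerates the d rows other than the pivot row e0.\<close>
  define \<sigma> where "\<sigma> e = (if e < e0 then e else Suc e)" for e
  define B where "B e t = A (\<sigma> e) t - A (\<sigma> e) m' / A e0 m' * A e0 t" for e t
  from Suc.IH[of m' B] Suc.prems m obtain c where c: "\<exists>t<m'. c t \<noteq> 0" "\<And>e. e < d ==> (\<Sum>t<m'. B e t * c t) = 0"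
   by auto
  define c' where "c' t = (if t < m' then c t else - (\<Sum>t<m'. A e0 t * c t) / A e0 m')" for t
  have s: "(\<Sum>t<m. A e t * c' t) = (\<Sum>t<m'. A e t * c t) - A e m' * (\<Sum>t<m'. A e0 t * c t) / A e0 m'" for e
   unfolding m sum.lessThan_Suc by (simp add: c'_def)
  have "(\<Sum>t<m. A e t * c' t) = 0" if "e < Suc d" for e
  proof (cases "e = e0")
   case True
   thus ?thesis using e0 by (simp add: s)
  next
   case False
   define e' where "e' = (if e < e0 then e else e - 1)"
   have e': "\<sigma> e' = e" "e' < d" using False that e0 by (auto simp: \<sigma>_def e'_def)
   have "(\<Sum>t<m'. B e' t * c t) = (\<Sum>t<m. A e t * c' t)"
    unfolding s B_def e' by (simp add: left_diff_distrib sum_subtractf sum_distrib_left mult.assoc sum_divide_distrib)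
   thus ?thesis using c(2)[OF e'(2)] by simp
  qed
  moreover have "\<exists>t<m. c' t \<noteq> 0" using c(1) m by (auto simp: c'_def)
  ultimately show ?thesis by blast
 qed
qed

lemma orthonormal_combination:
 assumes "orthonormal z m x" "\<exists>t<m. c t \<noteq> 0"
 shows "(\<Sum>t<m. sc (c t) * x t) \<noteq> 0" "(\<Sum>t<m. sc (c t) * x t) * eu z = (\<Sum>t<m. sc (c t) * x t)"
proof -
 show "(\<Sum>t<m. sc (c t) * x t) * eu z = (\<Sum>t<m. sc (c t) * x t)"
  unfolding sum_distrib_right using assms(1) by (intro sum.cong refl) (simp add: orthonormal_def mult.assoc)
 obtain t where t: "t < m" "c t \<noteq> 0" using assms(2) by blast
 have "adj (x t) * (\<Sum>s<m. sc (c s) * x s) = (\<Sum>s<m. if s = t then sc (c t) * eu z else 0)"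
  unfolding sum_distrib_left
  using assms(1) t by (intro sum.cong refl) (auto simp: orthonormal_def sc_left_commute[of "adj (x t)"])
 also have "... = sc (c t) * eu z" using t by simp
 finally have e: "adj (x t) * (\<Sum>s<m. sc (c s) * x s) = sc (c t) * eu z" .
 show "(\<Sum>t<m. sc (c t) * x t) \<noteq> 0"
 proof
  assume "(\<Sum>t<m. sc (c t) * x t) = 0"
  hence "sc (c t) * eu z = 0" using e by simp
  hence "mat (sc (c t) * eu z) z z = 0" by (simp add: zero_bop.rep_eq)
  thus False using t by (simp add: sc_mult_entry eu_def rl_entry pinj_single)
 qed
qed

text \<open>Here compactness enters: U is at distance less than 1 from an operator B whose nonzero
  columns are indexed by the finite set F. More than \<open>card F\<close> orthonormal fixed vectors
  would have a nontrivial combination y with no coordinates in F; then B y = 0 and y = (U - B) y,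
  which contradicts the norm bound.\<close>

lemma fix_dim_compact:
 assumes "nrm (U - B) < 1" "finite F" "\<And>i j. j \<notin> F ==> mat B i j = 0"
 shows "fix_dim_le z U (card F)"
 unfolding fix_dim_le_def
proof (intro allI impI)
 fix m x assume x: "orthonormal z m x" "\<forall>t<m. U * x t = x t"
 show "m \<le> card F"
 proof (rule ccontr)
  assume "\<not> m \<le> card F"
  hence lt: "card F < m" by simp
  obtain f where f: "bij_betw f {..<card F} F"
   using ex_bij_betw_nat_finite[OF assms(2)] by (metis atLeast0LessThan)
  obtain c where c: "\<exists>t<m. c t \<noteq> 0" "\<And>e. e < card F ==> (\<Sum>t<m. mat (x t) (f e) z * c t) = 0"
   using solve_underdetermined[OF lt, of "\<lambda>e t. mat (x t) (f e) z"] by blast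
  define y where "y = (\<Sum>t<m. sc (c t) * x t)"
  note y = orthonormal_combination[OF x(1) c(1), folded y_def]
  have yF: "mat y i j = 0" if "i \<in> F" for i j
  proof (cases "j = z")
   case True
   have "i \<in> f ` {..<card F}" using that by (simp only: bij_betw_imp_surj_on[OF f])
   then obtain e where e: "e < card F" "i = f e" by blast
   show ?thesis using c(2)[OF e(1)] unfolding True e(2) y_def mat_sum sc_mult_entry by (simp add: mult.commute)
  next
   case False
   have "mat y i j = mat (y * adj (eu z)) i j" using y(2) by simp
   also have "... = 0" unfolding eu_def by (rule mult_adj_rl_entry0[OF pinj_single]) (use False in auto)
   finally show ?thesis .
  qed
  have By: "B * y = 0"
  proof (rule bop_eqI)
   fix i j
   have 0: "mat B i k * mat y k j = 0" for k using assms(3)[of k i] yF[of k j] by (cases "k \<in> F") simp_all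
   have "mat (B * y) i j = (\<Sum>\<^sub>\<infinity>k. mat B i k * mat y k j)" by (simp add: mat_mult mat_mul_def)
   also have "... = 0" unfolding 0 by simp
   finally show "mat (B * y) i j = mat 0 i j" by (simp add: zero_bop.rep_eq)
  qed
  have "U * y = y"
   unfolding y_def sum_distrib_left using x(2)
   by (intro sum.cong refl) (simp add: sc_left_commute[of U])
  hence "(U - B) * y = y" using By by (simp add: left_diff_distrib)
  hence "nrm y \<le> nrm (U - B) * nrm y" using nrm_mult[of "U - B" y] by simp
  moreover have "nrm y > 0" using y(1) by (simp add: less_le)
  ultimately show False using assms(1) by simp
 qed
qed

lemma star_hom_sum:
 assumes "star_hom A B \<pi>" "cstar_algebra A" "\<And>x. x \<in> X ==> f x \<in> A"
 shows "(\<Sum>x\<in>X. f x) \<in> A \<and> \<pi> (\<Sum>x\<in>X. f x) = (\<Sum>x\<in>X. \<pi> (f x))"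
proof -
 have "\<pi> (0 + 0) = \<pi> 0 + \<pi> 0" using assms(1) cstar_algebraD(2)[OF assms(2)] unfolding star_hom_def by blast
 hence 0: "\<pi> 0 = 0" by simp
 show ?thesis using assms(3)
 proof (induction X rule: infinite_finite_induct)
  case (insert x X)
  hence "f x \<in> A" "sum f X \<in> A" "\<pi> (sum f X) = (\<Sum>x\<in>X. \<pi> (f x))" by auto
  hence "f x + sum f X \<in> A" "\<pi> (f x + sum f X) = \<pi> (f x) + \<pi> (sum f X)"
   using cstar_algebraD(3)[OF assms(2)] assms(1) unfolding star_hom_def by auto
  moreover have "(\<Sum>x\<in>insert x X. f x) = f x + sum f X"
   "(\<Sum>x\<in>insert x X. \<pi> (f x)) = \<pi> (f x) + (\<Sum>x\<in>X. \<pi> (f x))"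
   by (rule sum.insert[OF insert.hyps])+
  ultimately show ?case using \<open>\<pi> (sum f X) = _\<close> by metis
 qed (use 0 cstar_algebraD(2)[OF assms(2)] in auto)
qed

text \<open>The star-extension turns the matrix units into partial isometries \<open>V i j\<close>
  with the same products. Their corners \<open>W i j\<close> satisfy the relations of
  \<open>tri\<close>, and a bound on the fixed space of their diagonal sum starts the splitting into
  strings.\<close>

theorem maps_K_frame:
 assumes r: "r \<ge> 1" and \<phi>: "\<phi> \<in> maps_K (T_max r)"
 obtains S :: "nat set" and h \<xi> where "has_frame r z \<phi> S h \<xi>"
proof -
 let ?E = "T_max r" and ?A = "cstar (T_max r)" and ?B = "cstar (tensor_K (T_max r))"
 obtain \<pi> where \<phi>E: "\<phi> ` ?E \<subseteq> TK r" and \<pi>: "star_hom ?A ?B \<pi>" and piext: "\<And>a. a \<in> ?E ==> \<pi> a = \<phi> a"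
  using \<phi> unfolding maps_K_def star_extendible_def by blast
 have A: "cstar_algebra ?A" by (rule cstar_algebra_cstar[OF T_max_bounded])
 have B: "cstar_algebra ?B" by (rule cstar_algebra_cstar) (use tensor_K_bounded in blast)
 have EA: "?E \<subseteq> ?A" by (rule cstar_superset)
 have \<pi>B: "bounded_op (\<pi> a)" if "a \<in> ?A" for a
  using \<pi> cstar_algebraD(1)[OF B] that unfolding star_hom_def by blast
 have \<pi>m: "\<pi> (a \<bullet>\<bullet> b) = \<pi> a \<bullet>\<bullet> \<pi> b" if "a \<in> ?A" "b \<in> ?A" for a b
  using \<pi> that unfolding star_hom_def by blast
 have \<pi>a: "\<pi> (mat_adj a) = mat_adj (\<pi> a)" if "a \<in> ?A" for a
  using \<pi> that unfolding star_hom_def by blast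
 have \<pi>s: "\<pi> (mat_scale c a) = mat_scale c (\<pi> a)" if "a \<in> ?A" for a c
  using \<pi> that unfolding star_hom_def by blast
 have \<pi>0: "\<pi> 0 = 0" using star_hom_sum[OF \<pi> A, of "{}"] by simp
 have eA: "eT r i j \<in> ?A" if "1 \<le> i" "i \<le> j" "j \<le> r" for i j
  using eT_in[OF that] EA by blast
 define V where "V i j = Bop (\<pi> (eT r i j))" for i j
 have mV: "mat (V i j) = \<pi> (eT r i j)" if "1 \<le> i" "i \<le> j" "j \<le> r" for i j
  unfolding V_def by (rule mat_Bop[OF \<pi>B[OF eA[OF that]]])
 have VK: "inTK r (V i j)" if "1 \<le> i" "i \<le> j" "j \<le> r" for i j
  using \<phi>E eT_in[OF that] piext[OF eT_in[OF that]] unfolding inTK_def mV[OF that] by auto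
 define W where "W i j = cp r {1..r} (V i j)" for i j
 have W: "UT r (W i j)" "V i j = spread r (W i j)" if "1 \<le> i" "i \<le> j" "j \<le> r" for i j
  using inTK_spread[OF r VK[OF that]] unfolding W_def by metis+
 have Vm: "V i j * V j k = V i k" if "1 \<le> i" "i \<le> j" "j \<le> k" "k \<le> r" for i j k
 proof (rule bop_eqI)
  have l: "j \<le> r" "1 \<le> j" "i \<le> k" using that by auto
  have "mat (V i j * V j k) = \<pi> (eT r i j) \<bullet>\<bullet> \<pi> (eT r j k)"
   using that l by (simp add: mat_mult mV)
  also have "... = \<pi> (eT r i k)"
   using \<pi>m[OF eA[of i j] eA[of j k]] eT_mul[OF that(2,3)] that l by simp
  finally show "mat (V i j * V j k) x y = mat (V i k) x y" for x y using that l by (simp add: mV)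
 qed
 have V0: "V i j * V k l = 0" if "1 \<le> i" "i \<le> j" "j \<le> r" "1 \<le> k" "k \<le> l" "l \<le> r" "j \<noteq> k" for i j k l
 proof (rule bop_eqI)
  have "mat (V i j * V k l) = \<pi> (eT r i j) \<bullet>\<bullet> \<pi> (eT r k l)"
   using that by (simp add: mat_mult mV)
  also have "... = 0"
   using \<pi>m[OF eA[OF that(1-3)] eA[OF that(4-6)]] eT_mul0[OF that(7)] \<pi>0 by simp
  finally show "mat (V i j * V k l) x y = mat 0 x y" for x y by (simp add: zero_bop.rep_eq)
 qed
 have Vp: "V i j * adj (V i j) * V i j = V i j" if "1 \<le> i" "i \<le> j" "j \<le> r" for i j
 proof (rule bop_eqI)
  note e = eA[OF that]
  have "mat (V i j * adj (V i j) * V i j) = \<pi> (eT r i j \<bullet>\<bullet> mat_adj (eT r i j) \<bullet>\<bullet> eT r i j)"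
   using \<pi>m[OF cstar_algebraD(4)[OF A e cstar_algebraD(6)[OF A e]] e]
    \<pi>m[OF e cstar_algebraD(6)[OF A e]] \<pi>a[OF e]
   by (simp add: mat_mult mat_adj mV[OF that])
  thus "mat (V i j * adj (V i j) * V i j) x y = mat (V i j) x y" for x y
   by (simp add: eT_pi mV[OF that])
 qed
 have Va: "adj (V i i) = V i i" if "1 \<le> i" "i \<le> r" for i
 proof (rule bop_eqI)
  show "mat (adj (V i i)) x y = mat (V i i) x y" for x y
   using \<pi>a[OF eA[of i i]] that by (simp add: mat_adj mV eT_adj)
 qed
 have top: "{1..r} \<in> intervals r" by (rule top_interval[OF r])
 \<comment> \<open>The identity V V^* V = V is read in the summand \<open>I\<close>: as
   \<open>V i j\<close> is block diagonal, the component of the product is the product of the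
   components, and these are interval compressions of \<open>W i j\<close>.\<close>
 have pis: "(Pk.pI r I * W i j * Pk.pI r I) * adj (Pk.pI r I * W i j * Pk.pI r I) * (Pk.pI r I * W i j * Pk.pI r I)
   = Pk.pI r I * W i j * Pk.pI r I" if ij: "1 \<le> i" "i \<le> j" "j \<le> r" and I: "I \<in> intervals r" for i j I
 proof -
  let ?p = "Pk.pI r I" and ?W = "W i j"
  have pp: "?p * ?p = ?p" using intervals_subset[OF I] by (intro Pk.pI_pI) auto
  have tp: "adj (tau r I) * tau r I = ?p" using adj_tau_tau'[OF I, of I] by simp
  have 1: "adj (tau r I) * (spread r ?W * X) = ?p * ?W * adj (tau r I) * X" for X
   by (rule cp_spread_mult[OF I])
  have 2: "adj (tau r I) * (adj (spread r ?W) * X) = ?p * adj ?W * adj (tau r I) * X" for X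
   unfolding spread_adj by (rule cp_spread_mult[OF I])
  have "cp r I (V i j * adj (V i j) * V i j) = ?p * ?W * (?p * adj ?W * (?p * ?W * ?p))"
   unfolding W(2)[OF ij] cp_def by (simp add: mult.assoc 1 2 tp)
  also have "... = (?p * ?W * ?p) * adj (?p * ?W * ?p) * (?p * ?W * ?p)"
   by (simp add: mult.assoc assoc_left[OF pp])
  finally have "cp r I (V i j) = (?p * ?W * ?p) * adj (?p * ?W * ?p) * (?p * ?W * ?p)"
   unfolding Vp[OF ij] .
  moreover have "cp r I (V i j) = ?p * ?W * ?p" unfolding W(2)[OF ij] by (rule cp_spread[OF I])
  ultimately show ?thesis by simp
 qed
 have Iab: "{a..b} \<in> intervals r" if "1 \<le> a" "a \<le> b" "b \<le> r" for a b
  unfolding intervals_def using that by blast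
 have Wtop: "Pk.pI r {1..r} * W i j = W i j" "W i j * Pk.pI r {1..r} = W i j" if "1 \<le> i" "i \<le> j" "j \<le> r" for i j
  using UT_D(1,2)[OF W(1)[OF that]] by auto
 have "tri r (Pk r) W"
 proof (unfold_locales)
  fix i j k assume a: "1 \<le> i" "i \<le> j" "j \<le> k" "k \<le> r"
  hence b: "j \<le> r" "1 \<le> j" "i \<le> k" by auto
  have "spread r (W i j * W j k) = spread r (W i k)"
   using Vm[OF a] W a b spread_mult by metis
  thus "W i j * W j k = W i k"
   using spread_inj[OF r UT_mult] W(1) a b by metis
 next
  fix i j k l assume a: "1 \<le> i" "i \<le> j" "j \<le> r" "1 \<le> k" "k \<le> l" "l \<le> r" "j \<noteq> k"
  have "spread r (W i j * W k l) = spread r 0"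
   using V0[OF a] W[OF a(1-3)] W[OF a(4-6)] spread_mult by simp
  thus "W i j * W k l = 0"
   using spread_inj[OF r UT_mult[OF W(1)[OF a(1-3)] W(1)[OF a(4-6)]] UT_0] by blast
 next
  fix i j assume a: "1 \<le> i" "i \<le> j" "j \<le> r"
  have "Pk.pI r {1..r} * W i j * Pk.pI r {1..r} = W i j" using Wtop[OF a] by simp
  with pis[OF a top] show "W i j * adj (W i j) * W i j = W i j" by simp
 next
  fix i assume a: "1 \<le> i" "i \<le> r"
  have "adj (W i i) = cp r {1..r} (adj (V i i))" by (simp add: W_def cp_def mult.assoc)
  thus "adj (W i i) = W i i" using Va[OF a] by (simp add: W_def)
 next
  fix i j assume a: "1 \<le> i" "i \<le> j" "j \<le> r"
  show "Pk.pI r {1..r} * W i j = W i j" by (rule Wtop[OF a])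
 next
  fix i j k l assume a: "1 \<le> i" "i \<le> j" "j \<le> r" "k \<in> {1..r}" "l \<in> {1..r}" "l < k"
  show "Pk r k * W i j * Pk r l = 0" by (rule UT_D(3)[OF W(1)[OF a(1-3)] a(4-6)])
 next
  fix i j k l assume a: "1 \<le> i" "i \<le> j" "j \<le> r" "k \<in> {1..r}" "l \<in> {1..r}"
  have bo: "Pk r m * adj (W i j) * Pk r k * W i j * Pk r m' = 0" "Pk r m * W i j * Pk r k * adj (W i j) * Pk r m' = 0"
   if "m \<in> {1..r}" "m' \<in> {1..r}" "m \<noteq> m'" for m m'
  proof -
   show "Pk r m * adj (W i j) * Pk r k * W i j * Pk r m' = 0"
    by (rule Pk.block_orthogonality(1)[OF _ _ a(4) that])
     (rule UT_D(3)[OF W(1)[OF a(1-3)]], assumption+, rule pis[OF a(1-3) Iab], assumption+)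
   show "Pk r m * W i j * Pk r k * adj (W i j) * Pk r m' = 0"
    by (rule Pk.block_orthogonality(2)[OF _ _ a(4) that])
     (rule UT_D(3)[OF W(1)[OF a(1-3)]], assumption+, rule pis[OF a(1-3) Iab], assumption+)
  qed
  \<comment> \<open>An operator in the corner without off-diagonal blocks commutes with every block
    projection; \<open>block_orthogonality\<close> is what removes those blocks.\<close>
  have comm: "Pk r l * X = X * Pk r l"
   if X: "Pk.pI r {1..r} * X = X" "X * Pk.pI r {1..r} = X"
    "\<And>m m'. m \<in> {1..r} ==> m' \<in> {1..r} ==> m \<noteq> m' ==> Pk r m * X * Pk r m' = 0" for X
  proof -
   have "Pk r l * X = (\<Sum>m\<in>{1..r}. Pk r l * X * Pk r m)"
    using X(2) by (metis Pk.pI_def mult.assoc sum_distrib_left)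
   also have "... = (\<Sum>m\<in>{l}. Pk r l * X * Pk r m)"
    using a(5) X(3)[OF a(5)] by (intro sum.mono_neutral_right) auto
   finally have 1: "Pk r l * X = Pk r l * X * Pk r l" by simp
   have "X * Pk r l = (\<Sum>m\<in>{1..r}. Pk r m * X * Pk r l)"
    using X(1) by (metis Pk.pI_def sum_distrib_right)
   also have "... = (\<Sum>m\<in>{l}. Pk r m * X * Pk r l)"
    using a(5) X(3)[OF _ a(5)] by (intro sum.mono_neutral_right) auto
   finally have 2: "X * Pk r l = Pk r l * X * Pk r l" by simp
   show ?thesis using 1 2 by simp
  qed
  have aW: "Pk.pI r {1..r} * adj (W i j) = adj (W i j)" "adj (W i j) * Pk.pI r {1..r} = adj (W i j)"
   using arg_cong[OF Wtop(2)[OF a(1-3)], of adj] arg_cong[OF Wtop(1)[OF a(1-3)], of adj] by simp_all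
  show "Pk r l * (adj (W i j) * Pk r k * W i j) = adj (W i j) * Pk r k * W i j * Pk r l"
   by (rule comm) (use bo(1) aW Wtop[OF a(1-3)] in \<open>simp_all add: mult.assoc\<close>, simp flip: mult.assoc)
  show "Pk r l * (W i j * Pk r k * adj (W i j)) = W i j * Pk r k * adj (W i j) * Pk r l"
   by (rule comm) (use bo(2) aW Wtop[OF a(1-3)] in \<open>simp_all add: mult.assoc\<close>, simp flip: mult.assoc)
 qed
 moreover define U where "U = (\<Sum>i\<in>{1..r}. W i i)"
 \<comment> \<open>\<open>spread r U\<close> is a sum of images of matrix units, hence in
   \<open>TK r\<close> and at distance less than 1 from an element of finite size. The corner of the
   latter has only finitely many nonzero columns.\<close>
 have "\<exists>n. fix_dim_le z U n"
 proof -
  have sU: "spread r U = (\<Sum>i\<in>{1..r}. V i i)"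
   unfolding U_def spread_sum using W(2) by (intro sum.cong refl) simp
  have "inTK r (spread r U)" unfolding sU by (rule inTK_sum[OF r]) (use VK in auto)
  then obtain c n where c: "mat c \<in> tensor_M (T_max r) n" "nrm (spread r U - c) < 1"
   unfolding inTK_iff by (metis zero_less_one)
  obtain X where X: "UT r X" "c = spread r X" "Nn n * X * Nn n = X" using tensor_M_spread[OF r c(1)] .
  have UU: "UT r U" unfolding U_def by (rule UT_sum) (use W(1) in auto)
  have "U - X = cp r {1..r} (spread r U - c)"
   using cp_top_spread[OF r UU] cp_top_spread[OF r X(1)] by (simp add: X(2) cp_def algebra_simps)
  hence "nrm (U - X) < 1" using nrm_cp[of r "{1..r}" "spread r U - c"] c(2) by simp
  moreover have "mat X i j = 0" if "j \<notin> ({{1..r}} \<times> {1..r}) \<times> {..<n}" for i j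
  proof (rule ccontr)
   assume nz: "mat X i j \<noteq> 0"
   obtain I k p J l q where ij: "i = ((I, k), p)" "j = ((J, l), q)" by (metis surj_pair)
   have "J = {1..r} \<and> l \<in> {1..r}" using UT_entry[OF X(1), of I k p J l q] nz unfolding ij by blast
   moreover have "mat (Nn n * X * Nn n) i j \<noteq> 0" using nz unfolding X(3) .
   hence "q < n" unfolding ij mult_Nn_entry by metis
   ultimately show False using that unfolding ij by blast
  qed
  ultimately show ?thesis
   using fix_dim_compact[of U X "({{1..r}} \<times> {1..r}) \<times> {..<n}" z] by blast
 qed
 ultimately obtain S :: "nat set" and h \<xi> where F: "is_frame r (Pk r) z S h \<xi>"
  and WF: "\<And>i j. 1 \<le> i ==> i \<le> j ==> j \<le> r ==> W i j = frame_op S h \<xi> i j"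
  using tri_frame_exists[of r "Pk r" W z] unfolding U_def by blast
 have "\<phi> a = mat (fmap r S h \<xi> a)" if a: "a \<in> ?E" for a
 proof -
  let ?t = "\<lambda>i j. a ({1..r}, i) ({1..r}, j)"
  have in1: "mat_scale (?t i j) (eT r i j) \<in> ?A" if "i \<in> {1..r}" "j \<in> {i..r}" for i j
   by (rule cstar_algebraD(5)[OF A eA]) (use that in auto)
  have in2: "(\<Sum>j\<in>{i..r}. mat_scale (?t i j) (eT r i j)) \<in> ?A \<and>
    \<pi> (\<Sum>j\<in>{i..r}. mat_scale (?t i j) (eT r i j)) = (\<Sum>j\<in>{i..r}. \<pi> (mat_scale (?t i j) (eT r i j)))"
   if "i \<in> {1..r}" for i by (rule star_hom_sum[OF \<pi> A in1[OF that]])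
  have "\<phi> a = \<pi> (\<Sum>i\<in>{1..r}. \<Sum>j\<in>{i..r}. mat_scale (?t i j) (eT r i j))"
   using piext[OF a] T_max_expand[OF a] by simp
  also have "... = (\<Sum>i\<in>{1..r}. \<pi> (\<Sum>j\<in>{i..r}. mat_scale (?t i j) (eT r i j)))"
   using star_hom_sum[OF \<pi> A, of "{1..r}" "\<lambda>i. \<Sum>j\<in>{i..r}. mat_scale (?t i j) (eT r i j)"] in2 by blast
  also have "... = (\<Sum>i\<in>{1..r}. \<Sum>j\<in>{i..r}. mat (sc (?t i j) * V i j))"
  proof (intro sum.cong refl)
   fix i assume i: "i \<in> {1..r}"
   have "\<pi> (mat_scale (?t i j) (eT r i j)) = mat (sc (?t i j) * V i j)" if "j \<in> {i..r}" for j
    using \<pi>s[OF eA[of i j]] i that by (simp add: mat_sc_mult mV)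
   thus "\<pi> (\<Sum>j\<in>{i..r}. mat_scale (?t i j) (eT r i j)) = (\<Sum>j\<in>{i..r}. mat (sc (?t i j) * V i j))"
    using in2[OF i] by simp
  qed
  also have "... = mat (\<Sum>i\<in>{1..r}. \<Sum>j\<in>{i..r}. sc (?t i j) * V i j)"
   by (intro ext) (simp only: mat_sum sum_cmat_apply)
  \<comment> \<open>The sum over j may be extended to all of 1, ..., r, because the coefficients
    below the diagonal are zero.\<close>
  also have "(\<Sum>i\<in>{1..r}. \<Sum>j\<in>{i..r}. sc (?t i j) * V i j)
    = (\<Sum>i\<in>{1..r}. \<Sum>j\<in>{1..r}. sc (?t i j) * spread r (frame_op S h \<xi> i j))"
  proof (rule sum.cong[OF refl])
   fix i assume i: "i \<in> {1..r}"
   show "(\<Sum>j\<in>{i..r}. sc (?t i j) * V i j) = (\<Sum>j\<in>{1..r}. sc (?t i j) * spread r (frame_op S h \<xi> i j))"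
   proof (rule sum.mono_neutral_cong_left)
    show "\<forall>j\<in>{1..r} - {i..r}. sc (?t i j) * spread r (frame_op S h \<xi> i j) = 0"
    proof
     fix j assume "j \<in> {1..r} - {i..r}"
     hence "\<not> i \<le> j" by auto
     hence "?t i j = 0" using T_max_entries(2)[OF a, of i j] by blast
     thus "sc (?t i j) * spread r (frame_op S h \<xi> i j) = 0" by simp
    qed
    fix j assume "j \<in> {i..r}"
    thus "sc (?t i j) * V i j = sc (?t i j) * spread r (frame_op S h \<xi> i j)"
     using W(2)[of i j] WF[of i j] i by simp
   qed (use i in auto)
  qed
  also have "... = fmap r S h \<xi> a" unfolding fmap_def spread_sum spread_sc ..
  finally show ?thesis .
 qed
 thus ?thesis using that[of S h \<xi>] F unfolding has_frame_def by blast
qed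

section \<open>Maps given by frames are star-extendible\<close>

definition pre :: "(nat \<rightharpoonup> nat) => nat set => nat set" where
 "pre h I = {i \<in> dom h. the (h i) \<in> I}"

text \<open>Monotonicity of h and convexity of its domain make the preimage convex. Consequently a
  copy of h, seen in the summand \<open>I\<close> of the target, reads one complete summand of the
  source.\<close>

lemma pre_interval:
 assumes h: "h \<in> Pend r" and I: "I \<in> intervals r" and ne: "pre h I \<noteq> {}"
 shows "pre h I \<in> intervals r"
proof -
 have dh: "dom h \<in> intervals r" using h by (simp add: Pend_def)
 have sub: "pre h I \<subseteq> dom h" by (auto simp: pre_def)
 hence fin: "finite (pre h I)" using intervals_subset[OF dh] finite_subset by blast
 define c d where "c = Min (pre h I)" and "d = Max (pre h I)"
 have cd: "c \<in> pre h I" "d \<in> pre h I" unfolding c_def d_def using Min_in[OF fin ne] Max_in[OF fin ne] by auto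
 have le: "c \<le> i" "i \<le> d" if "i \<in> pre h I" for i unfolding c_def d_def using fin that by auto
 have mem: "i \<in> pre h I" if "c \<le> i" "i \<le> d" for i
 proof -
  have i: "i \<in> dom h" using intervals_convex[OF dh, of c d i] cd sub that by blast
  have c: "c \<in> dom h" "the (h c) \<in> I" "d \<in> dom h" "the (h d) \<in> I" using cd by (auto simp: pre_def)
  have "the (h i) \<in> I"
   using intervals_convex[OF I c(2,4)] Pend_mono[OF h c(1) i that(1)] Pend_mono[OF h i c(3) that(2)] by blast
  thus ?thesis using i by (simp add: pre_def)
 qed
 have "pre h I \<subseteq> {c..d}" by (meson atLeastAtMost_iff le subsetI)
 moreover have "{c..d} \<subseteq> pre h I" by (meson atLeastAtMost_iff mem subsetI)
 ultimately have "pre h I = {c..d}" by (rule equalityI)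
 moreover have "1 \<le> c" "c \<le> d" "d \<le> r"
  using Pend_dom[OF h, of c] Pend_dom[OF h, of d] cd sub le(1)[OF cd(2)] by auto
 ultimately show ?thesis unfolding intervals_def by blast
qed

text \<open>Block diagonal matrices. The bounded ones form a C*-algebra that contains the one
  generated by \<open>T_max r\<close>, and membership can be read off from the entries.\<close>

definition bd :: "nat => (nat set \<times> nat) cmat => bool" where
 "bd r x \<longleftrightarrow> (\<forall>I k J l. x (I, k) (J, l) \<noteq> 0 \<longrightarrow> I = J \<and> I \<in> intervals r \<and> k \<in> I \<and> l \<in> I)"

lemma bdD: "bd r x ==> x (I, k) (J, l) \<noteq> 0 ==> I = J \<and> I \<in> intervals r \<and> k \<in> I \<and> l \<in> I"
 unfolding bd_def by blast

text \<open>A row of a block diagonal matrix is supported in its own finite block, which collapses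
  the infinite sum.\<close>

lemma bd_mul_entry:
 assumes "bd r x" "J \<in> intervals r"
 shows "(x \<bullet>\<bullet> y) (J, i) (J, k) = (\<Sum>j\<in>J. x (J, i) (J, j) * y (J, j) (J, k))"
proof -
 have fin: "finite J" using intervals_subset[OF assms(2)] by blast
 have "(x \<bullet>\<bullet> y) (J, i) (J, k) = infsum (\<lambda>m. x (J, i) m * y m (J, k)) (Pair J ` J)"
  unfolding mat_mul_def
 proof (rule infsum_cong_neutral)
  fix m :: "nat set \<times> nat" assume "m \<in> UNIV - Pair J ` J"
  hence "x (J, i) m = 0" using bdD[OF assms(1), of J i "fst m" "snd m"]
   by (cases m) auto
  thus "x (J, i) m * y m (J, k) = 0" by simp
 qed auto
 also have "... = (\<Sum>m\<in>Pair J ` J. x (J, i) m * y m (J, k))" using fin by simp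
 also have "... = (\<Sum>j\<in>J. x (J, i) (J, j) * y (J, j) (J, k))"
  by (subst sum.reindex) (auto simp: inj_on_def)
 finally show ?thesis .
qed

text \<open>Vanishing of entries outside the blocks passes to products, since some intermediate
  index must link both factors, and to norm limits, since entries are bounded by the norm.\<close>

lemma cstar_algebra_bd: "cstar_algebra {x. bounded_op x \<and> bd r x}"
 unfolding cstar_algebra_def
proof (intro conjI ballI allI)
 show "0 \<in> {x. bounded_op x \<and> bd r x}" by (simp add: bounded_op_0 bd_def)
 fix a assume a: "a \<in> {x. bounded_op x \<and> bd r x}"
 have "bd r (mat_scale c a)" for c unfolding bd_def mat_scale_def
 proof (intro allI impI)
  fix I k J l assume "c * a (I, k) (J, l) \<noteq> 0"
  thus "I = J \<and> I \<in> intervals r \<and> k \<in> I \<and> l \<in> I" using bdD[of r a I k J l] a by auto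
 qed
 thus "mat_scale c a \<in> {x. bounded_op x \<and> bd r x}" for c using a by (simp add: bounded_op_scale)
 have "bd r (mat_adj a)" unfolding bd_def mat_adj_def
 proof (intro allI impI)
  fix I k J l assume "cnj (a (J, l) (I, k)) \<noteq> 0"
  thus "I = J \<and> I \<in> intervals r \<and> k \<in> I \<and> l \<in> I" using bdD[of r a J l I k] a by auto
 qed
 thus "mat_adj a \<in> {x. bounded_op x \<and> bd r x}" using a by (simp add: bounded_op_adj)
 fix b assume b: "b \<in> {x. bounded_op x \<and> bd r x}"
 have "bd r (a + b)" unfolding bd_def
 proof (intro allI impI)
  fix I k J l assume "(a + b) (I, k) (J, l) \<noteq> 0"
  hence "a (I, k) (J, l) \<noteq> 0 \<or> b (I, k) (J, l) \<noteq> 0" by auto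
  thus "I = J \<and> I \<in> intervals r \<and> k \<in> I \<and> l \<in> I" using bdD[of r a I k J l] bdD[of r b I k J l] a b by blast
 qed
 thus "a + b \<in> {x. bounded_op x \<and> bd r x}" using a b bounded_op_add[of a b] by blast
 have "bd r (a \<bullet>\<bullet> b)" unfolding bd_def
 proof (intro allI impI)
  fix I k J l assume nz: "(a \<bullet>\<bullet> b) (I, k) (J, l) \<noteq> 0"
  have "\<exists>m. a (I, k) m * b m (J, l) \<noteq> 0"
  proof (rule ccontr)
   assume "\<not> ?thesis"
   hence "(\<lambda>m. a (I, k) m * b m (J, l)) = (\<lambda>m. 0)" by (intro ext) blast
   hence "(a \<bullet>\<bullet> b) (I, k) (J, l) = 0" unfolding mat_mul_def by simp
   thus False using nz by blast
  qed
  then obtain K m where "a (I, k) (K, m) \<noteq> 0" "b (K, m) (J, l) \<noteq> 0" by (metis mult_eq_0_iff surj_pair)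
  thus "I = J \<and> I \<in> intervals r \<and> k \<in> I \<and> l \<in> I" using bdD[of r a I k K m] bdD[of r b K m J l] a b by blast
 qed
 thus "a \<bullet>\<bullet> b \<in> {x. bounded_op x \<and> bd r x}" using a b bounded_op_mul[of a b] by blast
next
 show "op_closure {x. bounded_op x \<and> bd r x} \<subseteq> {x. bounded_op x \<and> bd r x}"
 proof
  fix a assume "a \<in> op_closure {x. bounded_op x \<and> bd r x}"
  hence a: "bounded_op a" and app: "\<And>e. e > 0 ==> \<exists>b\<in>{x. bounded_op x \<and> bd r x}. bounded_op b \<and> op_norm (a - b) < e"
   unfolding op_closure_def by blast+
  have "bd r a" unfolding bd_def
  proof (intro allI impI)
   fix I k J l assume nz: "a (I, k) (J, l) \<noteq> 0"
   hence "0 < cmod (a (I, k) (J, l))" by simp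
   from app[OF this] obtain b where b: "bounded_op b" "bd r b" "op_norm (a - b) < cmod (a (I, k) (J, l))" by blast
   have "cmod ((a - b) (I, k) (J, l)) \<le> op_norm (a - b)"
    by (rule bnd_entry[OF bnd_op_norm[OF bounded_op_diff[OF a b(1)]]])
   hence "b (I, k) (J, l) \<noteq> 0" using b(3) by auto
   thus "I = J \<and> I \<in> intervals r \<and> k \<in> I \<and> l \<in> I" by (rule bdD[OF b(2)])
  qed
  thus "a \<in> {x. bounded_op x \<and> bd r x}" using a by blast
 qed
qed auto

lemma T_max_bd: "T_max r \<subseteq> {x. bounded_op x \<and> bd r x}"
proof
 fix a assume a: "a \<in> T_max r"
 have "bd r a" unfolding bd_def using T_max_entries(1)[OF a] by metis
 thus "a \<in> {x. bounded_op x \<and> bd r x}" using a T_max_bounded by blast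
qed

text \<open>A block diagonal family of coefficient matrices acts through an orthonormal family.\<close>

definition blk_op :: "'a set => ('a => nat set) => ('a => nat => 'i bop) => ('a => nat => nat => complex) => 'i bop" where
 "blk_op A J g c = (\<Sum>\<mu>\<in>A. \<Sum>i\<in>J \<mu>. \<Sum>j\<in>J \<mu>. sc (c \<mu> i j) * (g \<mu> i * adj (g \<mu> j)))"

lemma sc_sc: "sc d * (sc c * x) = sc (c * d) * x"
 by (metis mult.assoc mult.commute sc_mult)

text \<open>For each \<mu> the operators \<open>g \<mu> i * adj (g \<mu> j)\<close> are matrix
  units, and those for different \<mu> annihilate each other; so coefficient matrices multiply block
  by block.\<close>

lemma blk_op_mult:
 assumes fin: "finite A" "\<And>\<mu>. \<mu> \<in> A ==> finite (J \<mu>)"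
  and e: "\<And>\<mu> i. \<mu> \<in> A ==> i \<in> J \<mu> ==> g \<mu> i * eu z = g \<mu> i"
  and on: "\<And>\<mu> \<nu> i j. \<mu> \<in> A ==> \<nu> \<in> A ==> i \<in> J \<mu> ==> j \<in> J \<nu> ==>
   adj (g \<mu> i) * g \<nu> j = (if \<mu> = \<nu> \<and> i = j then eu z else 0)"
 shows "blk_op A J g c * blk_op A J g d = blk_op A J g (\<lambda>\<mu> i k. \<Sum>j\<in>J \<mu>. c \<mu> i j * d \<mu> j k)"
proof -
 have app: "blk_op A J g c * g \<nu> k = (\<Sum>i\<in>J \<nu>. sc (c \<nu> i k) * g \<nu> i)" if b: "\<nu> \<in> A" "k \<in> J \<nu>" for \<nu> k
 proof -
  have "blk_op A J g c * g \<nu> k = (\<Sum>\<mu>\<in>A. if \<mu> = \<nu> then \<Sum>i\<in>J \<nu>. sc (c \<nu> i k) * g \<nu> i else 0)"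
   unfolding blk_op_def sum_distrib_right
  proof (rule sum.cong[OF refl])
   fix \<mu> assume a: "\<mu> \<in> A"
   show "(\<Sum>i\<in>J \<mu>. \<Sum>j\<in>J \<mu>. sc (c \<mu> i j) * (g \<mu> i * adj (g \<mu> j)) * g \<nu> k)
     = (if \<mu> = \<nu> then \<Sum>i\<in>J \<nu>. sc (c \<nu> i k) * g \<nu> i else 0)"
   proof (cases "\<mu> = \<nu>")
    case True
    have "(\<Sum>j\<in>J \<nu>. sc (c \<nu> i j) * (g \<nu> i * adj (g \<nu> j)) * g \<nu> k) = sc (c \<nu> i k) * g \<nu> i"
     if i: "i \<in> J \<nu>" for i
    proof -
     have "(\<Sum>j\<in>J \<nu>. sc (c \<nu> i j) * (g \<nu> i * adj (g \<nu> j)) * g \<nu> k)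
       = (\<Sum>j\<in>J \<nu>. if j = k then sc (c \<nu> i k) * g \<nu> i else 0)"
      using on[OF b(1) b(1) _ b(2)] e[OF b(1) i] by (intro sum.cong refl) (simp add: mult.assoc)
     thus ?thesis using b fin(2)[OF b(1)] by simp
    qed
    thus ?thesis using True by simp
   next
    case False
    thus ?thesis using on[OF a b(1) _ b(2)] by (simp add: mult.assoc)
   qed
  qed
  thus ?thesis using b fin by simp
 qed
 have "blk_op A J g c * blk_op A J g d
   = (\<Sum>\<nu>\<in>A. \<Sum>j\<in>J \<nu>. \<Sum>k\<in>J \<nu>. sc (d \<nu> j k) * (blk_op A J g c * g \<nu> j * adj (g \<nu> k)))"
  by (subst (2) blk_op_def) (simp add: sum_distrib_left sc_left_commute[of "blk_op A J g c"] mult.assoc)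
 also have "... = (\<Sum>\<nu>\<in>A. \<Sum>j\<in>J \<nu>. \<Sum>k\<in>J \<nu>. \<Sum>i\<in>J \<nu>. sc (c \<nu> i j * d \<nu> j k) * (g \<nu> i * adj (g \<nu> k)))"
  by (intro sum.cong refl) (simp only: app sum_distrib_left sum_distrib_right mult.assoc sc_sc)
 also have "... = (\<Sum>\<nu>\<in>A. \<Sum>i\<in>J \<nu>. \<Sum>k\<in>J \<nu>. \<Sum>j\<in>J \<nu>. sc (c \<nu> i j * d \<nu> j k) * (g \<nu> i * adj (g \<nu> k)))"
 proof (rule sum.cong[OF refl])
  fix \<nu>
  let ?F = "\<lambda>i j k. sc (c \<nu> i j * d \<nu> j k) * (g \<nu> i * adj (g \<nu> k))"
  have "(\<Sum>j\<in>J \<nu>. \<Sum>k\<in>J \<nu>. \<Sum>i\<in>J \<nu>. ?F i j k) = (\<Sum>j\<in>J \<nu>. \<Sum>i\<in>J \<nu>. \<Sum>k\<in>J \<nu>. ?F i j k)"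
   by (rule sum.cong[OF refl], rule sum.swap)
  also have "... = (\<Sum>i\<in>J \<nu>. \<Sum>j\<in>J \<nu>. \<Sum>k\<in>J \<nu>. ?F i j k)" by (rule sum.swap)
  also have "... = (\<Sum>i\<in>J \<nu>. \<Sum>k\<in>J \<nu>. \<Sum>j\<in>J \<nu>. ?F i j k)" by (rule sum.cong[OF refl], rule sum.swap)
  finally show "(\<Sum>j\<in>J \<nu>. \<Sum>k\<in>J \<nu>. \<Sum>i\<in>J \<nu>. ?F i j k) = (\<Sum>i\<in>J \<nu>. \<Sum>k\<in>J \<nu>. \<Sum>j\<in>J \<nu>. ?F i j k)" .
 qed
 also have "... = blk_op A J g (\<lambda>\<mu> i k. \<Sum>j\<in>J \<mu>. c \<mu> i j * d \<mu> j k)"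
  by (simp add: blk_op_def sc_sum sum_distrib_right)
 finally show ?thesis .
qed

lemma blk_op_adj: "adj (blk_op A J g c) = blk_op A J g (\<lambda>\<mu> i j. cnj (c \<mu> j i))"
proof -
 have "adj (blk_op A J g c) = (\<Sum>\<mu>\<in>A. \<Sum>i\<in>J \<mu>. \<Sum>j\<in>J \<mu>. sc (cnj (c \<mu> i j)) * (g \<mu> j * adj (g \<mu> i)))"
  unfolding blk_op_def adj_sum by (intro sum.cong refl) (simp only: adj_mult adj_sc adj_adj sc_commute)
 also have "... = blk_op A J g (\<lambda>\<mu> i j. cnj (c \<mu> j i))"
  unfolding blk_op_def by (rule sum.cong[OF refl], rule sum.swap)
 finally show ?thesis .
qed

definition fop :: "nat => 's set => ('s => nat \<rightharpoonup> nat) => ('s => nat => bix bop) => (nat set \<times> nat) cmat => bix bop" where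
 "fop r S h \<xi> a = (\<Sum>i\<in>{1..r}. \<Sum>j\<in>{1..r}. sc (a ({1..r}, i) ({1..r}, j)) * frame_op S h \<xi> i j)"

lemma fmap_fop: "fmap r S h \<xi> a = spread r (fop r S h \<xi> a)"
 by (simp add: fmap_def fop_def)

lemma pI_vec:
 assumes "Pk r k * x = x" "k \<in> {1..r}" "I \<subseteq> {1..r}"
 shows "Pk.pI r I * x = (if k \<in> I then x else 0)"
proof -
 have "Pk.pI r I * x = Pk.pI r I * Pk r k * x" using assms(1) by (simp add: mult.assoc)
 thus ?thesis using assms(1) unfolding Pk.pI_P[OF assms(2,3)] by simp
qed

lemma tau_vec0:
 assumes "Pk r k * x = x" "k \<in> {1..r}" "I \<in> intervals r" "k \<notin> I"
 shows "tau r I * x = 0"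
proof -
 have "tau r I * x = tau r I * (Pk.pI r I * x)" by (simp add: tau_pI[OF assms(3)] flip: mult.assoc)
 thus ?thesis using pI_vec[OF assms(1,2), of I] assms intervals_subset[OF assms(3)] by simp
qed

text \<open>In the summand \<open>I\<close> the copy s sees only the indices in
  \<open>pre (h s) I\<close>. This set being an interval, the coefficients can be taken from that
  summand of a instead of the largest one. In this form the expression makes sense for every block
  diagonal matrix.\<close>

lemma fmap_blk_op:
 assumes F: "is_frame r (Pk r) z S h \<xi>" and a: "a \<in> T_max r"
 shows "fmap r S h \<xi> a = blk_op (intervals r \<times> S) (\<lambda>\<mu>. pre (h (snd \<mu>)) (fst \<mu>))
  (\<lambda>\<mu> i. tau r (fst \<mu>) * \<xi> (snd \<mu>) i)
  (\<lambda>\<mu> i j. a (pre (h (snd \<mu>)) (fst \<mu>), i) (pre (h (snd \<mu>)) (fst \<mu>), j))"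
proof -
 let ?t = "\<lambda>i j. a ({1..r}, i) ({1..r}, j)"
 have "tau r I * fop r S h \<xi> a * adj (tau r I)
   = (\<Sum>s\<in>S. \<Sum>i\<in>pre (h s) I. \<Sum>j\<in>pre (h s) I. sc (a (pre (h s) I, i) (pre (h s) I, j)) * (tau r I * \<xi> s i * adj (tau r I * \<xi> s j)))"
  if I: "I \<in> intervals r" for I
 proof -
  let ?G = "\<lambda>s i j. if i \<in> pre (h s) I then if j \<in> pre (h s) I then sc (?t i j) * (tau r I * \<xi> s i * adj (tau r I * \<xi> s j)) else 0 else 0"
  have t: "tau r I * (if i \<in> dom (h s) \<and> j \<in> dom (h s) then \<xi> s i * adj (\<xi> s j) else 0) * adj (tau r I)
    = (if i \<in> pre (h s) I then if j \<in> pre (h s) I then tau r I * \<xi> s i * adj (tau r I * \<xi> s j) else 0 else 0)"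
   if s: "s \<in> S" for s i j
  proof (cases "i \<in> dom (h s) \<and> j \<in> dom (h s)")
   case True
   have z: "tau r I * \<xi> s m = 0" if "m \<in> dom (h s)" "m \<notin> pre (h s) I" for m
    using tau_vec0[OF is_frameD(4)[OF F s that(1)] Pend_ran[OF is_frameD(2)[OF F s] that(1)] I] that
    by (simp add: pre_def)
   have e: "tau r I * (\<xi> s i * adj (\<xi> s j)) * adj (tau r I) = (tau r I * \<xi> s i) * adj (tau r I * \<xi> s j)"
    by (simp add: mult.assoc)
   show ?thesis unfolding if_P[OF True] e using True z[of i] z[of j]
    by (cases "i \<in> pre (h s) I"; cases "j \<in> pre (h s) I") (simp_all del: adj_mult)
  next
   case False
   thus ?thesis by (auto simp: pre_def)
  qed
  have "tau r I * fop r S h \<xi> a * adj (tau r I)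
    = (\<Sum>i\<in>{1..r}. \<Sum>j\<in>{1..r}. sc (?t i j) * (\<Sum>s\<in>S. tau r I * (if i \<in> dom (h s) \<and> j \<in> dom (h s) then \<xi> s i * adj (\<xi> s j) else 0) * adj (tau r I)))"
   unfolding fop_def frame_op_def sum_distrib_left sum_distrib_right
   by (intro sum.cong refl) (simp only: mult.assoc sc_left_commute[of "tau r I"])
  also have "... = (\<Sum>i\<in>{1..r}. \<Sum>j\<in>{1..r}. \<Sum>s\<in>S. ?G s i j)"
   unfolding sum_distrib_left by (intro sum.cong refl) (simp add: t)
  also have "... = (\<Sum>s\<in>S. \<Sum>i\<in>{1..r}. \<Sum>j\<in>{1..r}. ?G s i j)"
  proof -
   have "(\<Sum>i\<in>{1..r}. \<Sum>j\<in>{1..r}. \<Sum>s\<in>S. ?G s i j) = (\<Sum>i\<in>{1..r}. \<Sum>s\<in>S. \<Sum>j\<in>{1..r}. ?G s i j)"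
    by (rule sum.cong[OF refl], rule sum.swap)
   also have "... = (\<Sum>s\<in>S. \<Sum>i\<in>{1..r}. \<Sum>j\<in>{1..r}. ?G s i j)" by (rule sum.swap)
   finally show ?thesis .
  qed
  also have "... = (\<Sum>s\<in>S. \<Sum>i\<in>pre (h s) I. \<Sum>j\<in>pre (h s) I. sc (a (pre (h s) I, i) (pre (h s) I, j)) * (tau r I * \<xi> s i * adj (tau r I * \<xi> s j)))"
  proof (rule sum.cong[OF refl])
   fix s assume s: "s \<in> S"
   have sub: "pre (h s) I \<subseteq> {1..r}" unfolding pre_def using Pend_dom[OF is_frameD(2)[OF F s]] by blast
   have av: "?t i j = a (pre (h s) I, i) (pre (h s) I, j)" if "i \<in> pre (h s) I" "j \<in> pre (h s) I" for i j
   proof -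
    have "pre (h s) I \<in> intervals r" using pre_interval[OF is_frameD(2)[OF F s] I] that by blast
    thus ?thesis using T_max_entries(1)[OF a, of "pre (h s) I" i "pre (h s) I" j] that by simp
   qed
   have "(\<Sum>i\<in>{1..r}. \<Sum>j\<in>{1..r}. ?G s i j) = (\<Sum>i\<in>pre (h s) I. \<Sum>j\<in>{1..r}. ?G s i j)"
    by (rule sum.mono_neutral_right) (use sub in auto)
   also have "... = (\<Sum>i\<in>pre (h s) I. \<Sum>j\<in>pre (h s) I. ?G s i j)"
    by (rule sum.cong[OF refl], rule sum.mono_neutral_right) (use sub in auto)
   also have "... = (\<Sum>i\<in>pre (h s) I. \<Sum>j\<in>pre (h s) I. sc (a (pre (h s) I, i) (pre (h s) I, j)) * (tau r I * \<xi> s i * adj (tau r I * \<xi> s j)))"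
    by (intro sum.cong refl) (simp add: av)
   finally show "(\<Sum>i\<in>{1..r}. \<Sum>j\<in>{1..r}. ?G s i j) = (\<Sum>i\<in>pre (h s) I. \<Sum>j\<in>pre (h s) I. sc (a (pre (h s) I, i) (pre (h s) I, j)) * (tau r I * \<xi> s i * adj (tau r I * \<xi> s j)))" .
  qed
  finally show ?thesis .
 qed
 hence "fmap r S h \<xi> a = (\<Sum>I\<in>intervals r. \<Sum>s\<in>S. \<Sum>i\<in>pre (h s) I. \<Sum>j\<in>pre (h s) I.
   sc (a (pre (h s) I, i) (pre (h s) I, j)) * (tau r I * \<xi> s i * adj (tau r I * \<xi> s j)))"
  unfolding fmap_fop spread_def by (intro sum.cong refl)
 thus ?thesis unfolding blk_op_def sum.cartesian_product by (simp add: case_prod_beta)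
qed

text \<open>Below the diagonal the coefficients vanish; on and above it monotonicity of each
  \<open>h s\<close> makes the rank one terms triangular.\<close>

lemma UT_fop:
 assumes F: "is_frame r (Pk r) z S h \<xi>" and a: "a \<in> T_max r"
 shows "UT r (fop r S h \<xi> a)"
 unfolding fop_def
proof (intro UT_sum)
 fix i j assume "i \<in> {1..r}" "j \<in> {1..r}"
 show "UT r (sc (a ({1..r}, i) ({1..r}, j)) * frame_op S h \<xi> i j)"
 proof (cases "i \<le> j")
  case True
  show ?thesis unfolding frame_op_def
  proof (intro UT_sc UT_sum)
   fix s assume s: "s \<in> S"
   show "UT r (if i \<in> dom (h s) \<and> j \<in> dom (h s) then \<xi> s i * adj (\<xi> s j) else 0)"
   proof (cases "i \<in> dom (h s) \<and> j \<in> dom (h s)")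
    case True': True
    hence "UT r (\<xi> s i * adj (\<xi> s j))"
     using UT_rank_one[OF is_frameD(4)[OF F s] is_frameD(4)[OF F s] Pend_ran[OF is_frameD(2)[OF F s]]
       Pend_ran[OF is_frameD(2)[OF F s]] Pend_mono[OF is_frameD(2)[OF F s]]] True by blast
    thus ?thesis using True' by simp
   next
    case False
    show ?thesis unfolding if_not_P[OF False] by (rule UT_0)
   qed
  qed
 next
  case False
  hence "a ({1..r}, i) ({1..r}, j) = 0" using T_max_entries(2)[OF a, of i j] by blast
  thus ?thesis by (simp add: UT_0)
 qed
qed

lemma inTK_fmap:
 assumes r: "r \<ge> 1" and F: "is_frame r (Pk r) z S h \<xi>" and a: "a \<in> T_max r"
 shows "inTK r (fmap r S h \<xi> a)"
 unfolding fmap_def spread_sum spread_sc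
proof (intro inTK_sum[OF r])
 fix i j assume "i \<in> {1..r}" "j \<in> {1..r}"
 show "inTK r (sc (a ({1..r}, i) ({1..r}, j)) * spread r (frame_op S h \<xi> i j))"
 proof (cases "i \<le> j")
  case True
  show ?thesis unfolding frame_op_def spread_sum
  proof (intro inTK_sc[OF r] inTK_sum[OF r])
   fix s assume s: "s \<in> S"
   show "inTK r (spread r (if i \<in> dom (h s) \<and> j \<in> dom (h s) then \<xi> s i * adj (\<xi> s j) else 0))"
   proof (cases "i \<in> dom (h s) \<and> j \<in> dom (h s)")
    case True': True
    hence "inTK r (spread r (\<xi> s i * adj (\<xi> s j)))"
     using inTK_rank_one[OF r is_frameD(3)[OF F s] is_frameD(4)[OF F s] is_frameD(3)[OF F s] is_frameD(4)[OF F s]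
      Pend_ran[OF is_frameD(2)[OF F s]] Pend_ran[OF is_frameD(2)[OF F s]] Pend_mono[OF is_frameD(2)[OF F s]]] True
     by blast
    thus ?thesis using True' by simp
   next
    case False
    show ?thesis unfolding if_not_P[OF False] spread_0 by (rule inTK_0)
   qed
  qed
 next
  case False
  hence "a ({1..r}, i) ({1..r}, j) = 0" using T_max_entries(2)[OF a, of i j] by blast
  thus ?thesis by (simp add: inTK_0)
 qed
qed

lemma fmap_tensor_M:
 assumes F: "is_frame r (Pk r) z S h \<xi>" and a: "a \<in> T_max r"
  and supp: "\<And>s i. s \<in> S ==> i \<in> dom (h s) ==> Nn n * \<xi> s i = \<xi> s i"
 shows "mat (fmap r S h \<xi> a) \<in> tensor_M (T_max r) n"
 unfolding fmap_fop
proof (rule spread_in_tensor_M[OF UT_fop[OF F a]])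
 have supp': "adj (\<xi> s i) * Nn n = adj (\<xi> s i)" if "s \<in> S" "i \<in> dom (h s)" for s i
  using arg_cong[OF supp[OF that], of adj] by simp
 have N: "Nn n * frame_op S h \<xi> i j * Nn n = frame_op S h \<xi> i j" for i j
  unfolding frame_op_def sum_distrib_left sum_distrib_right
 proof (intro sum.cong refl)
  fix s assume s: "s \<in> S"
  show "Nn n * (if i \<in> dom (h s) \<and> j \<in> dom (h s) then \<xi> s i * adj (\<xi> s j) else 0) * Nn n
   = (if i \<in> dom (h s) \<and> j \<in> dom (h s) then \<xi> s i * adj (\<xi> s j) else 0)"
   using supp[OF s, of i] supp'[OF s, of j] by (simp add: mult.assoc) (simp flip: mult.assoc)
 qed
 have "Nn n * (sc c * X) * Nn n = sc c * (Nn n * X * Nn n)" for c X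
  by (simp add: mult.assoc sc_left_commute[of "Nn n" c])
 thus "Nn n * fop r S h \<xi> a * Nn n = fop r S h \<xi> a"
  unfolding fop_def sum_distrib_left sum_distrib_right by (intro sum.cong refl) (simp add: N)
qed

text \<open>The extension \<open>\<pi>\<close> applies the block formula to arbitrary block diagonal
  matrices; it is multiplicative because each index \<mu> reads one whole block. That
  \<open>\<pi>\<close> takes values in the C*-algebra generated by \<open>B\<close> is shown by
  checking that the elements \<open>C\<close> for which it does form a C*-algebra containing
  \<open>T_max r\<close>.\<close>

theorem fmap_star_extendible:
 assumes F: "is_frame r (Pk r) z S h \<xi>" and B: "B \<subseteq> Collect bounded_op"
  and fB: "\<And>a. a \<in> T_max r ==> mat (fmap r S h \<xi> a) \<in> B"
  and \<phi>: "\<And>a. a \<in> T_max r ==> \<phi> a = mat (fmap r S h \<xi> a)"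
 shows "star_extendible (T_max r) B \<phi>"
proof -
 define A where "A = intervals r \<times> S"
 define J where "J \<mu> = pre (h (snd \<mu>)) (fst \<mu>)" for \<mu> :: "nat set \<times> 'a"
 define g where "g \<mu> i = tau r (fst \<mu>) * \<xi> (snd \<mu>) i" for \<mu> :: "nat set \<times> 'a" and i
 define cf where "cf x \<mu> i j = x (J \<mu>, i) (J \<mu>, j)" for x :: "(nat set \<times> nat) cmat" and \<mu> i j
 define \<pi> where "\<pi> x = blk_op A J g (cf x)" for x
 let ?D = "{x. bounded_op x \<and> bd r x}"
 have cB: "cstar_algebra (cstar B)" by (rule cstar_algebra_cstar[OF B])
 have AD: "cstar (T_max r) \<subseteq> ?D" by (rule cstar_least[OF T_max_bd cstar_algebra_bd])
 have finA: "finite A" unfolding A_def using intervals_finite is_frameD(1)[OF F] by simp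
 have AS: "fst \<mu> \<in> intervals r" "snd \<mu> \<in> S" if "\<mu> \<in> A" for \<mu> using that by (auto simp: A_def)
 have Jd: "i \<in> dom (h (snd \<mu>))" "the (h (snd \<mu>) i) \<in> fst \<mu>" if "i \<in> J \<mu>" for i \<mu>
  using that by (auto simp: J_def pre_def)
 have finJ: "finite (J \<mu>)" if "\<mu> \<in> A" for \<mu>
  by (rule finite_subset[of _ "{1..r}"]) (use Pend_dom[OF is_frameD(2)[OF F AS(2)[OF that]]] Jd(1) in blast)+
 have Jint: "J \<mu> \<in> intervals r" if "\<mu> \<in> A" "i \<in> J \<mu>" for \<mu> i
  unfolding J_def by (rule pre_interval[OF is_frameD(2)[OF F AS(2)[OF that(1)]] AS(1)[OF that(1)]])
   (use that(2) in \<open>auto simp: J_def\<close>)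
 have ge: "g \<mu> i * eu z = g \<mu> i" if "\<mu> \<in> A" "i \<in> J \<mu>" for \<mu> i
  using is_frameD(3)[OF F AS(2)[OF that(1)] Jd(1)[OF that(2)]] by (simp add: g_def mult.assoc)
 have gon: "adj (g \<mu> i) * g \<nu> j = (if \<mu> = \<nu> \<and> i = j then eu z else 0)"
  if a: "\<mu> \<in> A" "\<nu> \<in> A" "i \<in> J \<mu>" "j \<in> J \<nu>" for \<mu> \<nu> i j
 proof -
  have "adj (g \<mu> i) * g \<nu> j = adj (\<xi> (snd \<mu>) i) * (adj (tau r (fst \<mu>)) * tau r (fst \<nu>) * \<xi> (snd \<nu>) j)"
   by (simp add: g_def mult.assoc)
  also have "adj (tau r (fst \<mu>)) * tau r (fst \<nu>) * \<xi> (snd \<nu>) j = (if fst \<mu> = fst \<nu> then \<xi> (snd \<nu>) j else 0)"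
  proof (cases "fst \<mu> = fst \<nu>")
   case True
   have "Pk.pI r (fst \<nu>) * \<xi> (snd \<nu>) j = \<xi> (snd \<nu>) j"
    using pI_vec[OF is_frameD(4)[OF F AS(2)[OF a(2)] Jd(1)[OF a(4)]]
      Pend_ran[OF is_frameD(2)[OF F AS(2)[OF a(2)]] Jd(1)[OF a(4)]], of "fst \<nu>"]
     intervals_subset[OF AS(1)[OF a(2)]] Jd(2)[OF a(4)] by simp
   thus ?thesis using True adj_tau_tau'[OF AS(1)[OF a(2)], of "fst \<nu>"] by simp
  next
   case False
   thus ?thesis using adj_tau_tau'[OF AS(1)[OF a(1)], of "fst \<nu>"] by simp
  qed
  finally have e: "adj (g \<mu> i) * g \<nu> j = (if fst \<mu> = fst \<nu> then adj (\<xi> (snd \<mu>) i) * \<xi> (snd \<nu>) j else 0)" by simp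
  show ?thesis
   unfolding e is_frameD(5)[OF F AS(2)[OF a(1)] AS(2)[OF a(2)] Jd(1)[OF a(3)] Jd(1)[OF a(4)]]
   by (auto simp: prod_eq_iff)
 qed
 have \<pi>E: "\<pi> a = fmap r S h \<xi> a" if "a \<in> T_max r" for a
  unfolding fmap_blk_op[OF F that] \<pi>_def A_def J_def g_def cf_def ..
 have blk_cong: "blk_op A J g c = blk_op A J g d" if "\<And>\<mu> i j. \<mu> \<in> A ==> i \<in> J \<mu> ==> j \<in> J \<mu> ==> c \<mu> i j = d \<mu> i j" for c d
  unfolding blk_op_def using that by (intro sum.cong refl) simp
 have bm: "blk_op A J g c * blk_op A J g d = blk_op A J g (\<lambda>\<mu> i k. \<Sum>j\<in>J \<mu>. c \<mu> i j * d \<mu> j k)" for c d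
  by (rule blk_op_mult[where z = z]) (simp_all add: finA finJ ge gon)
 have \<pi>m: "\<pi> (x \<bullet>\<bullet> y) = \<pi> x * \<pi> y" if "x \<in> ?D" for x y
  unfolding \<pi>_def bm
  by (rule blk_cong) (use that bd_mul_entry[OF _ Jint] in \<open>simp add: cf_def\<close>)
 have \<pi>a: "\<pi> (mat_adj x) = adj (\<pi> x)" for x
  unfolding \<pi>_def blk_op_adj by (simp add: cf_def[abs_def] mat_adj_def)
 have \<pi>p: "\<pi> (x + y) = \<pi> x + \<pi> y" for x y
  unfolding \<pi>_def blk_op_def cf_def by (simp add: sc_add distrib_right sum.distrib)
 have \<pi>s: "\<pi> (mat_scale c x) = sc c * \<pi> x" for c x
  unfolding \<pi>_def blk_op_def cf_def mat_scale_def by (simp add: sc_mult sum_distrib_left mult.assoc)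
 have \<pi>d: "\<pi> (x - y) = \<pi> x - \<pi> y" for x y
  using \<pi>p[of "x - y" y] by (simp add: algebra_simps)
 \<comment> \<open>A crude Lipschitz constant of \<open>\<pi>\<close>: every coefficient is an entry
   and so bounded by the operator norm. Continuity is what makes \<open>C\<close> closed.\<close>
 define K where "K = (\<Sum>\<mu>\<in>A. \<Sum>i\<in>J \<mu>. \<Sum>j\<in>J \<mu>. nrm (g \<mu> i * adj (g \<mu> j))) + 1"
 have K: "K > 0" unfolding K_def by (intro add_nonneg_pos sum_nonneg) simp_all
 have \<pi>n: "nrm (\<pi> x) \<le> op_norm x * K" if "bounded_op x" for x
 proof -
  have x: "cmod (x i j) \<le> op_norm x" for i j by (rule bnd_entry[OF bnd_op_norm[OF that]])
  hence x0: "0 \<le> op_norm x" using norm_ge_zero order_trans by blast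
  have "nrm (\<pi> x) \<le> (\<Sum>\<mu>\<in>A. \<Sum>i\<in>J \<mu>. \<Sum>j\<in>J \<mu>. op_norm x * nrm (g \<mu> i * adj (g \<mu> j)))"
   unfolding \<pi>_def blk_op_def
   by (intro order_trans[OF nrm_sum] sum_mono order_trans[OF nrm_sc_le] mult_right_mono) (simp_all add: cf_def x)
  also have "... = op_norm x * (K - 1)" by (simp add: K_def sum_distrib_left)
  also have "... \<le> op_norm x * K" using x0 by (intro mult_left_mono) auto
  finally show ?thesis .
 qed
 define C where "C = {x \<in> ?D. mat (\<pi> x) \<in> cstar B}"
 have "cstar_algebra C"
  unfolding cstar_algebra_def
 proof (intro conjI ballI allI)
  note D = cstar_algebraD[OF cstar_algebra_bd[of r]]
  show "C \<subseteq> Collect bounded_op" by (auto simp: C_def)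
  have "\<pi> 0 = 0" using \<pi>d[of 0 0] by simp
  thus "0 \<in> C" using D(2) cstar_algebraD(2)[OF cB] unfolding C_def by (simp add: zero_bop.rep_eq)
  fix a assume a: "a \<in> C"
  hence a': "a \<in> ?D" "mat (\<pi> a) \<in> cstar B" by (auto simp: C_def)
  show "mat_scale c a \<in> C" for c
   using D(5)[OF a'(1), of c] cstar_algebraD(5)[OF cB a'(2), of c] unfolding C_def by (simp add: \<pi>s mat_sc_mult)
  show "mat_adj a \<in> C"
   using D(6)[OF a'(1)] cstar_algebraD(6)[OF cB a'(2)] unfolding C_def by (simp add: \<pi>a mat_adj)
  fix b assume b: "b \<in> C"
  hence b': "b \<in> ?D" "mat (\<pi> b) \<in> cstar B" by (auto simp: C_def)
  show "a + b \<in> C"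
   using D(3)[OF a'(1) b'(1)] cstar_algebraD(3)[OF cB a'(2) b'(2)]
   unfolding C_def mem_Collect_eq \<pi>p mat_add by blast
  show "a \<bullet>\<bullet> b \<in> C"
   using D(4)[OF a'(1) b'(1)] cstar_algebraD(4)[OF cB a'(2) b'(2)]
   unfolding C_def mem_Collect_eq \<pi>m[OF a'(1)] mat_mult by blast
 next
  show "op_closure C \<subseteq> C"
  proof
   fix x assume x: "x \<in> op_closure C"
   have "C \<subseteq> ?D" by (auto simp: C_def)
   hence xD: "x \<in> ?D" using x op_closure_mono cstar_algebraD(7)[OF cstar_algebra_bd] by blast
   have "mat (\<pi> x) \<in> op_closure (cstar B)"
    unfolding op_closure_def mem_Collect_eq
   proof (intro conjI allI impI bounded_mat)
    fix e :: real assume e: "e > 0"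
    hence "e / K > 0" using K by simp
    then obtain y where y: "y \<in> C" "bounded_op y" "op_norm (x - y) < e / K"
     using x unfolding op_closure_def by blast
    have "op_norm (mat (\<pi> x) - mat (\<pi> y)) = nrm (\<pi> (x - y))" by (simp add: \<pi>d nrm.rep_eq mat_minus)
    also have "... \<le> op_norm (x - y) * K" by (rule \<pi>n[OF bounded_op_diff]) (use xD y in auto)
    also have "... < e" using y(3) K by (simp add: pos_less_divide_eq)
    finally show "\<exists>b\<in>cstar B. bounded_op b \<and> op_norm (mat (\<pi> x) - b) < e"
     using y(1) unfolding C_def by (intro bexI[of _ "mat (\<pi> y)"]) auto
   qed
   hence "mat (\<pi> x) \<in> cstar B" by (rule cstar_algebraD(7)[OF cB])
   thus "x \<in> C" using xD unfolding C_def by blast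
  qed
 qed
 moreover have "T_max r \<subseteq> C"
 proof
  fix a assume a: "a \<in> T_max r"
  have "mat (\<pi> a) \<in> cstar B" unfolding \<pi>E[OF a] using fB[OF a] cstar_superset by blast
  thus "a \<in> C" using T_max_bd a unfolding C_def by blast
 qed
 ultimately have EC: "cstar (T_max r) \<subseteq> C" by (intro cstar_least)
 have "star_hom (cstar (T_max r)) (cstar B) (\<lambda>x. mat (\<pi> x))"
  unfolding star_hom_def
 proof (intro conjI ballI allI)
  show "(\<lambda>x. mat (\<pi> x)) ` cstar (T_max r) \<subseteq> cstar B" using EC by (auto simp: C_def)
  fix a assume a: "a \<in> cstar (T_max r)"
  show "mat (\<pi> (mat_scale c a)) = mat_scale c (mat (\<pi> a))" for c by (simp add: \<pi>s mat_sc_mult)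
  show "mat (\<pi> (mat_adj a)) = mat_adj (mat (\<pi> a))" by (simp add: \<pi>a mat_adj)
  fix b assume "b \<in> cstar (T_max r)"
  show "mat (\<pi> (a + b)) = mat (\<pi> a) + mat (\<pi> b)" by (simp only: \<pi>p mat_add)
  show "mat (\<pi> (a \<bullet>\<bullet> b)) = mat (\<pi> a) \<bullet>\<bullet> mat (\<pi> b)"
   using \<pi>m[of a b] AD a by (auto simp: mat_mult)
 qed
 moreover have "\<forall>a\<in>T_max r. mat (\<pi> a) = \<phi> a" using \<pi>E \<phi> by simp
 moreover have "\<phi> ` T_max r \<subseteq> B" using \<phi> fB by auto
 ultimately show ?thesis unfolding star_extendible_def by blast
qed

lemma has_frame_maps_K:
 assumes "r \<ge> 1" "has_frame r z \<phi> S h \<xi>"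
 shows "\<phi> \<in> maps_K (T_max r)"
proof -
 have F: "is_frame r (Pk r) z S h \<xi>" "\<And>a. a \<in> T_max r ==> \<phi> a = mat (fmap r S h \<xi> a)"
  using assms(2) by (auto simp: has_frame_def)
 have "star_extendible (T_max r) (TK r) \<phi>"
  by (rule fmap_star_extendible[OF F(1) _ _ F(2)])
   (use tensor_K_bounded inTK_fmap[OF assms(1) F(1)] in \<open>auto simp: inTK_def\<close>)
 thus ?thesis by (simp add: maps_K_def)
qed

lemma has_frame_maps_M:
 assumes "has_frame r z \<phi> S h \<xi>"
  and supp: "\<And>s i. s \<in> S ==> i \<in> dom (h s) ==> Nn n * \<xi> s i = \<xi> s i"
 shows "\<phi> \<in> maps_M (T_max r) n"
proof -
 have F: "is_frame r (Pk r) z S h \<xi>" "\<And>a. a \<in> T_max r ==> \<phi> a = mat (fmap r S h \<xi> a)"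
  using assms(1) by (auto simp: has_frame_def)
 have "star_extendible (T_max r) (tensor_M (T_max r) n) \<phi>"
  by (rule fmap_star_extendible[OF F(1) _ _ F(2)])
   (use tensor_M_bounded fmap_tensor_M[OF F(1) _ supp] in auto)
 thus ?thesis by (simp add: maps_M_def)
qed

text \<open>The vector is fixed by \<open>frame_op S h \<xi> i i\<close>, the corner of the image of
  a diagonal matrix unit, and the range of this operator lies in the first n copies.\<close>

lemma maps_M_frame_support:
 assumes r: "r \<ge> 1" and hf: "has_frame r z \<phi> S h \<xi>" and \<phi>: "\<phi> \<in> maps_M (T_max r) n"
  and s: "s \<in> S" "i \<in> dom (h s)"
 shows "Nn n * \<xi> s i = \<xi> s i"
proof -
 have F: "is_frame r (Pk r) z S h \<xi>" using hf by (auto simp: has_frame_def)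
 have i: "i \<in> {1..r}" by (rule Pend_dom[OF is_frameD(2)[OF F s(1)] s(2)])
 have e: "eT r i i \<in> T_max r" by (rule eT_in) (use i in auto)
 let ?W = "frame_op S h \<xi> i i"
 have "\<phi> (eT r i i) \<in> tensor_M (T_max r) n"
  using \<phi> e unfolding maps_M_def star_extendible_def by blast
 hence "mat (spread r ?W) \<in> tensor_M (T_max r) n"
  using hf e fmap_eT[OF i i] unfolding has_frame_def by metis
 then obtain X where X: "UT r X" "spread r ?W = spread r X" "Nn n * X * Nn n = X"
  by (rule tensor_M_spread[OF r])
 have "fop r S h \<xi> (eT r i i) = ?W"
 proof -
  have "(\<Sum>k\<in>{1..r}. \<Sum>l\<in>{1..r}. sc (eT r i i ({1..r}, k) ({1..r}, l)) * frame_op S h \<xi> k l)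
    = (\<Sum>k\<in>{1..r}. \<Sum>l\<in>{1..r}. if l = i then if k = i then ?W else 0 else 0)"
   unfolding eT_top_entry[OF i i] by (intro sum.cong refl) auto
  thus ?thesis using i by (simp add: fop_def)
 qed
 hence "UT r ?W" using UT_fop[OF F e] by simp
 hence "?W = X" using spread_inj[OF r _ X(1) X(2)] by blast
 hence "Nn n * ?W = ?W" using X(3) Nn_idem(1)[of n n] by (metis mult.assoc order_refl)
 hence "Nn n * (?W * \<xi> s i) = ?W * \<xi> s i" by (simp flip: mult.assoc)
 thus ?thesis using frame_op_apply[OF F s, of i] s by simp
qed

section \<open>Unitary equivalence of frames\<close>

text \<open>Both \<open>K\<close> and its adjoint are triangular and their spreads lie in the stable
  algebra. Hence 1 + \<open>spread r K\<close> and its adjoint belong to the unitisation, and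
  unitarity needs to be checked only in the corner.\<close>

definition diagK :: "nat => bix bop set" where
 "diagK r = {K. UT r K \<and> UT r (adj K) \<and> (\<forall>k\<in>{1..r}. Pk r k * K = K * Pk r k) \<and>
   inTK r (spread r K) \<and> inTK r (spread r (adj K))}"

lemma diagK_unitary:
 assumes r: "r \<ge> 1" and K: "K \<in> diagK r" "(1 + K) * adj (1 + K) = 1" "adj (1 + K) * (1 + K) = 1"
 shows "mat (1 + spread r K) \<in> inner_unitaries (T_max r)"
  and "UT r X ==> (1 + spread r K) * spread r X * adj (1 + spread r K) = spread r ((1 + K) * X * adj (1 + K))"
proof -
 have U: "UT r K" "UT r (adj K)" and T: "inTK r (spread r K)" "inTK r (spread r (adj K))"
  using K(1) by (auto simp: diagK_def)
 let ?u = "1 + spread r K"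
 have au: "adj ?u = 1 + spread r (adj K)" by (simp add: spread_adj)
 have "?u * adj ?u = 1 + spread r (K + adj K + K * adj K)"
  unfolding au by (simp add: distrib_left distrib_right spread_add spread_mult[OF U] add_ac)
 also have "K + adj K + K * adj K = (1 + K) * adj (1 + K) - 1" by (simp add: distrib_left distrib_right add_ac)
 finally have uu: "?u * adj ?u = 1" using K(2) by simp
 have "adj ?u * ?u = 1 + spread r (K + adj K + adj K * K)"
  unfolding au by (simp add: distrib_left distrib_right spread_add spread_mult[OF U(2,1)] add_ac)
 also have "K + adj K + adj K * K = adj (1 + K) * (1 + K) - 1" by (simp add: distrib_left distrib_right add_ac)
 finally have uu': "adj ?u * ?u = 1" using K(3) by simp
 have unit: "mat (1 + spread r Y) \<in> unitisation (T_max r)" if "inTK r (spread r Y)" for Y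
 proof -
  have "mat (1 + spread r Y) = mat (spread r Y) + mat_scale 1 mat_one"
   by (simp add: mat_add one_bop.rep_eq mat_scale_def)
  thus ?thesis using that unfolding unitisation_def inTK_def by blast
 qed
 show "mat ?u \<in> inner_unitaries (T_max r)"
  unfolding inner_unitaries_def mem_Collect_eq mat_adj[symmetric] mat_mult[symmetric] uu uu'
  unfolding au one_bop.rep_eq using unit[OF T(1)] unit[OF T(2)] by blast
 assume X: "UT r X"
 show "?u * spread r X * adj ?u = spread r ((1 + K) * X * adj (1 + K))"
  unfolding au using spread_mult[OF U(1) X] spread_mult[OF X U(2)] spread_mult[OF UT_mult[OF U(1) X] U(2)]
  by (simp add: distrib_left distrib_right spread_add mult.assoc)
qed

lemma diagK_closed:
 assumes r: "r \<ge> 1"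
 shows "0 \<in> diagK r" "a \<in> diagK r ==> b \<in> diagK r ==> a + b \<in> diagK r"
  "a \<in> diagK r ==> b \<in> diagK r ==> a * b \<in> diagK r" "a \<in> diagK r ==> sc c * a \<in> diagK r"
  "k \<in> {1..r} ==> v * eu z = v ==> Pk r k * v = v ==> v * adj v \<in> diagK r"
proof -
 show "0 \<in> diagK r" by (simp add: diagK_def UT_0 inTK_0)
 show "a + b \<in> diagK r" if "a \<in> diagK r" "b \<in> diagK r"
  using that unfolding diagK_def mem_Collect_eq
  by (simp add: UT_add spread_add inTK_add[OF r] distrib_left distrib_right)
 show "a * b \<in> diagK r" if ab: "a \<in> diagK r" "b \<in> diagK r"
 proof -
  have U: "UT r a" "UT r (adj a)" "UT r b" "UT r (adj b)"
   and c: "\<And>k. k \<in> {1..r} ==> Pk r k * a = a * Pk r k" "\<And>k. k \<in> {1..r} ==> Pk r k * b = b * Pk r k"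
   and T: "inTK r (spread r a)" "inTK r (spread r (adj a))" "inTK r (spread r b)" "inTK r (spread r (adj b))"
   using ab by (auto simp: diagK_def)
  show ?thesis
   unfolding diagK_def mem_Collect_eq adj_mult spread_mult[OF U(1,3), symmetric] spread_mult[OF U(4,2), symmetric]
   by (intro conjI UT_mult U inTK_mult[OF r] T ballI commute_mult c)
 qed
 show "sc c * a \<in> diagK r" if a: "a \<in> diagK r"
 proof -
  have e: "adj (sc c * a) = sc (cnj c) * adj a" by (simp add: sc_commute)
  show ?thesis
   using a unfolding diagK_def mem_Collect_eq e spread_sc
   by (auto intro: UT_sc inTK_sc[OF r] simp: sc_left_commute[of "Pk r _" c] mult.assoc)
 qed
 assume k: "k \<in> {1..r}" and v: "v * eu z = v" "Pk r k * v = v"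
 have av: "adj v * Pk r k = adj v" using arg_cong[OF v(2), of adj] by simp
 have "Pk r l * (v * adj v) = v * adj v * Pk r l" if l: "l \<in> {1..r}" for l
 proof (cases "l = k")
  case True
  thus ?thesis using v av by (simp add: mult.assoc) (simp flip: mult.assoc)
 next
  case False
  have "Pk r l * v = 0" using Pk.P_orth[OF l k] False v(2) by (metis assoc_left mult_zero_left)
  moreover from arg_cong[OF this, of adj] have "adj v * Pk r l = 0" by simp
  ultimately show ?thesis by (simp add: mult.assoc) (simp flip: mult.assoc)
 qed
 thus "v * adj v \<in> diagK r"
  unfolding diagK_def using UT_rank_one[OF v(2,2) k k order_refl] inTK_rank_one[OF r v v k k order_refl]
  by simp
qed

lemma fop_conj:
 assumes u: "\<And>s i. s \<in> S ==> i \<in> dom (h s) ==> u * \<xi> s i = \<eta> s i"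
 shows "u * fop r S h \<xi> a * adj u = fop r S h \<eta> a"
proof -
 have au: "adj (\<xi> s i) * adj u = adj (\<eta> s i)" if "s \<in> S" "i \<in> dom (h s)" for s i
  using arg_cong[OF u[OF that], of adj] by simp
 have N: "u * frame_op S h \<xi> i j * adj u = frame_op S h \<eta> i j" for i j
  unfolding frame_op_def sum_distrib_left sum_distrib_right
 proof (intro sum.cong refl)
  fix s assume s: "s \<in> S"
  have "u * (\<xi> s i * adj (\<xi> s j)) * adj u = (u * \<xi> s i) * (adj (\<xi> s j) * adj u)" by (simp add: mult.assoc)
  thus "u * (if i \<in> dom (h s) \<and> j \<in> dom (h s) then \<xi> s i * adj (\<xi> s j) else 0) * adj u
   = (if i \<in> dom (h s) \<and> j \<in> dom (h s) then \<eta> s i * adj (\<eta> s j) else 0)"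
   using u[OF s, of i] au[OF s, of j] by auto
 qed
 have "u * (sc c * X) * adj u = sc c * (u * X * adj u)" for c X
  by (simp only: mult.assoc sc_left_commute[of u c])
 thus ?thesis
  unfolding fop_def sum_distrib_left sum_distrib_right by (intro sum.cong refl) (simp only: N)
qed

text \<open>As the partial maps are the same, corresponding vectors of the two frames lie in the
  same block. A unitary that respects the blocks and matches the vectors in the corner then spreads
  to all summands.\<close>

theorem frame_unitary:
 assumes r: "r \<ge> 1" and F: "is_frame r (Pk r) z S h \<xi>" and G: "is_frame r (Pk r) z S h \<eta>"
 obtains u where "u \<in> inner_unitaries (T_max r)"
  "\<And>a. a \<in> T_max r ==> mat (fmap r S h \<eta> a) = Ad u (mat (fmap r S h \<xi> a))"
proof -
 define A where "A = Sigma S (\<lambda>s. dom (h s))"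
 have A: "fst \<mu> \<in> S" "snd \<mu> \<in> dom (h (fst \<mu>))" if "\<mu> \<in> A" for \<mu> using that by (auto simp: A_def)
 have "finite (dom (h s))" if "s \<in> S" for s
  by (rule finite_subset[of _ "{1..r}"]) (use Pend_dom[OF is_frameD(2)[OF F that]] in blast)+
 hence finA: "finite A" unfolding A_def using is_frameD(1)[OF F] by (intro finite_SigmaI)
 have on: "adj (\<zeta> (fst \<mu>) (snd \<mu>)) * \<zeta> (fst \<nu>) (snd \<nu>) = (if \<mu> = \<nu> then eu z else 0)"
  if "is_frame r (Pk r) z S h \<zeta>" "\<mu> \<in> A" "\<nu> \<in> A" for \<zeta> \<mu> \<nu>
  using is_frameD(5)[OF that(1) A(1)[OF that(2)] A(1)[OF that(3)] A(2)[OF that(2)] A(2)[OF that(3)]]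
  by (simp add: prod_eq_iff)
 have "\<exists>K\<in>diagK r. (1 + K) * adj (1 + K) = 1 \<and> adj (1 + K) * (1 + K) = 1 \<and>
   (\<forall>\<mu>\<in>A. (1 + K) * \<xi> (fst \<mu>) (snd \<mu>) = \<eta> (fst \<mu>) (snd \<mu>))"
 proof (rule orthonormal_unitary[where P = "Pk r" and I = "{1..r}" and k = "\<lambda>\<mu>. the (h (fst \<mu>) (snd \<mu>))" and z = z])
  show "finite A" by (rule finA)
  show "\<xi> (fst \<mu>) (snd \<mu>) * eu z = \<xi> (fst \<mu>) (snd \<mu>) \<and> Pk r (the (h (fst \<mu>) (snd \<mu>))) * \<xi> (fst \<mu>) (snd \<mu>) = \<xi> (fst \<mu>) (snd \<mu>)"
   if "\<mu> \<in> A" for \<mu> using is_frameD(3,4)[OF F A(1)[OF that] A(2)[OF that]] by blast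
  show "\<eta> (fst \<mu>) (snd \<mu>) * eu z = \<eta> (fst \<mu>) (snd \<mu>) \<and> Pk r (the (h (fst \<mu>) (snd \<mu>))) * \<eta> (fst \<mu>) (snd \<mu>) = \<eta> (fst \<mu>) (snd \<mu>)"
   if "\<mu> \<in> A" for \<mu> using is_frameD(3,4)[OF G A(1)[OF that] A(2)[OF that]] by blast
  show "the (h (fst \<mu>) (snd \<mu>)) \<in> {1..r}" if "\<mu> \<in> A" for \<mu>
   by (rule Pend_ran[OF is_frameD(2)[OF F A(1)[OF that]] A(2)[OF that]])
  show "Pk r i * a = a * Pk r i" if "i \<in> {1..r}" "a \<in> diagK r" for i a using that by (simp add: diagK_def)
 qed (use on[OF F] on[OF G] diagK_closed[OF r] in blast)+
 then obtain K where K: "K \<in> diagK r" "(1 + K) * adj (1 + K) = 1" "adj (1 + K) * (1 + K) = 1"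
  "\<And>\<mu>. \<mu> \<in> A ==> (1 + K) * \<xi> (fst \<mu>) (snd \<mu>) = \<eta> (fst \<mu>) (snd \<mu>)" by blast
 have K4: "(1 + K) * \<xi> s i = \<eta> s i" if "s \<in> S" "i \<in> dom (h s)" for s i
  using K(4)[of "(s, i)"] that by (simp add: A_def)
 show ?thesis
 proof (rule that[OF diagK_unitary(1)[OF r K(1-3)]])
  fix a assume a: "a \<in> T_max r"
  have "(1 + K) * fop r S h \<xi> a * adj (1 + K) = fop r S h \<eta> a"
   by (rule fop_conj) (rule K4)
  hence "fmap r S h \<eta> a = (1 + spread r K) * fmap r S h \<xi> a * adj (1 + spread r K)"
   unfolding fmap_fop diagK_unitary(2)[OF r K(1-3) UT_fop[OF F a]] by simp
  thus "mat (fmap r S h \<eta> a) = Ad (mat (1 + spread r K)) (mat (fmap r S h \<xi> a))"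
   by (simp only: Ad_def mat_mult mat_adj)
 qed
qed

section \<open>Unitaries of the unitisation inside the ring\<close>

definition uni :: "nat => bix bop => bool" where
 "uni r v \<longleftrightarrow> (\<exists>Y c. UT r Y \<and> inTK r (spread r Y) \<and> v = spread r Y + sc c)"

text \<open>The adjoint must lie in the unitisation as well; this is a genuine condition, since the
  algebra is not closed under adjoints, and it later forces the corner to be diagonal.\<close>

definition IU :: "nat => bix bop => bool" where
 "IU r v \<longleftrightarrow> uni r v \<and> uni r (adj v) \<and> v * adj v = 1 \<and> adj v * v = 1"

lemma unitisation_uni:
 assumes "r \<ge> 1"
 shows "u \<in> unitisation (T_max r) \<longleftrightarrow> (\<exists>v. u = mat v \<and> uni r v)"
proof
 assume "u \<in> unitisation (T_max r)"
 then obtain b c where b: "b \<in> TK r" "u = b + mat_scale c mat_one" unfolding unitisation_def by blast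
 have mb: "mat (Bop b) = b" by (rule mat_Bop[OF tensor_K_bounded[OF b(1)]])
 have "inTK r (Bop b)" unfolding inTK_def mb by (rule b(1))
 then obtain Y where Y: "UT r Y" "Bop b = spread r Y" by (rule inTK_spread[OF assms])
 have "u = mat (spread r Y + sc c)"
  unfolding mat_add Y(2)[symmetric] mb sc.rep_eq by (rule b(2))
 moreover have "uni r (spread r Y + sc c)"
  unfolding uni_def using Y \<open>inTK r (Bop b)\<close> by auto
 ultimately show "\<exists>v. u = mat v \<and> uni r v" by blast
next
 assume "\<exists>v. u = mat v \<and> uni r v"
 then obtain Y c where Y: "inTK r (spread r Y)" "u = mat (spread r Y + sc c)" unfolding uni_def by blast
 show "u \<in> unitisation (T_max r)"
  unfolding unitisation_def Y(2) mat_add sc.rep_eq using Y(1) unfolding inTK_def by blast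
qed

lemma mat_inject: "mat a = mat b \<longleftrightarrow> a = b"
 by (metis bop_eqI)

lemma inner_unitaries_IU:
 assumes "r \<ge> 1"
 shows "inner_unitaries (T_max r) = mat ` {v. IU r v}"
proof (intro equalityI subsetI)
 fix u assume u: "u \<in> inner_unitaries (T_max r)"
 then obtain v where v: "u = mat v" "uni r v" unfolding inner_unitaries_def unitisation_uni[OF assms] by blast
 obtain w where w: "mat_adj u = mat w" "uni r w" using u unfolding inner_unitaries_def unitisation_uni[OF assms] by blast
 have "w = adj v" using w(1) v(1) by (simp add: mat_adj[symmetric] mat_inject)
 moreover have "mat (v * adj v) = mat 1" "mat (adj v * v) = mat 1"
  using u v(1) unfolding inner_unitaries_def by (simp_all add: mat_mult mat_adj one_bop.rep_eq)
 ultimately show "u \<in> mat ` {v. IU r v}" using v w unfolding IU_def mat_inject by blast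
next
 fix u assume "u \<in> mat ` {v. IU r v}"
 then obtain v where v: "u = mat v" "uni r v" "uni r (adj v)" "v * adj v = 1" "adj v * v = 1"
  unfolding IU_def by blast
 have "mat v \<bullet>\<bullet> mat_adj (mat v) = mat_one" "mat_adj (mat v) \<bullet>\<bullet> mat v = mat_one"
  using v(4,5) by (simp_all add: mat_mult[symmetric] mat_adj[symmetric] one_bop.rep_eq)
 moreover have "mat v \<in> unitisation (T_max r)" "mat_adj (mat v) \<in> unitisation (T_max r)"
  unfolding unitisation_uni[OF assms] using v(2,3) mat_adj[of v] by metis+
 ultimately show "u \<in> inner_unitaries (T_max r)" unfolding v(1) inner_unitaries_def by blast
qed

lemma uni_mult:
 assumes r: "r \<ge> 1" and "uni r v" "uni r w"
 shows "uni r (v * w)"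
proof -
 obtain Y c where Y: "UT r Y" "inTK r (spread r Y)" "v = spread r Y + sc c" using assms(2) unfolding uni_def by blast
 obtain X d where X: "UT r X" "inTK r (spread r X)" "w = spread r X + sc d" using assms(3) unfolding uni_def by blast
 have UT: "UT r (Y * X + sc d * Y + sc c * X)" by (intro UT_add UT_mult UT_sc X Y)
 have e: "spread r (Y * X + sc d * Y + sc c * X) = spread r Y * spread r X + sc d * spread r Y + sc c * spread r X"
  by (simp add: spread_add spread_sc spread_mult[OF Y(1) X(1)])
 have "v * w = spread r Y * spread r X + sc d * spread r Y + sc c * spread r X + sc (c * d)"
  unfolding Y(3) X(3) by (simp add: distrib_left distrib_right sc_mult sc_commute[of "spread r Y"] add_ac)
 hence "v * w = spread r (Y * X + sc d * Y + sc c * X) + sc (c * d)" unfolding e .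
 moreover have "inTK r (spread r (Y * X + sc d * Y + sc c * X))"
  unfolding e by (intro inTK_add[OF r] inTK_mult[OF r] inTK_sc[OF r] X Y)
 ultimately show ?thesis unfolding uni_def using UT by blast
qed

text \<open>Supplies the unitary for the triangle inequality of the distance between
  classes.\<close>

lemma IU_mult: "r \<ge> 1 ==> IU r v ==> IU r w ==> IU r (v * w)"
proof -
 assume a: "r \<ge> 1" "IU r v" "IU r w"
 have "v * w * adj (v * w) = v * (w * adj w) * adj v" "adj (v * w) * (v * w) = adj w * (adj v * v) * w"
  by (simp_all add: mult.assoc)
 thus ?thesis using a uni_mult[OF a(1), of v w] uni_mult[OF a(1), of "adj w" "adj v"]
  unfolding IU_def by simp
qed

lemma IU_adj: "IU r v ==> IU r (adj v)"
 unfolding IU_def by simp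

lemma IU_1: "IU r 1"
proof -
 have "uni r 1" unfolding uni_def by (rule exI[of _ 0], rule exI[of _ 1]) (simp add: UT_0 inTK_0)
 thus ?thesis unfolding IU_def by simp
qed

lemma unitary_nrm:
 assumes "v * adj v = 1" "adj v * v = 1"
 shows "nrm (v * x * adj v) = nrm x"
proof -
 have le: "nrm (w * y * adj w) \<le> nrm y" if "adj w * w = 1" for w y :: "'i bop"
 proof -
  have "nrm w = 1" using nrm_cstar_eq[of w] that by (simp add: power2_eq_1_iff) (metis nrm_nonneg not_one_le_zero neg_0_le_iff_le order_trans zero_le_one)
  thus ?thesis using nrm_mult[of "w * y" "adj w"] nrm_mult[of w y] by simp
 qed
 have "adj v * (v * x * adj v) * adj (adj v) = (adj v * v) * x * (adj v * v)" by (simp add: mult.assoc)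
 hence "adj v * (v * x * adj v) * adj (adj v) = x" using assms(2) by simp
 hence "nrm x \<le> nrm (v * x * adj v)" using le[of "adj v" "v * x * adj v"] assms(1) by simp
 thus ?thesis using le[OF assms(2), of x] by simp
qed

section \<open>Multiplicities are determined by a map up to a small perturbation\<close>

text \<open>The leading factor \<open>W a a\<close> gives the product its meaning for n = 0, the
  case of partial maps with a one-point domain.\<close>

primrec chain :: "(nat => nat => 'i bop) => (nat => 'i bop) => nat => nat => 'i bop" where
 "chain W p a 0 = p a * W a a"
| "chain W p a (Suc n) = chain W p a n * (W (a + n) (Suc (a + n)) * p (Suc (a + n)))"

lemma nrm_mult_le1: "nrm x \<le> 1 ==> nrm y \<le> 1 ==> nrm (x * y) \<le> 1"
 using nrm_mult[of x y] mult_mono[of "nrm x" 1 "nrm y" 1] by simp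

lemma chain_nrm:
 assumes "\<And>i. nrm (p i) \<le> 1" "\<And>i j. a \<le> i ==> i \<le> j ==> j \<le> a + n ==> nrm (W i j) \<le> 1"
 shows "nrm (chain W p a n) \<le> 1"
 using assms(2)
proof (induction n)
 case 0
 thus ?case using assms(1) by (simp add: nrm_mult_le1)
next
 case (Suc n)
 have "nrm (chain W p a n) \<le> 1" by (rule Suc.IH) (use Suc.prems in simp)
 moreover have "nrm (W (a + n) (Suc (a + n))) \<le> 1" by (rule Suc.prems) simp_all
 ultimately show ?case using assms(1) by (simp add: nrm_mult_le1)
qed

text \<open>The chain has n + 1 factors from the family W; exchanging them one by one costs e each
  time, since all other factors have norm at most 1. From here stems the threshold 1 / (r +
  1).\<close>

lemma chain_diff:
 assumes p: "\<And>i. nrm (p i) \<le> 1"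
  and W: "\<And>i j. a \<le> i ==> i \<le> j ==> j \<le> a + n ==> nrm (W i j) \<le> 1"
  and V: "\<And>i j. a \<le> i ==> i \<le> j ==> j \<le> a + n ==> nrm (V i j) \<le> 1"
  and d: "\<And>i j. a \<le> i ==> i \<le> j ==> j \<le> a + n ==> nrm (W i j - V i j) \<le> e"
 shows "nrm (chain W p a n - chain V p a n) \<le> (real n + 1) * e"
 using W V d
proof (induction n)
 case 0
 have "nrm (p a * (W a a - V a a)) \<le> 1 * e"
  by (rule order_trans[OF nrm_mult mult_mono]) (use p 0(3)[of a a] in auto)
 thus ?case by (simp add: right_diff_distrib)
next
 case (Suc n)
 let ?X = "chain W p a n" and ?Y = "chain V p a n"
 let ?x = "W (a + n) (Suc (a + n)) * p (Suc (a + n))" and ?y = "V (a + n) (Suc (a + n)) * p (Suc (a + n))"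
 have 1: "nrm (?X - ?Y) \<le> (real n + 1) * e" by (rule Suc.IH) (use Suc.prems in simp_all)
 have 2: "nrm ?Y \<le> 1" by (rule chain_nrm[OF p]) (use Suc.prems(2) in simp)
 have 3: "nrm ?x \<le> 1" by (rule nrm_mult_le1[OF Suc.prems(1) p]) simp_all
 have dd: "nrm (W (a + n) (Suc (a + n)) - V (a + n) (Suc (a + n))) \<le> e" by (rule Suc.prems(3)) simp_all
 have e0: "0 \<le> e" using dd nrm_nonneg order_trans by blast
 have 4: "nrm (?x - ?y) \<le> e"
 proof -
  have "nrm ((W (a + n) (Suc (a + n)) - V (a + n) (Suc (a + n))) * p (Suc (a + n))) \<le> e * 1"
   by (rule order_trans[OF nrm_mult mult_mono]) (use p dd e0 in auto)
  thus ?thesis by (simp add: left_diff_distrib)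
 qed
 have "?X * ?x - ?Y * ?y = (?X - ?Y) * ?x + ?Y * (?x - ?y)" by (simp add: left_diff_distrib right_diff_distrib)
 hence "nrm (?X * ?x - ?Y * ?y) \<le> nrm (?X - ?Y) * nrm ?x + nrm ?Y * nrm (?x - ?y)"
  using nrm_add[of "(?X - ?Y) * ?x" "?Y * (?x - ?y)"] nrm_mult[of "?X - ?Y" ?x] nrm_mult[of ?Y "?x - ?y"] by simp
 also have "... \<le> (real n + 1) * e * 1 + 1 * e"
  using 1 2 3 4 e0 by (intro add_mono mult_mono) auto
 also have "... = (real (Suc n) + 1) * e" by (simp add: algebra_simps)
 finally show ?case by simp
qed

text \<open>Since u commutes with the p i, the inner pairs \<open>adj u * u\<close> meet and are
  absorbed by W.\<close>

lemma chain_conj: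
 assumes pu: "\<And>i. p i * u = u * p i" and uu: "adj u * u = T"
  and TW: "\<And>i j. a \<le> i ==> i \<le> j ==> j \<le> a + n ==> T * W i j = W i j" and padj: "\<And>i. adj (p i) = p i"
 shows "chain (\<lambda>i j. u * W i j * adj u) p a n = u * chain W p a n * adj u"
proof -
 have up: "adj u * p i = p i * adj u" for i
  using arg_cong[OF pu[of i], of adj] padj by simp
 show ?thesis using TW
 proof (induction n)
  case 0
  have "p a * (u * W a a * adj u) = (p a * u) * W a a * adj u" by (simp add: mult.assoc)
  thus ?case unfolding pu by (simp add: mult.assoc)
 next
  case (Suc n)
  let ?W = "W (a + n) (Suc (a + n))"
  have IH: "chain (\<lambda>i j. u * W i j * adj u) p a n = u * chain W p a n * adj u"
   by (rule Suc.IH) (use Suc.prems in simp)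
  have "chain (\<lambda>i j. u * W i j * adj u) p a (Suc n)
    = u * chain W p a n * ((adj u * u) * ?W) * (adj u * p (Suc (a + n)))"
   unfolding chain.simps IH by (simp add: mult.assoc)
  also have "(adj u * u) * ?W = ?W" unfolding uu by (rule Suc.prems) simp_all
  finally show ?case unfolding up by (simp add: mult.assoc)
 qed
qed

lemma Pk_vec:
 assumes "Pk r k * x = x" "k \<in> {1..r}" "l \<in> {1..r}"
 shows "Pk r l * x = (if l = k then x else 0)"
proof -
 have "Pk r l * x = Pk r l * Pk r k * x" using assms(1) by (simp add: mult.assoc)
 thus ?thesis using assms(1) unfolding Pk.P_orth[OF assms(3,2)] by simp
qed

lemma adj_frame_op: "adj (frame_op S h \<xi> i j) = frame_op S h \<xi> j i"
 unfolding frame_op_def adj_sum by (intro sum.cong refl) auto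

text \<open>The projection at m discards every copy whose map is undefined at m or takes a value
  other than \<open>\<gamma> m\<close>; what is left are the copies that agree with \<gamma> along
  the whole chain.\<close>

lemma chain_frame:
 assumes F: "is_frame r (Pk r) z S h \<xi>" and \<gamma>: "\<And>i. \<gamma> i \<in> {1..r}"
 shows "chain (frame_op S h \<xi>) (\<lambda>i. Pk r (\<gamma> i)) a n =
  (\<Sum>s\<in>S. if \<forall>m\<in>{a..a + n}. h s m = Some (\<gamma> m) then \<xi> s a * adj (\<xi> s (a + n)) else 0)"
proof (induction n)
 case 0
 show ?case unfolding chain.simps frame_op_def sum_distrib_left
 proof (rule sum.cong[OF refl])
  fix s assume s: "s \<in> S"
  show "Pk r (\<gamma> a) * (if a \<in> dom (h s) \<and> a \<in> dom (h s) then \<xi> s a * adj (\<xi> s a) else 0) =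
   (if \<forall>m\<in>{a..a + 0}. h s m = Some (\<gamma> m) then \<xi> s a * adj (\<xi> s (a + 0)) else 0)"
  proof (cases "a \<in> dom (h s)")
   case True
   hence "Pk r (\<gamma> a) * \<xi> s a = (if \<gamma> a = the (h s a) then \<xi> s a else 0)"
    by (intro Pk_vec is_frameD(4)[OF F s] Pend_ran[OF is_frameD(2)[OF F s]] \<gamma>)
   hence "Pk r (\<gamma> a) * (\<xi> s a * adj (\<xi> s a)) = (if \<gamma> a = the (h s a) then \<xi> s a * adj (\<xi> s a) else 0)"
    by (simp flip: mult.assoc)
   thus ?thesis using True by auto
  next
   case False
   thus ?thesis by auto
  qed
 qed
next
 case (Suc n)
 let ?m = "Suc (a + n)"
 have step: "adj (\<xi> s (a + n)) * (frame_op S h \<xi> (a + n) ?m * Pk r (\<gamma> ?m))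
   = (if h s ?m = Some (\<gamma> ?m) then adj (\<xi> s ?m) else 0)"
  if s: "s \<in> S" "a + n \<in> dom (h s)" for s
 proof -
  have e: "adj (\<xi> s (a + n)) * frame_op S h \<xi> (a + n) ?m = (if ?m \<in> dom (h s) then adj (\<xi> s ?m) else 0)"
   using arg_cong[OF frame_op_apply[OF F s, of ?m], of adj] by (simp add: adj_frame_op split: if_splits)
  show ?thesis
  proof (cases "?m \<in> dom (h s)")
   case True
   have "Pk r (\<gamma> ?m) * \<xi> s ?m = (if \<gamma> ?m = the (h s ?m) then \<xi> s ?m else 0)"
    by (intro Pk_vec is_frameD(4)[OF F s(1) True] Pend_ran[OF is_frameD(2)[OF F s(1)] True] \<gamma>)
   from arg_cong[OF this, of adj]
   have "adj (\<xi> s ?m) * Pk r (\<gamma> ?m) = (if \<gamma> ?m = the (h s ?m) then adj (\<xi> s ?m) else 0)" by (simp split: if_splits)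
   thus ?thesis using e True by (auto simp flip: mult.assoc)
  next
   case False
   hence "h s ?m = None" by auto
   thus ?thesis using e False by (simp flip: mult.assoc)
  qed
 qed
 show ?case unfolding chain.simps Suc sum_distrib_right
 proof (rule sum.cong[OF refl])
  fix s assume s: "s \<in> S"
  have dom: "a + n \<in> dom (h s)" if "\<forall>m\<in>{a..a + n}. h s m = Some (\<gamma> m)" using that by auto
  have sp: "(\<forall>m\<in>{a..a + Suc n}. h s m = Some (\<gamma> m)) \<longleftrightarrow>
    (\<forall>m\<in>{a..a + n}. h s m = Some (\<gamma> m)) \<and> h s ?m = Some (\<gamma> ?m)"
  proof -
   have "{a..a + Suc n} = insert ?m {a..a + n}" by auto
   thus ?thesis by auto
  qed
  show "(if \<forall>m\<in>{a..a + n}. h s m = Some (\<gamma> m) then \<xi> s a * adj (\<xi> s (a + n)) else 0) *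
    (frame_op S h \<xi> (a + n) ?m * Pk r (\<gamma> ?m))
    = (if \<forall>m\<in>{a..a + Suc n}. h s m = Some (\<gamma> m) then \<xi> s a * adj (\<xi> s (a + Suc n)) else 0)"
   unfolding sp using step[OF s dom]
   by (cases "\<forall>m\<in>{a..a + n}. h s m = Some (\<gamma> m)"; cases "h s ?m = Some (\<gamma> ?m)")
    (simp_all only: mult.assoc if_P if_not_P simp_thms mult_zero_left mult_zero_right add_Suc_right cong: if_weak_cong)
 qed
qed

lemma projection_nrm:
 assumes "adj H = H" "H * H = H"
 shows "nrm H \<le> 1"
proof -
 have "nrm H = nrm H * nrm H" using nrm_cstar_eq[of H] assms by (simp add: power2_eq_square)
 thus ?thesis by (metis mult_cancel_right1 nrm_nonneg order_refl zero_le_one)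
qed

text \<open>The operator is a partial isometry, so its product with its adjoint is a projection and
  the C*-identity gives the bound.\<close>

lemma frame_op_nrm:
 assumes F: "is_frame r (Pk r) z S h \<xi>"
 shows "nrm (frame_op S h \<xi> i j) \<le> 1"
proof -
 let ?H = "frame_op S h \<xi> j i * frame_op S h \<xi> i j"
 have *: "frame_op S h \<xi> i j * frame_op S h \<xi> j i * frame_op S h \<xi> i j = frame_op S h \<xi> i j"
 proof -
  have "frame_op S h \<xi> i j * frame_op S h \<xi> j i * frame_op S h \<xi> i j
    = (\<Sum>s\<in>S. frame_op S h \<xi> i j * (frame_op S h \<xi> j i * (if i \<in> dom (h s) \<and> j \<in> dom (h s) then \<xi> s i * adj (\<xi> s j) else 0)))"
   by (subst (3) frame_op_def) (simp add: sum_distrib_left mult.assoc)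
  also have "... = frame_op S h \<xi> i j"
   unfolding frame_op_def[of S h \<xi> i j, symmetric]
  proof (subst (2) frame_op_def, rule sum.cong[OF refl])
   fix s assume s: "s \<in> S"
   show "frame_op S h \<xi> i j * (frame_op S h \<xi> j i * (if i \<in> dom (h s) \<and> j \<in> dom (h s) then \<xi> s i * adj (\<xi> s j) else 0))
    = (if i \<in> dom (h s) \<and> j \<in> dom (h s) then \<xi> s i * adj (\<xi> s j) else 0)"
   proof (cases "i \<in> dom (h s) \<and> j \<in> dom (h s)")
    case True
    have "frame_op S h \<xi> i j * (frame_op S h \<xi> j i * (\<xi> s i * adj (\<xi> s j)))
     = frame_op S h \<xi> i j * (frame_op S h \<xi> j i * \<xi> s i) * adj (\<xi> s j)" by (simp only: mult.assoc)
    thus ?thesis unfolding if_P[OF True]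
     using frame_op_apply[OF F s, of i j] frame_op_apply[OF F s, of j i] True by simp
   next
    case False
    show ?thesis unfolding if_not_P[OF False] by simp
   qed
  qed
  finally show ?thesis .
 qed
 have "adj ?H = ?H" by (simp add: adj_frame_op)
 moreover have "?H * ?H = ?H" using * by (simp add: mult.assoc)
 ultimately have "nrm ?H \<le> 1" by (rule projection_nrm)
 hence "(nrm (frame_op S h \<xi> i j))\<^sup>2 \<le> 1"
  using nrm_cstar_eq[of "frame_op S h \<xi> i j"] by (simp add: adj_frame_op)
 hence "(nrm (frame_op S h \<xi> i j))\<^sup>2 \<le> 1\<^sup>2" by simp
 thus ?thesis by (rule power2_le_imp_le) simp
qed

text \<open>The value depends on the coefficients alone, so equal combinations of two orthonormal
  families have equal norms.\<close>

lemma orthonormal_combination_inner: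
 assumes "orthonormal z m x"
 shows "adj (\<Sum>t<m. sc (c t) * x t) * (\<Sum>t<m. sc (c t) * x t) = (\<Sum>t<m. sc (cnj (c t) * c t) * eu z)"
proof -
 have "adj (\<Sum>t<m. sc (c t) * x t) * (\<Sum>t<m. sc (c t) * x t)
   = (\<Sum>s<m. \<Sum>t<m. sc (cnj (c s) * c t) * (adj (x s) * x t))"
  unfolding adj_sum sum_product by (intro sum.cong refl) (rule inner_sc)
 also have "... = (\<Sum>s<m. \<Sum>t<m. if t = s then sc (cnj (c s) * c s) * eu z else 0)"
  using assms unfolding orthonormal_def by (intro sum.cong refl) auto
 also have "... = (\<Sum>s<m. sc (cnj (c s) * c s) * eu z)" by (intro sum.cong refl) simp
 finally show ?thesis .
qed

lemma tau_top: "tau r {1..r} = Pk.pI r {1..r}"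
 by (rule bix_eqI) (unfold tau_entry pI_entry[OF finite_atLeastAtMost], rule if_cong, blast, rule refl, rule refl)

text \<open>The full interval is itself one of the summands, and there spreading changes
  nothing.\<close>

lemma top_spread:
 assumes r: "r \<ge> 1" and Y: "UT r Y"
 shows "Pk.pI r {1..r} * spread r Y = Y" "spread r Y * Pk.pI r {1..r} = Y"
proof -
 have g: "Pk.pI r {1..r} * spread r Z = Pk.pI r {1..r} * Z * Pk.pI r {1..r}" for Z
  using cp_spread_mult[OF top_interval[OF r], of Z 1] by (simp add: tau_top)
 show "Pk.pI r {1..r} * spread r Y = Y" unfolding g using UT_D(1,2)[OF Y] by simp
 have "Pk.pI r {1..r} * adj Y * Pk.pI r {1..r} = adj Y"
  using arg_cong[OF UT_D(1)[OF Y], of adj] arg_cong[OF UT_D(2)[OF Y], of adj] by simp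
 hence "adj (Pk.pI r {1..r} * spread r (adj Y)) = Y" unfolding g by simp
 thus "spread r Y * Pk.pI r {1..r} = Y" by (simp add: spread_adj)
qed

lemma block_diag_commute:
 assumes X: "Pk.pI r {1..r} * X = X" "X * Pk.pI r {1..r} = X"
  "\<And>m m'. m \<in> {1..r} ==> m' \<in> {1..r} ==> m \<noteq> m' ==> Pk r m * X * Pk r m' = 0" and l: "l \<in> {1..r}"
 shows "Pk r l * X = X * Pk r l"
proof -
 have "Pk r l * X = Pk r l * (X * Pk.pI r {1..r})" using X(2) by simp
 also have "... = (\<Sum>m\<in>{1..r}. Pk r l * X * Pk r m)" by (simp add: Pk.pI_def sum_distrib_left mult.assoc)
 also have "... = (\<Sum>m\<in>{l}. Pk r l * X * Pk r m)"
  using l X(3)[OF l] by (intro sum.mono_neutral_right) auto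
 finally have 1: "Pk r l * X = Pk r l * X * Pk r l" by simp
 have "X * Pk r l = Pk.pI r {1..r} * X * Pk r l" using X(1) by simp
 also have "... = (\<Sum>m\<in>{1..r}. Pk r m * X * Pk r l)" by (simp add: Pk.pI_def sum_distrib_right)
 also have "... = (\<Sum>m\<in>{l}. Pk r m * X * Pk r l)"
  using l X(3)[OF _ l] by (intro sum.mono_neutral_right) auto
 finally show ?thesis using 1 by simp
qed

text \<open>An element of the unitisation commutes with the projection onto the corner and is upper
  triangular in it. For an inner unitary this holds for v and for \<open>adj v\<close>, so its
  corner is unitary and diagonal with respect to the blocks.\<close>

lemma IU_top:
 assumes r: "r \<ge> 1" and v: "IU r v" and u_def: "u = Pk.pI r {1..r} * v"
 shows "u * Pk.pI r {1..r} = u" "v * Pk.pI r {1..r} = u" "adj u * u = Pk.pI r {1..r}"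
  "k \<in> {1..r} ==> Pk r k * u = u * Pk r k"
proof -
 let ?T = "Pk.pI r {1..r}"
 have TT: "?T * ?T = ?T" by (rule Pk.pI_pI) auto
 have com: "?T * w = w * ?T \<and> (\<forall>k\<in>{1..r}. \<forall>l\<in>{1..r}. l < k \<longrightarrow> Pk r k * (?T * w) * Pk r l = 0)" if w: "uni r w" for w
 proof -
  obtain Y c where Y: "UT r Y" "w = spread r Y + sc c" using w unfolding uni_def by blast
  have e: "?T * w = Y + sc c * ?T" "w * ?T = Y + sc c * ?T"
   unfolding Y(2) by (simp_all add: distrib_left distrib_right top_spread[OF r Y(1)] sc_commute)
  have "Pk r k * (?T * w) * Pk r l = 0" if kl: "k \<in> {1..r}" "l \<in> {1..r}" "l < k" for k l
  proof -
   have "Pk r k * ?T * Pk r l = 0" using Pk.P_pI[OF kl(1) subset_refl] Pk.P_orth[OF kl(1,2)] kl by simp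
   thus ?thesis unfolding e(1)
    using UT_D(3)[OF Y(1) kl] by (simp add: distrib_left distrib_right mult.assoc sc_left_commute[of "Pk r k" c])
  qed
  thus ?thesis using e by simp
 qed
 have 1: "?T * v = v * ?T" "?T * adj v = adj v * ?T" using com v unfolding IU_def by blast+
 show vT: "v * ?T = u" using 1 u_def by simp
 show uT: "u * ?T = u" using 1 TT unfolding u_def by (metis mult.assoc)
 have au: "adj u = ?T * adj v" using 1(2) by (simp add: u_def)
 have "adj u * u = ?T * (adj v * v) * ?T" unfolding au vT[symmetric] by (simp add: mult.assoc)
 thus "adj u * u = ?T" using v TT unfolding IU_def by simp
 have Tu: "?T * u = u" using TT by (simp add: u_def flip: mult.assoc)
 assume k: "k \<in> {1..r}"
 show "Pk r k * u = u * Pk r k"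
 proof (rule block_diag_commute[OF Tu uT _ k])
  fix m m' assume m: "m \<in> {1..r}" "m' \<in> {1..r}" "m \<noteq> m'"
  show "Pk r m * u * Pk r m' = 0"
  proof (cases "m' < m")
   case True
   thus ?thesis using com[of v] v m unfolding IU_def u_def by blast
  next
   case False
   hence "Pk r m' * (?T * adj v) * Pk r m = 0" using com[of "adj v"] v m unfolding IU_def by auto
   from arg_cong[OF this[folded au], of adj] show ?thesis by (simp add: mult.assoc)
  qed
 qed
qed

lemma UT_frame_op:
 assumes F: "is_frame r (Pk r) z S h \<xi>" and ij: "1 \<le> i" "i \<le> j" "j \<le> r"
 shows "UT r (frame_op S h \<xi> i j)"
proof -
 have ij': "i \<in> {1..r}" "j \<in> {1..r}" using ij by auto
 have "(\<Sum>k\<in>{1..r}. \<Sum>l\<in>{1..r}. sc (eT r i j ({1..r}, k) ({1..r}, l)) * frame_op S h \<xi> k l)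
   = (\<Sum>k\<in>{1..r}. \<Sum>l\<in>{1..r}. if l = j then if k = i then frame_op S h \<xi> i j else 0 else 0)"
  unfolding eT_top_entry[OF ij'] by (intro sum.cong refl) auto
 hence "fop r S h \<xi> (eT r i j) = frame_op S h \<xi> i j" using ij' by (simp add: fop_def)
 thus ?thesis using UT_fop[OF F eT_in[OF ij]] by simp
qed

text \<open>For a chain \<open>a, \<dots>, a + n = dom g\<close> the product of the \<open>W\<^bsub>i,i+1\<^esub>\<close> interlaced with the projections
 \<open>P\<^bsub>g i\<^esub>\<close> has rank the number of \<open>s\<close> whose partial map extends \<open>g\<close>; a perturbation of norm less
 than 1 cannot lower the rank of a partial isometry.\<close>

theorem frame_count_le:
 assumes r: "r \<ge> 1" and F: "is_frame r (Pk r) z S h \<xi>" and G: "is_frame r (Pk r) z S' h' \<eta>"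
  and v: "IU r v"
  and close: "\<And>i j. 1 \<le> i ==> i \<le> j ==> j \<le> r ==>
   nrm (spread r (frame_op S h \<xi> i j) - v * spread r (frame_op S' h' \<eta> i j) * adj v) \<le> \<epsilon>"
  and \<epsilon>: "(real r + 1) * \<epsilon> < 1" and g: "g \<in> Pend r"
 shows "card {s \<in> S. g \<subseteq>\<^sub>m h s} \<le> card {s \<in> S'. g \<subseteq>\<^sub>m h' s}"
proof (rule ccontr)
 let ?T = "Pk.pI r {1..r}"
 define Sg where "Sg = {s \<in> S. g \<subseteq>\<^sub>m h s}"
 define Tg where "Tg = {s \<in> S'. g \<subseteq>\<^sub>m h' s}"
 define N where "N = card Sg"
 define M where "M = card Tg"
 assume "\<not> card {s \<in> S. g \<subseteq>\<^sub>m h s} \<le> card {s \<in> S'. g \<subseteq>\<^sub>m h' s}"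
 hence MN: "M < N" by (simp add: N_def M_def Sg_def Tg_def)
 obtain e where e: "bij_betw e {..<N} Sg"
  using ex_bij_betw_nat_finite[of Sg] is_frameD(1)[OF F] unfolding N_def Sg_def atLeast0LessThan by auto
 obtain f where f: "bij_betw f {..<M} Tg"
  using ex_bij_betw_nat_finite[of Tg] is_frameD(1)[OF G] unfolding M_def Tg_def atLeast0LessThan by auto
 have eS: "e s \<in> S" "g \<subseteq>\<^sub>m h (e s)" if "s < N" for s
  using bij_betwE[OF e] that unfolding Sg_def by blast+
 obtain a b where ab: "dom g = {a..b}" "1 \<le> a" "a \<le> b" "b \<le> r"
  using g unfolding Pend_def intervals_def by blast
 define n where "n = b - a"
 have bn: "b = a + n" using ab by (simp add: n_def)
 \<comment> \<open>Off the domain the value 1 is a filler that keeps \<open>\<gamma>\<close> within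
   1, ..., r.\<close>
 define \<gamma> where "\<gamma> i = (if i \<in> dom g then the (g i) else 1)" for i
 have \<gamma>: "\<gamma> i \<in> {1..r}" for i using Pend_ran[OF g] r by (auto simp: \<gamma>_def)
 have le: "(\<forall>m\<in>{a..a + n}. k m = Some (\<gamma> m)) \<longleftrightarrow> g \<subseteq>\<^sub>m k" for k
  unfolding map_le_def ab(1) bn using ab(1) bn by (auto simp: \<gamma>_def domI) (metis atLeastAtMost_iff domD option.sel)+
 let ?A = "frame_op S h \<xi>" and ?B = "frame_op S' h' \<eta>"
 let ?p = "\<lambda>i. Pk r (\<gamma> i)"
 define u where "u = ?T * v"
 note u = IU_top[OF r v u_def]
 let ?C = "\<lambda>i j. u * ?B i j * adj u"
 have UA: "UT r (?A i j)" and UB: "UT r (?B i j)" if "1 \<le> i" "i \<le> j" "j \<le> r" for i j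
  by (rule UT_frame_op[OF F that], rule UT_frame_op[OF G that])
 have pu: "?p i * u = u * ?p i" for i by (rule u(4)[OF \<gamma>])
 have TB: "?T * ?B i j = ?B i j" if "a \<le> i" "i \<le> j" "j \<le> a + n" for i j
  by (rule UT_D(1)[OF UB]) (use that ab bn in auto)
 have Y: "chain ?C ?p a n = u * chain ?B ?p a n * adj u"
  by (rule chain_conj[OF pu u(3) TB]) auto
 have d: "nrm (?A i j - ?C i j) \<le> \<epsilon>" if "a \<le> i" "i \<le> j" "j \<le> a + n" for i j
 proof -
  have ij: "1 \<le> i" "i \<le> j" "j \<le> r" using that ab bn by auto
  have tt: "tau r {1..r} = ?T" by (rule tau_top)
  have Tv: "?T * v = u" by (simp add: u_def)
  have aTv: "adj v * ?T = adj u" by (simp add: u_def)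
  have "cp r {1..r} (v * spread r (?B i j) * adj v) = (?T * v) * spread r (?B i j) * (adj v * ?T)"
   unfolding cp_def tt by (simp add: mult.assoc)
  also have "... = u * (?T * spread r (?B i j)) * adj u"
   unfolding Tv aTv by (subst (1) u(1)[symmetric]) (simp only: mult.assoc)
  also have "... = ?C i j" unfolding top_spread(1)[OF r UB[OF ij]] ..
  finally have e: "cp r {1..r} (v * spread r (?B i j) * adj v) = ?C i j" .
  have cpd: "cp r {1..r} (x - y) = cp r {1..r} x - cp r {1..r} y" for x y
   unfolding cp_def by (simp only: left_diff_distrib right_diff_distrib)
  have "?A i j - ?C i j = cp r {1..r} (spread r (?A i j) - v * spread r (?B i j) * adj v)"
   unfolding cpd e cp_top_spread[OF r UA[OF ij]] ..
  hence "nrm (?A i j - ?C i j) \<le> nrm (spread r (?A i j) - v * spread r (?B i j) * adj v)"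
   using nrm_cp by metis
  thus ?thesis by (rule order_trans[OF _ close[OF ij]])
 qed
 have nu: "nrm u \<le> 1"
 proof -
  have "nrm ?T \<le> 1" by (rule projection_nrm) (auto intro: Pk.pI_pI)
  hence "(nrm u)\<^sup>2 \<le> 1\<^sup>2" using nrm_cstar_eq[of u] u(3) by simp
  thus ?thesis by (rule power2_le_imp_le) simp
 qed
 have p1: "nrm (?p i) \<le> 1" for i
  by (rule projection_nrm) (use Pk.P_orth[OF \<gamma> \<gamma>] in auto)
 have C1: "nrm (?C i j) \<le> 1" for i j
  by (intro nrm_mult_le1 nu frame_op_nrm[OF G]) (use nu in simp)
 have diff: "nrm (chain ?A ?p a n - chain ?C ?p a n) \<le> (real n + 1) * \<epsilon>"
  by (rule chain_diff[OF p1 frame_op_nrm[OF F] C1 d])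
 have X: "chain ?A ?p a n = (\<Sum>s\<in>Sg. \<xi> s a * adj (\<xi> s b))"
  unfolding chain_frame[OF F \<gamma>] le Sg_def bn using is_frameD(1)[OF F]
  by (simp add: sum.inter_filter)
 have Yt: "chain ?B ?p a n = (\<Sum>s\<in>Tg. \<eta> s a * adj (\<eta> s b))"
  unfolding chain_frame[OF G \<gamma>] le Tg_def bn using is_frameD(1)[OF G]
  by (simp add: sum.inter_filter)
 have dom: "m \<in> dom (h (e s))" if "s < N" "m \<in> {a..b}" for s m
  using eS(2)[OF that(1)] that(2) ab(1) map_le_implies_dom_le by blast
 have on: "orthonormal z N (\<lambda>s. \<xi> (e s) m)" if m: "m \<in> {a..b}" for m
  unfolding orthonormal_def
  using is_frameD(3)[OF F eS(1) dom[OF _ m]] is_frameD(5)[OF F eS(1) eS(1) dom[OF _ m] dom[OF _ m]]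
   bij_betw_imp_inj_on[OF e] by (auto simp: inj_on_def)
 \<comment> \<open>There are N unknowns and only M < N equations. The resulting combination
   \<open>x\<close> of vectors of the first frame at b is orthogonal to all vectors of the second
   frame at b, moved by \<open>u\<close>.\<close>
 obtain c where c: "\<exists>t<N. c t \<noteq> 0"
  "\<forall>t<M. (\<Sum>s<N. mat (adj (\<eta> (f t) b) * adj u * \<xi> (e s) b) z z * c s) = 0"
  using solve_underdetermined[OF MN, of "\<lambda>t s. mat (adj (\<eta> (f t) b) * adj u * \<xi> (e s) b) z z"] by blast
 define x where "x = (\<Sum>s<N. sc (c s) * \<xi> (e s) b)"
 define y where "y = (\<Sum>s<N. sc (c s) * \<xi> (e s) a)"
 have b: "b \<in> {a..b}" "a \<in> {a..b}" using ab by auto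
 \<comment> \<open>\<open>x\<close> and \<open>y\<close> have the same coefficients with respect to
   orthonormal families at b and at a.\<close>
 have inner: "adj x * x = adj y * y" unfolding x_def y_def
  by (simp only: orthonormal_combination_inner[OF on[OF b(1)]] orthonormal_combination_inner[OF on[OF b(2)]])
 hence nxy: "nrm y = nrm x" using nrm_cstar_eq[of x] nrm_cstar_eq[of y]
  by (metis nrm_nonneg power2_eq_iff_nonneg)
 have x0: "x \<noteq> 0" unfolding x_def by (rule orthonormal_combination(1)[OF on[OF b(1)] c(1)])
 have Xx: "chain ?A ?p a n * x = y"
 proof -
  have "chain ?A ?p a n * (\<xi> (e s) b) = \<xi> (e s) a" if s: "s < N" for s
  proof -
   have "chain ?A ?p a n * (\<xi> (e s) b) = (\<Sum>t<N. \<xi> (e t) a * (adj (\<xi> (e t) b) * \<xi> (e s) b))"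
    unfolding X sum.reindex_bij_betw[OF e, symmetric] by (simp add: sum_distrib_right mult.assoc)
   also have "... = (\<Sum>t<N. if t = s then \<xi> (e s) a else 0)"
   proof (rule sum.cong[OF refl])
    fix t assume t: "t \<in> {..<N}"
    have "adj (\<xi> (e t) b) * \<xi> (e s) b = (if t = s then eu z else 0)"
     using on[OF b(1)] t s unfolding orthonormal_def by auto
    thus "\<xi> (e t) a * (adj (\<xi> (e t) b) * \<xi> (e s) b) = (if t = s then \<xi> (e s) a else 0)"
     using on[OF b(2)] s unfolding orthonormal_def by auto
   qed
   also have "... = \<xi> (e s) a" using s by simp
   finally show ?thesis .
  qed
  thus ?thesis unfolding x_def y_def sum_distrib_left
   by (intro sum.cong refl) (simp add: sc_left_commute[of "chain ?A ?p a n"])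
 qed
 have Yx: "chain ?C ?p a n * x = 0"
 proof -
  have ez: "x * eu z = x" unfolding x_def by (rule orthonormal_combination(2)[OF on[OF b(1)] c(1)])
  have t0: "adj (\<eta> (f t) b) * adj u * x = 0" if t: "t < M" for t
  proof -
   have ft: "f t \<in> S'" "g \<subseteq>\<^sub>m h' (f t)" using bij_betwE[OF f] t unfolding Tg_def by blast+
   hence bd: "b \<in> dom (h' (f t))" using ab(1) b(1) map_le_implies_dom_le by blast
   have he: "\<eta> (f t) b * eu z = \<eta> (f t) b" by (rule is_frameD(3)[OF G ft(1) bd])
   have e2: "(u * \<eta> (f t) b) * eu z = u * \<eta> (f t) b" using he by (simp add: mult.assoc)
   have "adj (u * \<eta> (f t) b) * x = sc (mat (adj (u * \<eta> (f t) b) * x) z z) * eu z"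
    by (rule vec_inner[OF e2 ez])
   moreover have "mat (adj (u * \<eta> (f t) b) * x) z z = (\<Sum>s<N. mat (adj (\<eta> (f t) b) * adj u * \<xi> (e s) b) z z * c s)"
    unfolding x_def sum_distrib_left mat_sum sum_cmat_apply
    by (intro sum.cong refl) (simp add: mult.assoc sc_left_commute[of "adj u"] sc_left_commute[of "adj (\<eta> (f t) b)"] sc_mult_entry mult.commute)
   ultimately show ?thesis using c(2) t by simp
  qed
  have "chain ?C ?p a n * x = (\<Sum>t<M. u * (\<eta> (f t) a * (adj (\<eta> (f t) b) * adj u * x)))"
   unfolding Y Yt sum.reindex_bij_betw[OF f, symmetric] by (simp add: sum_distrib_right sum_distrib_left mult.assoc)
  thus ?thesis using t0 by simp
 qed
 \<comment> \<open>The first chain carries \<open>x\<close> to \<open>y\<close> without loss of norm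
   and the second annihilates \<open>x\<close>, so their distance would be at least 1.\<close>
 have "y = (chain ?A ?p a n - chain ?C ?p a n) * x" by (simp add: left_diff_distrib Xx Yx)
 hence "nrm x \<le> nrm (chain ?A ?p a n - chain ?C ?p a n) * nrm x" using nrm_mult nxy by metis
 also have "... \<le> ((real n + 1) * \<epsilon>) * nrm x" by (rule mult_right_mono[OF diff]) simp
 also have "... < 1 * nrm x"
 proof (rule mult_strict_right_mono)
  have "0 \<le> \<epsilon>" using d[of a a] nrm_nonneg order_trans by (metis le_add1 order_refl)
  hence "(real n + 1) * \<epsilon> \<le> (real r + 1) * \<epsilon>" using ab bn by (intro mult_right_mono) auto
  thus "(real n + 1) * \<epsilon> < 1" using \<epsilon> by simp
  show "0 < nrm x" using x0 nrm_eq_0 nrm_nonneg by (metis less_eq_real_def)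
 qed
 finally show False by simp
qed

section \<open>Multiplicity functions and canonical frames\<close>

definition mlt :: "'s set => ('s => nat \<rightharpoonup> nat) => (nat \<rightharpoonup> nat) => nat" where
 "mlt S h g = card {s \<in> S. h s = g}"

lemma finite_Pend: "finite (Pend r)"
proof (rule finite_subset)
 show "Pend r \<subseteq> (\<Union>I\<in>intervals r. {m. dom m = I \<and> ran m \<subseteq> {1..r}})" unfolding Pend_def by blast
 show "finite (\<Union>I\<in>intervals r. {m :: nat \<rightharpoonup> nat. dom m = I \<and> ran m \<subseteq> {1..r}})"
  by (intro finite_UN_I intervals_finite finite_set_of_finite_maps) (use intervals_subset in auto)
qed

lemma finite_Pend_dom: "g \<in> Pend r ==> finite (dom g)" "g \<in> Pend r ==> card (dom g) \<le> r"
proof -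
 assume g: "g \<in> Pend r"
 have sub: "dom g \<subseteq> {1..r}" using Pend_dom[OF g] by blast
 show "finite (dom g)" by (rule finite_subset[OF sub]) simp
 show "card (dom g) \<le> r" using card_mono[OF _ sub] by simp
qed

lemma up_count:
 assumes "finite S" "h ` S \<subseteq> Pend r"
 shows "card {s \<in> S. g \<subseteq>\<^sub>m h s} = (\<Sum>k\<in>{k \<in> Pend r. g \<subseteq>\<^sub>m k}. mlt S h k)"
proof -
 have "{s \<in> S. g \<subseteq>\<^sub>m h s} = (\<Union>k\<in>{k \<in> Pend r. g \<subseteq>\<^sub>m k}. {s \<in> S. h s = k})" using assms(2) by blast
 thus ?thesis unfolding mlt_def
  by (simp only:) (rule card_UN_disjoint, use finite_Pend assms(1) in auto)
qed

text \<open>Inversion over the order of extension: the count at g is the multiplicity of g plus the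
  multiplicities of its proper extensions. These have a larger domain, which suggests descending
  induction on the size of the domain.\<close>

lemma mlt_eq_from_up_counts:
 assumes S: "finite S" "h ` S \<subseteq> Pend r" and S': "finite S'" "h' ` S' \<subseteq> Pend r"
  and up: "\<And>g. g \<in> Pend r ==> card {s \<in> S. g \<subseteq>\<^sub>m h s} = card {s \<in> S'. g \<subseteq>\<^sub>m h' s}"
  and g: "g \<in> Pend r"
 shows "mlt S h g = mlt S' h' g"
 using g
proof (induction "Suc r - card (dom g)" arbitrary: g rule: less_induct)
 case less
 let ?K = "{k \<in> Pend r. g \<subseteq>\<^sub>m k}"
 have gK: "g \<in> ?K" using less.prems by simp
 have finK: "finite ?K" using finite_Pend by simp
 have rest: "mlt S h k = mlt S' h' k" if k: "k \<in> ?K - {g}" for k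
 proof (rule less.hyps)
  show kP: "k \<in> Pend r" using k by simp
  have le: "g \<subseteq>\<^sub>m k" "k \<noteq> g" using k by auto
  have "dom g \<noteq> dom k"
  proof
   assume "dom g = dom k"
   hence "g = k" by (intro map_le_antisym le) (use le(1) in \<open>auto simp: map_le_def\<close>)
   thus False using le(2) by simp
  qed
  hence "dom g \<subset> dom k" using map_le_implies_dom_le[OF le(1)] by blast
  hence "card (dom g) < card (dom k)" by (rule psubset_card_mono[OF finite_Pend_dom(1)[OF kP]])
  thus "Suc r - card (dom k) < Suc r - card (dom g)" using finite_Pend_dom(2)[OF kP] by simp
 qed
 have "(\<Sum>k\<in>?K. mlt S h k) = (\<Sum>k\<in>?K. mlt S' h' k)"
  using up[OF less.prems] unfolding up_count[OF S] up_count[OF S'] .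
 moreover have "(\<Sum>k\<in>?K - {g}. mlt S h k) = (\<Sum>k\<in>?K - {g}. mlt S' h' k)"
  by (rule sum.cong[OF refl rest])
 ultimately show ?case unfolding sum.remove[OF finK gK] by simp
qed

text \<open>The comparison of counts is applied in both directions, the second time with the frames
  exchanged and \<open>adj v\<close> for v.\<close>

lemma frame_mlt_eq:
 assumes r: "r \<ge> 1" and F: "is_frame r (Pk r) z S h \<xi>" and G: "is_frame r (Pk r) z S' h' \<eta>"
  and v: "IU r v"
  and close: "\<And>i j. 1 \<le> i ==> i \<le> j ==> j \<le> r ==>
   nrm (spread r (frame_op S h \<xi> i j) - v * spread r (frame_op S' h' \<eta> i j) * adj v) \<le> \<epsilon>"
  and \<epsilon>: "(real r + 1) * \<epsilon> < 1" and g: "g \<in> Pend r"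
 shows "mlt S h g = mlt S' h' g"
proof (rule mlt_eq_from_up_counts[where r = r])
 show "finite S" "finite S'" by (rule is_frameD(1)[OF F], rule is_frameD(1)[OF G])
 show "h ` S \<subseteq> Pend r" "h' ` S' \<subseteq> Pend r" using is_frameD(2)[OF F] is_frameD(2)[OF G] by blast+
 show "g \<in> Pend r" by (rule g)
 have vv: "adj v * adj (adj v) = 1" "adj (adj v) * adj v = 1" using v unfolding IU_def by simp_all
 have close': "nrm (spread r (frame_op S' h' \<eta> i j) - adj v * spread r (frame_op S h \<xi> i j) * adj (adj v)) \<le> \<epsilon>"
  if ij: "1 \<le> i" "i \<le> j" "j \<le> r" for i j
 proof -
  let ?A = "spread r (frame_op S h \<xi> i j)" and ?B = "spread r (frame_op S' h' \<eta> i j)"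
  have "adj v * (v * ?B * adj v) * adj (adj v) = (adj v * v) * ?B * (adj v * v)" by (simp add: mult.assoc)
  also have "... = ?B" using v unfolding IU_def by simp
  finally have "adj v * (?A - v * ?B * adj v) * adj (adj v) = adj v * ?A * adj (adj v) - ?B"
   by (simp only: right_diff_distrib left_diff_distrib)
  hence "nrm (adj v * ?A * adj (adj v) - ?B) = nrm (?A - v * ?B * adj v)"
   using unitary_nrm[OF vv, of "?A - v * ?B * adj v"] by simp
  thus ?thesis using close[OF ij] unfolding nrm_diff_commute[of ?B] by (rule ord_eq_le_trans)
 qed
 fix k assume k: "k \<in> Pend r"
 show "card {s \<in> S. k \<subseteq>\<^sub>m h s} = card {s \<in> S'. k \<subseteq>\<^sub>m h' s}"
 proof (rule antisym)
  show "card {s \<in> S. k \<subseteq>\<^sub>m h s} \<le> card {s \<in> S'. k \<subseteq>\<^sub>m h' s}"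
   by (rule frame_count_le[OF r F G v _ \<epsilon> k]) (rule close)
  show "card {s \<in> S'. k \<subseteq>\<^sub>m h' s} \<le> card {s \<in> S. k \<subseteq>\<^sub>m h s}"
   by (rule frame_count_le[OF r G F IU_adj[OF v] _ \<epsilon> k]) (rule close')
 qed
qed

lemma frame_reindex:
 assumes b: "bij_betw \<nu> S' S" and h: "\<And>s. s \<in> S' ==> h' s = h (\<nu> s)" and hf: "has_frame r z \<phi> S h \<xi>"
 shows "has_frame r z \<phi> S' h' (\<lambda>s. \<xi> (\<nu> s))"
proof -
 have F: "is_frame r (Pk r) z S h \<xi>" using hf by (simp add: has_frame_def)
 have bS: "\<nu> s \<in> S" if "s \<in> S'" for s using bij_betwE[OF b] that by blast
 have inj: "\<nu> s = \<nu> t \<longleftrightarrow> s = t" if "s \<in> S'" "t \<in> S'" for s t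
  using bij_betw_imp_inj_on[OF b] that by (auto simp: inj_on_def)
 have "is_frame r (Pk r) z S' h' (\<lambda>s. \<xi> (\<nu> s))"
  unfolding is_frame_def
 proof (intro conjI ballI)
  show "finite S'" using bij_betw_finite[OF b] is_frameD(1)[OF F] by simp
  show "h' ` S' \<subseteq> Pend r" using h bS is_frameD(2)[OF F] by auto
 next
  fix s i assume "s \<in> S'" "i \<in> dom (h' s)"
  thus "\<xi> (\<nu> s) i * eu z = \<xi> (\<nu> s) i" "Pk r (the (h' s i)) * \<xi> (\<nu> s) i = \<xi> (\<nu> s) i"
   using is_frameD(3,4)[OF F bS] h by auto
 next
  fix s t i j assume "s \<in> S'" "t \<in> S'" "i \<in> dom (h' s)" "j \<in> dom (h' t)"
  thus "adj (\<xi> (\<nu> s) i) * \<xi> (\<nu> t) j = (if s = t \<and> i = j then eu z else 0)"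
   using is_frameD(5)[OF F bS bS] h inj by auto
 qed
 moreover have "frame_op S' h' (\<lambda>s. \<xi> (\<nu> s)) = frame_op S h \<xi>"
  unfolding frame_op_def sum.reindex_bij_betw[OF b, symmetric] by (intro ext sum.cong refl) (simp add: h)
 ultimately show ?thesis using hf by (simp add: has_frame_def fmap_def)
qed

text \<open>The canonical index set with \<open>m g\<close> copies of each g. Over it, maps with
  equal multiplicities have frames with literally the same indices and the same partial maps
  \<open>fst\<close>, the situation of \<open>frame_unitary\<close>.\<close>

definition CI :: "nat => ((nat \<rightharpoonup> nat) => nat) => ((nat \<rightharpoonup> nat) \<times> nat) set" where
 "CI r m = Sigma (Pend r) (\<lambda>g. {..<m g})"

lemma canonical_bij:
 assumes S: "finite S" "h ` S \<subseteq> Pend r" and m: "\<And>g. g \<in> Pend r ==> m g = mlt S h g"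
 obtains \<nu> where "bij_betw \<nu> (CI r m) S" "\<And>p. p \<in> CI r m ==> fst p = h (\<nu> p)"
proof -
 have "\<exists>e. bij_betw e {..<m g} {s \<in> S. h s = g}" if "g \<in> Pend r" for g
  using ex_bij_betw_nat_finite[of "{s \<in> S. h s = g}"] S(1) m[OF that] unfolding mlt_def atLeast0LessThan by auto
 then obtain e where e: "\<And>g. g \<in> Pend r ==> bij_betw (e g) {..<m g} {s \<in> S. h s = g}" by metis
 define \<nu> where "\<nu> p = e (fst p) (snd p)" for p
 have he: "h (\<nu> p) = fst p \<and> \<nu> p \<in> S" if "p \<in> CI r m" for p
  using that bij_betwE[OF e[of "fst p"]] unfolding CI_def \<nu>_def by auto
 have "bij_betw \<nu> (CI r m) S" unfolding bij_betw_def
 proof (intro conjI inj_onI equalityI subsetI)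
  fix p q assume pq: "p \<in> CI r m" "q \<in> CI r m" "\<nu> p = \<nu> q"
  hence 1: "fst p = fst q" using he by metis
  have "snd p = snd q"
   using bij_betw_imp_inj_on[OF e[of "fst p"]] pq 1 unfolding CI_def \<nu>_def inj_on_def by auto
  thus "p = q" using 1 by (simp add: prod_eq_iff)
 next
  fix s assume "s \<in> \<nu> ` CI r m" thus "s \<in> S" using he by blast
 next
  fix s assume s: "s \<in> S"
  hence hs: "h s \<in> Pend r" using S by blast
  have "s \<in> e (h s) ` {..<m (h s)}" unfolding bij_betw_imp_surj_on[OF e[OF hs]] using s by simp
  thus "s \<in> \<nu> ` CI r m"
  proof (rule imageE)
   fix c assume c: "s = e (h s) c" "c \<in> {..<m (h s)}"
   have "(h s, c) \<in> CI r m" using hs c(2) by (simp add: CI_def)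
   moreover have "s = \<nu> (h s, c)" unfolding \<nu>_def fst_conv snd_conv by (rule c(1))
   ultimately show ?thesis by (rule rev_image_eqI)
  qed
 qed
 thus ?thesis by (rule that) (use he in simp)
qed

text \<open>A fixed column in which all vectors are written from now on; the choice is
  arbitrary.\<close>

definition z0 :: bix where "z0 = (({}, 0), 0)"

text \<open>\<open>mf r \<phi> m\<close>: the map \<open>\<phi>\<close> contains every \<open>g\<close> with multiplicity \<open>m g\<close>.\<close>

definition mf :: "nat => (nat set \<times> nat) stable_map => ((nat \<rightharpoonup> nat) => nat) => bool" where
 "mf r \<phi> m \<longleftrightarrow> (\<forall>g. g \<notin> Pend r \<longrightarrow> m g = 0) \<and> (\<exists>\<xi>. has_frame r z0 \<phi> (CI r m) fst \<xi>)"

lemma mfI: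
 assumes "has_frame r z0 \<phi> S h \<xi>" "\<And>g. g \<in> Pend r ==> m g = mlt S h g" "\<And>g. g \<notin> Pend r ==> m g = 0"
 shows "mf r \<phi> m"
proof -
 have F: "is_frame r (Pk r) z0 S h \<xi>" using assms(1) by (simp add: has_frame_def)
 have hS: "h ` S \<subseteq> Pend r" using is_frameD(2)[OF F] by blast
 obtain \<nu> where \<nu>: "bij_betw \<nu> (CI r m) S" "\<And>p. p \<in> CI r m ==> fst p = h (\<nu> p)"
  by (rule canonical_bij[OF is_frameD(1)[OF F] hS assms(2)]) (assumption, rule that)
 show ?thesis unfolding mf_def using frame_reindex[OF \<nu>(1) \<nu>(2) assms(1)] assms(3) by blast
qed

lemma mf_ex:
 assumes "r \<ge> 1" "\<phi> \<in> maps_K (T_max r)"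
 obtains m where "mf r \<phi> m"
proof -
 obtain S :: "nat set" and h \<xi> where hf: "has_frame r z0 \<phi> S h \<xi>" by (rule maps_K_frame[OF assms])
 have "mf r \<phi> (\<lambda>g. if g \<in> Pend r then mlt S h g else 0)" by (rule mfI[OF hf]) simp_all
 thus ?thesis by (rule that)
qed

lemma mlt_CI: "g \<in> Pend r ==> mlt (CI r m) fst g = m g"
proof -
 assume g: "g \<in> Pend r"
 have "{s \<in> CI r m. fst s = g} = Pair g ` {..<m g}" using g unfolding CI_def by auto
 thus ?thesis unfolding mlt_def by (simp add: card_image inj_on_def)
qed

lemma op_norm_diff_Ad: "op_norm (mat a - Ad (mat v) (mat b)) = nrm (a - v * b * adj v)"
 unfolding Ad_def mat_mult[symmetric] mat_adj[symmetric] mat_minus[symmetric] nrm.rep_eq ..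

text \<open>Closeness is asked for on the matrix units only, since the chains that count copies are
  built from their images.\<close>

lemma mf_close:
 assumes r: "r \<ge> 1" and m: "mf r \<phi> m" "mf r \<psi> m'" and u: "u \<in> inner_unitaries (T_max r)"
  and close: "\<And>i j. 1 \<le> i ==> i \<le> j ==> j \<le> r ==> op_norm (\<phi> (eT r i j) - Ad u (\<psi> (eT r i j))) \<le> \<epsilon>"
  and \<epsilon>: "(real r + 1) * \<epsilon> < 1"
 shows "m = m'"
proof
 obtain v where v: "u = mat v" "IU r v" using u unfolding inner_unitaries_IU[OF r] by blast
 obtain \<xi> \<eta> where hf: "has_frame r z0 \<phi> (CI r m) fst \<xi>" "has_frame r z0 \<psi> (CI r m') fst \<eta>"
  using m unfolding mf_def by blast
 hence F: "is_frame r (Pk r) z0 (CI r m) fst \<xi>" "is_frame r (Pk r) z0 (CI r m') fst \<eta>"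
  by (simp_all add: has_frame_def)
 have cl: "nrm (spread r (frame_op (CI r m) fst \<xi> i j) - v * spread r (frame_op (CI r m') fst \<eta> i j) * adj v) \<le> \<epsilon>"
  if ij: "1 \<le> i" "i \<le> j" "j \<le> r" for i j
 proof -
  have i: "i \<in> {1..r}" "j \<in> {1..r}" using ij by auto
  have "\<phi> (eT r i j) = mat (spread r (frame_op (CI r m) fst \<xi> i j))"
   "\<psi> (eT r i j) = mat (spread r (frame_op (CI r m') fst \<eta> i j))"
   using hf eT_in[OF ij] unfolding has_frame_def fmap_eT[OF i, symmetric] by blast+
  thus ?thesis using close[OF ij] unfolding v(1) by (simp only: op_norm_diff_Ad)
 qed
 fix g
 show "m g = m' g"
 proof (cases "g \<in> Pend r")
  case True
  show ?thesis using frame_mlt_eq[OF r F v(2) cl \<epsilon> True] unfolding mlt_CI[OF True] .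
 next
  case False
  thus ?thesis using m unfolding mf_def by simp
 qed
qed

text \<open>Equal multiplicities give canonical frames over the same index set, which
  \<open>frame_unitary\<close> connects; the converse is the perturbation result at distance
  0.\<close>

lemma mf_equiv:
 assumes r: "r \<ge> 1" and m: "mf r \<phi> m" "mf r \<psi> m'"
 shows "m = m' \<longleftrightarrow> (\<exists>u\<in>inner_unitaries (T_max r). \<forall>a\<in>T_max r. \<phi> a = Ad u (\<psi> a))"
proof
 assume "m = m'"
 then obtain \<xi> \<eta> where hf: "has_frame r z0 \<phi> (CI r m) fst \<xi>" "has_frame r z0 \<psi> (CI r m) fst \<eta>"
  using m unfolding mf_def by blast
 hence F: "is_frame r (Pk r) z0 (CI r m) fst \<eta>" "is_frame r (Pk r) z0 (CI r m) fst \<xi>"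
  by (simp_all add: has_frame_def)
 obtain u where "u \<in> inner_unitaries (T_max r)"
  "\<And>a. a \<in> T_max r ==> mat (fmap r (CI r m) fst \<xi> a) = Ad u (mat (fmap r (CI r m) fst \<eta> a))"
  by (rule frame_unitary[OF r F]) (rule that)
 thus "\<exists>u\<in>inner_unitaries (T_max r). \<forall>a\<in>T_max r. \<phi> a = Ad u (\<psi> a)"
  using hf unfolding has_frame_def by metis
next
 assume "\<exists>u\<in>inner_unitaries (T_max r). \<forall>a\<in>T_max r. \<phi> a = Ad u (\<psi> a)"
 then obtain u where u: "u \<in> inner_unitaries (T_max r)" "\<And>a. a \<in> T_max r ==> \<phi> a = Ad u (\<psi> a)" by blast
 have "op_norm (0 :: bix cmat) = 0" using nrm_eq_0[of "0 :: bix bop"] by (simp add: nrm.rep_eq zero_bop.rep_eq)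
 hence "op_norm (\<phi> (eT r i j) - Ad u (\<psi> (eT r i j))) \<le> 0" if "1 \<le> i" "i \<le> j" "j \<le> r" for i j
  using u(2)[OF eT_in[OF that]] by simp
 thus "m = m'" by (rule mf_close[OF r m u(1)]) simp_all
qed

lemma mf_unique:
 assumes r: "r \<ge> 1" and m: "mf r \<phi> m" "mf r \<phi> m'"
 shows "m = m'"
 unfolding mf_equiv[OF assms]
proof
 show "mat (1 :: bix bop) \<in> inner_unitaries (T_max r)" unfolding inner_unitaries_IU[OF r] using IU_1 by blast
 obtain \<xi> where hf: "has_frame r z0 \<phi> (CI r m) fst \<xi>" using m unfolding mf_def by blast
 show "\<forall>a\<in>T_max r. \<phi> a = Ad (mat (1 :: bix bop)) (\<phi> a)"
  using hf unfolding has_frame_def Ad_def by (simp flip: mat_mult mat_adj)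
qed

section \<open>Maps with prescribed multiplicities, the zero and the unit\<close>

definition ev :: "bix => bix => bix bop" where "ev x z = rl {(x, z)}"

lemma ev_entry: "mat (ev x z) i j = (if i = x \<and> j = z then 1 else 0)"
 unfolding ev_def by (simp add: rl_entry pinj_single)

lemma ev_eu: "ev x z * eu z = ev x z"
 unfolding ev_def eu_def by (simp add: rl_mult pinj_single single_O)

lemma ev_inner: "adj (ev x z) * ev y z = (if x = y then eu z else 0)"
 unfolding ev_def eu_def by (simp add: adj_rl rl_mult pinj_single single_O single_converse)

lemma if_absorb: "(B ==> A) ==> (if A then if B then x else y else y) = (if B then x else y)"
 by auto

lemma Pk_ev: "Pk r k * ev (({1..r}, k), p) z = ev (({1..r}, k), p) z"
 unfolding Pk_mult_entry ev_entry by (rule bix_eqI, unfold Pk_mult_entry ev_entry, rule if_absorb, blast)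

lemma Nn_ev: "p < n ==> Nn n * ev (x, p) z = ev (x, p) z"
proof (rule bop_eqI)
 fix i j assume "p < n"
 thus "mat (Nn n * ev (x, p) z) i j = mat (ev (x, p) z) i j"
  by (cases i) (auto simp: Nn_mult_entry ev_entry)
qed

text \<open>Each frame vector is a basis vector in a copy of its own, numbered injectively by
  \<open>pos\<close>, which makes the family orthonormal. As there are finitely many vectors, the
  copies stay below some n and the map is of finite size.\<close>

lemma mf_exists:
 assumes r: "r \<ge> 1" and m: "\<And>g. g \<notin> Pend r ==> m g = 0"
 obtains \<phi> where "\<phi> \<in> maps_fin (T_max r)" "mf r \<phi> m"
proof -
 have fin: "finite (CI r m)" unfolding CI_def by (intro finite_SigmaI finite_Pend) simp
 obtain q :: "(nat \<rightharpoonup> nat) \<times> nat => nat" where q: "inj_on q (CI r m)"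
  using ex_bij_betw_finite_nat[OF fin] unfolding bij_betw_def by blast
 define pos where "pos s i = prod_encode (q s, i)" for s and i :: nat
 have pos: "pos s i = pos t j \<longleftrightarrow> s = t \<and> i = j" if "s \<in> CI r m" "t \<in> CI r m" for s t i j
  using q that unfolding pos_def by (auto simp: inj_on_def)
 define \<xi> where "\<xi> s i = ev (({1..r}, the (fst s i)), pos s i) z0" for s :: "(nat \<rightharpoonup> nat) \<times> nat" and i
 have hs: "fst s \<in> Pend r" if "s \<in> CI r m" for s using that unfolding CI_def by auto
 have "finite (\<Union>s\<in>CI r m. pos s ` dom (fst s))"
  using fin finite_Pend_dom(1)[OF hs] by blast
 then obtain n where n: "\<forall>k\<in>(\<Union>s\<in>CI r m. pos s ` dom (fst s)). k < n"
  unfolding finite_nat_set_iff_bounded by blast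
 have F: "is_frame r (Pk r) z0 (CI r m) fst \<xi>"
  unfolding is_frame_def \<xi>_def
  using fin hs by (auto simp only: ev_eu Pk_ev ev_inner prod.inject pos split: if_split)
 define \<phi> where "\<phi> a = mat (fmap r (CI r m) fst \<xi> a)" for a
 have hf: "has_frame r z0 \<phi> (CI r m) fst \<xi>" unfolding has_frame_def \<phi>_def using F by simp
 have "\<phi> \<in> maps_M (T_max r) n"
  by (rule has_frame_maps_M[OF hf]) (use n in \<open>auto simp: \<xi>_def intro!: Nn_ev\<close>)
 hence "\<phi> \<in> maps_fin (T_max r)" unfolding maps_fin_def by blast
 moreover have "mf r \<phi> m" unfolding mf_def using m hf by blast
 ultimately show ?thesis by (rule that)
qed

lemma vec_entry0: "x * eu z = x ==> j \<noteq> z ==> mat x i j = 0"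
 using mult_adj_rl_entry0[of "{(z, z)}" j x i] by (simp add: pinj_single flip: eu_def)

lemma outer_entry:
 assumes "x * eu z = x" "y * eu z = y"
 shows "mat (x * adj y) i j = mat x i z * cnj (mat y j z)"
proof -
 have "(\<Sum>\<^sub>\<infinity>k. mat x i k * cnj (mat y j k)) = (\<Sum>\<^sub>\<infinity>k\<in>{z}. mat x i k * cnj (mat y j k))"
  by (rule infsum_cong_neutral) (use vec_entry0[OF assms(1)] in auto)
 thus ?thesis by (simp add: mat_mult mat_mul_def adj_entry)
qed

lemma inner_entry:
 assumes "finite F" "\<And>k. k \<notin> F ==> mat x k z = 0"
 shows "mat (adj x * y) z z = (\<Sum>k\<in>F. cnj (mat x k z) * mat y k z)"
proof -
 have "(\<Sum>\<^sub>\<infinity>k. cnj (mat x k z) * mat y k z) = (\<Sum>\<^sub>\<infinity>k\<in>F. cnj (mat x k z) * mat y k z)"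
  by (rule infsum_cong_neutral) (use assms in auto)
 thus ?thesis using assms(1) by (simp add: mat_mult mat_mul_def adj_entry)
qed

text \<open>With this formula the unit, sums and products of maps are identified by comparing finite
  sums of complex numbers.\<close>

lemma fmap_entry:
 assumes F: "is_frame r (Pk r) z S h \<xi>"
 shows "mat (fmap r S h \<xi> a) ((I, k), p) ((J, l), q) =
  (if I = J \<and> I \<in> intervals r \<and> k \<in> I \<and> l \<in> I then
   \<Sum>e\<in>{1..r} \<times> {1..r}. a ({1..r}, fst e) ({1..r}, snd e) *
    (\<Sum>s\<in>S. if fst e \<in> dom (h s) \<and> snd e \<in> dom (h s)
     then mat (\<xi> s (fst e)) (({1..r}, k), p) z * cnj (mat (\<xi> s (snd e)) (({1..r}, l), q) z) else 0)
   else 0)"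
proof -
 have "mat (frame_op S h \<xi> i j) x y
   = (\<Sum>s\<in>S. if i \<in> dom (h s) \<and> j \<in> dom (h s) then mat (\<xi> s i) x z * cnj (mat (\<xi> s j) y z) else 0)" for i j x y
  unfolding frame_op_def mat_sum sum_cmat_apply
 proof (rule sum.cong[OF refl])
  fix s assume s: "s \<in> S"
  show "mat (if i \<in> dom (h s) \<and> j \<in> dom (h s) then \<xi> s i * adj (\<xi> s j) else 0) x y =
   (if i \<in> dom (h s) \<and> j \<in> dom (h s) then mat (\<xi> s i) x z * cnj (mat (\<xi> s j) y z) else 0)"
  proof (cases "i \<in> dom (h s) \<and> j \<in> dom (h s)")
   case True
   thus ?thesis unfolding if_P[OF True]
    by (intro outer_entry is_frameD(3)[OF F s]) blast+
  next
   case False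
   show ?thesis unfolding if_not_P[OF False] by (simp add: zero_bop.rep_eq)
  qed
 qed
 thus ?thesis unfolding fmap_def spread_entry mat_sum sum_cmat_apply sc_mult_entry sum.cartesian_product'
  by (simp only: fst_conv snd_conv)
qed

lemma frame_entry:
 assumes F: "is_frame r (Pk r) z S h \<xi>" and s: "s \<in> S" "i \<in> dom (h s)"
 shows "mat (\<xi> s i) ((I, k), p) z = (if I = {1..r} \<and> k = the (h s i) then mat (\<xi> s i) (({1..r}, the (h s i)), p) z else 0)"
proof -
 have "mat (\<xi> s i) ((I, k), p) z = mat (Pk r (the (h s i)) * \<xi> s i) ((I, k), p) z"
  unfolding is_frameD(4)[OF F s] ..
 also have "... = (if I = {1..r} \<and> k = the (h s i) then mat (\<xi> s i) ((I, k), p) z else 0)"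
  unfolding Pk_mult_entry ..
 finally show ?thesis by (metis (no_types, lifting))
qed

lemma maps_M_fin: "\<phi> \<in> maps_M E n ==> \<phi> \<in> maps_fin E"
 unfolding maps_fin_def by blast

lemma mf_zero: "mf r (\<lambda>a. 0) (\<lambda>g. 0)" "(\<lambda>a. 0) \<in> maps_fin (T_max r)"
proof -
 have "is_frame r (Pk r) z0 ({} :: nat set) h \<xi>" for h \<xi> by (simp add: is_frame_def)
 hence hf: "has_frame r z0 (\<lambda>a. 0) ({} :: nat set) h \<xi>" for h \<xi>
  by (simp add: has_frame_def fmap_def frame_op_def zero_bop.rep_eq)
 thus "mf r (\<lambda>a. 0) (\<lambda>g. 0)" by (rule mfI) (simp_all add: mlt_def)
 show "(\<lambda>a. 0) \<in> maps_fin (T_max r)" by (rule maps_M_fin, rule has_frame_maps_M[where n = 0], rule hf) simp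
qed

definition idm :: "nat => nat \<rightharpoonup> nat" where
 "idm r = (\<lambda>i. if i \<in> {1..r} then Some i else None)"

lemma idm_dom: "dom (idm r) = {1..r}" "i \<in> {1..r} ==> idm r i = Some i"
 unfolding idm_def dom_def by auto

lemma idm_Pend: "r \<ge> 1 ==> idm r \<in> Pend r"
 unfolding Pend_def mem_Collect_eq idm_dom(1) using top_interval[of r] idm_dom(2)[of _ r]
 by (auto simp: ran_def idm_def split: if_splits)

text \<open>The inclusion into the corner is a single copy of the identity map of the chain, with
  the basis vectors of copy 0 as its frame.\<close>

lemma mf_corner:
 assumes r: "r \<ge> 1"
 shows "mf r corner_map (\<lambda>g. if g = idm r then 1 else 0)" "corner_map \<in> maps_fin (T_max r)"
proof -
 let ?S = "{0 :: nat}" and ?h = "\<lambda>_ :: nat. idm r" and ?\<xi> = "\<lambda>_ i. ev (({1..r}, i), 0) z0"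
 have F: "is_frame r (Pk r) z0 ?S ?h ?\<xi>"
  unfolding is_frame_def using idm_Pend[OF r]
  by (auto simp only: ev_eu Pk_ev ev_inner prod.inject idm_dom option.sel finite.intros image_insert image_empty
    insert_subset empty_subsetI split: if_split)
 have e: "corner_map a = mat (fmap r ?S ?h ?\<xi> a)" if a: "a \<in> T_max r" for a
 proof (intro ext)
  fix i j :: "(nat set \<times> nat) \<times> nat"
  obtain I k p J l q where ij: "i = ((I, k), p)" "j = ((J, l), q)" by (metis prod.collapse)
  have delta: "(\<Sum>e\<in>{1..r} \<times> {1..r}. a ({1..r}, fst e) ({1..r}, snd e) *
    (\<Sum>s\<in>?S. if fst e \<in> dom (?h s) \<and> snd e \<in> dom (?h s)
     then mat (?\<xi> s (fst e)) (({1..r}, k), p) z0 * cnj (mat (?\<xi> s (snd e)) (({1..r}, l), q) z0) else 0))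
   = (\<Sum>e\<in>{1..r} \<times> {1..r}. if e = (k, l) then if p = 0 \<and> q = 0 then a ({1..r}, k) ({1..r}, l) else 0 else 0)"
   by (rule sum.cong[OF refl]) (auto simp: ev_entry idm_dom)
  have s: "(\<Sum>e\<in>{1..r} \<times> {1..r}. a ({1..r}, fst e) ({1..r}, snd e) *
    (\<Sum>s\<in>?S. if fst e \<in> dom (?h s) \<and> snd e \<in> dom (?h s)
     then mat (?\<xi> s (fst e)) (({1..r}, k), p) z0 * cnj (mat (?\<xi> s (snd e)) (({1..r}, l), q) z0) else 0))
   = (if p = 0 \<and> q = 0 then a ({1..r}, k) ({1..r}, l) else 0)"
   if "I = J \<and> I \<in> intervals r \<and> k \<in> I \<and> l \<in> I"
  proof -
   have "(k, l) \<in> {1..r} \<times> {1..r}" using that intervals_subset[of I r] by blast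
   thus ?thesis unfolding delta by (subst sum.delta) simp_all
  qed
  have "mat (fmap r ?S ?h ?\<xi> a) i j = (if I = J \<and> I \<in> intervals r \<and> k \<in> I \<and> l \<in> I then
    (if p = 0 \<and> q = 0 then a ({1..r}, k) ({1..r}, l) else 0) else 0)"
   unfolding ij fmap_entry[OF F] by (rule if_cong[OF refl s refl])
  also have "... = corner_map a i j"
   unfolding ij corner_map_def prod.case T_max_entries(1)[OF a, of I k J l] by argo
  finally show "corner_map a i j = mat (fmap r ?S ?h ?\<xi> a) i j" ..
 qed
 have hf: "has_frame r z0 corner_map ?S ?h ?\<xi>" unfolding has_frame_def using F e by blast
 show "mf r corner_map (\<lambda>g. if g = idm r then 1 else 0)"
 proof (rule mfI[OF hf])
  fix g
  show "(if g = idm r then 1 else 0) = mlt ?S ?h g" by (cases "g = idm r") (auto simp: mlt_def)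
  show "(if g = idm r then 1 else 0) = (0 :: nat)" if "g \<notin> Pend r" using that idm_Pend[OF r] by auto
 qed
 show "corner_map \<in> maps_fin (T_max r)"
  by (rule maps_M_fin, rule has_frame_maps_M[OF hf, where n = 1]) (rule Nn_ev, simp)
qed

text \<open>Cutting the shift off after m copies makes shifts by different multiples of m have
  orthogonal ranges; they thus realise the tensor factors of an amplification.\<close>

definition shrel :: "nat => nat => (bix \<times> bix) set" where
 "shrel c m = {((x, c + k), (x, k)) | x k. k < m}"

definition shf :: "nat => nat => bix bop" where
 "shf c m = rl (shrel c m)"

lemma pinj_shrel: "pinj (shrel c m)"
 unfolding pinj_def single_valued_def shrel_def by auto

lemma shf_mult_entry: "mat (shf c m * a) (x, p) j = (if c \<le> p \<and> p < c + m then mat a (x, p - c) j else 0)"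
proof (cases "c \<le> p \<and> p < c + m")
 case True
 hence "((x, p), (x, p - c)) \<in> shrel c m" unfolding shrel_def by auto
 thus ?thesis unfolding shf_def if_P[OF True] by (rule rl_mult_entry[OF pinj_shrel])
next
 case False
 hence "((x, p), k) \<notin> shrel c m" for k unfolding shrel_def by auto
 thus ?thesis unfolding shf_def if_not_P[OF False] by (rule rl_mult_entry0[OF pinj_shrel])
qed

lemma adj_shf_shf: "adj (shf c m) * shf c m = Nn m"
proof -
 have "(shrel c m)\<inverse> O shrel c m = {(x, x) | x. snd x < m}" unfolding shrel_def by force
 thus ?thesis unfolding shf_def Nn_def adj_rl[OF pinj_shrel] by (simp add: rl_mult pinj_shrel pinj_converse)
qed

lemma adj_shf_shf0: "c + m \<le> d ==> adj (shf c m) * shf d n = 0" "c + m \<le> d ==> adj (shf d n) * shf c m = 0"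
proof -
 assume "c + m \<le> d"
 hence "(shrel c m)\<inverse> O shrel d n = {}" unfolding shrel_def by force
 thus "adj (shf c m) * shf d n = 0" unfolding shf_def adj_rl[OF pinj_shrel] by (simp add: rl_mult pinj_shrel pinj_converse)
 from arg_cong[OF this, of adj] show "adj (shf d n) * shf c m = 0" by simp
qed

lemma Nn_shf0: "n \<le> c ==> Nn n * shf c m = 0"
proof (rule bop_eqI)
 fix i j assume "n \<le> c"
 thus "mat (Nn n * shf c m) i j = mat 0 i j"
  using shf_mult_entry[of c m 1 "fst i" "snd i" j] Nn_mult_entry[of n "shf c m" "fst i" "snd i" j]
  by (simp add: zero_bop.rep_eq)
qed

lemma Nn_shf: "c + m \<le> n ==> Nn n * shf c m = shf c m"
proof (rule bop_eqI)
 fix i j assume "c + m \<le> n"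
 thus "mat (Nn n * shf c m) i j = mat (shf c m) i j"
  using shf_mult_entry[of c m 1 "fst i" "snd i" j] Nn_mult_entry[of n "shf c m" "fst i" "snd i" j]
  by simp
qed

lemma Pk_shf: "Pk r k * shf c m = shf c m * Pk r k"
proof -
 have "prel {1..r} k O shrel c m = shrel c m O prel {1..r} k" unfolding shrel_def prel_def by blast
 thus ?thesis unfolding Pk_def shf_def by (simp add: rl_mult pinj_shrel pinj_prel)
qed

section \<open>Direct sums\<close>

lemma union_frame:
 assumes F: "is_frame r P z S h \<xi>" and G: "is_frame r P z S' h' \<eta>"
  and orth: "\<And>s i t j. s \<in> S ==> i \<in> dom (h s) ==> t \<in> S' ==> j \<in> dom (h' t) ==> adj (\<xi> s i) * \<eta> t j = 0"
 shows "is_frame r P z (S <+> S') (case_sum h h') (case_sum \<xi> \<eta>)"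
proof -
 have InlD: "s \<in> S" if "Inl s \<in> S <+> S'" for s using that by (rule PlusE) auto
 have InrD: "s \<in> S'" if "Inr s \<in> S <+> S'" for s using that by (rule PlusE) auto
 have orth': "adj (\<eta> t j) * \<xi> s i = 0" if "s \<in> S" "i \<in> dom (h s)" "t \<in> S'" "j \<in> dom (h' t)" for s t i j
  using arg_cong[OF orth[OF that], of adj] by simp
 show ?thesis
 unfolding is_frame_def
proof (intro conjI ballI)
 show "finite (S <+> S')" using is_frameD(1)[OF F] is_frameD(1)[OF G] by simp
 show "case_sum h h' ` (S <+> S') \<subseteq> Pend r" using is_frameD(2)[OF F] is_frameD(2)[OF G] by auto
next
 fix u i assume u: "u \<in> S <+> S'" "i \<in> dom (case_sum h h' u)"
 show "case_sum \<xi> \<eta> u i * eu z = case_sum \<xi> \<eta> u i" "P (the (case_sum h h' u i)) * case_sum \<xi> \<eta> u i = case_sum \<xi> \<eta> u i"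
  using u is_frameD(3,4)[OF F, of _ i] is_frameD(3,4)[OF G, of _ i]
  by (cases u; simp add: InlD InrD)+
next
 fix u v i j assume u: "u \<in> S <+> S'" "v \<in> S <+> S'" "i \<in> dom (case_sum h h' u)" "j \<in> dom (case_sum h h' v)"
 show "adj (case_sum \<xi> \<eta> u i) * case_sum \<xi> \<eta> v j = (if u = v \<and> i = j then eu z else 0)"
 proof (cases u; cases v)
  fix s t assume "u = Inl s" "v = Inl t"
  thus ?thesis using u is_frameD(5)[OF F, of s t i j] InlD by simp
 next
  fix s t assume "u = Inl s" "v = Inr t"
  thus ?thesis using u orth[of s i t j] InlD InrD by simp
 next
  fix s t assume "u = Inr s" "v = Inl t"
  thus ?thesis using u orth'[of t j s i] InlD InrD by simp
 next
  fix s t assume "u = Inr s" "v = Inr t"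
  thus ?thesis using u is_frameD(5)[OF G, of s t i j] InrD by simp
 qed
qed
qed

lemma mlt_Plus:
 "finite S ==> finite S' ==> mlt (S <+> S') (case_sum h h') g = mlt S h g + mlt S' h' g"
proof -
 assume fin: "finite S" "finite S'"
 have "{u \<in> S <+> S'. case_sum h h' u = g} = {s \<in> S. h s = g} <+> {t \<in> S'. h' t = g}" by auto
 thus ?thesis unfolding mlt_def using fin by (simp add: card_Plus)
qed

text \<open>The frame of \<psi> is shifted by n copies and so becomes orthogonal to the frame of
  \<phi>, which lives in the first n copies. The disjoint union of both is a frame of the sum, and
  its multiplicities add.\<close>

lemma mf_dsum:
 assumes r: "r \<ge> 1" and \<phi>: "\<phi> \<in> maps_M (T_max r) n" and \<psi>: "\<psi> \<in> maps_fin (T_max r)"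
  and m: "mf r \<phi> m1" "mf r \<psi> m2"
 shows "mf r (dsum n \<phi> \<psi>) (\<lambda>g. m1 g + m2 g)" "dsum n \<phi> \<psi> \<in> maps_fin (T_max r)"
proof -
 let ?S = "CI r m1" and ?T = "CI r m2"
 obtain \<xi> \<eta> where hf: "has_frame r z0 \<phi> ?S fst \<xi>" "has_frame r z0 \<psi> ?T fst \<eta>" using m unfolding mf_def by blast
 hence F: "is_frame r (Pk r) z0 ?S fst \<xi>" and G: "is_frame r (Pk r) z0 ?T fst \<eta>" by (simp_all add: has_frame_def)
 obtain n' where n': "\<psi> \<in> maps_M (T_max r) n'" using \<psi> unfolding maps_fin_def by blast
 have supp: "Nn n * \<xi> s i = \<xi> s i" if "s \<in> ?S" "i \<in> dom (fst s)" for s i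
  by (rule maps_M_frame_support[OF r hf(1) \<phi> that])
 have supp': "Nn n' * \<eta> s i = \<eta> s i" if "s \<in> ?T" "i \<in> dom (fst s)" for s i
  by (rule maps_M_frame_support[OF r hf(2) n' that])
 let ?U = "?S <+> ?T" and ?h = "case_sum fst fst" and ?\<zeta> = "case_sum \<xi> (\<lambda>t i. shf n n' * \<eta> t i)"
 have mixed: "adj (\<xi> s i) * (shf n n' * y) = 0" if "s \<in> ?S" "i \<in> dom (fst s)" for s i y
 proof -
  have "adj (\<xi> s i) * (shf n n' * y) = adj (Nn n * \<xi> s i) * (shf n n' * y)" unfolding supp[OF that] ..
  also have "... = adj (\<xi> s i) * (Nn n * shf n n') * y" by (simp add: mult.assoc)
  finally show ?thesis by (simp add: Nn_shf0)
 qed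
 have inner: "adj (shf n n' * \<eta> s i) * (shf n n' * \<eta> t j) = adj (\<eta> s i) * \<eta> t j"
  if "s \<in> ?T" "i \<in> dom (fst s)" "t \<in> ?T" "j \<in> dom (fst t)" for s t i j
 proof -
  have "adj (shf n n' * \<eta> s i) * (shf n n' * \<eta> t j) = adj (\<eta> s i) * ((adj (shf n n') * shf n n') * \<eta> t j)"
   by (simp add: mult.assoc)
  thus ?thesis unfolding adj_shf_shf supp'[OF that(3,4)] .
 qed
 have G': "is_frame r (Pk r) z0 ?T fst (\<lambda>t i. shf n n' * \<eta> t i)"
  unfolding is_frame_def
 proof (intro conjI ballI)
  show "finite ?T" "fst ` ?T \<subseteq> Pend r" using is_frameD(1,2)[OF G] by auto
  fix t i assume t: "t \<in> ?T" "i \<in> dom (fst t)"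
  show "shf n n' * \<eta> t i * eu z0 = shf n n' * \<eta> t i" using is_frameD(3)[OF G t] by (simp add: mult.assoc)
  have "Pk r k * (shf n n' * \<eta> t i) = shf n n' * (Pk r k * \<eta> t i)" for k by (simp add: Pk_shf flip: mult.assoc)
  thus "Pk r (the (fst t i)) * (shf n n' * \<eta> t i) = shf n n' * \<eta> t i" using is_frameD(4)[OF G t] by simp
  fix s j assume s: "s \<in> ?T" "j \<in> dom (fst s)"
  show "adj (shf n n' * \<eta> t i) * (shf n n' * \<eta> s j) = (if t = s \<and> i = j then eu z0 else 0)"
   unfolding inner[OF t s] by (rule is_frameD(5)[OF G t(1) s(1) t(2) s(2)])
 qed
 have FG: "is_frame r (Pk r) z0 ?U ?h ?\<zeta>" by (rule union_frame[OF F G' mixed])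
 have e: "dsum n \<phi> \<psi> a = mat (fmap r ?U ?h ?\<zeta> a)" if a: "a \<in> T_max r" for a
 proof (intro ext)
  fix i j :: "(nat set \<times> nat) \<times> nat"
  obtain I k p J l q where ij: "i = ((I, k), p)" "j = ((J, l), q)" by (metis prod.collapse)
  define C where "C \<longleftrightarrow> I = J \<and> I \<in> intervals r \<and> k \<in> I \<and> l \<in> I"
  define X where "X f t e x = mat (f t e) x z0" for f :: "(nat \<rightharpoonup> nat) \<times> nat => nat => bix bop" and t e x
  have ent: "mat (fmap r R h' \<xi>' a) ((I, k), p') ((J, l), q') = (if C then
   \<Sum>e\<in>{1..r} \<times> {1..r}. a ({1..r}, fst e) ({1..r}, snd e) *
    (\<Sum>s\<in>R. if fst e \<in> dom (h' s) \<and> snd e \<in> dom (h' s)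
     then mat (\<xi>' s (fst e)) (({1..r}, k), p') z0 * cnj (mat (\<xi>' s (snd e)) (({1..r}, l), q') z0) else 0) else 0)"
   if "is_frame r (Pk r) z0 R h' \<xi>'" for R :: "'c set" and h' \<xi>' p' q'
   unfolding C_def by (rule fmap_entry[OF that])
  have \<eta>0: "mat (\<eta> t e) (x, p') z0 = 0" if "t \<in> ?T" "e \<in> dom (fst t)" "\<not> p' < n'" for t e x p'
   using Nn_mult_entry[of n' "\<eta> t e" x p' z0] supp'[OF that(1,2)] that(3) by simp
  \<comment> \<open>The upper end of the shift leaves no trace, because \<open>\<eta>\<close> has no
    entries from copy n' on.\<close>
  have sh: "mat (shf n n' * \<eta> t e) (x, p') z0 = (if n \<le> p' then mat (\<eta> t e) (x, p' - n) z0 else 0)"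
   if "t \<in> ?T" "e \<in> dom (fst t)" for t e x p'
   unfolding shf_mult_entry using \<eta>0[OF that, of "p' - n" x] by auto
  have zero: "mat (fmap r ?S fst \<xi> a) ((I, k), p) ((J, l), q) = 0" if "\<not> (p < n \<and> q < n)"
   using tensor_M_good(2)[OF fmap_tensor_M[OF F a supp]] that by metis
  have "mat (fmap r ?U ?h ?\<zeta> a) i j = mat (fmap r ?S fst \<xi> a) ((I, k), p) ((J, l), q) +
   (if n \<le> p \<and> n \<le> q then mat (fmap r ?T fst \<eta> a) ((I, k), p - n) ((J, l), q - n) else 0)"
  proof (cases C)
   case True
   show ?thesis unfolding ij ent[OF FG] ent[OF F] ent[OF G] if_P[OF True]
    sum.Plus[OF is_frameD(1)[OF F] is_frameD(1)[OF G]] sum.case distrib_left sum.distrib comp_def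
   proof (intro arg_cong2[of _ _ _ _ "(+)"] refl)
    let ?L = "\<lambda>e t. if fst e \<in> dom (fst t) \<and> snd e \<in> dom (fst t)
     then mat (shf n n' * \<eta> t (fst e)) (({1..r}, k), p) z0 * cnj (mat (shf n n' * \<eta> t (snd e)) (({1..r}, l), q) z0) else 0"
    let ?R = "\<lambda>e t. if fst e \<in> dom (fst t) \<and> snd e \<in> dom (fst t)
     then mat (\<eta> t (fst e)) (({1..r}, k), p - n) z0 * cnj (mat (\<eta> t (snd e)) (({1..r}, l), q - n) z0) else 0"
    have t: "?L e t = (if n \<le> p \<and> n \<le> q then ?R e t else 0)" if "t \<in> ?T" for e t
     using sh[OF that] by auto
    show "(\<Sum>e\<in>{1..r} \<times> {1..r}. a ({1..r}, fst e) ({1..r}, snd e) * (\<Sum>t\<in>?T. ?L e t))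
     = (if n \<le> p \<and> n \<le> q then \<Sum>e\<in>{1..r} \<times> {1..r}. a ({1..r}, fst e) ({1..r}, snd e) * (\<Sum>t\<in>?T. ?R e t) else 0)"
     by (cases "n \<le> p \<and> n \<le> q") (simp_all only: t if_True if_False simp_thms sum.neutral_const mult_zero_right cong: sum.cong)
   qed
  next
   case False
   show ?thesis unfolding ij ent[OF FG] ent[OF F] ent[OF G] if_not_P[OF False] by simp
  qed
  moreover have "\<phi> a = mat (fmap r ?S fst \<xi> a)" "\<psi> a = mat (fmap r ?T fst \<eta> a)" using hf a unfolding has_frame_def by blast+
  ultimately show "dsum n \<phi> \<psi> a i j = mat (fmap r ?U ?h ?\<zeta> a) i j"
   unfolding dsum_def ij prod.case using zero by auto
 qed
 have hf': "has_frame r z0 (dsum n \<phi> \<psi>) ?U ?h ?\<zeta>" unfolding has_frame_def using FG e by blast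
 show "mf r (dsum n \<phi> \<psi>) (\<lambda>g. m1 g + m2 g)"
 proof (rule mfI[OF hf'])
  fix g assume g: "g \<in> Pend r"
  have "mlt ?U ?h g = mlt ?S fst g + mlt ?T fst g"
   by (rule mlt_Plus[OF is_frameD(1)[OF F] is_frameD(1)[OF G]])
  thus "m1 g + m2 g = mlt ?U ?h g" by (simp add: mlt_CI[OF g])
 next
  fix g assume "g \<notin> Pend r"
  thus "m1 g + m2 g = 0" using m unfolding mf_def by simp
 qed
 show "dsum n \<phi> \<psi> \<in> maps_fin (T_max r)"
 proof (rule maps_M_fin, rule has_frame_maps_M[OF hf', where n = "n + n'"])
  fix u i assume u: "u \<in> ?U" "i \<in> dom (?h u)"
  show "Nn (n + n') * ?\<zeta> u i = ?\<zeta> u i"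
  proof (cases u)
   case (Inl s)
   hence s: "s \<in> ?S" "i \<in> dom (fst s)" using u by auto
   have "Nn (n + n') * \<xi> s i = Nn (n + n') * Nn n * \<xi> s i" using supp[OF s] by (simp add: mult.assoc)
   also have "... = \<xi> s i" using supp[OF s] Nn_idem(2)[of n "n + n'"] by simp
   finally show ?thesis using Inl by simp
  next
   case (Inr t)
   thus ?thesis by (simp add: Nn_shf flip: mult.assoc)
  qed
 qed
qed

section \<open>Composition of maps\<close>

lemma map_comp_dom:
 fixes g h :: "nat \<rightharpoonup> nat"
 shows "dom (g \<circ>\<^sub>m h) = pre h (dom g)"
 unfolding pre_def map_comp_def dom_def by (auto split: option.splits)

lemma map_comp_dom_iff:
 fixes g h :: "nat \<rightharpoonup> nat"
 shows "i \<in> dom (g \<circ>\<^sub>m h) \<longleftrightarrow> i \<in> dom h \<and> the (h i) \<in> dom g"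
 unfolding map_comp_dom pre_def by simp

lemma map_comp_the: "i \<in> dom (g \<circ>\<^sub>m h) ==> the ((g \<circ>\<^sub>m h) i) = the (g (the (h i)))"
 unfolding map_comp_def by (auto split: option.splits)

lemma Pend_comp:
 assumes g: "g \<in> Pend r" and h: "h \<in> Pend r" and ne: "dom (g \<circ>\<^sub>m h) \<noteq> {}"
 shows "g \<circ>\<^sub>m h \<in> Pend r"
 unfolding Pend_def mem_Collect_eq
proof (intro conjI ballI impI)
 have "dom g \<in> intervals r" using g by (simp add: Pend_def)
 thus "dom (g \<circ>\<^sub>m h) \<in> intervals r" using pre_interval[OF h] ne unfolding map_comp_dom by blast
 show "ran (g \<circ>\<^sub>m h) \<subseteq> {1..r}"
 proof
  fix y assume "y \<in> ran (g \<circ>\<^sub>m h)"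
  hence "y \<in> ran g" by (auto simp: ran_def map_comp_def split: option.splits)
  thus "y \<in> {1..r}" using g by (auto simp: Pend_def)
 qed
 fix i j assume ij: "i \<in> dom (g \<circ>\<^sub>m h)" "j \<in> dom (g \<circ>\<^sub>m h)" "i \<le> j"
 thus "the ((g \<circ>\<^sub>m h) i) \<le> the ((g \<circ>\<^sub>m h) j)"
  unfolding map_comp_the[OF ij(1)] map_comp_the[OF ij(2)]
  by (intro Pend_mono[OF g] Pend_mono[OF h]) (auto simp only: map_comp_dom_iff)
qed

lemma Pend_ne: "g \<in> Pend r ==> dom g \<noteq> {}"
 using intervals_subset unfolding Pend_def by blast

text \<open>Pairs whose composite has empty domain are taken out of the index set; this realises the
  convention that such a composition is 0.\<close>

lemma mlt_comp:
 assumes S: "finite S" "h ` S \<subseteq> Pend r" and T: "finite T" "k ` T \<subseteq> Pend r" and g: "g \<in> Pend r"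
 shows "mlt {u \<in> S \<times> T. dom (h (fst u) \<circ>\<^sub>m k (snd u)) \<noteq> {}} (\<lambda>u. h (fst u) \<circ>\<^sub>m k (snd u)) g
  = (\<Sum>(a, b) \<in> {(a, b) \<in> Pend r \<times> Pend r. a \<circ>\<^sub>m b = g}. mlt S h a * mlt T k b)"
proof -
 let ?C = "{(a, b) \<in> Pend r \<times> Pend r. a \<circ>\<^sub>m b = g}"
 have "{u \<in> {u \<in> S \<times> T. dom (h (fst u) \<circ>\<^sub>m k (snd u)) \<noteq> {}}. h (fst u) \<circ>\<^sub>m k (snd u) = g}
  = (\<Union>c\<in>?C. {s \<in> S. h s = fst c} \<times> {t \<in> T. k t = snd c})"
  using S(2) T(2) Pend_ne[OF g] by fastforce
 moreover have "card (\<Union>c\<in>?C. {s \<in> S. h s = fst c} \<times> {t \<in> T. k t = snd c})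
  = (\<Sum>c\<in>?C. card ({s \<in> S. h s = fst c} \<times> {t \<in> T. k t = snd c}))"
 proof (rule card_UN_disjoint)
  show "finite ?C" by (rule finite_subset[of _ "Pend r \<times> Pend r"]) (auto simp: finite_Pend)
  show "\<forall>c\<in>?C. finite ({s \<in> S. h s = fst c} \<times> {t \<in> T. k t = snd c})" using S(1) T(1) by auto
  show "\<forall>c\<in>?C. \<forall>d\<in>?C. c \<noteq> d \<longrightarrow> ({s \<in> S. h s = fst c} \<times> {t \<in> T. k t = snd c}) \<inter>
    ({s \<in> S. h s = fst d} \<times> {t \<in> T. k t = snd d}) = {}" by auto
 qed
 ultimately show ?thesis unfolding mlt_def by (simp add: card_cartesian_product case_prod_beta)
qed

lemma sum_exchange:
 fixes a :: "'p => complex"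
 shows "(\<Sum>k\<in>K. (\<Sum>p\<in>P. a p * (\<Sum>t\<in>T. G p t k)) * (\<Sum>s\<in>S. H s k))
  = (\<Sum>p\<in>P. a p * (\<Sum>s\<in>S. \<Sum>t\<in>T. \<Sum>k\<in>K. G p t k * H s k))"
proof -
 have i: "(\<Sum>s\<in>S. \<Sum>t\<in>T. \<Sum>k\<in>K. G p t k * H s k) = (\<Sum>k\<in>K. (\<Sum>t\<in>T. G p t k) * (\<Sum>s\<in>S. H s k))" for p
 proof -
  have "(\<Sum>s\<in>S. \<Sum>t\<in>T. \<Sum>k\<in>K. G p t k * H s k) = (\<Sum>s\<in>S. \<Sum>k\<in>K. \<Sum>t\<in>T. G p t k * H s k)"
   by (intro sum.cong refl) (rule sum.swap)
  also have "... = (\<Sum>k\<in>K. \<Sum>s\<in>S. \<Sum>t\<in>T. G p t k * H s k)" by (rule sum.swap)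
  also have "... = (\<Sum>k\<in>K. \<Sum>t\<in>T. \<Sum>s\<in>S. G p t k * H s k)" by (intro sum.cong refl) (rule sum.swap)
  finally show ?thesis unfolding sum_product .
 qed
 have "(\<Sum>k\<in>K. (\<Sum>p\<in>P. a p * (\<Sum>t\<in>T. G p t k)) * (\<Sum>s\<in>S. H s k))
  = (\<Sum>k\<in>K. \<Sum>p\<in>P. a p * ((\<Sum>t\<in>T. G p t k) * (\<Sum>s\<in>S. H s k)))"
  by (simp add: sum_distrib_right mult.assoc)
 also have "... = (\<Sum>p\<in>P. \<Sum>k\<in>K. a p * ((\<Sum>t\<in>T. G p t k) * (\<Sum>s\<in>S. H s k)))" by (rule sum.swap)
 finally show ?thesis unfolding i sum_distrib_left .
qed

text \<open>The tensor product of the vector with coordinates c and the vector x, under the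
  numbering of copies that sends (k, P) to P m + k.\<close>

definition amp_vec :: "nat => nat => (nat => complex) => bix bop => bix bop" where
 "amp_vec n m c x = (\<Sum>P<n. sc (c P) * (shf (P * m) m * x))"

lemma amp_vec_entry:
 assumes "m > 0"
 shows "mat (amp_vec n m c x) (i, p) j = (if p div m < n then c (p div m) * mat x (i, p mod m) j else 0)"
proof -
 have "mat (amp_vec n m c x) (i, p) j
   = (\<Sum>P<n. if P = p div m then c (p div m) * mat x (i, p mod m) j else 0)"
  unfolding amp_vec_def mat_sum sc_mult_entry shf_mult_entry
 proof (rule sum.cong[OF refl])
  fix P
  have "P * m \<le> p \<and> p < P * m + m \<longleftrightarrow> P = p div m"
  proof
   assume "P * m \<le> p \<and> p < P * m + m"
   hence "p div m = P" by (intro div_nat_eqI) (simp_all add: mult.commute)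
   thus "P = p div m" ..
  next
   assume "P = p div m"
   thus "P * m \<le> p \<and> p < P * m + m"
    using dividend_less_div_times[OF assms, of p] by (simp add: add.commute)
  qed
  moreover have "p - p div m * m = p mod m" by (rule minus_div_mult_eq_mod)
  ultimately show "c P * (if P * m \<le> p \<and> p < P * m + m then mat x (i, p - P * m) j else 0)
   = (if P = p div m then c (p div m) * mat x (i, p mod m) j else 0)" by simp
 qed
 thus ?thesis by simp
qed

text \<open>Different values of P give orthogonal ranges, so the inner product of tensor products
  factors.\<close>

lemma amp_vec_inner:
 assumes "Nn m * y = y"
 shows "adj (amp_vec n m c x) * amp_vec n m d y = sc (\<Sum>P<n. cnj (c P) * d P) * (adj x * y)"
proof -
 have sh: "adj (shf (P * m) m * x) * (shf (Q * m) m * y) = (if P = Q then adj x * y else 0)" for P Q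
 proof -
  have e: "adj (shf (P * m) m * x) * (shf (Q * m) m * y) = adj x * ((adj (shf (P * m) m) * shf (Q * m) m) * y)"
   by (simp add: mult.assoc)
  have lt: "P < Q ==> P * m + m \<le> Q * m" for P Q :: nat
   using mult_le_mono1[of "Suc P" Q m] by simp
  show ?thesis
  proof (cases P Q rule: linorder_cases)
   case less
   thus ?thesis unfolding e adj_shf_shf0(1)[OF lt[OF less]] by simp
  next
   case equal
   show ?thesis unfolding e unfolding equal adj_shf_shf assms by simp
  next
   case greater
   thus ?thesis unfolding e adj_shf_shf0(2)[OF lt[OF greater]] by simp
  qed
 qed
 have "adj (amp_vec n m c x) * amp_vec n m d y = (\<Sum>P<n. \<Sum>Q<n. sc (cnj (c P) * d Q) * (if P = Q then adj x * y else 0))"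
  unfolding amp_vec_def adj_sum sum_product inner_sc sh ..
 also have "... = (\<Sum>P<n. \<Sum>Q<n. if Q = P then sc (cnj (c P) * d P) * (adj x * y) else 0)"
  by (intro sum.cong refl) auto
 also have "... = (\<Sum>P<n. sc (cnj (c P) * d P) * (adj x * y))" by (intro sum.cong refl) simp
 also have "... = sc (\<Sum>P<n. cnj (c P) * d P) * (adj x * y)"
  by (induction n) (simp_all add: sc_add distrib_right)
 finally show ?thesis .
qed

text \<open>A vector \<open>\<eta> t i\<close> lies in one block, so it amounts to its coordinates
  \<open>c t i\<close> over the copies together with the index of that block. Amplifying \<phi>
  replaces the block index by the vector of \<open>\<xi> s\<close> at this index. A pair (s, t)
  therefore contributes one copy of the composite of the two partial maps, with tensor products as
  vectors.\<close>

lemma mf_amplify: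
 assumes r: "r \<ge> 1" and \<phi>: "\<phi> \<in> maps_M (T_max r) m" and \<psi>: "\<psi> \<in> maps_fin (T_max r)"
  and m: "mf r \<phi> m1" "mf r \<psi> m2"
 shows "mf r (\<lambda>a. amplify m \<phi> (\<psi> a)) (mult (Pend_semiring r) m1 m2)"
  "(\<lambda>a. amplify m \<phi> (\<psi> a)) \<in> maps_fin (T_max r)"
proof -
 let ?S = "CI r m1" and ?T = "CI r m2"
 obtain \<xi> \<eta> where hf: "has_frame r z0 \<phi> ?S fst \<xi>" "has_frame r z0 \<psi> ?T fst \<eta>" using m unfolding mf_def by blast
 hence F: "is_frame r (Pk r) z0 ?S fst \<xi>" and G: "is_frame r (Pk r) z0 ?T fst \<eta>" by (simp_all add: has_frame_def)
 obtain n where n: "\<psi> \<in> maps_M (T_max r) n" using \<psi> unfolding maps_fin_def by blast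
 have supp: "Nn m * \<xi> s i = \<xi> s i" if "s \<in> ?S" "i \<in> dom (fst s)" for s i
  by (rule maps_M_frame_support[OF r hf(1) \<phi> that])
 have supp': "Nn n * \<eta> s i = \<eta> s i" if "s \<in> ?T" "i \<in> dom (fst s)" for s i
  by (rule maps_M_frame_support[OF r hf(2) n that])
 have SP: "fst s \<in> Pend r" if "s \<in> ?S" for s by (rule is_frameD(2)[OF F that])
 have TP: "fst t \<in> Pend r" if "t \<in> ?T" for t by (rule is_frameD(2)[OF G that])
 let ?U = "{u \<in> ?S \<times> ?T. dom (fst (fst u) \<circ>\<^sub>m fst (snd u)) \<noteq> {}}"
 let ?h = "\<lambda>u :: ((nat \<rightharpoonup> nat) \<times> nat) \<times> ((nat \<rightharpoonup> nat) \<times> nat). fst (fst u) \<circ>\<^sub>m fst (snd u)"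
 define c where "c t i P = mat (\<eta> t i) (({1..r}, the (fst t i)), P) z0" for t :: "(nat \<rightharpoonup> nat) \<times> nat" and i P
 define \<zeta> where "\<zeta> u i = amp_vec n m (c (snd u) i) (\<xi> (fst u) (the (fst (snd u) i)))"
  for u :: "((nat \<rightharpoonup> nat) \<times> nat) \<times> ((nat \<rightharpoonup> nat) \<times> nat)" and i
 \<comment> \<open>For m = 0 there are no copies of \<phi>; this excludes the degenerate division by
   m in the numbering of copies.\<close>
 have m0: "m > 0" if "s \<in> ?S" for s
 proof (rule ccontr)
  assume "\<not> m > 0"
  have "dom (fst s) \<noteq> {}" by (rule Pend_ne[OF SP[OF that]])
  then obtain i where i: "i \<in> dom (fst s)" by blast
  have "Nn 0 = 0" by (rule bop_eqI) (simp add: Nn_def rl_empty)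
  hence "\<xi> s i = 0" using supp[OF that i] \<open>\<not> m > 0\<close> by simp
  thus False using is_frameD(5)[OF F that that i i] eu_neq_0[of z0] by simp
 qed
 \<comment> \<open>Within one block, vectors are determined by their coordinates over the copies, so
   the coordinate vectors inherit orthonormality.\<close>
 have cinner: "(\<Sum>P<n. cnj (c s i P) * c t j P) = (if s = t \<and> i = j then 1 else 0)"
  if st: "s \<in> ?T" "i \<in> dom (fst s)" "t \<in> ?T" "j \<in> dom (fst t)" and eq: "the (fst s i) = the (fst t j)" for s t i j
 proof -
  let ?x = "({1..r}, the (fst s i))"
  have 0: "mat (\<eta> s i) k z0 = 0" if "k \<notin> Pair ?x ` {..<n}" for k
  proof -
   obtain I l p where k: "k = ((I, l), p)" by (metis prod.collapse)
   show ?thesis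
   proof (cases "I = {1..r} \<and> l = the (fst s i)")
    case True
    hence "\<not> p < n" using that unfolding k by blast
    thus ?thesis using Nn_mult_entry[of n "\<eta> s i" "(I, l)" p z0] supp'[OF st(1,2)] unfolding k by simp
   next
    case False
    show ?thesis unfolding k frame_entry[OF G st(1,2), of I] if_not_P[OF False] ..
   qed
  qed
  have "mat (adj (\<eta> s i) * \<eta> t j) z0 z0 = (\<Sum>k\<in>Pair ?x ` {..<n}. cnj (mat (\<eta> s i) k z0) * mat (\<eta> t j) k z0)"
   by (rule inner_entry[OF _ 0]) auto
  also have "... = (\<Sum>P<n. cnj (c s i P) * c t j P)"
   unfolding c_def eq by (subst sum.reindex) (auto simp: inj_on_def eq)
  finally have "(\<Sum>P<n. cnj (c s i P) * c t j P) = mat (if s = t \<and> i = j then eu z0 else 0) z0 z0"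
   unfolding is_frameD(5)[OF G st(1,3,2,4)] ..
  thus ?thesis by (simp add: zero_bop.rep_eq eu_def rl_entry pinj_single)
 qed
 have U: "fst u \<in> ?S" "snd u \<in> ?T" if "u \<in> ?U" for u using that by auto
 have FG: "is_frame r (Pk r) z0 ?U ?h \<zeta>"
  unfolding is_frame_def
 proof (intro conjI ballI)
  show "finite ?U" using is_frameD(1)[OF F] is_frameD(1)[OF G] by simp
  show "?h ` ?U \<subseteq> Pend r"
  proof
   fix g assume "g \<in> ?h ` ?U"
   then obtain u where u: "u \<in> ?U" "g = ?h u" by blast
   hence ne: "dom (?h u) \<noteq> {}" by blast
   show "g \<in> Pend r" unfolding u(2) by (rule Pend_comp[OF SP[OF U(1)[OF u(1)]] TP[OF U(2)[OF u(1)]] ne])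
  qed
 next
  fix u i assume u: "u \<in> ?U" "i \<in> dom (?h u)"
  have d: "the (fst (snd u) i) \<in> dom (fst (fst u))" using u(2) unfolding map_comp_dom_iff by blast
  show "\<zeta> u i * eu z0 = \<zeta> u i" unfolding \<zeta>_def amp_vec_def sum_distrib_right mult.assoc
   is_frameD(3)[OF F U(1)[OF u(1)] d] ..
  show "Pk r (the (?h u i)) * \<zeta> u i = \<zeta> u i"
  proof -
   have P: "Pk r k * (sc w * (shf e m * x)) = sc w * (shf e m * (Pk r k * x))" for k w e x
   proof -
    have "Pk r k * (shf e m * x) = shf e m * (Pk r k * x)" by (simp only: mult.assoc[symmetric] Pk_shf)
    thus ?thesis by (simp only: sc_left_commute[of "Pk r k" w])
   qed
   show ?thesis unfolding \<zeta>_def amp_vec_def sum_distrib_left map_comp_the[OF u(2)] P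
    is_frameD(4)[OF F U(1)[OF u(1)] d] ..
  qed
 next
  fix u v i j assume u: "u \<in> ?U" "v \<in> ?U" "i \<in> dom (?h u)" "j \<in> dom (?h v)"
  have d: "the (fst (snd u) i) \<in> dom (fst (fst u))" "the (fst (snd v) j) \<in> dom (fst (fst v))"
   "i \<in> dom (fst (snd u))" "j \<in> dom (fst (snd v))"
   using u(3,4) unfolding map_comp_dom_iff by blast+
  have "adj (\<zeta> u i) * \<zeta> v j = sc (\<Sum>P<n. cnj (c (snd u) i P) * c (snd v) j P) *
   (if fst u = fst v \<and> the (fst (snd u) i) = the (fst (snd v) j) then eu z0 else 0)"
   unfolding \<zeta>_def amp_vec_inner[OF supp[OF U(1)[OF u(2)] d(2)]]
    is_frameD(5)[OF F U(1)[OF u(1)] U(1)[OF u(2)] d(1,2)] ..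
  also have "... = (if u = v \<and> i = j then eu z0 else 0)"
  proof (cases "fst u = fst v \<and> the (fst (snd u) i) = the (fst (snd v) j)")
   case True
   show ?thesis unfolding if_P[OF True] cinner[OF U(2)[OF u(1)] d(3) U(2)[OF u(2)] d(4) conjunct2[OF True]]
    using True by (simp add: prod_eq_iff)
  next
   case False
   thus ?thesis unfolding if_not_P[OF False] by auto
  qed
  finally show "adj (\<zeta> u i) * \<zeta> v j = (if u = v \<and> i = j then eu z0 else 0)" .
 qed
 have e: "amplify m \<phi> (\<psi> a) = mat (fmap r ?U ?h \<zeta> a)" if a: "a \<in> T_max r" for a
 proof (intro ext)
  fix i j :: "(nat set \<times> nat) \<times> nat"
  obtain I k p J l q where ij: "i = ((I, k), p)" "j = ((J, l), q)" by (metis prod.collapse)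
  define P where "P = p div m"
  define Q where "Q = q div m"
  let ?b = "block (\<psi> a) P Q"
  let ?D = "{1..r} \<times> {1..r}"
  have \<psi>a: "\<psi> a = mat (fmap r ?T fst \<eta> a)" using hf(2) a unfolding has_frame_def by blast
  have "\<psi> a \<in> tensor_M (T_max r) n" using n a unfolding maps_M_def star_extendible_def by blast
  hence "if P < n \<and> Q < n then ?b \<in> T_max r else ?b = 0" unfolding tensor_M_def by blast
  hence b: "?b \<in> T_max r" using zero_T_max[of r] by (metis (full_types))
  have L: "amplify m \<phi> (\<psi> a) i j = mat (fmap r ?S fst \<xi> ?b) ((I, k), p mod m) ((J, l), q mod m)"
   using hf(1) b unfolding has_frame_def amplify_def ij prod.case P_def Q_def by simp
  show "amplify m \<phi> (\<psi> a) i j = mat (fmap r ?U ?h \<zeta> a) i j"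
   unfolding L unfolding ij fmap_entry[OF F] fmap_entry[OF FG]
  proof (rule if_cong[OF refl _ refl])
   \<comment> \<open>The coefficient at f in a block of \<open>\<psi> a\<close> collects the pairs e
     that a copy t maps onto f.\<close>
   have bent: "?b ({1..r}, fst f) ({1..r}, snd f) = (\<Sum>e\<in>?D. a ({1..r}, fst e) ({1..r}, snd e) *
     (\<Sum>t\<in>?T. if fst e \<in> dom (fst t) \<and> snd e \<in> dom (fst t) \<and> f = (the (fst t (fst e)), the (fst t (snd e)))
      then c t (fst e) P * cnj (c t (snd e) Q) else 0))" if f: "f \<in> ?D" for f
   proof -
    have C: "{1..r} = {1..r} \<and> {1..r} \<in> intervals r \<and> fst f \<in> {1..r} \<and> snd f \<in> {1..r}"
     using f top_interval[OF r] by auto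
    show ?thesis unfolding block_def \<psi>a fmap_entry[OF G] if_P[OF C]
    proof (intro sum.cong refl arg_cong2[of _ _ _ _ times])
     fix e t assume t: "t \<in> ?T"
     show "(if fst e \<in> dom (fst t) \<and> snd e \<in> dom (fst t)
       then mat (\<eta> t (fst e)) (({1..r}, fst f), P) z0 * cnj (mat (\<eta> t (snd e)) (({1..r}, snd f), Q) z0) else 0)
      = (if fst e \<in> dom (fst t) \<and> snd e \<in> dom (fst t) \<and> f = (the (fst t (fst e)), the (fst t (snd e)))
      then c t (fst e) P * cnj (c t (snd e) Q) else 0)"
     proof (cases "fst e \<in> dom (fst t) \<and> snd e \<in> dom (fst t)")
      case True
      hence d: "fst e \<in> dom (fst t)" "snd e \<in> dom (fst t)" by auto
      show ?thesis unfolding if_P[OF True]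
       by (subst (1 2) frame_entry[OF G t]) (use True d in \<open>auto simp: c_def prod_eq_iff\<close>)
     next
      case False
      thus ?thesis by auto
     qed
    qed
   qed
   let ?H = "\<lambda>s f. if fst f \<in> dom (fst s) \<and> snd f \<in> dom (fst s)
     then mat (\<xi> s (fst f)) (({1..r}, k), p mod m) z0 * cnj (mat (\<xi> s (snd f)) (({1..r}, l), q mod m) z0) else 0"
   let ?G = "\<lambda>e t f. if fst e \<in> dom (fst t) \<and> snd e \<in> dom (fst t) \<and> f = (the (fst t (fst e)), the (fst t (snd e)))
      then c t (fst e) P * cnj (c t (snd e) Q) else 0"
   let ?W = "\<lambda>e u. if fst e \<in> dom (?h u) \<and> snd e \<in> dom (?h u)
     then mat (\<zeta> u (fst e)) (({1..r}, k), p) z0 * cnj (mat (\<zeta> u (snd e)) (({1..r}, l), q) z0) else 0"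
   have "(\<Sum>f\<in>?D. ?b ({1..r}, fst f) ({1..r}, snd f) * (\<Sum>s\<in>?S. ?H s f))
    = (\<Sum>f\<in>?D. (\<Sum>e\<in>?D. a ({1..r}, fst e) ({1..r}, snd e) * (\<Sum>t\<in>?T. ?G e t f)) * (\<Sum>s\<in>?S. ?H s f))"
    using bent by (intro sum.cong refl) simp
   also have "... = (\<Sum>e\<in>?D. a ({1..r}, fst e) ({1..r}, snd e) * (\<Sum>s\<in>?S. \<Sum>t\<in>?T. \<Sum>f\<in>?D. ?G e t f * ?H s f))"
    by (rule sum_exchange)
   also have "... = (\<Sum>e\<in>?D. a ({1..r}, fst e) ({1..r}, snd e) * (\<Sum>u\<in>?U. ?W e u))"
   proof (intro sum.cong refl arg_cong2[of _ _ _ _ times])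
    fix e
    have \<zeta>e: "mat (\<zeta> (s, t) i') (x, y) z0 = (if y div m < n then c t i' (y div m) * mat (\<xi> s (the (fst t i'))) (x, y mod m) z0 else 0)"
     if "s \<in> ?S" for s t i' x y
     unfolding \<zeta>_def amp_vec_entry[OF m0[OF that]] by simp
    have c0: "c t i' y = 0" if "t \<in> ?T" "i' \<in> dom (fst t)" "\<not> y < n" for t i' y
     unfolding c_def using Nn_mult_entry[of n "\<eta> t i'" _ y z0] supp'[OF that(1,2)] that(3) by simp
    have "(\<Sum>f\<in>?D. ?G e t f * ?H s f) = ?W e (s, t)" if s: "s \<in> ?S" and t: "t \<in> ?T" for s t
    proof (cases "fst e \<in> dom (fst t) \<and> snd e \<in> dom (fst t)")
     case True
     let ?x = "(the (fst t (fst e)), the (fst t (snd e)))"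
     have x: "?x \<in> ?D" using Pend_ran[OF TP[OF t]] True by blast
     have "(\<Sum>f\<in>?D. ?G e t f * ?H s f) = (\<Sum>f\<in>?D. if f = ?x then c t (fst e) P * cnj (c t (snd e) Q) * ?H s ?x else 0)"
      using True by (intro sum.cong refl) auto
     also have "... = c t (fst e) P * cnj (c t (snd e) Q) * ?H s ?x"
      by (subst sum.delta) (use x in simp_all)
     also have "... = ?W e (s, t)"
     proof (cases "fst ?x \<in> dom (fst s) \<and> snd ?x \<in> dom (fst s)")
      case True2: True
      hence 1: "fst e \<in> dom (?h (s, t)) \<and> snd e \<in> dom (?h (s, t))"
       using True unfolding fst_conv snd_conv map_comp_dom_iff by blast
      show ?thesis unfolding if_P[OF True2] if_P[OF 1] \<zeta>e[OF s] P_def[symmetric] Q_def[symmetric]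
       using c0[OF t, of "fst e" P] c0[OF t, of "snd e" Q] True by (simp add: mult_ac)
     next
      case False
      hence 1: "\<not> (fst e \<in> dom (?h (s, t)) \<and> snd e \<in> dom (?h (s, t)))"
       unfolding fst_conv snd_conv map_comp_dom_iff by blast
      show ?thesis unfolding if_not_P[OF False] if_not_P[OF 1] by simp
     qed
     finally show ?thesis .
    next
     case False
     hence 1: "\<not> (fst e \<in> dom (?h (s, t)) \<and> snd e \<in> dom (?h (s, t)))"
      unfolding fst_conv snd_conv map_comp_dom_iff by blast
     have "?G e t f = 0" for f using False by auto
     thus ?thesis unfolding if_not_P[OF 1] by simp
    qed
    hence "(\<Sum>s\<in>?S. \<Sum>t\<in>?T. \<Sum>f\<in>?D. ?G e t f * ?H s f) = (\<Sum>s\<in>?S. \<Sum>t\<in>?T. ?W e (s, t))"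
     by (intro sum.cong refl)
    also have "... = (\<Sum>u\<in>?S \<times> ?T. ?W e u)" by (rule sum.cartesian_product'[symmetric])
    also have "... = (\<Sum>u\<in>?U. ?W e u)"
     by (rule sum.mono_neutral_right) (use is_frameD(1)[OF F] is_frameD(1)[OF G] in auto)
    finally show "(\<Sum>s\<in>?S. \<Sum>t\<in>?T. \<Sum>f\<in>?D. ?G e t f * ?H s f) = (\<Sum>u\<in>?U. ?W e u)" .
   qed
   finally show "(\<Sum>f\<in>?D. ?b ({1..r}, fst f) ({1..r}, snd f) * (\<Sum>s\<in>?S. ?H s f))
    = (\<Sum>e\<in>?D. a ({1..r}, fst e) ({1..r}, snd e) * (\<Sum>u\<in>?U. ?W e u))" .
  qed
 qed
 have hf': "has_frame r z0 (\<lambda>a. amplify m \<phi> (\<psi> a)) ?U ?h \<zeta>" unfolding has_frame_def using FG e by blast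
 show "mf r (\<lambda>a. amplify m \<phi> (\<psi> a)) (mult (Pend_semiring r) m1 m2)"
 proof (rule mfI[OF hf'])
  fix g assume g: "g \<in> Pend r"
  have "mlt ?U ?h g = (\<Sum>(a, b) \<in> {(a, b) \<in> Pend r \<times> Pend r. a \<circ>\<^sub>m b = g}. mlt ?S fst a * mlt ?T fst b)"
   by (rule mlt_comp[OF is_frameD(1)[OF F] _ is_frameD(1)[OF G] _ g]) (use SP TP in blast)+
  also have "... = (\<Sum>(a, b) \<in> {(a, b) \<in> Pend r \<times> Pend r. a \<circ>\<^sub>m b = g}. m1 a * m2 b)"
   by (intro sum.cong refl) (auto simp: mlt_CI)
  finally show "mult (Pend_semiring r) m1 m2 g = mlt ?U ?h g" using g by (simp add: Pend_semiring_def)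
 next
  fix g assume "g \<notin> Pend r"
  thus "mult (Pend_semiring r) m1 m2 g = 0" by (simp add: Pend_semiring_def)
 qed
 show "(\<lambda>a. amplify m \<phi> (\<psi> a)) \<in> maps_fin (T_max r)"
 proof (rule maps_M_fin, rule has_frame_maps_M[OF hf', where n = "n * m"])
  fix u i
  have "Nn (n * m) * (sc w * (shf (P * m) m * x)) = sc w * (shf (P * m) m * x)" if "P < n" for P w x
  proof -
   have "P * m + m \<le> n * m" using that using mult_le_mono1[of "Suc P" n m] by simp
   thus ?thesis
    by (simp only: sc_left_commute[of "Nn (n * m)" w] mult.assoc[symmetric] Nn_shf)
     (simp only: mult.assoc Nn_shf assoc_left[OF Nn_shf] sc_left_commute[of "Nn (n * m)" w])
  qed
  thus "Nn (n * m) * \<zeta> u i = \<zeta> u i" unfolding \<zeta>_def amp_vec_def sum_distrib_left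
   by (intro sum.cong refl) simp
 qed
qed

section \<open>The semiring of formal combinations\<close>

lemma map_comp_assoc: "(g \<circ>\<^sub>m h) \<circ>\<^sub>m k = g \<circ>\<^sub>m (h \<circ>\<^sub>m k)"
 by (rule HOL.ext) (simp add: map_comp_def split: option.splits)

text \<open>The product of the semiring with the condition on the composite moved into the summand;
  the sums then run over a fixed finite set and can be exchanged.\<close>

definition conv :: "nat => ((nat \<rightharpoonup> nat) => nat) => ((nat \<rightharpoonup> nat) => nat) => (nat \<rightharpoonup> nat) => nat" where
 "conv r x y k = (if k \<in> Pend r then \<Sum>g\<in>Pend r. \<Sum>h\<in>Pend r. if g \<circ>\<^sub>m h = k then x g * y h else 0 else 0)"

lemma mult_Pend_semiring: "mult (Pend_semiring r) = conv r"
proof (intro ext)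
 fix x y :: "(nat \<rightharpoonup> nat) => nat" and k
 have "(\<Sum>(g, h) \<in> {(g, h) \<in> Pend r \<times> Pend r. g \<circ>\<^sub>m h = k}. x g * y h)
   = (\<Sum>p\<in>Pend r \<times> Pend r. if fst p \<circ>\<^sub>m snd p = k then x (fst p) * y (snd p) else 0)"
  by (rule sum.mono_neutral_cong_left) (auto simp: finite_Pend)
 thus "mult (Pend_semiring r) x y k = conv r x y k"
  by (simp add: Pend_semiring_def conv_def sum.cartesian_product' cong: if_cong)
qed

text \<open>Both sides equal the sum over all triples that compose to k. The convention on empty
  domains is harmless: if the composite of three maps has nonempty domain, so have the partial
  composites, which therefore belong to \<open>Pend r\<close>.\<close>

lemma conv_assoc: "conv r (conv r x y) z = conv r x (conv r y z)"
proof
 fix k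
 let ?P = "Pend r"
 show "conv r (conv r x y) z k = conv r x (conv r y z) k"
 proof (cases "k \<in> ?P")
  case k: True
  let ?p = "\<lambda>a b g h. if a \<circ>\<^sub>m b = g then if g \<circ>\<^sub>m h = k then x a * y b * z h else 0 else 0"
  let ?q = "\<lambda>a b g h. if b \<circ>\<^sub>m h = g then if a \<circ>\<^sub>m g = k then x a * y b * z h else 0 else 0"
  let ?t = "\<lambda>a b h. if (a \<circ>\<^sub>m b) \<circ>\<^sub>m h = k then x a * y b * z h else 0"
  have dl: "a \<circ>\<^sub>m b \<in> ?P" if "(a \<circ>\<^sub>m b) \<circ>\<^sub>m h = k" "a \<in> ?P" "b \<in> ?P" for a b h
   using Pend_comp[OF that(2,3)] Pend_ne[OF k] that(1) map_comp_dom_iff[of _ "a \<circ>\<^sub>m b" h] by blast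
  have dr: "b \<circ>\<^sub>m h \<in> ?P" if "a \<circ>\<^sub>m (b \<circ>\<^sub>m h) = k" "b \<in> ?P" "h \<in> ?P" for a b h
   using Pend_comp[OF that(2,3)] Pend_ne[OF k] that(1) map_comp_dom_iff[of _ a "b \<circ>\<^sub>m h"] by blast
  have "conv r (conv r x y) z k
   = (\<Sum>g\<in>?P. \<Sum>h\<in>?P. \<Sum>a\<in>?P. \<Sum>b\<in>?P. ?p a b g h)"
   unfolding conv_def if_P[OF k]
   by (intro sum.cong refl) (auto simp: sum_distrib_right if_distrib intro!: sum.cong)
  also have "... = (\<Sum>h\<in>?P. \<Sum>g\<in>?P. \<Sum>a\<in>?P. \<Sum>b\<in>?P. ?p a b g h)"
   by (rule sum.swap)
  also have "... = (\<Sum>h\<in>?P. \<Sum>a\<in>?P. \<Sum>b\<in>?P. ?t a b h)"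
  proof (rule sum.cong[OF refl])
   fix h assume h: "h \<in> ?P"
   have "(\<Sum>g\<in>?P. \<Sum>a\<in>?P. \<Sum>b\<in>?P. ?p a b g h)
    = (\<Sum>a\<in>?P. \<Sum>g\<in>?P. \<Sum>b\<in>?P. ?p a b g h)"
    by (rule sum.swap)
   also have "... = (\<Sum>a\<in>?P. \<Sum>b\<in>?P. \<Sum>g\<in>?P. ?p a b g h)"
    by (rule sum.cong[OF refl], rule sum.swap)
   also have "... = (\<Sum>a\<in>?P. \<Sum>b\<in>?P. ?t a b h)"
   proof (intro sum.cong refl)
    fix a b assume ab: "a \<in> ?P" "b \<in> ?P"
    have "(\<Sum>g\<in>?P. ?p a b g h)
     = (if a \<circ>\<^sub>m b \<in> ?P then ?t a b h else 0)"
     by (rule sum.delta'[OF finite_Pend])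
    also have "... = ?t a b h" using dl[OF _ ab] by auto
    finally show "(\<Sum>g\<in>?P. ?p a b g h) = ?t a b h" .
   qed
   finally show "(\<Sum>g\<in>?P. \<Sum>a\<in>?P. \<Sum>b\<in>?P. ?p a b g h)
    = (\<Sum>a\<in>?P. \<Sum>b\<in>?P. ?t a b h)" .
  qed
  also have "... = (\<Sum>a\<in>?P. \<Sum>h\<in>?P. \<Sum>b\<in>?P. ?t a b h)" by (rule sum.swap)
  also have "... = (\<Sum>a\<in>?P. \<Sum>b\<in>?P. \<Sum>h\<in>?P. ?t a b h)" by (rule sum.cong[OF refl], rule sum.swap)
  finally have L: "conv r (conv r x y) z k = (\<Sum>a\<in>?P. \<Sum>b\<in>?P. \<Sum>h\<in>?P. ?t a b h)" .
  have "conv r x (conv r y z) k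
   = (\<Sum>a\<in>?P. \<Sum>g\<in>?P. \<Sum>b\<in>?P. \<Sum>h\<in>?P. ?q a b g h)"
   unfolding conv_def if_P[OF k]
   by (intro sum.cong refl) (auto simp: sum_distrib_left if_distrib mult.assoc intro!: sum.cong)
  also have "... = (\<Sum>a\<in>?P. \<Sum>b\<in>?P. \<Sum>g\<in>?P. \<Sum>h\<in>?P. ?q a b g h)"
   by (rule sum.cong[OF refl], rule sum.swap)
  also have "... = (\<Sum>a\<in>?P. \<Sum>b\<in>?P. \<Sum>h\<in>?P. \<Sum>g\<in>?P. ?q a b g h)"
   by (rule sum.cong[OF refl], rule sum.cong[OF refl], rule sum.swap)
  also have "... = (\<Sum>a\<in>?P. \<Sum>b\<in>?P. \<Sum>h\<in>?P. ?t a b h)"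
  proof (intro sum.cong refl)
   fix a b h assume bh: "b \<in> ?P" "h \<in> ?P"
   have "(\<Sum>g\<in>?P. ?q a b g h)
    = (if b \<circ>\<^sub>m h \<in> ?P then if a \<circ>\<^sub>m (b \<circ>\<^sub>m h) = k then x a * y b * z h else 0 else 0)"
    by (rule sum.delta'[OF finite_Pend])
   also have "... = ?t a b h" unfolding map_comp_assoc using dr[OF _ bh] by auto
   finally show "(\<Sum>g\<in>?P. ?q a b g h) = ?t a b h" .
  qed
  finally show ?thesis unfolding L ..
 next
  case False
  thus ?thesis by (simp add: conv_def)
 qed
qed

lemma idm_comp: "k \<in> Pend r ==> idm r \<circ>\<^sub>m k = k" "k \<in> Pend r ==> k \<circ>\<^sub>m idm r = k"
proof -
 assume k: "k \<in> Pend r"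
 show "idm r \<circ>\<^sub>m k = k"
 proof (rule HOL.ext)
  fix i show "(idm r \<circ>\<^sub>m k) i = k i"
   using Pend_ran[OF k, of i] by (cases "k i") (auto simp: map_comp_def idm_def)
 qed
 show "k \<circ>\<^sub>m idm r = k"
 proof (rule HOL.ext)
  fix i show "(k \<circ>\<^sub>m idm r) i = k i"
   using Pend_dom[OF k, of i] by (cases "k i") (auto simp: map_comp_def idm_def)
 qed
qed

lemma conv_idm:
 assumes r: "r \<ge> 1" and x: "\<And>h. h \<notin> Pend r ==> x h = 0"
 shows "conv r (\<lambda>g. if g = idm r then 1 else 0) x = x" "conv r x (\<lambda>g. if g = idm r then 1 else 0) = x"
proof -
 let ?P = "Pend r" and ?e = "\<lambda>g. if g = idm r then 1 else 0 :: nat"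
 have "conv r ?e x k = x k" for k
 proof (cases "k \<in> ?P")
  case True
  have "conv r ?e x k = (\<Sum>g\<in>?P. if g = idm r then \<Sum>h\<in>?P. if h = k then x h else 0 else 0)"
   unfolding conv_def if_P[OF True] by (intro sum.cong refl) (auto simp: idm_comp intro!: sum.cong sum.neutral)
  also have "... = x k" using True idm_Pend[OF r] finite_Pend by simp
  finally show ?thesis .
 qed (simp add: conv_def x)
 thus "conv r ?e x = x" by (rule HOL.ext)
 have "conv r x ?e k = x k" for k
 proof (cases "k \<in> ?P")
  case True
  have "conv r x ?e k = (\<Sum>g\<in>?P. \<Sum>h\<in>?P. if h = idm r then if g = k then x g else 0 else 0)"
   unfolding conv_def if_P[OF True] by (intro sum.cong refl) (auto simp: idm_comp)
  also have "... = x k" using True idm_Pend[OF r] finite_Pend by simp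
  finally show ?thesis .
 qed (simp add: conv_def x)
 thus "conv r x ?e = x" by (rule HOL.ext)
qed

lemma conv_add:
 "conv r (\<lambda>h. x h + y h) z = (\<lambda>h. conv r x z h + conv r y z h)"
 "conv r z (\<lambda>h. x h + y h) = (\<lambda>h. conv r z x h + conv r z y h)"
proof -
 have i: "(if P then a + b else 0) = (if P then a else 0) + (if P then b else 0 :: nat)" for P a b by simp
 show "conv r (\<lambda>h. x h + y h) z = (\<lambda>h. conv r x z h + conv r y z h)"
  "conv r z (\<lambda>h. x h + y h) = (\<lambda>h. conv r z x h + conv r z y h)"
  by (rule HOL.ext, simp add: conv_def distrib_left distrib_right i sum.distrib cong: if_cong)+
qed

lemma conv_0: "conv r (\<lambda>h. 0) x = (\<lambda>h. 0)" "conv r x (\<lambda>h. 0) = (\<lambda>h. 0)"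
 by (rule HOL.ext, simp add: conv_def cong: if_cong)+

lemma Pend_semiring_simps:
 "carrier (Pend_semiring r) = {x. \<forall>h. h \<notin> Pend r \<longrightarrow> x h = 0}"
 "mult (Pend_semiring r) = conv r" "one (Pend_semiring r) = (\<lambda>h. if h = idm r then 1 else 0)"
 "zero (Pend_semiring r) = (\<lambda>h. 0)" "add (Pend_semiring r) = (\<lambda>x y h. x h + y h)"
 unfolding mult_Pend_semiring by (simp_all add: Pend_semiring_def idm_def)

lemma semiring_Pend:
 assumes r: "r \<ge> 1"
 shows "semiring (Pend_semiring r)"
proof (intro semiring.intro semiring_axioms.intro abelian_monoidI monoidI)
 fix x y z assume xyz: "x \<in> carrier (Pend_semiring r)" "y \<in> carrier (Pend_semiring r)" "z \<in> carrier (Pend_semiring r)"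
 thus "(x \<otimes>\<^bsub>Pend_semiring r\<^esub> y) \<otimes>\<^bsub>Pend_semiring r\<^esub> z = x \<otimes>\<^bsub>Pend_semiring r\<^esub> (y \<otimes>\<^bsub>Pend_semiring r\<^esub> z)"
  by (simp add: Pend_semiring_simps conv_assoc)
qed (use idm_Pend[OF r] conv_idm[OF r] in \<open>auto simp: Pend_semiring_simps conv_add conv_0 conv_def add_ac\<close>)

text \<open>The operations on classes are unions over representatives. Carrying the axioms over from
  the formal combinations avoids verifying them on such unions.\<close>

lemma semiring_transport:
 assumes S: "semiring S" and f: "bij_betw f (carrier S) (carrier V)"
  and m: "\<And>x y. x \<in> carrier S ==> y \<in> carrier S ==> f (x \<otimes>\<^bsub>S\<^esub> y) = f x \<otimes>\<^bsub>V\<^esub> f y"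
  and a: "\<And>x y. x \<in> carrier S ==> y \<in> carrier S ==> f (x \<oplus>\<^bsub>S\<^esub> y) = f x \<oplus>\<^bsub>V\<^esub> f y"
  and o: "f \<one>\<^bsub>S\<^esub> = \<one>\<^bsub>V\<^esub>" and z: "f \<zero>\<^bsub>S\<^esub> = \<zero>\<^bsub>V\<^esub>"
 shows "semiring V"
proof -
 interpret S: semiring S by (rule S)
 have V: "carrier V = f ` carrier S" using f by (simp add: bij_betw_def)
 note e = m[symmetric] a[symmetric] o[symmetric] z[symmetric]
 show ?thesis
  by (intro semiring.intro semiring_axioms.intro abelian_monoidI monoidI)
   (auto simp: V e S.l_distr S.r_distr S.m_assoc S.a_ac)
qed

section \<open>Classes indexed by multiplicity functions, and the isomorphism\<close>

definition cls :: "nat => ((nat \<rightharpoonup> nat) => nat) => (nat set \<times> nat) stable_map set" where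
 "cls r m = {\<phi> \<in> maps_fin (T_max r). mf r \<phi> m}"

lemma map_class_cls:
 assumes r: "r \<ge> 1" and \<phi>: "\<phi> \<in> maps_fin (T_max r)" "mf r \<phi> m"
 shows "map_class (T_max r) \<phi> = cls r m"
proof (intro equalityI subsetI)
 fix \<psi> assume "\<psi> \<in> map_class (T_max r) \<phi>"
 hence \<psi>: "\<psi> \<in> maps_fin (T_max r)" "\<exists>u\<in>inner_unitaries (T_max r). \<forall>a\<in>T_max r. \<phi> a = Ad u (\<psi> a)"
  unfolding inner_equiv_on_def by blast+
 obtain m' where m': "mf r \<psi> m'" using mf_ex[OF r] \<psi>(1) maps_fin_subset_K by blast
 hence "m = m'" using mf_equiv[OF r \<phi>(2) m'] \<psi>(2) by simp
 thus "\<psi> \<in> cls r m" using \<psi>(1) m' by (simp add: cls_def)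
next
 fix \<psi> assume "\<psi> \<in> cls r m"
 hence \<psi>: "\<psi> \<in> maps_fin (T_max r)" "mf r \<psi> m" by (simp_all add: cls_def)
 hence "\<exists>u\<in>inner_unitaries (T_max r). \<forall>a\<in>T_max r. \<phi> a = Ad u (\<psi> a)" using mf_equiv[OF r \<phi>(2) \<psi>(2)] by simp
 thus "\<psi> \<in> map_class (T_max r) \<phi>" using \<phi>(1) \<psi>(1) unfolding inner_equiv_on_def by blast
qed

lemma cls_ne:
 assumes r: "r \<ge> 1" and m: "m \<in> carrier (Pend_semiring r)"
 obtains \<phi> where "\<phi> \<in> cls r m"
proof -
 obtain \<phi> where "\<phi> \<in> maps_fin (T_max r)" "mf r \<phi> m"
  by (rule mf_exists[OF r, of m]) (use m in \<open>auto simp: Pend_semiring_simps\<close>)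
 thus ?thesis by (intro that) (simp add: cls_def)
qed

lemma mf_carrier: "mf r \<phi> m ==> m \<in> carrier (Pend_semiring r)"
 by (simp add: mf_def Pend_semiring_simps)

lemma cls_bij:
 assumes r: "r \<ge> 1"
 shows "bij_betw (cls r) (carrier (Pend_semiring r)) (carrier (embedding_semiring (T_max r)))"
 unfolding bij_betw_def
proof
 show "inj_on (cls r) (carrier (Pend_semiring r))"
 proof (rule inj_onI)
  fix m m' assume m: "m \<in> carrier (Pend_semiring r)" "cls r m = cls r m'"
  obtain \<phi> where \<phi>: "\<phi> \<in> cls r m" by (rule cls_ne[OF r m(1)])
  hence "\<phi> \<in> cls r m'" using m(2) by simp
  thus "m = m'" using mf_unique[OF r] \<phi> by (auto simp: cls_def)
 qed
 have "carrier (embedding_semiring (T_max r)) = map_class (T_max r) ` maps_fin (T_max r)"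
  by (auto simp: embedding_semiring_def quotient_def)
 also have "... = cls r ` carrier (Pend_semiring r)"
 proof (intro equalityI subsetI)
  fix X assume "X \<in> map_class (T_max r) ` maps_fin (T_max r)"
  then obtain \<phi> where \<phi>: "\<phi> \<in> maps_fin (T_max r)" "X = map_class (T_max r) \<phi>" by blast
  obtain m where m: "mf r \<phi> m" using mf_ex[OF r] \<phi>(1) maps_fin_subset_K by blast
  show "X \<in> cls r ` carrier (Pend_semiring r)"
   unfolding \<phi>(2) map_class_cls[OF r \<phi>(1) m] using mf_carrier[OF m] by (rule imageI)
 next
  fix X assume "X \<in> cls r ` carrier (Pend_semiring r)"
  then obtain m where m: "m \<in> carrier (Pend_semiring r)" "X = cls r m" by blast
  obtain \<phi> where \<phi>: "\<phi> \<in> cls r m" by (rule cls_ne[OF r m(1)])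
  hence "X = map_class (T_max r) \<phi>" using map_class_cls[OF r, of \<phi> m] m(2) by (simp add: cls_def)
  thus "X \<in> map_class (T_max r) ` maps_fin (T_max r)" using \<phi> by (simp add: cls_def)
 qed
 finally show "cls r ` carrier (Pend_semiring r) = carrier (embedding_semiring (T_max r))" ..
qed

text \<open>All choices of representatives and sizes produce the same class, because it depends only
  on the sum of the multiplicities; the union in the definition is over a one-element
  family.\<close>

lemma cls_add:
 assumes r: "r \<ge> 1" and m: "m \<in> carrier (Pend_semiring r)" "m' \<in> carrier (Pend_semiring r)"
 shows "cls r (m \<oplus>\<^bsub>Pend_semiring r\<^esub> m') = cls r m \<oplus>\<^bsub>embedding_semiring (T_max r)\<^esub> cls r m'"
proof -
 let ?C = "{map_class (T_max r) (dsum n \<phi> \<psi>) | \<phi> \<psi> n. \<phi> \<in> cls r m \<and> \<psi> \<in> cls r m' \<and> \<phi> \<in> maps_M (T_max r) n}"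
 have e: "map_class (T_max r) (dsum n \<phi> \<psi>) = cls r (\<lambda>g. m g + m' g)"
  if "\<phi> \<in> cls r m" "\<psi> \<in> cls r m'" "\<phi> \<in> maps_M (T_max r) n" for \<phi> \<psi> n
  using that mf_dsum[OF r that(3), of \<psi> m m'] map_class_cls[OF r] by (simp add: cls_def)
 obtain \<phi> where \<phi>: "\<phi> \<in> cls r m" by (rule cls_ne[OF r m(1)])
 obtain \<psi> where \<psi>: "\<psi> \<in> cls r m'" by (rule cls_ne[OF r m(2)])
 obtain n where n: "\<phi> \<in> maps_M (T_max r) n" using \<phi> unfolding cls_def maps_fin_def by blast
 have "cls r (\<lambda>g. m g + m' g) \<in> ?C" using e[OF \<phi> \<psi> n] \<phi> \<psi> n by blast
 moreover have "?C \<subseteq> {cls r (\<lambda>g. m g + m' g)}" using e by blast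
 ultimately have "?C = {cls r (\<lambda>g. m g + m' g)}" by blast
 thus ?thesis by (simp add: Pend_semiring_simps embedding_semiring_def)
qed

lemma cls_mult:
 assumes r: "r \<ge> 1" and m: "m \<in> carrier (Pend_semiring r)" "m' \<in> carrier (Pend_semiring r)"
 shows "cls r (m \<otimes>\<^bsub>Pend_semiring r\<^esub> m') = cls r m \<otimes>\<^bsub>embedding_semiring (T_max r)\<^esub> cls r m'"
proof -
 let ?p = "m \<otimes>\<^bsub>Pend_semiring r\<^esub> m'"
 let ?C = "{map_class (T_max r) (\<lambda>a. amplify n \<phi> (\<psi> a)) | \<phi> \<psi> n. \<phi> \<in> cls r m \<and> \<psi> \<in> cls r m' \<and> \<phi> \<in> maps_M (T_max r) n}"
 have e: "map_class (T_max r) (\<lambda>a. amplify n \<phi> (\<psi> a)) = cls r ?p"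
  if "\<phi> \<in> cls r m" "\<psi> \<in> cls r m'" "\<phi> \<in> maps_M (T_max r) n" for \<phi> \<psi> n
  using that mf_amplify[OF r that(3), of \<psi> m m'] map_class_cls[OF r] by (simp add: cls_def)
 obtain \<phi> where \<phi>: "\<phi> \<in> cls r m" by (rule cls_ne[OF r m(1)])
 obtain \<psi> where \<psi>: "\<psi> \<in> cls r m'" by (rule cls_ne[OF r m(2)])
 obtain n where n: "\<phi> \<in> maps_M (T_max r) n" using \<phi> unfolding cls_def maps_fin_def by blast
 have "cls r ?p \<in> ?C" using e[OF \<phi> \<psi> n] \<phi> \<psi> n by blast
 moreover have "?C \<subseteq> {cls r ?p}" using e by blast
 ultimately have C: "?C = {cls r ?p}" by blast
 have "cls r m \<otimes>\<^bsub>embedding_semiring (T_max r)\<^esub> cls r m' = \<Union>?C" by (simp add: embedding_semiring_def)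
 thus ?thesis unfolding C by simp
qed

lemma cls_one_zero:
 assumes r: "r \<ge> 1"
 shows "cls r \<one>\<^bsub>Pend_semiring r\<^esub> = \<one>\<^bsub>embedding_semiring (T_max r)\<^esub>"
  "cls r \<zero>\<^bsub>Pend_semiring r\<^esub> = \<zero>\<^bsub>embedding_semiring (T_max r)\<^esub>"
 using map_class_cls[OF r mf_corner(2,1)[OF r]] map_class_cls[OF r mf_zero(2,1)]
 by (simp_all add: Pend_semiring_simps embedding_semiring_def)

lemma semiring_embedding:
 assumes "r \<ge> 1"
 shows "semiring (embedding_semiring (T_max r))"
 by (rule semiring_transport[OF semiring_Pend[OF assms] cls_bij[OF assms]])
  (intro cls_mult cls_add cls_one_zero assms; assumption)+

text \<open>\<open>cls\<close> respects the operations in the direction from multiplicities to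
  classes, so the isomorphism sought is its inverse.\<close>

lemma embedding_iso:
 assumes r: "r \<ge> 1"
 shows "embedding_semiring (T_max r) \<simeq> Pend_semiring r"
proof -
 let ?V = "embedding_semiring (T_max r)" and ?P = "Pend_semiring r"
 interpret P: semiring ?P by (rule semiring_Pend[OF r])
 let ?g = "inv_into (carrier ?P) (cls r)"
 have V: "carrier ?V = cls r ` carrier ?P" using cls_bij[OF r] by (simp add: bij_betw_def)
 have gi: "?g (cls r m) = m" if "m \<in> carrier ?P" for m
  using bij_betw_inv_into_left[OF cls_bij[OF r] that] .
 have "?g \<in> ring_hom ?V ?P"
  unfolding ring_hom_def mem_Collect_eq V
 proof (intro conjI allI impI)
  show "?g \<in> cls r ` carrier ?P \<rightarrow> carrier ?P" using gi by auto
  fix X Y assume "X \<in> cls r ` carrier ?P \<and> Y \<in> cls r ` carrier ?P"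
  then obtain m m' where m: "m \<in> carrier ?P" "X = cls r m" "m' \<in> carrier ?P" "Y = cls r m'" by blast
  show "?g (X \<otimes>\<^bsub>?V\<^esub> Y) = ?g X \<otimes>\<^bsub>?P\<^esub> ?g Y"
   unfolding m(2,4) cls_mult[OF r m(1,3), symmetric] using gi m P.m_closed by simp
  show "?g (X \<oplus>\<^bsub>?V\<^esub> Y) = ?g X \<oplus>\<^bsub>?P\<^esub> ?g Y"
   unfolding m(2,4) cls_add[OF r m(1,3), symmetric] using gi m P.a_closed by simp
 next
  show "?g \<one>\<^bsub>?V\<^esub> = \<one>\<^bsub>?P\<^esub>" unfolding cls_one_zero(1)[OF r, symmetric] by (rule gi) (rule P.one_closed)
 qed
 hence "?g \<in> ring_iso ?V ?P" unfolding ring_iso_def using bij_betw_inv_into[OF cls_bij[OF r]] by blast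
 thus ?thesis unfolding is_ring_iso_def by blast
qed

section \<open>The metric\<close>

definition UB :: "nat => (nat set \<times> nat) cmat set" where
 "UB r = {a \<in> T_max r. op_norm a \<le> 1}"

text \<open>Ring-valued representatives with bounded values on the unit ball; boundedness is what
  makes the suprema in the distance meaningful.\<close>

definition frep :: "nat => (nat set \<times> nat) stable_map => ((nat set \<times> nat) cmat => bix bop) => bool" where
 "frep r \<phi> f \<longleftrightarrow> (\<exists>K. \<forall>a\<in>UB r. nrm (f a) \<le> K) \<and> (\<forall>a\<in>T_max r. \<phi> a = mat (f a))"

definition ddist :: "nat => bix bop => ((nat set \<times> nat) cmat => bix bop) => ((nat set \<times> nat) cmat => bix bop) => real" where
 "ddist r v f g = (SUP a\<in>UB r. nrm (f a - v * g a * adj v))"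

lemma UB_0: "0 \<in> UB r"
proof -
 have "op_norm (rmat {} :: (nat set \<times> nat) cmat) \<le> 1" by (rule op_norm_le[OF bnd_rmat[OF pinj_empty]])
 hence "op_norm (0 :: (nat set \<times> nat) cmat) \<le> 1" unfolding rmat_empty .
 thus ?thesis unfolding UB_def using zero_T_max by simp
qed

lemma UB_eT: "1 \<le> i ==> i \<le> j ==> j \<le> r ==> eT r i j \<in> UB r"
 unfolding UB_def eT_def mem_Collect_eq
 by (intro conjI op_norm_le bnd_rmat pinj_erel) (fold eT_def, rule eT_in)

text \<open>On the unit ball all entries have modulus at most 1, so the corner is a sum of r^2 terms
  of norm at most 1; spreading adds the factor from \<open>nrm_spread\<close>.\<close>

lemma fmap_bounded:
 assumes F: "is_frame r (Pk r) z S h \<xi>" and a: "a \<in> UB r"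
 shows "nrm (fmap r S h \<xi> a) \<le> real (card (intervals r)) * (real r * real r)"
proof -
 have b: "bounded_op a" "op_norm a \<le> 1" using a T_max_bounded unfolding UB_def by blast+
 have e: "cmod (a i j) \<le> 1" for i j by (rule order_trans[OF bnd_entry[OF bnd_op_norm[OF b(1)]] b(2)])
 have "nrm (sc (a i j) * frame_op S h \<xi> k l) \<le> 1" for i j k l
  using mult_mono[OF e[of i j] frame_op_nrm[OF F, of k l]] nrm_sc_le[of "a i j" "frame_op S h \<xi> k l"] by simp
 hence "nrm (fop r S h \<xi> a) \<le> (\<Sum>i\<in>{1..r}. \<Sum>j\<in>{1..r}. 1)"
  unfolding fop_def by (intro order_trans[OF nrm_sum] sum_mono)
 thus ?thesis unfolding fmap_fop
  by (intro order_trans[OF nrm_spread] mult_left_mono) simp_all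
qed

lemma mf_frep:
 assumes "mf r \<phi> m"
 obtains f where "frep r \<phi> f"
proof -
 obtain \<xi> where hf: "has_frame r z0 \<phi> (CI r m) fst \<xi>" using assms unfolding mf_def by blast
 hence "is_frame r (Pk r) z0 (CI r m) fst \<xi>" by (simp add: has_frame_def)
 hence "frep r \<phi> (fmap r (CI r m) fst \<xi>)"
  using hf fmap_bounded unfolding frep_def has_frame_def by blast
 thus ?thesis by (rule that)
qed

lemma nrm_conj_diff:
 assumes "v * adj v = 1" "adj v * v = 1"
 shows "nrm (v * x * adj v - v * y * adj v) = nrm (x - y)"
 using unitary_nrm[OF assms, of "x - y"] by (simp add: left_diff_distrib right_diff_distrib)

lemma nrm_triangle: "nrm (a - c) \<le> nrm (a - b) + nrm (b - c)"
 using nrm_add[of "a - b" "b - c"] by simp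

context
 fixes r :: nat and \<phi> \<psi> \<rho> f g h
 assumes f: "frep r \<phi> f" and g: "frep r \<psi> g" and h: "frep r \<rho> h"
begin

lemma ddist_bdd:
 assumes v: "IU r v"
 shows "bdd_above ((\<lambda>a. nrm (f a - v * g a * adj v)) ` UB r)"
proof -
 obtain K L where K: "\<And>a. a \<in> UB r ==> nrm (f a) \<le> K" "\<And>a. a \<in> UB r ==> nrm (g a) \<le> L"
  using f g unfolding frep_def by blast
 have "nrm (f a - v * g a * adj v) \<le> K + L" if "a \<in> UB r" for a
 proof -
  have "nrm (v * g a * adj v) = nrm (g a)" using v unfolding IU_def by (intro unitary_nrm) auto
  thus ?thesis using nrm_triangle[of "f a" "v * g a * adj v" 0] K[OF that]
   nrm_diff_commute[of 0 "v * g a * adj v"] by simp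
 qed
 thus ?thesis by (intro bdd_aboveI2)
qed

lemma ddist_upper: "IU r v ==> a \<in> UB r ==> nrm (f a - v * g a * adj v) \<le> ddist r v f g"
 unfolding ddist_def by (rule cSUP_upper[OF _ ddist_bdd])

lemma ddist_nonneg: "IU r v ==> 0 \<le> ddist r v f g"
 using ddist_upper[OF _ UB_0] nrm_nonneg order_trans by blast

text \<open>Conjugation by a unitary preserves norms, so v in one direction corresponds to
  \<open>adj v\<close> in the other.\<close>

lemma ddist_sym: "IU r v ==> ddist r (adj v) g f = ddist r v f g"
proof -
 assume v: "IU r v"
 hence u: "v * adj v = 1" "adj v * v = 1" unfolding IU_def by auto
 have "nrm (g a - adj v * f a * adj (adj v)) = nrm (f a - v * g a * adj v)" for a
 proof -
  have "v * (adj v * f a * v) * adj v = (v * adj v) * f a * (v * adj v)" by (simp only: mult.assoc)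
  hence "v * (adj v * f a * v) * adj v = f a" by (simp add: u)
  thus ?thesis using nrm_conj_diff[OF u, of "g a" "adj v * f a * v"] by (simp add: nrm_diff_commute)
 qed
 thus ?thesis unfolding ddist_def by simp
qed

lemma map_dist_INF:
 assumes r: "r \<ge> 1"
 shows "map_dist (T_max r) \<phi> \<psi> = (INF v\<in>{v. IU r v}. ddist r v f g)"
proof -
 have N: "map_norm (T_max r) (\<lambda>a. \<phi> a - Ad (mat v) (\<psi> a)) = ddist r v f g" for v
 proof -
  have "{op_norm (\<phi> a - Ad (mat v) (\<psi> a)) | a. a \<in> T_max r \<and> op_norm a \<le> 1}
   = (\<lambda>a. op_norm (\<phi> a - Ad (mat v) (\<psi> a))) ` UB r" unfolding UB_def by blast
  also have "... = (\<lambda>a. nrm (f a - v * g a * adj v)) ` UB r"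
  proof (rule image_cong[OF refl])
   fix a assume "a \<in> UB r"
   hence "\<phi> a = mat (f a)" "\<psi> a = mat (g a)" using f g unfolding frep_def UB_def by auto
   thus "op_norm (\<phi> a - Ad (mat v) (\<psi> a)) = nrm (f a - v * g a * adj v)" by (simp only: op_norm_diff_Ad)
  qed
  finally show ?thesis unfolding map_norm_def ddist_def by simp
 qed
 have "{map_norm (T_max r) (\<lambda>a. \<phi> a - Ad u (\<psi> a)) | u. u \<in> inner_unitaries (T_max r)}
  = (\<lambda>v. ddist r v f g) ` {v. IU r v}"
  unfolding inner_unitaries_IU[OF r] N[symmetric] by blast
 thus ?thesis unfolding map_dist_def by simp
qed

lemma ddist_INF_bdd: "bdd_below ((\<lambda>v. ddist r v f g) ` {v. IU r v})"
 by (rule bdd_belowI2[of _ 0]) (simp add: ddist_nonneg)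

lemma map_dist_nonneg: "r \<ge> 1 ==> 0 \<le> map_dist (T_max r) \<phi> \<psi>"
 using IU_1 by (auto simp: map_dist_INF intro!: cINF_greatest ddist_nonneg)

lemma map_dist_less:
 assumes "r \<ge> 1" "map_dist (T_max r) \<phi> \<psi> < e"
 obtains v where "IU r v" "ddist r v f g < e"
proof -
 have "\<exists>v\<in>{v. IU r v}. ddist r v f g < e"
  using assms(2) cINF_less_iff[OF _ ddist_INF_bdd, of e] IU_1 unfolding map_dist_INF[OF assms(1)] by blast
 thus ?thesis using that by blast
qed

lemma map_dist_le: "r \<ge> 1 ==> IU r v ==> map_dist (T_max r) \<phi> \<psi> \<le> ddist r v f g"
 unfolding map_dist_INF by (rule cINF_lower[OF ddist_INF_bdd]) simp

lemma ddist_triangle: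
 assumes r: "r \<ge> 1" and v: "IU r v" and w: "IU r w"
  and up: "\<And>a. a \<in> UB r ==> nrm (g a - w * h a * adj w) \<le> ddist r w g h"
 shows "ddist r (v * w) f h \<le> ddist r v f g + ddist r w g h"
 unfolding ddist_def[of r "v * w"]
proof (rule cSUP_least)
 show "UB r \<noteq> {}" using UB_0 by blast
 fix a assume a: "a \<in> UB r"
 have u: "v * adj v = 1" "adj v * v = 1" using v unfolding IU_def by auto
 have "v * w * h a * adj (v * w) = v * (w * h a * adj w) * adj v" by (simp add: mult.assoc)
 hence "nrm (f a - v * w * h a * adj (v * w))
   \<le> nrm (f a - v * g a * adj v) + nrm (v * g a * adj v - v * (w * h a * adj w) * adj v)"
  using nrm_triangle by simp
 also have "... \<le> ddist r v f g + ddist r w g h"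
  unfolding nrm_conj_diff[OF u] by (intro add_mono ddist_upper v a up)
 finally show "nrm (f a - v * w * h a * adj (v * w)) \<le> ddist r v f g + ddist r w g h" .
qed

end

lemma map_dist_sym:
 assumes r: "r \<ge> 1" and f: "frep r \<phi> f" and g: "frep r \<psi> g"
 shows "map_dist (T_max r) \<psi> \<phi> = map_dist (T_max r) \<phi> \<psi>"
proof -
 have le: "map_dist (T_max r) \<psi> \<phi> \<le> map_dist (T_max r) \<phi> \<psi>" if f: "frep r \<phi> f" and g: "frep r \<psi> g" for \<phi> \<psi> f g
  unfolding map_dist_INF[OF f g g r]
 proof (rule cINF_greatest)
  show "{v. IU r v} \<noteq> {}" using IU_1 by blast
  fix v assume "v \<in> {v. IU r v}"
  hence v: "IU r v" by simp
  show "map_dist (T_max r) \<psi> \<phi> \<le> ddist r v f g"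
   using map_dist_le[OF g f f r IU_adj[OF v]] unfolding ddist_sym[OF f g g v] .
 qed
 show ?thesis by (rule antisym[OF le[OF f g] le[OF g f]])
qed

text \<open>The product of two nearly optimal unitaries is used. The infima may not be attained,
  hence the margins e / 2.\<close>

lemma map_dist_triangle:
 assumes r: "r \<ge> 1" and f: "frep r \<phi> f" and g: "frep r \<psi> g" and h: "frep r \<rho> h"
 shows "map_dist (T_max r) \<phi> \<rho> \<le> map_dist (T_max r) \<phi> \<psi> + map_dist (T_max r) \<psi> \<rho>"
proof (rule field_le_epsilon)
 fix e :: real assume e: "e > 0"
 obtain v where v: "IU r v" "ddist r v f g < map_dist (T_max r) \<phi> \<psi> + e / 2"
  by (rule map_dist_less[OF f g h r, of "map_dist (T_max r) \<phi> \<psi> + e / 2"]) (use e in auto)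
 obtain w where w: "IU r w" "ddist r w g h < map_dist (T_max r) \<psi> \<rho> + e / 2"
  by (rule map_dist_less[OF g h f r, of "map_dist (T_max r) \<psi> \<rho> + e / 2"]) (use e in auto)
 have "map_dist (T_max r) \<phi> \<rho> \<le> ddist r (v * w) f h" by (rule map_dist_le[OF f h g r IU_mult[OF r v(1) w(1)]])
 also have "... \<le> ddist r v f g + ddist r w g h"
  by (rule ddist_triangle[OF f g h r v(1) w(1) ddist_upper[OF g h f w(1)]])
 finally show "map_dist (T_max r) \<phi> \<rho> \<le> map_dist (T_max r) \<phi> \<psi> + map_dist (T_max r) \<psi> \<rho> + e"
  using v(2) w(2) by simp
qed

lemma map_dist_same:
 assumes r: "r \<ge> 1" and m: "mf r \<phi> m" "mf r \<psi> m"
 shows "map_dist (T_max r) \<phi> \<psi> = 0"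
proof -
 obtain f where f: "frep r \<phi> f" by (rule mf_frep[OF m(1)])
 obtain g where g: "frep r \<psi> g" by (rule mf_frep[OF m(2)])
 obtain u where u: "u \<in> inner_unitaries (T_max r)" "\<forall>a\<in>T_max r. \<phi> a = Ad u (\<psi> a)"
  using mf_equiv[OF r m] by blast
 then obtain v where v: "u = mat v" "IU r v" unfolding inner_unitaries_IU[OF r] by blast
 have "f a = v * g a * adj v" if "a \<in> UB r" for a
 proof -
  have a: "a \<in> T_max r" using that by (simp add: UB_def)
  hence "mat (f a) = Ad (mat v) (mat (g a))" using u(2) f g unfolding frep_def v(1) by simp
  thus ?thesis unfolding Ad_def mat_mult[symmetric] mat_adj[symmetric] mat_inject .
 qed
 hence "ddist r v f g \<le> 0" unfolding ddist_def using UB_0 nrm_eq_0[of "0 :: bix bop"]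
  by (intro cSUP_least) auto
 thus ?thesis using map_dist_le[OF f g g r v(2)] map_dist_nonneg[OF f g g r] by simp
qed

text \<open>If the infimum is below 1 / (r + 1), so is the distance for some unitary. Matrix units
  lie in the unit ball, and \<open>mf_close\<close> applies.\<close>

lemma map_dist_separated:
 assumes r: "r \<ge> 1" and m: "mf r \<phi> m" "mf r \<psi> m'" and less: "map_dist (T_max r) \<phi> \<psi> < 1 / (real r + 1)"
 shows "m = m'"
proof -
 obtain f where f: "frep r \<phi> f" by (rule mf_frep[OF m(1)])
 obtain g where g: "frep r \<psi> g" by (rule mf_frep[OF m(2)])
 obtain v where v: "IU r v" "ddist r v f g < 1 / (real r + 1)" by (rule map_dist_less[OF f g g r less])
 show ?thesis
 proof (rule mf_close[OF r m])
  show "mat v \<in> inner_unitaries (T_max r)" unfolding inner_unitaries_IU[OF r] using v(1) by blast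
  show "(real r + 1) * ddist r v f g < 1" using v(2) by (simp add: field_simps)
  fix i j assume ij: "1 \<le> i" "i \<le> j" "j \<le> r"
  have "\<phi> (eT r i j) = mat (f (eT r i j))" "\<psi> (eT r i j) = mat (g (eT r i j))"
   using f g eT_in[OF ij] unfolding frep_def by blast+
  thus "op_norm (\<phi> (eT r i j) - Ad (mat v) (\<psi> (eT r i j))) \<le> ddist r v f g"
   using ddist_upper[OF f g g v(1) UB_eT[OF ij]] by (simp only: op_norm_diff_Ad)
 qed
qed

text \<open>Equivalent maps are at distance 0, so by the triangle inequality the distance is the
  same for all representatives, and the definite description denotes this value.\<close>

lemma embedding_dist_eq:
 assumes r: "r \<ge> 1" and \<phi>: "\<phi> \<in> cls r m" and \<psi>: "\<psi> \<in> cls r m'"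
 shows "embedding_dist (T_max r) (cls r m) (cls r m') = map_dist (T_max r) \<phi> \<psi>"
proof -
 have mf: "mf r \<phi> m" "mf r \<psi> m'" using \<phi> \<psi> by (simp_all add: cls_def)
 have car: "cls r m \<in> carrier (embedding_semiring (T_max r))" "cls r m' \<in> carrier (embedding_semiring (T_max r))"
  using bij_betwE[OF cls_bij[OF r]] mf_carrier[OF mf(1)] mf_carrier[OF mf(2)] by blast+
 have le: "map_dist (T_max r) \<phi> \<psi> \<le> map_dist (T_max r) \<phi>' \<psi>'"
  if "\<phi> \<in> cls r m" "\<psi> \<in> cls r m'" "\<phi>' \<in> cls r m" "\<psi>' \<in> cls r m'" for \<phi> \<phi>' \<psi> \<psi>'
 proof -
  have m: "mf r \<phi> m" "mf r \<psi> m'" "mf r \<phi>' m" "mf r \<psi>' m'" using that by (simp_all add: cls_def)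
  obtain f where f: "frep r \<phi> f" by (rule mf_frep[OF m(1)])
  obtain g where g: "frep r \<psi> g" by (rule mf_frep[OF m(2)])
  obtain f' where f': "frep r \<phi>' f'" by (rule mf_frep[OF m(3)])
  obtain g' where g': "frep r \<psi>' g'" by (rule mf_frep[OF m(4)])
  show ?thesis
   using map_dist_triangle[OF r f f' g] map_dist_triangle[OF r f' g' g]
    map_dist_same[OF r m(1,3)] map_dist_same[OF r m(4,2)] by simp
 qed
 have all: "map_dist (T_max r) \<phi>' \<psi>' = map_dist (T_max r) \<phi> \<psi>" if "\<phi>' \<in> cls r m" "\<psi>' \<in> cls r m'" for \<phi>' \<psi>'
  by (rule antisym[OF le[OF that \<phi> \<psi>] le[OF \<phi> \<psi> that]])
 have "(THE c. \<forall>\<phi>\<in>cls r m. \<forall>\<psi>\<in>cls r m'. map_dist (T_max r) \<phi> \<psi> = c) = map_dist (T_max r) \<phi> \<psi>"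
 proof (rule the_equality)
  fix c assume "\<forall>\<phi>\<in>cls r m. \<forall>\<psi>\<in>cls r m'. map_dist (T_max r) \<phi> \<psi> = c"
  thus "c = map_dist (T_max r) \<phi> \<psi>" using \<phi> \<psi> by simp
 qed (use all in simp)
 thus ?thesis unfolding embedding_dist_def using car by simp
qed

lemma carrier_rep:
 assumes r: "r \<ge> 1" and X: "X \<in> carrier (embedding_semiring (T_max r))"
 obtains m \<phi> f where "X = cls r m" "\<phi> \<in> cls r m" "mf r \<phi> m" "frep r \<phi> f"
proof -
 obtain m where m: "m \<in> carrier (Pend_semiring r)" "X = cls r m"
  using X cls_bij[OF r] unfolding bij_betw_def by blast
 obtain \<phi> where \<phi>: "\<phi> \<in> cls r m" by (rule cls_ne[OF r m(1)])
 hence mf: "mf r \<phi> m" by (simp add: cls_def)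
 obtain f where f: "frep r \<phi> f" by (rule mf_frep[OF mf])
 show ?thesis by (rule that[OF m(2) \<phi> mf f])
qed

lemma embedding_metric:
 assumes r: "r \<ge> 1"
 shows "Metric_space (carrier (embedding_semiring (T_max r))) (embedding_dist (T_max r))"
  and "Metric_space.mtopology (carrier (embedding_semiring (T_max r))) (embedding_dist (T_max r)) =
   discrete_topology (carrier (embedding_semiring (T_max r)))"
proof -
 let ?M = "carrier (embedding_semiring (T_max r))" and ?d = "embedding_dist (T_max r)"
 have out: "?d X Y = 0" if "\<not> (X \<in> ?M \<and> Y \<in> ?M)" for X Y unfolding embedding_dist_def if_not_P[OF that] ..
 have sep: "X = Y" if "X \<in> ?M" "Y \<in> ?M" "?d X Y < 1 / (real r + 1)" for X Y
 proof -
  note XY = that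
  obtain m \<phi> f where 1: "X = cls r m" "\<phi> \<in> cls r m" "mf r \<phi> m" "frep r \<phi> f" by (rule carrier_rep[OF r XY(1)])
  obtain m' \<psi> g where 2: "Y = cls r m'" "\<psi> \<in> cls r m'" "mf r \<psi> m'" "frep r \<psi> g" by (rule carrier_rep[OF r XY(2)])
  have "m = m'"
   by (rule map_dist_separated[OF r 1(3) 2(3)])
    (use XY(3) in \<open>simp only: 1(1) 2(1) embedding_dist_eq[OF r 1(2) 2(2)]\<close>)
  thus ?thesis using 1(1) 2(1) by simp
 qed
 show M: "Metric_space ?M ?d"
 proof
  fix X Y
  show "0 \<le> ?d X Y"
  proof (cases "X \<in> ?M \<and> Y \<in> ?M")
   case True
   obtain m \<phi> f where 1: "X = cls r m" "\<phi> \<in> cls r m" "mf r \<phi> m" "frep r \<phi> f" by (rule carrier_rep[OF r conjunct1[OF True]])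
   obtain m' \<psi> g where 2: "Y = cls r m'" "\<psi> \<in> cls r m'" "mf r \<psi> m'" "frep r \<psi> g" by (rule carrier_rep[OF r conjunct2[OF True]])
   show ?thesis unfolding 1(1) 2(1) embedding_dist_eq[OF r 1(2) 2(2)] by (rule map_dist_nonneg[OF 1(4) 2(4) 2(4) r])
  qed (simp add: out)
  show "?d X Y = ?d Y X"
  proof (cases "X \<in> ?M \<and> Y \<in> ?M")
   case True
   obtain m \<phi> f where 1: "X = cls r m" "\<phi> \<in> cls r m" "mf r \<phi> m" "frep r \<phi> f" by (rule carrier_rep[OF r conjunct1[OF True]])
   obtain m' \<psi> g where 2: "Y = cls r m'" "\<psi> \<in> cls r m'" "mf r \<psi> m'" "frep r \<psi> g" by (rule carrier_rep[OF r conjunct2[OF True]])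
   show ?thesis unfolding 1(1) 2(1) embedding_dist_eq[OF r 1(2) 2(2)] embedding_dist_eq[OF r 2(2) 1(2)]
    by (rule map_dist_sym[OF r 2(4) 1(4)])
  next
   case False
   thus ?thesis using out[of X Y] out[of Y X] by auto
  qed
 next
  fix X Y assume XY: "X \<in> ?M" "Y \<in> ?M"
  show "?d X Y = 0 \<longleftrightarrow> X = Y"
  proof
   assume "?d X Y = 0"
   thus "X = Y" by (intro sep XY) simp
  next
   assume "X = Y"
   obtain m \<phi> f where 1: "X = cls r m" "\<phi> \<in> cls r m" "mf r \<phi> m" "frep r \<phi> f" by (rule carrier_rep[OF r XY(1)])
   show "?d X Y = 0" unfolding \<open>X = Y\<close>[symmetric] unfolding 1(1) embedding_dist_eq[OF r 1(2,2)]
    by (rule map_dist_same[OF r 1(3,3)])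
  qed
 next
  fix X Y Z assume XYZ: "X \<in> ?M" "Y \<in> ?M" "Z \<in> ?M"
  obtain m \<phi> f where 1: "X = cls r m" "\<phi> \<in> cls r m" "mf r \<phi> m" "frep r \<phi> f" by (rule carrier_rep[OF r XYZ(1)])
  obtain m' \<psi> g where 2: "Y = cls r m'" "\<psi> \<in> cls r m'" "mf r \<psi> m'" "frep r \<psi> g" by (rule carrier_rep[OF r XYZ(2)])
  obtain m'' \<rho> h where 3: "Z = cls r m''" "\<rho> \<in> cls r m''" "mf r \<rho> m''" "frep r \<rho> h" by (rule carrier_rep[OF r XYZ(3)])
  show "?d X Z \<le> ?d X Y + ?d Y Z"
   unfolding 1(1) 2(1) 3(1) embedding_dist_eq[OF r 1(2) 2(2)] embedding_dist_eq[OF r 2(2) 3(2)] embedding_dist_eq[OF r 1(2) 3(2)]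
   by (rule map_dist_triangle[OF r 1(4) 2(4) 3(4)])
 qed
 interpret M: Metric_space ?M ?d by (rule M)
 show "M.mtopology = discrete_topology ?M"
  unfolding topology_eq M.openin_mtopology openin_discrete_topology
 proof (intro allI iffI conjI impI)
  fix U X assume U: "U \<subseteq> ?M" and X: "X \<in> U"
  \<comment> \<open>Distinct classes are at least 1 / (r + 1) apart, so this ball contains X
    alone.\<close>
  have "M.mball X (1 / (real r + 1)) \<subseteq> U"
  proof
   fix Y assume "Y \<in> M.mball X (1 / (real r + 1))"
   hence "X = Y" by (intro sep) simp_all
   thus "Y \<in> U" using X by simp
  qed
  thus "\<exists>e>0. M.mball X e \<subseteq> U" by (intro exI[of _ "1 / (real r + 1)"]) simp
 qed auto
qed

section \<open>Indecomposable maps\<close>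

lemma fmap_split:
 assumes "\<And>i j. frame_op S h \<xi> i j = frame_op T k \<eta> i j + frame_op U l \<zeta> i j"
 shows "fmap r S h \<xi> a = fmap r T k \<eta> a + fmap r U l \<zeta> a"
 unfolding fmap_def assms by (simp add: distrib_left sum.distrib spread_add)

lemma eT_image:
 assumes hf: "has_frame r z \<phi> S h \<xi>" and s: "s \<in> S" "i \<in> dom (h s)"
 shows "\<phi> (eT r i i) = mat (spread r (frame_op S h \<xi> i i))" "eT r i i \<in> T_max r"
  "UT r (frame_op S h \<xi> i i)" "frame_op S h \<xi> i i * \<xi> s i = \<xi> s i"
proof -
 have F: "is_frame r (Pk r) z S h \<xi>" using hf by (simp add: has_frame_def)
 have i: "i \<in> {1..r}" by (rule Pend_dom[OF is_frameD(2)[OF F s(1)] s(2)])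
 show e: "eT r i i \<in> T_max r" using i by (intro eT_in) auto
 show "\<phi> (eT r i i) = mat (spread r (frame_op S h \<xi> i i))"
  using hf e unfolding has_frame_def fmap_eT[OF i i, symmetric] by blast
 show "UT r (frame_op S h \<xi> i i)" using i by (intro UT_frame_op[OF F]) auto
 show "frame_op S h \<xi> i i * \<xi> s i = \<xi> s i" using frame_op_apply[OF F s, of i] s(2) by simp
qed

text \<open>The images of diagonal matrix units under the two maps annihilate each other, and they
  fix the respective frame vectors; so the two frames are orthogonal and unite to a frame of the
  sum.\<close>

lemma mf_direct_sum:
 assumes r: "r \<ge> 1" and m: "mf r \<phi>1 m1" "mf r \<phi>2 m2" and ds: "is_direct_sum (T_max r) \<phi> \<phi>1 \<phi>2"
 shows "mf r \<phi> (\<lambda>g. m1 g + m2 g)"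
proof -
 let ?S = "CI r m1" and ?T = "CI r m2"
 obtain \<xi> \<eta> where hf: "has_frame r z0 \<phi>1 ?S fst \<xi>" "has_frame r z0 \<phi>2 ?T fst \<eta>" using m unfolding mf_def by blast
 hence F: "is_frame r (Pk r) z0 ?S fst \<xi>" and G: "is_frame r (Pk r) z0 ?T fst \<eta>" by (simp_all add: has_frame_def)
 have orth: "adj (\<xi> s i) * \<eta> t j = 0" if st: "s \<in> ?S" "i \<in> dom (fst s)" "t \<in> ?T" "j \<in> dom (fst t)" for s i t j
 proof -
  let ?A = "frame_op ?S fst \<xi> i i" and ?B = "frame_op ?T fst \<eta> j j"
  note A = eT_image[OF hf(1) st(1,2)] and B = eT_image[OF hf(2) st(3,4)]
  have "\<phi>1 (eT r i i) \<bullet>\<bullet> \<phi>2 (eT r j j) = 0" using ds A(2) B(2) unfolding is_direct_sum_def by blast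
  hence "mat (spread r ?A * spread r ?B) = mat 0" unfolding A(1) B(1) by (simp add: mat_mult zero_bop.rep_eq)
  hence "spread r (?A * ?B) = spread r 0" unfolding mat_inject by (simp add: spread_mult A(3) B(3))
  hence AB: "?A * ?B = 0" by (rule spread_inj[OF r UT_mult[OF A(3) B(3)] UT_0])
  have "adj (\<xi> s i) * \<eta> t j = adj (?A * \<xi> s i) * (?B * \<eta> t j)" unfolding A(4) B(4) ..
  also have "... = adj (\<xi> s i) * (?A * ?B) * \<eta> t j" by (simp add: adj_frame_op mult.assoc)
  finally show ?thesis unfolding AB by simp
 qed
 have "frame_op (?S <+> ?T) (case_sum fst fst) (case_sum \<xi> \<eta>) i j = frame_op ?S fst \<xi> i j + frame_op ?T fst \<eta> i j" for i j
  unfolding frame_op_def by (simp add: sum.Plus is_frameD(1)[OF F] is_frameD(1)[OF G] cong: if_cong)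
 from fmap_split[OF this]
 have fm: "fmap r (?S <+> ?T) (case_sum fst fst) (case_sum \<xi> \<eta>) a = fmap r ?S fst \<xi> a + fmap r ?T fst \<eta> a" for a .
 have hf': "has_frame r z0 \<phi> (?S <+> ?T) (case_sum fst fst) (case_sum \<xi> \<eta>)"
  unfolding has_frame_def
 proof (intro conjI ballI)
  show "is_frame r (Pk r) z0 (?S <+> ?T) (case_sum fst fst) (case_sum \<xi> \<eta>)" by (rule union_frame[OF F G orth])
  fix a assume a: "a \<in> T_max r"
  have "\<phi> a = \<phi>1 a + \<phi>2 a" using ds a unfolding is_direct_sum_def by blast
  thus "\<phi> a = mat (fmap r (?S <+> ?T) (case_sum fst fst) (case_sum \<xi> \<eta>) a)"
   unfolding fm mat_add using hf a unfolding has_frame_def by simp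
 qed
 show ?thesis
  by (rule mfI[OF hf']) (use m in \<open>simp_all add: mlt_Plus is_frameD(1)[OF F] is_frameD(1)[OF G] mlt_CI mf_def\<close>)
qed

text \<open>A copy of g contributes a unit vector that is fixed by the corner of the image of a
  diagonal matrix unit, for any point of the nonempty domain of g.\<close>

lemma mf_nonzero:
 assumes r: "r \<ge> 1" and m: "mf r \<phi> m"
 shows "nonzero_map (T_max r) \<phi> \<longleftrightarrow> (\<exists>g. m g \<noteq> 0)"
proof
 obtain \<xi> where hf: "has_frame r z0 \<phi> (CI r m) fst \<xi>" using m unfolding mf_def by blast
 hence F: "is_frame r (Pk r) z0 (CI r m) fst \<xi>" by (simp add: has_frame_def)
 show "\<exists>g. m g \<noteq> 0" if nz: "nonzero_map (T_max r) \<phi>"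
 proof (rule ccontr)
  assume "\<nexists>g. m g \<noteq> 0"
  hence "CI r m = {}" by (auto simp: CI_def)
  hence "\<phi> a = 0" if "a \<in> T_max r" for a
   using hf that unfolding has_frame_def by (simp add: fmap_def frame_op_def zero_bop.rep_eq)
  thus False using nz unfolding nonzero_map_def by blast
 qed
 assume "\<exists>g. m g \<noteq> 0"
 then obtain g where g: "m g \<noteq> 0" by blast
 have gP: "g \<in> Pend r"
 proof (rule ccontr)
  assume "g \<notin> Pend r"
  thus False using m g unfolding mf_def by simp
 qed
 obtain i where i: "i \<in> dom g" using Pend_ne[OF gP] by blast
 have s: "(g, 0) \<in> CI r m" "i \<in> dom (fst (g, 0 :: nat))" using g gP i by (auto simp: CI_def)
 note A = eT_image[OF hf s]
 have "\<phi> (eT r i i) \<noteq> 0"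
 proof
  assume "\<phi> (eT r i i) = 0"
  hence "mat (spread r (frame_op (CI r m) fst \<xi> i i)) = mat 0" unfolding A(1) by (simp add: zero_bop.rep_eq)
  hence "spread r (frame_op (CI r m) fst \<xi> i i) = spread r 0" unfolding mat_inject by simp
  hence "frame_op (CI r m) fst \<xi> i i = 0" by (rule spread_inj[OF r A(3) UT_0])
  hence "\<xi> (g, 0) i = 0" using A(4) by simp
  thus False using is_frameD(5)[OF F s(1,1,2,2)] eu_neq_0[of z0] by simp
 qed
 thus "nonzero_map (T_max r) \<phi>" unfolding nonzero_map_def using A(2) by blast
qed

lemma blk_op_orth:
 assumes "\<And>\<mu> \<nu> i j. \<mu> \<in> A ==> \<nu> \<in> B ==> i \<in> J \<mu> ==> j \<in> J \<nu> ==> adj (g \<mu> i) * g \<nu> j = 0"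
 shows "blk_op A J g c * blk_op B J g d = 0"
proof -
 have "(sc c' * (g \<mu> i * adj (g \<mu> j))) * (sc d' * (g \<nu> k * adj (g \<nu> l))) = 0"
  if "\<mu> \<in> A" "\<nu> \<in> B" "j \<in> J \<mu>" "k \<in> J \<nu>" for c' d' \<mu> \<nu> i j k l
 proof -
  have "(sc c' * (g \<mu> i * adj (g \<mu> j))) * (sc d' * (g \<nu> k * adj (g \<nu> l)))
   = sc c' * (sc d' * (g \<mu> i * (adj (g \<mu> j) * g \<nu> k) * adj (g \<nu> l)))"
   by (simp add: mult.assoc sc_left_commute[of "g \<mu> i"] sc_left_commute[of "adj (g \<mu> j)"])
  thus ?thesis unfolding assms[OF that] by simp
 qed
 thus ?thesis unfolding blk_op_def sum_distrib_left sum_distrib_right by (intro sum.neutral ballI) simp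
qed

text \<open>Different copies have orthogonal vectors in every summand, and taking adjoints only
  changes the coefficients of a block operator.\<close>

lemma fmap_orth:
 assumes F: "is_frame r (Pk r) z S h \<xi>" and T: "T \<subseteq> S" "U \<subseteq> S" "T \<inter> U = {}"
  and a: "a \<in> T_max r" "b \<in> T_max r"
  and x: "x \<in> {fmap r T h \<xi> a, adj (fmap r T h \<xi> a)}" and y: "y \<in> {fmap r U h \<xi> b, adj (fmap r U h \<xi> b)}"
 shows "x * y = 0"
proof -
 let ?J = "\<lambda>\<mu>. pre (h (snd \<mu>)) (fst \<mu>)" and ?g = "\<lambda>\<mu> i. tau r (fst \<mu>) * \<xi> (snd \<mu>) i"
 have sub: "is_frame r (Pk r) z R h \<xi>" if "R \<subseteq> S" for R
  using F finite_subset[OF that] that unfolding is_frame_def by blast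
 obtain c where c: "x = blk_op (intervals r \<times> T) ?J ?g c"
  using x fmap_blk_op[OF sub[OF T(1)] a(1)] blk_op_adj[of "intervals r \<times> T" ?J ?g] by fastforce
 obtain d where d: "y = blk_op (intervals r \<times> U) ?J ?g d"
  using y fmap_blk_op[OF sub[OF T(2)] a(2)] blk_op_adj[of "intervals r \<times> U" ?J ?g] by fastforce
 show ?thesis unfolding c d
 proof (rule blk_op_orth)
  fix \<mu> \<nu> i j assume \<mu>: "\<mu> \<in> intervals r \<times> T" "\<nu> \<in> intervals r \<times> U" "i \<in> ?J \<mu>" "j \<in> ?J \<nu>"
  have s: "snd \<mu> \<in> S" "snd \<nu> \<in> S" "snd \<mu> \<noteq> snd \<nu>" "i \<in> dom (h (snd \<mu>))" "j \<in> dom (h (snd \<nu>))"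
   and I: "fst \<mu> \<in> intervals r" using \<mu> T by (auto simp: pre_def)
  have "Pk.pI r (fst \<mu>) * \<xi> (snd \<nu>) j = (if the (h (snd \<nu>) j) \<in> fst \<mu> then \<xi> (snd \<nu>) j else 0)"
   by (rule pI_vec[OF is_frameD(4)[OF F s(2,5)] Pend_ran[OF is_frameD(2)[OF F s(2)] s(5)]])
    (use intervals_subset[OF I] in blast)
  hence "adj (\<xi> (snd \<mu>) i) * (Pk.pI r (fst \<mu>) * \<xi> (snd \<nu>) j) = 0"
   using is_frameD(5)[OF F s(1,2,4,5)] s(3) by simp
  moreover have "adj (?g \<mu> i) * ?g \<nu> j = adj (\<xi> (snd \<mu>) i) * ((adj (tau r (fst \<mu>)) * tau r (fst \<nu>)) * \<xi> (snd \<nu>) j)"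
   by (simp add: mult.assoc)
  ultimately show "adj (?g \<mu> i) * ?g \<nu> j = 0"
   unfolding adj_tau_tau'[OF I] by (cases "fst \<mu> = fst \<nu>") simp_all
 qed
qed

definition \<delta> :: "(nat \<rightharpoonup> nat) => (nat \<rightharpoonup> nat) => nat" where
 "\<delta> g = (\<lambda>k. if k = g then 1 else 0)"

text \<open>Separating one copy from the others is a decomposition into a direct sum. If anything
  were left over, both parts would be nonzero.\<close>

lemma indecomposable_single:
 assumes r: "r \<ge> 1" and \<phi>: "\<phi> \<in> indecomposable_maps (T_max r)"
 obtains g where "g \<in> Pend r" "mf r \<phi> (\<delta> g)"
proof -
 have K: "\<phi> \<in> maps_K (T_max r)" and nz: "nonzero_map (T_max r) \<phi>" and ind: "indecomposable (T_max r) \<phi>"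
  using \<phi> unfolding indecomposable_maps_def by auto
 obtain m where m: "mf r \<phi> m" by (rule mf_ex[OF r K])
 obtain \<xi> where hf: "has_frame r z0 \<phi> (CI r m) fst \<xi>" using m unfolding mf_def by blast
 hence F: "is_frame r (Pk r) z0 (CI r m) fst \<xi>" by (simp add: has_frame_def)
 obtain g where "m g \<noteq> 0" using mf_nonzero[OF r m] nz by blast
 hence g: "g \<in> Pend r" "(g, 0) \<in> CI r m" using m unfolding mf_def CI_def by auto
 define T where "T = {(g, 0 :: nat)}"
 have part: "T \<subseteq> CI r m" "CI r m - T \<subseteq> CI r m" "T \<inter> (CI r m - T) = {}" using g by (auto simp: T_def)
 have sub: "is_frame r (Pk r) z0 R fst \<xi>" if "R \<subseteq> CI r m" for R
  using F finite_subset[OF that] that unfolding is_frame_def by blast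
 define \<phi>' where "\<phi>' R a = mat (fmap r R fst \<xi> a)" for R a
 have hf': "has_frame r z0 (\<phi>' R) R fst \<xi>" if "R \<subseteq> CI r m" for R
  unfolding has_frame_def \<phi>'_def using sub[OF that] by simp
 have mf': "mf r (\<phi>' R) (\<lambda>g. if g \<in> Pend r then mlt R fst g else 0)" if "R \<subseteq> CI r m" for R
  by (rule mfI[OF hf'[OF that]]) simp_all
 have nz': "nonzero_map (T_max r) (\<phi>' R)" if "R \<subseteq> CI r m" "s \<in> R" for R s
 proof -
  have "fst s \<in> Pend r" using is_frameD(2)[OF sub[OF that(1)] that(2)] .
  moreover have "mlt R fst (fst s) \<noteq> 0"
  proof -
   have fin: "finite {t \<in> R. fst t = fst s}" using is_frameD(1)[OF sub[OF that(1)]] by simp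
   have "s \<in> {t \<in> R. fst t = fst s}" using that(2) by simp
   thus ?thesis unfolding mlt_def card_0_eq[OF fin] by blast
  qed
  ultimately show ?thesis unfolding mf_nonzero[OF r mf'[OF that(1)]] by (intro exI[of _ "fst s"]) simp
 qed
 have "frame_op (CI r m) fst \<xi> i j = frame_op T fst \<xi> i j + frame_op (CI r m - T) fst \<xi> i j" for i j
  unfolding frame_op_def by (subst add.commute, rule sum.subset_diff[OF part(1) is_frameD(1)[OF F]])
 from fmap_split[OF this]
 have fm: "fmap r (CI r m) fst \<xi> a = fmap r T fst \<xi> a + fmap r (CI r m - T) fst \<xi> a" for a .
 have ds: "is_direct_sum (T_max r) \<phi> (\<phi>' T) (\<phi>' (CI r m - T))"
  unfolding is_direct_sum_def
 proof (intro conjI ballI)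
  fix a assume "a \<in> T_max r"
  hence "\<phi> a = mat (fmap r (CI r m) fst \<xi> a)" using hf unfolding has_frame_def by blast
  thus "\<phi> a = \<phi>' T a + \<phi>' (CI r m - T) a" unfolding fm mat_add \<phi>'_def .
 next
  fix a b x y assume ab: "a \<in> T_max r" "b \<in> T_max r"
   and x: "x \<in> {\<phi>' T a, mat_adj (\<phi>' T a)}" and y: "y \<in> {\<phi>' (CI r m - T) b, mat_adj (\<phi>' (CI r m - T) b)}"
  obtain x' where x': "x' \<in> {fmap r T fst \<xi> a, adj (fmap r T fst \<xi> a)}" "x = mat x'"
   using x unfolding \<phi>'_def mat_adj[symmetric] by blast
  obtain y' where y': "y' \<in> {fmap r (CI r m - T) fst \<xi> b, adj (fmap r (CI r m - T) fst \<xi> b)}" "y = mat y'"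
   using y unfolding \<phi>'_def mat_adj[symmetric] by blast
  show "x \<bullet>\<bullet> y = 0"
   unfolding x'(2) y'(2) mat_mult[symmetric] fmap_orth[OF F part ab x'(1) y'(1)] by (rule zero_bop.rep_eq)
 qed
 have "CI r m - T = {}"
 proof (rule ccontr)
  assume "CI r m - T \<noteq> {}"
  then obtain s where "s \<in> CI r m - T" by blast
  hence "nonzero_map (T_max r) (\<phi>' (CI r m - T))" by (rule nz'[OF part(2)])
  moreover have "nonzero_map (T_max r) (\<phi>' T)" by (rule nz'[OF part(1), of "(g, 0)"]) (simp add: T_def)
  ultimately show False
   using ind ds has_frame_maps_K[OF r hf'[OF part(1)]] has_frame_maps_K[OF r hf'[OF part(2)]]
   unfolding indecomposable_def by blast
 qed
 hence C: "CI r m = T" using part(1) by blast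
 have "m k = \<delta> g k" for k
 proof (cases "k \<in> Pend r")
  case True
  hence "m k = mlt T fst k" using mlt_CI[OF True, of m] C by simp
  moreover have "{s \<in> T. fst s = k} = (if k = g then {(g, 0)} else {})" by (auto simp: T_def)
  ultimately show ?thesis unfolding mlt_def \<delta>_def by simp
 next
  case False
  hence "k \<noteq> g" using g(1) by blast
  moreover have "m k = 0" using m False unfolding mf_def by blast
  ultimately show ?thesis unfolding \<delta>_def by simp
 qed
 hence "m = \<delta> g" by (rule HOL.ext)
 with m have "mf r \<phi> (\<delta> g)" by simp
 thus ?thesis by (rule that[OF g(1)])
qed

text \<open>Multiplicities add under direct sums, and the function with the single value 1 is not
  the sum of two nonzero functions with values in the naturals.\<close>

lemma single_indecomposable:
 assumes r: "r \<ge> 1" and m: "mf r \<phi> (\<delta> g)"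
 shows "\<phi> \<in> indecomposable_maps (T_max r)"
proof -
 obtain \<xi> where hf: "has_frame r z0 \<phi> (CI r (\<delta> g)) fst \<xi>" using m unfolding mf_def by blast
 have "indecomposable (T_max r) \<phi>"
  unfolding indecomposable_def
 proof (intro notI, elim bexE conjE)
  fix \<phi>1 \<phi>2 assume K: "\<phi>1 \<in> maps_K (T_max r)" "\<phi>2 \<in> maps_K (T_max r)"
   and nz: "nonzero_map (T_max r) \<phi>1" "nonzero_map (T_max r) \<phi>2" and ds: "is_direct_sum (T_max r) \<phi> \<phi>1 \<phi>2"
  obtain m1 where m1: "mf r \<phi>1 m1" by (rule mf_ex[OF r K(1)])
  obtain m2 where m2: "mf r \<phi>2 m2" by (rule mf_ex[OF r K(2)])
  have "\<delta> g = (\<lambda>k. m1 k + m2 k)" by (rule mf_unique[OF r m mf_direct_sum[OF r m1 m2 ds]])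
  hence e: "\<delta> g k = m1 k + m2 k" for k by (rule fun_cong)
  obtain k l where kl: "m1 k \<noteq> 0" "m2 l \<noteq> 0" using nz mf_nonzero[OF r m1] mf_nonzero[OF r m2] by blast
  hence "k = g" "l = g" using e[of k] e[of l] by (auto simp: \<delta>_def split: if_splits)
  thus False using e[of g] kl by (simp add: \<delta>_def)
 qed
 moreover have "nonzero_map (T_max r) \<phi>"
  unfolding mf_nonzero[OF r m] by (rule exI[of _ g]) (simp add: \<delta>_def)
 ultimately show ?thesis unfolding indecomposable_maps_def using has_frame_maps_K[OF r hf] by simp
qed

text \<open>Indecomposable maps are single copies, and their classes are separated by the partial
  map g. The classes counted here consist of maps into the stable algebra; by
  \<open>mf_exists\<close> every g occurs.\<close>

lemma embedding_rank_Pend: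
 assumes r: "r \<ge> 1"
 shows "embedding_rank (T_max r) = card (Pend r)"
proof -
 let ?Q = "indecomposable_maps (T_max r)" and ?c = "\<lambda>g. {\<phi>. mf r \<phi> (\<delta> g)}"
 have cl: "inner_equiv_on (T_max r) ?Q `` {\<phi>} = ?c g" if "mf r \<phi> (\<delta> g)" for \<phi> g
 proof (intro equalityI subsetI)
  fix \<psi> assume "\<psi> \<in> inner_equiv_on (T_max r) ?Q `` {\<phi>}"
  hence \<psi>: "\<psi> \<in> ?Q" "\<exists>u\<in>inner_unitaries (T_max r). \<forall>a\<in>T_max r. \<phi> a = Ad u (\<psi> a)"
   unfolding inner_equiv_on_def by blast+
  obtain k where k: "k \<in> Pend r" "mf r \<psi> (\<delta> k)" by (rule indecomposable_single[OF r \<psi>(1)])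
  have "\<delta> g = \<delta> k" using mf_equiv[OF r that k(2)] \<psi>(2) by simp
  thus "\<psi> \<in> ?c g" using k(2) by simp
 next
  fix \<psi> assume "\<psi> \<in> ?c g"
  hence "mf r \<psi> (\<delta> g)" by simp
  thus "\<psi> \<in> inner_equiv_on (T_max r) ?Q `` {\<phi>}"
   using mf_equiv[OF r that, of \<psi> "\<delta> g"] single_indecomposable[OF r] that unfolding inner_equiv_on_def by blast
 qed
 have ex: "\<exists>\<phi>. mf r \<phi> (\<delta> g)" if "g \<in> Pend r" for g
 proof -
  have "\<delta> g k = 0" if "k \<notin> Pend r" for k using that \<open>g \<in> Pend r\<close> by (auto simp: \<delta>_def)
  thus ?thesis using mf_exists[OF r, of "\<delta> g"] by blast
 qed
 have "?Q // inner_equiv_on (T_max r) ?Q = ?c ` Pend r"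
 proof (intro equalityI subsetI)
  fix X assume "X \<in> ?Q // inner_equiv_on (T_max r) ?Q"
  then obtain \<phi> where \<phi>: "\<phi> \<in> ?Q" "X = inner_equiv_on (T_max r) ?Q `` {\<phi>}" by (rule quotientE)
  obtain g where g: "g \<in> Pend r" "mf r \<phi> (\<delta> g)" by (rule indecomposable_single[OF r \<phi>(1)])
  show "X \<in> ?c ` Pend r" unfolding \<phi>(2) cl[OF g(2)] using g(1) by (rule imageI)
 next
  fix X assume "X \<in> ?c ` Pend r"
  then obtain g where g: "g \<in> Pend r" "X = ?c g" by blast
  obtain \<phi> where \<phi>: "mf r \<phi> (\<delta> g)" using ex[OF g(1)] by blast
  show "X \<in> ?Q // inner_equiv_on (T_max r) ?Q"
   unfolding g(2) cl[OF \<phi>, symmetric] by (rule quotientI[OF single_indecomposable[OF r \<phi>]])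
 qed
 moreover have "inj_on ?c (Pend r)"
 proof (rule inj_onI)
  fix g k assume gk: "g \<in> Pend r" "k \<in> Pend r" "?c g = ?c k"
  obtain \<phi> where \<phi>: "mf r \<phi> (\<delta> g)" using ex[OF gk(1)] by blast
  hence "mf r \<phi> (\<delta> k)" using gk(3) by blast
  hence "\<delta> g g = \<delta> k g" using mf_unique[OF r \<phi>] by metis
  thus "g = k" by (simp add: \<delta>_def split: if_splits)
 qed
 ultimately show ?thesis unfolding embedding_rank_def by (simp add: card_image)
qed

text \<open>A class is sent to its multiplicities, listed along an enumeration of
  \<open>Pend r\<close>.\<close>

lemma add_monoid_iso:
 assumes r: "r \<ge> 1"
 shows "add_monoid (embedding_semiring (T_max r)) \<cong> nat_power_monoid (card (Pend r))"
proof -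
 let ?V = "embedding_semiring (T_max r)" and ?P = "Pend_semiring r" and ?D = "{..<card (Pend r)}"
 interpret P: semiring ?P by (rule semiring_Pend[OF r])
 let ?g = "inv_into (carrier ?P) (cls r)"
 have V: "carrier ?V = cls r ` carrier ?P" using cls_bij[OF r] by (simp add: bij_betw_def)
 have gi: "?g (cls r m) = m" if "m \<in> carrier ?P" for m
  using bij_betw_inv_into_left[OF cls_bij[OF r] that] .
 obtain b where b: "bij_betw b ?D (Pend r)"
  using ex_bij_betw_nat_finite[OF finite_Pend] unfolding atLeast0LessThan by blast
 define f where "f m = (\<lambda>i\<in>?D. m (b i))" for m :: "(nat \<rightharpoonup> nat) => nat"
 have bf: "bij_betw f (carrier ?P) (\<Pi>\<^sub>E i\<in>?D. UNIV)"
 proof (rule bij_betw_byWitness[where f' = "\<lambda>x g. if g \<in> Pend r then x (inv_into ?D b g) else 0"])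
  show "\<forall>m\<in>carrier ?P. (\<lambda>g. if g \<in> Pend r then f m (inv_into ?D b g) else 0) = m"
  proof (intro ballI HOL.ext)
   fix m g assume m: "m \<in> carrier ?P"
   show "(if g \<in> Pend r then f m (inv_into ?D b g) else 0) = m g"
    using m bij_betw_inv_into_right[OF b, of g] bij_betwE[OF bij_betw_inv_into[OF b]]
    by (auto simp: f_def Pend_semiring_simps)
  qed
  show "\<forall>x\<in>\<Pi>\<^sub>E i\<in>?D. UNIV. f (\<lambda>g. if g \<in> Pend r then x (inv_into ?D b g) else 0) = x"
  proof (intro ballI HOL.ext)
   fix x i assume x: "x \<in> (\<Pi>\<^sub>E i\<in>?D. UNIV :: nat set)"
   show "f (\<lambda>g. if g \<in> Pend r then x (inv_into ?D b g) else 0) i = x i"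
    using PiE_arb[OF x, of i] bij_betwE[OF b] bij_betw_inv_into_left[OF b, of i] by (auto simp: f_def)
  qed
  show "f ` carrier ?P \<subseteq> (\<Pi>\<^sub>E i\<in>?D. UNIV)"
   by (rule image_subsetI) (simp only: f_def restrict_PiE_iff UNIV_I, simp)
  show "(\<lambda>x g. if g \<in> Pend r then x (inv_into ?D b g) else 0) ` (\<Pi>\<^sub>E i\<in>?D. UNIV) \<subseteq> carrier ?P"
   by (rule image_subsetI) (simp add: Pend_semiring_simps)
 qed
 have "carrier (nat_power_monoid (card (Pend r))) = (\<Pi>\<^sub>E i\<in>?D. UNIV)" "carrier (add_monoid ?V) = carrier ?V"
  by (simp_all add: nat_power_monoid_def nat_add_monoid_def)
 hence bij: "bij_betw (f \<circ> ?g) (carrier (add_monoid ?V)) (carrier (nat_power_monoid (card (Pend r))))"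
  using bij_betw_trans[OF bij_betw_inv_into[OF cls_bij[OF r]] bf] by (simp only:)
 have "f \<circ> ?g \<in> hom (add_monoid ?V) (nat_power_monoid (card (Pend r)))"
  unfolding hom_def mem_Collect_eq
 proof (intro conjI ballI)
  show "f \<circ> ?g \<in> carrier (add_monoid ?V) \<rightarrow> carrier (nat_power_monoid (card (Pend r)))"
   by (rule bij_betw_imp_funcset[OF bij])
  fix X Y assume "X \<in> carrier (add_monoid ?V)" "Y \<in> carrier (add_monoid ?V)"
  hence "X \<in> cls r ` carrier ?P" "Y \<in> cls r ` carrier ?P" unfolding V[symmetric] by simp_all
  then obtain m m' where m: "m \<in> carrier ?P" "X = cls r m" "m' \<in> carrier ?P" "Y = cls r m'" by blast
  have s: "?g (X \<oplus>\<^bsub>?V\<^esub> Y) = (\<lambda>k. m k + m' k)"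
   unfolding m(2,4) cls_add[OF r m(1,3), symmetric] gi[OF P.a_closed[OF m(1,3)]] by (simp add: Pend_semiring_simps)
  have "f (\<lambda>k. m k + m' k) = f m \<otimes>\<^bsub>nat_power_monoid (card (Pend r))\<^esub> f m'"
   by (rule HOL.ext) (simp add: f_def nat_power_monoid_def nat_add_monoid_def)
  moreover have "?g X = m" "?g Y = m'" unfolding m(2,4) by (rule gi[OF m(1)], rule gi[OF m(3)])
  ultimately show "(f \<circ> ?g) (X \<otimes>\<^bsub>add_monoid ?V\<^esub> Y) = (f \<circ> ?g) X \<otimes>\<^bsub>nat_power_monoid (card (Pend r))\<^esub> (f \<circ> ?g) Y"
   using s by simp
 qed
 thus ?thesis unfolding is_iso_def iso_def using bij by blast
qed

section \<open>Counting\<close>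

text \<open>Weakly increasing maps from n consecutive points, beginning at a, to a chain of k
  points. The starting point does not affect the number, but it keeps the pieces of
  \<open>Pend r\<close> apart.\<close>

definition MM :: "nat => nat => nat => (nat \<rightharpoonup> nat) set" where
 "MM a n k = {h. dom h = {a..<a + n} \<and> ran h \<subseteq> {1..k} \<and>
   (\<forall>i\<in>dom h. \<forall>j\<in>dom h. i \<le> j \<longrightarrow> the (h i) \<le> the (h j))}"

lemma finite_MM: "finite (MM a n k)"
 by (rule finite_subset[OF _ finite_set_of_finite_maps[of "{a..<a + n}" "{1..k}"]]) (auto simp: MM_def)

text \<open>Pascal's recursion. By monotonicity the top value \<open>Suc k\<close> is attained at
  the last point or not at all; in the first case the last point can be removed.\<close>

lemma MM_Suc: "MM a (Suc n) (Suc k) = MM a (Suc n) k \<union> (\<lambda>h. h(a + n \<mapsto> Suc k)) ` MM a n (Suc k)"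
proof (intro equalityI subsetI)
 fix h assume h: "h \<in> MM a (Suc n) (Suc k)"
 hence d: "dom h = {a..<a + Suc n}" and ran: "ran h \<subseteq> {1..Suc k}"
  and mono: "\<And>i j. i \<in> dom h ==> j \<in> dom h ==> i \<le> j ==> the (h i) \<le> the (h j)"
  unfolding MM_def by blast+
 have "a + n \<in> dom h" unfolding d by simp
 then obtain y where y: "h (a + n) = Some y" by blast
 show "h \<in> MM a (Suc n) k \<union> (\<lambda>h. h(a + n \<mapsto> Suc k)) ` MM a n (Suc k)"
 proof (cases "y = Suc k")
  case True
  let ?h = "h |` {a..<a + n}"
  have "h = ?h(a + n \<mapsto> Suc k)"
  proof (rule HOL.ext)
   fix i show "h i = (?h(a + n \<mapsto> Suc k)) i"
    using y True d by (cases "i \<in> dom h") (auto simp: restrict_map_def domIff)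
  qed
  moreover have "?h \<in> MM a n (Suc k)"
  proof -
   have "dom ?h = {a..<a + n}" unfolding dom_restrict d by auto
   moreover have "ran ?h \<subseteq> ran h" by (auto simp: ran_def restrict_map_def split: if_splits)
   moreover have "the (?h i) \<le> the (?h j)" if "i \<in> {a..<a + n}" "j \<in> {a..<a + n}" "i \<le> j" for i j
    using mono[of i j] that unfolding d by simp
   ultimately show ?thesis unfolding MM_def using ran by auto
  qed
  ultimately show ?thesis by blast
 next
  case False
  have "y \<le> k" using ran ranI[of h "a + n" y] y False by force
  have "ran h \<subseteq> {1..k}"
  proof
   fix x assume x: "x \<in> ran h"
   then obtain i where i: "h i = Some x" by (auto simp: ran_def)
   hence id: "i \<in> dom h" by blast
   hence "i \<le> a + n" unfolding d by simp
   hence "x \<le> y" using mono[OF id \<open>a + n \<in> dom h\<close>] i y by simp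
   thus "x \<in> {1..k}" using x ran \<open>y \<le> k\<close> by force
  qed
  thus ?thesis using h unfolding MM_def by simp
 qed
next
 fix h assume "h \<in> MM a (Suc n) k \<union> (\<lambda>h. h(a + n \<mapsto> Suc k)) ` MM a n (Suc k)"
 thus "h \<in> MM a (Suc n) (Suc k)"
 proof
  assume "h \<in> MM a (Suc n) k"
  thus ?thesis unfolding MM_def by force
 next
  assume "h \<in> (\<lambda>h. h(a + n \<mapsto> Suc k)) ` MM a n (Suc k)"
  then obtain g where g: "dom g = {a..<a + n}" "ran g \<subseteq> {1..Suc k}"
   "\<And>i j. i \<in> dom g ==> j \<in> dom g ==> i \<le> j ==> the (g i) \<le> the (g j)" "h = g(a + n \<mapsto> Suc k)"
   unfolding MM_def by blast
  have le: "the (g i) \<le> Suc k" if "i \<in> dom g" for i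
   using g(2) that by (metis atLeastAtMost_iff domD option.sel ranI subsetD)
  have dom: "dom h = {a..<a + Suc n}" unfolding g(4) using g(1) by auto
  have "ran h \<subseteq> {1..Suc k}" unfolding g(4) using g(2) by (auto simp: ran_def split: if_splits)
  moreover have "the (h i) \<le> the (h j)" if "i \<in> dom h" "j \<in> dom h" "i \<le> j" for i j
  proof -
   have ij: "i \<in> dom g \<or> i = a + n" "j \<in> dom g \<or> j = a + n" "j \<in> dom g ==> j < a + n"
    using that unfolding dom g(1) by auto
   show ?thesis
   proof (cases "j = a + n")
    case True
    thus ?thesis using le[of i] ij(1) unfolding g(4) by auto
   next
    case False
    hence j: "j \<in> dom g" "j < a + n" using ij by auto
    hence "i \<in> dom g" "i \<noteq> a + n" using ij(1) that(3) by auto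
    thus ?thesis using g(3)[of i j] j that(3) unfolding g(4) by simp
   qed
  qed
  ultimately show ?thesis unfolding MM_def using dom by blast
 qed
qed

text \<open>The number of multisets of size n from k values. For k = 0 the truncated subtraction
  still gives the right result, 1 for n = 0 and 0 otherwise.\<close>

lemma card_MM: "card (MM a n k) = (n + k - 1) choose n"
proof (induction n arbitrary: k)
 case 0
 have "MM a 0 k = {Map.empty}" by (auto simp: MM_def)
 thus ?case by simp
next
 case (Suc n)
 show ?case
 proof (induction k)
  case 0
  have "MM a (Suc n) 0 = {}"
  proof -
   have False if "dom h = {a..<a + Suc n}" "ran h \<subseteq> {1..0}" for h :: "nat \<rightharpoonup> nat"
   proof -
    have "a \<in> dom h" using that(1) by simp
    thus False using that(2) by (auto simp: ran_def)
   qed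
   thus ?thesis unfolding MM_def by blast
  qed
  thus ?case by simp
 next
  case (Suc k)
  let ?U = "\<lambda>h :: nat \<rightharpoonup> nat. h(a + n \<mapsto> Suc k)"
  have disj: "MM a (Suc n) k \<inter> ?U ` MM a n (Suc k) = {}"
  proof -
   have "?U g \<notin> MM a (Suc n) k" for g
   proof
    assume "?U g \<in> MM a (Suc n) k"
    hence "ran (?U g) \<subseteq> {1..k}" unfolding MM_def by blast
    moreover have "Suc k \<in> ran (?U g)" by (rule ranI[of _ "a + n"]) simp
    ultimately show False by auto
   qed
   thus ?thesis by blast
  qed
  have inj: "inj_on ?U (MM a n (Suc k))"
  proof (rule inj_onI)
   fix g h assume gh: "g \<in> MM a n (Suc k)" "h \<in> MM a n (Suc k)" "?U g = ?U h"
   hence "a + n \<notin> dom g" "a + n \<notin> dom h" unfolding MM_def by auto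
   hence "g (a + n) = None" "h (a + n) = None" by auto
   thus "g = h" using gh(3) by (metis fun_upd_triv fun_upd_upd)
  qed
  show ?case unfolding MM_Suc card_Un_disjoint[OF finite_MM finite_imageI[OF finite_MM] disj]
    card_image[OF inj] Suc.IH \<open>\<And>k. card (MM a n k) = (n + k - 1) choose n\<close> by simp
 qed
qed

text \<open>A domain is given by its first point a and its length n; that it ends at r at the latest
  means n \<le> r + 1 - a.\<close>

lemma Pend_MM: "Pend r = (\<Union>p\<in>Sigma {1..r} (\<lambda>a. {1..r + 1 - a}). MM (fst p) (snd p) r)"
proof (intro equalityI subsetI)
 fix h assume h: "h \<in> Pend r"
 then obtain a b where ab: "dom h = {a..b}" "1 \<le> a" "a \<le> b" "b \<le> r" unfolding Pend_def intervals_def by blast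
 have "{a..b} = {a..<a + (b + 1 - a)}" using ab by auto
 hence "h \<in> MM a (b + 1 - a) r" using h ab(1) unfolding MM_def Pend_def by simp
 moreover have "(a, b + 1 - a) \<in> Sigma {1..r} (\<lambda>a. {1..r + 1 - a})" using ab by auto
 ultimately show "h \<in> (\<Union>p\<in>Sigma {1..r} (\<lambda>a. {1..r + 1 - a}). MM (fst p) (snd p) r)" by force
next
 fix h assume "h \<in> (\<Union>p\<in>Sigma {1..r} (\<lambda>a. {1..r + 1 - a}). MM (fst p) (snd p) r)"
 then obtain a n where an: "a \<in> {1..r}" "n \<in> {1..r + 1 - a}" "h \<in> MM a n r" by auto
 have "{a..<a + n} = {a..a + n - 1}" using an by auto
 hence "dom h = {a..a + n - 1}" using an(3) unfolding MM_def by simp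
 moreover have "1 \<le> a" "a \<le> a + n - 1" "a + n - 1 \<le> r" using an by auto
 ultimately have "dom h \<in> intervals r" unfolding intervals_def by blast
 thus "h \<in> Pend r" using an(3) unfolding Pend_def MM_def by simp
qed

text \<open>The hockey-stick identity is used twice, over the length n and over the largest length N
  = r + 1 - a. The inner sums lack their term n = 0, one for each of r starting points, and the
  outer sum lacks its term N = 0; together these make up the r + 1 that is added.\<close>

lemma card_Pend:
 assumes r: "r \<ge> 1"
 shows "card (Pend r) + (r + 1) = (2 * r + 1) choose (r + 1)"
proof -
 have "card (Pend r) = (\<Sum>p\<in>Sigma {1..r} (\<lambda>a. {1..r + 1 - a}). card (MM (fst p) (snd p) r))"
  unfolding Pend_MM
 proof (rule card_UN_disjoint)
  show "\<forall>p\<in>Sigma {1..r} (\<lambda>a. {1..r + 1 - a}). \<forall>q\<in>Sigma {1..r} (\<lambda>a. {1..r + 1 - a}).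
   p \<noteq> q \<longrightarrow> MM (fst p) (snd p) r \<inter> MM (fst q) (snd q) r = {}"
  proof (intro ballI impI)
   fix p q assume pq: "p \<in> Sigma {1..r} (\<lambda>a. {1..r + 1 - a})" "q \<in> Sigma {1..r} (\<lambda>a. {1..r + 1 - a})" "p \<noteq> q"
   have "{fst p..<fst p + snd p} \<noteq> {fst q..<fst q + snd q}"
    using pq by (auto simp: atLeastLessThan_eq_iff prod_eq_iff)
   hence "\<not> (h \<in> MM (fst p) (snd p) r \<and> h \<in> MM (fst q) (snd q) r)" for h unfolding MM_def by auto
   thus "MM (fst p) (snd p) r \<inter> MM (fst q) (snd q) r = {}" by blast
  qed
 qed (auto simp: finite_MM)
 also have "... = (\<Sum>a\<in>{1..r}. \<Sum>n\<in>{1..r + 1 - a}. (n + r - 1) choose n)"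
 proof -
  have "(\<Sum>a\<in>{1..r}. \<Sum>n\<in>{1..r + 1 - a}. (n + r - 1) choose n)
   = (\<Sum>(a, n)\<in>Sigma {1..r} (\<lambda>a. {1..r + 1 - a}). (n + r - 1) choose n)" by (rule sum.Sigma) simp_all
  thus ?thesis unfolding card_MM case_prod_unfold by (rule sym)
 qed
 \<comment> \<open>Reversal of the outer sum: N = r + 1 - a is the largest length of a domain that
   begins at a.\<close>
 also have "... = (\<Sum>N\<in>{1..r}. \<Sum>n\<in>{1..r + 1 - (r + 1 - N)}. (n + r - 1) choose n)"
  by (rule sum.atLeastAtMost_rev)
 also have "... = (\<Sum>N\<in>{1..r}. \<Sum>n\<in>{1..N}. (n + r - 1) choose n)"
  by (intro sum.cong refl) auto
 finally have c: "card (Pend r) = (\<Sum>N\<in>{1..r}. \<Sum>n\<in>{1..N}. (n + r - 1) choose n)" .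
 have at: "(\<Sum>k\<le>N. f k) = f 0 + (\<Sum>k\<in>{1..N}. f k)" for f :: "nat => nat" and N
 proof -
  have "{..N} = insert 0 {1..N}" by auto
  thus ?thesis by simp
 qed
 \<comment> \<open>The added 1 is the missing term n = 0.\<close>
 have i: "(\<Sum>n\<in>{1..N}. (n + r - 1) choose n) + 1 = (r + N) choose N" for N
 proof -
  have "(\<Sum>k\<le>N. ((r - 1) + k) choose k) = Suc (r - 1 + N) choose N" by (rule sum_choose_lower)
  moreover have "n + r - 1 = r - 1 + n" for n using r by simp
  ultimately show ?thesis using r unfolding at by simp
 qed
 have "card (Pend r) + r = (\<Sum>N\<in>{1..r}. (\<Sum>n\<in>{1..N}. (n + r - 1) choose n) + 1)"
  unfolding c sum.distrib by simp
 also have "... = (\<Sum>N\<in>{1..r}. (r + N) choose N)" by (intro sum.cong refl i)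
 finally have "card (Pend r) + (r + 1) = (\<Sum>N\<le>r. (r + N) choose N)" unfolding at by simp
 also have "... = Suc (r + r) choose r" by (rule sum_choose_lower)
 also have "... = (2 * r + 1) choose (r + 1)"
  using binomial_symmetric[of r "2 * r + 1"] by (simp add: mult_2 Suc_eq_plus1)
 finally show ?thesis .
qed

theorem theorem8p6:
  fixes r :: nat
  assumes "r \<ge> 1"
  shows "semiring (embedding_semiring (T_max r)) \<and>
    embedding_semiring (T_max r) \<simeq> Pend_semiring r \<and>
    Metric_space (carrier (embedding_semiring (T_max r))) (embedding_dist (T_max r)) \<and>
    Metric_space.mtopology (carrier (embedding_semiring (T_max r))) (embedding_dist (T_max r)) =
      discrete_topology (carrier (embedding_semiring (T_max r))) \<and>
    add_monoid (embedding_semiring (T_max r)) \<cong> nat_power_monoid (embedding_rank (T_max r)) \<and>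
    int (embedding_rank (T_max r)) = int ((2 * r + 1) choose (r + 1)) - int (r + 1)"
  unfolding embedding_rank_Pend[OF assms]
proof (intro conjI)
  show "int (card (Pend r)) = int ((2 * r + 1) choose (r + 1)) - int (r + 1)"
    using card_Pend[OF assms] by linarith
qed (fact semiring_embedding[OF assms] embedding_iso[OF assms] embedding_metric[OF assms] add_monoid_iso[OF assms])+

end
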